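(* Let $W$ and $W'$ be even Coxeter groups of finite rank. If $W$ and $W'$ are elementarily equivalent, then they are isomorphic. Furthermore, $W$ is an algebraically prime model of its first-order theory, i.e., $W$ embeds into every model of the first-order theory of $W$.
   Context: A Coxeter system $(W,S)$, $S=\{s_1,\dots,s_n\}$ finite, with presentation $\langle S\mid (s_is_j)^{m_{ij}}=1\rangle$ ($m_{ii}=1$, $m_{ij}=m_{ji}\in\{2,\dots,\infty\}$ for $i\ne j$) is even if every $m_{ij}$ with $i\ne j$ is even or $\infty$; a Coxeter group is even if it admits an even Coxeter system. Elementary equivalence means satisfying the same first-order sentences in the language of groups. *)

theory Defs
  imports "HOL-Algebra.Algebra" "HOL-Library.Extended_Nat"
begin

definition coxeter_matrix :: "nat \<Rightarrow> (nat \<Rightarrow> nat \<Rightarrow> enat) \<Rightarrow> bool" where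
  "coxeter_matrix n m \<longleftrightarrow>
     (\<forall>i<n. m i i = 1) \<and> (\<forall>i<n. \<forall>j<n. m i j = m j i) \<and>
     (\<forall>i<n. \<forall>j<n. i \<noteq> j \<longrightarrow> m i j \<ge> 2)"

definition even_coxeter_matrix :: "nat \<Rightarrow> (nat \<Rightarrow> nat \<Rightarrow> enat) \<Rightarrow> bool" where
  "even_coxeter_matrix n m \<longleftrightarrow> coxeter_matrix n m \<and>
     (\<forall>i<n. \<forall>j<n. i \<noteq> j \<longrightarrow> m i j = \<infinity> \<or> (\<exists>k. m i j = enat k \<and> even k))"

text \<open>The congruence on words (lists of generator indices) generated by the Coxeter relations
  (s_i s_j)^{m_ij} = 1 (for finite m_ij). Since m_ii = 1 makes every generator an involution,
  the group presented by the Coxeter presentation is the quotient of the free monoid on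
  {0..n-1} by this congruence.\<close>
inductive cox_equiv :: "nat \<Rightarrow> (nat \<Rightarrow> nat \<Rightarrow> enat) \<Rightarrow> nat list \<Rightarrow> nat list \<Rightarrow> bool"
  for n m where
  rel: "i < n \<Longrightarrow> j < n \<Longrightarrow> m i j = enat k \<Longrightarrow> cox_equiv n m (concat (replicate k [i, j])) []"
| refl: "cox_equiv n m w w"
| sym: "cox_equiv n m u v \<Longrightarrow> cox_equiv n m v u"
| trans: "cox_equiv n m u v \<Longrightarrow> cox_equiv n m v w \<Longrightarrow> cox_equiv n m u w"
| ctxt: "cox_equiv n m u v \<Longrightarrow> set a \<subseteq> {..<n} \<Longrightarrow> set b \<subseteq> {..<n} \<Longrightarrow>
         cox_equiv n m (a @ u @ b) (a @ v @ b)"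

definition word_eval :: "('a, 'b) monoid_scheme \<Rightarrow> (nat \<Rightarrow> 'a) \<Rightarrow> nat list \<Rightarrow> 'a" where
  "word_eval G s w = foldr (\<lambda>i x. s i \<otimes>\<^bsub>G\<^esub> x) w \<one>\<^bsub>G\<^esub>"

definition coxeter_system :: "('a, 'b) monoid_scheme \<Rightarrow> nat \<Rightarrow> (nat \<Rightarrow> 'a) \<Rightarrow> (nat \<Rightarrow> nat \<Rightarrow> enat) \<Rightarrow> bool" where
  "coxeter_system G n s m \<longleftrightarrow> group G \<and> coxeter_matrix n m \<and>
     (\<forall>i<n. s i \<in> carrier G) \<and>
     generate G (s ` {..<n}) = carrier G \<and>
     (\<forall>u v. set u \<subseteq> {..<n} \<longrightarrow> set v \<subseteq> {..<n} \<longrightarrow>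
        (word_eval G s u = word_eval G s v \<longleftrightarrow> cox_equiv n m u v))"

definition even_coxeter_group :: "('a, 'b) monoid_scheme \<Rightarrow> bool" where
  "even_coxeter_group G \<longleftrightarrow>
     (\<exists>n s m. coxeter_system G n s m \<and> even_coxeter_matrix n m)"

datatype gterm = GVar nat | GOne | GMul gterm gterm | GInv gterm

datatype gform = GEq gterm gterm | GNot gform | GAnd gform gform | GEx nat gform

record 'a gstruct =
  gdom :: "'a set"
  gmul :: "'a \<Rightarrow> 'a \<Rightarrow> 'a"
  ginv :: "'a \<Rightarrow> 'a"
  gone :: 'a

definition is_gstruct :: "'a gstruct \<Rightarrow> bool" where
  "is_gstruct M \<longleftrightarrow> gdom M \<noteq> {} \<and> gone M \<in> gdom M \<and>
     (\<forall>x\<in>gdom M. ginv M x \<in> gdom M) \<and>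
     (\<forall>x\<in>gdom M. \<forall>y\<in>gdom M. gmul M x y \<in> gdom M)"

fun teval :: "'a gstruct \<Rightarrow> (nat \<Rightarrow> 'a) \<Rightarrow> gterm \<Rightarrow> 'a" where
  "teval M e (GVar x) = e x"
| "teval M e GOne = gone M"
| "teval M e (GMul t u) = gmul M (teval M e t) (teval M e u)"
| "teval M e (GInv t) = ginv M (teval M e t)"

fun sat :: "'a gstruct \<Rightarrow> (nat \<Rightarrow> 'a) \<Rightarrow> gform \<Rightarrow> bool" where
  "sat M e (GEq t u) \<longleftrightarrow> teval M e t = teval M e u"
| "sat M e (GNot \<phi>) \<longleftrightarrow> \<not> sat M e \<phi>"
| "sat M e (GAnd \<phi> \<psi>) \<longleftrightarrow> sat M e \<phi> \<and> sat M e \<psi>"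
| "sat M e (GEx x \<phi>) \<longleftrightarrow> (\<exists>a\<in>gdom M. sat M (e(x := a)) \<phi>)"

fun tvars :: "gterm \<Rightarrow> nat set" where
  "tvars (GVar x) = {x}"
| "tvars GOne = {}"
| "tvars (GMul t u) = tvars t \<union> tvars u"
| "tvars (GInv t) = tvars t"

fun fvars :: "gform \<Rightarrow> nat set" where
  "fvars (GEq t u) = tvars t \<union> tvars u"
| "fvars (GNot \<phi>) = fvars \<phi>"
| "fvars (GAnd \<phi> \<psi>) = fvars \<phi> \<union> fvars \<psi>"
| "fvars (GEx x \<phi>) = fvars \<phi> - {x}"

definition sentence :: "gform \<Rightarrow> bool" where
  "sentence \<phi> \<longleftrightarrow> fvars \<phi> = {}"

definition holds :: "'a gstruct \<Rightarrow> gform \<Rightarrow> bool" where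
  "holds M \<phi> \<longleftrightarrow> (\<forall>e. (\<forall>x. e x \<in> gdom M) \<longrightarrow> sat M e \<phi>)"

definition group_struct :: "('a, 'b) monoid_scheme \<Rightarrow> 'a gstruct" where
  "group_struct G = \<lparr>gdom = carrier G, gmul = (\<otimes>\<^bsub>G\<^esub>), ginv = m_inv G, gone = \<one>\<^bsub>G\<^esub>\<rparr>"

definition elem_equiv :: "'a gstruct \<Rightarrow> 'b gstruct \<Rightarrow> bool" where
  "elem_equiv A B \<longleftrightarrow> (\<forall>\<phi>. sentence \<phi> \<longrightarrow> (holds A \<phi> \<longleftrightarrow> holds B \<phi>))"

definition model_of_theory :: "'b gstruct \<Rightarrow> 'a gstruct \<Rightarrow> bool" where
  "model_of_theory M A \<longleftrightarrow> is_gstruct M \<and>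
     (\<forall>\<phi>. sentence \<phi> \<longrightarrow> holds A \<phi> \<longrightarrow> holds M \<phi>)"

definition gembedding :: "('a \<Rightarrow> 'b) \<Rightarrow> 'a gstruct \<Rightarrow> 'b gstruct \<Rightarrow> bool" where
  "gembedding h A B \<longleftrightarrow> inj_on h (gdom A) \<and> h ` gdom A \<subseteq> gdom B \<and>
     h (gone A) = gone B \<and>
     (\<forall>x\<in>gdom A. h (ginv A x) = ginv B (h x)) \<and>
     (\<forall>x\<in>gdom A. \<forall>y\<in>gdom A. h (gmul A x y) = gmul B (h x) (h y))"

end

theory Submission
  imports Defs "HOL-Library.Z2" Complex_Main "Jordan_Normal_Form.Determinant"
begin

text \<open>An even Coxeter group retracts onto each of its standard parabolic subgroups, and it has only finitely
  many conjugacy classes of \<open>N\<close>-tuples generating a finite subgroup. Hence a single existential sentence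
  says that images of the Coxeter generators satisfy the Coxeter relations while no two of these
  classes are merged. For \<open>N\<close> at least the rank, an endomorphism of \<open>W\<close> with this property becomes inner
  on every finite subgroup after composition with a suitable endomorphism, and is therefore injective by Dyer's theory
  of reflection subgroups and the Hopf property. So \<open>W\<close> satisfies the sentences saying that any such images
  keep a given nontrivial word nontrivial, and embeds in every model.

  If \<open>W\<close> and \<open>W'\<close> are elementarily equivalent, the sentence yields homomorphisms in both directions that
  may be chosen mutually inverse on the classes of tuples. They induce mutually inverse matrices on the
  abelianisations. A nonzero term of the determinant and a count give a bijection of the generators preserving the
  2-parts of the labels and the spherical subsets; rotations of odd order in the
  dihedral subgroups give a bijection of the edges preserving the odd parts. Comparing the two on maximal
  spherical subsets produces one bijection of the generators that preserves all labels.\<close>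

section \<open>Even Coxeter systems and their retractions\<close>

text \<open>Evenness of the labels enters in one way: deleting any set of generators respects the
  relations. Deletion gives the retractions and, one letter at a time, the parities that make up the
  abelianisation over F_2. Injectivity concerns infinitely many words at once, whereas a finite list
  of non-conjugacies fits into one sentence. The list is about tuples rather than elements because
  one conjugating element has to serve all components. Nothing in the argument shows that the
  homomorphisms between \<open>W\<close> and \<open>W'\<close> are surjective, so the isomorphism is
  not one of them. They only serve to compare labels, and a label-preserving bijection of the
  generators then defines the isomorphism. The obstacle is that the two comparisons differ in kind.
  Parities see the powers of 2 in the labels but are blind to elements of odd order, and a
  permutation read off a determinant is not unique. Rotations of odd order see the odd parts, but
  they match edges and not the endpoints of edges.\<close>

declare add_bit_eq_xor [simp del] mult_bit_eq_and [simp del]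

lemma bit_add_self [simp]: "x + x = (0::bit)"
  by (cases x) auto

lemma bit_neq_1 [simp]: "(x::bit) \<noteq> 1 \<longleftrightarrow> x = 0"
  by (cases x) auto

lemma bit_add_eq_0_iff: "x + y = 0 \<longleftrightarrow> x = (y::bit)"
  by (cases x; cases y) auto

lemma of_nat_bit_eq_0_iff: "of_nat k = (0::bit) \<longleftrightarrow> even k"
  by (induction k) (auto simp: bit_add_eq_0_iff)

lemma word_eval_Nil [simp]: "word_eval H x [] = \<one>\<^bsub>H\<^esub>"
  by (simp add: word_eval_def)

lemma word_eval_Cons [simp]: "word_eval H x (i # w) = x i \<otimes>\<^bsub>H\<^esub> word_eval H x w"
  by (simp add: word_eval_def)

context monoid begin

lemma word_eval_closed: "(\<And>i. i \<in> set w \<Longrightarrow> x i \<in> carrier G) \<Longrightarrow> word_eval G x w \<in> carrier G"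
  by (induction w) auto

lemma word_eval_append:
  assumes "\<And>i. i \<in> set u \<union> set v \<Longrightarrow> x i \<in> carrier G"
  shows "word_eval G x (u @ v) = word_eval G x u \<otimes> word_eval G x v"
  using assms by (induction u) (auto simp: word_eval_closed m_assoc)

lemma word_eval_concat_replicate:
  assumes "x i \<in> carrier G" "x j \<in> carrier G"
  shows "word_eval G x (concat (replicate k [i, j])) = (x i \<otimes> x j) [^] k"
proof (induction k)
  case (Suc k)
  have "(x i \<otimes> x j) [^] Suc k = (x i \<otimes> x j) \<otimes> (x i \<otimes> x j) [^] k"
    using assms by (intro nat_pow_Suc2) simp
  then show ?case using Suc assms by (simp add: m_assoc del: nat_pow_Suc)
qed simp

text \<open>\<open>cox_equiv\<close> is reflexive on every word, including words with letters
  outside the range. The alternative \<open>u = v\<close> absorbs this; pairs obtained otherwise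
  have all letters below \<open>n\<close>.\<close>

lemma word_eval_cox_equiv:
  assumes "cox_equiv n m u v" and x: "\<And>i. i < n \<Longrightarrow> x i \<in> carrier G"
    and rels: "\<And>i j k. i < n \<Longrightarrow> j < n \<Longrightarrow> m i j = enat k \<Longrightarrow> (x i \<otimes> x j) [^] k = \<one>"
  shows "u = v \<or> (set u \<subseteq> {..<n} \<and> set v \<subseteq> {..<n} \<and> word_eval G x u = word_eval G x v)"
  using assms(1)
proof induction
  case (rel i j k)
  then show ?case using rels[OF rel] x by (auto simp: word_eval_concat_replicate)
next
  case (ctxt u v a b)
  have "word_eval G x (a @ w @ b) = word_eval G x a \<otimes> (word_eval G x w \<otimes> word_eval G x b)"
    if "set w \<subseteq> {..<n}" for w
    using that ctxt x by (subst word_eval_append | force)+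
  then show ?case using ctxt by auto
qed auto

end

locale even_coxeter = group G for G (structure) +
  fixes n :: nat and s :: "nat \<Rightarrow> 'a" and m :: "nat \<Rightarrow> nat \<Rightarrow> enat"
  assumes sys: "coxeter_system G n s m" and even_mat: "even_coxeter_matrix n m"
begin

text \<open>The label \<^term>\<open>\<infinity>\<close> is encoded as \<open>0\<close>, so that \<open>(s\<^sub>i s\<^sub>j)\<^sup>k = 1\<close> iff \<open>d i j\<close> divides \<open>k\<close>.\<close>
definition d :: "nat \<Rightarrow> nat \<Rightarrow> nat" where
  "d i j = (case m i j of enat k \<Rightarrow> k | \<infinity> \<Rightarrow> 0)"

abbreviation ev :: "nat list \<Rightarrow> 'a" where "ev \<equiv> word_eval G s"

lemma s_closed [simp, intro]: "i < n \<Longrightarrow> s i \<in> carrier G"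
  using sys by (auto simp: coxeter_system_def)

lemma d_self [simp]: "i < n \<Longrightarrow> d i i = 1"
  using sys by (auto simp: coxeter_system_def coxeter_matrix_def d_def one_enat_def)

lemma d_sym: "i < n \<Longrightarrow> j < n \<Longrightarrow> d i j = d j i"
  using sys by (auto simp: coxeter_system_def coxeter_matrix_def d_def)

lemma d_even: "i < n \<Longrightarrow> j < n \<Longrightarrow> i \<noteq> j \<Longrightarrow> even (d i j)"
  using even_mat by (force simp: even_coxeter_matrix_def d_def)

lemma ev_closed: "w \<in> lists {..<n} \<Longrightarrow> ev w \<in> carrier G"
  by (rule word_eval_closed) auto

lemma ev_append: "u \<in> lists {..<n} \<Longrightarrow> v \<in> lists {..<n} \<Longrightarrow> ev (u @ v) = ev u \<otimes> ev v"
  by (rule word_eval_append) auto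

lemma cox_equiv_iff: "u \<in> lists {..<n} \<Longrightarrow> v \<in> lists {..<n} \<Longrightarrow> ev u = ev v \<longleftrightarrow> cox_equiv n m u v"
  using sys by (simp add: coxeter_system_def in_lists_conv_set subset_eq)

lemma s_pow: assumes "i < n" "j < n" shows "(s i \<otimes> s j) [^] d i j = \<one>"
proof (cases "m i j")
  case (enat k)
  then have "cox_equiv n m (concat (replicate k [i, j])) []"
    using assms by (auto intro: cox_equiv.rel)
  moreover have "concat (replicate k [i, j]) \<in> lists {..<n}"
    using assms by (induction k) auto
  ultimately show ?thesis
    using cox_equiv_iff[of "concat (replicate k [i, j])" "[]"] assms enat
    by (simp add: word_eval_concat_replicate d_def del: in_lists_conv_set)
qed (simp add: d_def)

lemma s_sq [simp]: "i < n \<Longrightarrow> s i \<otimes> s i = \<one>"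
  using s_pow[of i i] by simp

lemma s_inv [simp]: "i < n \<Longrightarrow> inv (s i) = s i"
  by (simp add: inv_equality)

lemma ev_rev: "w \<in> lists {..<n} \<Longrightarrow> ev (rev w) = inv (ev w)"
  by (induction w) (auto simp: ev_append ev_closed inv_mult_group in_lists_conv_set)

lemma ev_surj: assumes "g \<in> carrier G" obtains w where "w \<in> lists {..<n}" "ev w = g"
proof -
  have "carrier G = generate G (s ` {..<n})" using sys by (simp add: coxeter_system_def)
  then have "g \<in> generate G (s ` {..<n})" using assms by simp
  then have "\<exists>w \<in> lists {..<n}. ev w = g"
  proof induction
    case one then show ?case by (intro bexI[of _ "[]"]) auto
  next
    case (incl h) then show ?case by (auto intro!: bexI[of _ "[_]"])
  next
    case (inv h) then show ?case by (auto intro!: bexI[of _ "[_]"])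
  next
    case (eng h1 h2)
    then obtain u v where "u \<in> lists {..<n}" "ev u = h1" "v \<in> lists {..<n}" "ev v = h2" by auto
    then show ?case by (intro bexI[of _ "u @ v"]) (auto simp: ev_append)
  qed
  then show ?thesis using that by auto
qed

definition wd :: "'a \<Rightarrow> nat list" where "wd g = (SOME w. w \<in> lists {..<n} \<and> ev w = g)"

lemma wd: assumes "g \<in> carrier G" shows "wd g \<in> lists {..<n}" "ev (wd g) = g"
proof -
  have "\<exists>w. w \<in> lists {..<n} \<and> ev w = g" using assms ev_surj by metis
  then have "wd g \<in> lists {..<n} \<and> ev (wd g) = g" unfolding wd_def by (rule someI_ex)
  then show "wd g \<in> lists {..<n}" "ev (wd g) = g" by auto
qed

definition lift :: "('c, 'd) monoid_scheme \<Rightarrow> (nat \<Rightarrow> 'c) \<Rightarrow> 'a \<Rightarrow> 'c" where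
  "lift H x g = word_eval H x (wd g)"

text \<open>Universal property of the presentation. Targets are monoids so that it applies directly
  to bits under addition and to functions under composition; since \<open>d i i = 1\<close>, the
  relations make every \<open>x i\<close> an involution.\<close>

lemma
  assumes H: "monoid H" and x: "\<And>i. i < n \<Longrightarrow> x i \<in> carrier H"
    and rels: "\<And>i j. i < n \<Longrightarrow> j < n \<Longrightarrow> (x i \<otimes>\<^bsub>H\<^esub> x j) [^]\<^bsub>H\<^esub> d i j = \<one>\<^bsub>H\<^esub>"
  shows lift_ev: "w \<in> lists {..<n} \<Longrightarrow> lift H x (ev w) = word_eval H x w"
    and lift_s: "i < n \<Longrightarrow> lift H x (s i) = x i"
    and lift_hom: "lift H x \<in> hom G H"
    and lift_one: "lift H x \<one> = \<one>\<^bsub>H\<^esub>"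
proof -
  interpret H: monoid H by (rule H)
  have ev: "lift H x (ev w) = word_eval H x w" if w: "w \<in> lists {..<n}" for w
  proof -
    have "cox_equiv n m (wd (ev w)) w"
      using w wd[OF ev_closed[OF w]] cox_equiv_iff by blast
    from H.word_eval_cox_equiv[OF this, of x] x rels show ?thesis
      unfolding lift_def d_def by fastforce
  qed
  then show "w \<in> lists {..<n} \<Longrightarrow> lift H x (ev w) = word_eval H x w" .
  show "i < n \<Longrightarrow> lift H x (s i) = x i" using ev[of "[i]"] x by simp
  show "lift H x \<one> = \<one>\<^bsub>H\<^esub>" using ev[of "[]"] by simp
  show "lift H x \<in> hom G H"
  proof (rule homI)
    fix g assume "g \<in> carrier G"
    then show "lift H x g \<in> carrier H"
      unfolding lift_def using wd x by (intro H.word_eval_closed) auto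
  next
    fix g h assume g: "g \<in> carrier G" and h: "h \<in> carrier G"
    have "lift H x (ev (wd g @ wd h)) = word_eval H x (wd g @ wd h)"
      using g h wd by (intro ev) auto
    also have "\<dots> = word_eval H x (wd g) \<otimes>\<^bsub>H\<^esub> word_eval H x (wd h)"
      using g h wd x by (intro H.word_eval_append) auto
    finally show "lift H x (g \<otimes> h) = lift H x g \<otimes>\<^bsub>H\<^esub> lift H x h"
      using g h wd by (simp add: ev_append lift_def)
  qed
qed

lemma word_induct [consumes 1, case_names one mult]:
  assumes "g \<in> carrier G" "P \<one>"
    "\<And>i h. i < n \<Longrightarrow> h \<in> carrier G \<Longrightarrow> P h \<Longrightarrow> P (s i \<otimes> h)"
  shows "P g"
proof -
  have "w \<in> lists {..<n} \<Longrightarrow> P (ev w)" for w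
    using assms by (induction w) (auto simp: ev_closed)
  then show ?thesis using wd[OF assms(1)] by metis
qed

lemma hom_eqI:
  assumes "f \<in> hom G H" "g \<in> hom G H" "group H" "\<And>i. i < n \<Longrightarrow> f (s i) = g (s i)" "x \<in> carrier G"
  shows "f x = g x"
  using assms(5)
proof (induction rule: word_induct)
  case one
  then show ?case using assms hom_one[of f G H] hom_one[of g G H] is_group by simp
qed (use assms in \<open>auto simp: hom_mult\<close>)

section \<open>Parity of each letter: the abelianisation over F_2\<close>

definition par :: "nat \<Rightarrow> 'a \<Rightarrow> bit" where
  "par k = lift \<lparr>carrier = UNIV, monoid.mult = (+), one = 0\<rparr> (\<lambda>i. if i = k then 1 else 0)"

lemma add_monoid: "monoid \<lparr>carrier = UNIV :: bit set, monoid.mult = (+), one = 0\<rparr>"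
  by unfold_locales (auto simp: add.assoc)

lemma add_monoid_pow: "(x::bit) [^]\<^bsub>\<lparr>carrier = UNIV, monoid.mult = (+), one = 0\<rparr>\<^esub> (k::nat) = of_nat k * x"
  by (induction k) (auto simp: monoid.nat_pow_Suc[OF add_monoid] monoid.nat_pow_0[OF add_monoid] algebra_simps)

text \<open>A relator contains \<open>d i j\<close> copies of each of its two letters. For
  \<open>i \<noteq> j\<close> this number is even; for \<open>i = j\<close> the two equal parities
  cancel.\<close>

lemma par_rels: "i < n \<Longrightarrow> j < n \<Longrightarrow> of_nat (d i j) * ((if i = k then 1 else 0) + (if j = k then 1 else (0::bit))) = 0"
  using d_even[of i j] by (cases "i = j") (auto simp: of_nat_bit_eq_0_iff bit_add_eq_0_iff)

lemma par_s: "i < n \<Longrightarrow> par k (s i) = (if i = k then 1 else 0)"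
  unfolding par_def by (rule lift_s[OF add_monoid]) (use par_rels in \<open>auto simp: add_monoid_pow\<close>)

lemma par_one [simp]: "par k \<one> = 0"
  unfolding par_def by (subst lift_one[OF add_monoid]) (use par_rels in \<open>auto simp: add_monoid_pow\<close>)

lemma par_mult [simp]: "g \<in> carrier G \<Longrightarrow> h \<in> carrier G \<Longrightarrow> par k (g \<otimes> h) = par k g + par k h"
  using hom_mult[OF lift_hom[OF add_monoid, of "\<lambda>i. if i = k then 1 else 0"], of g h] par_rels[of _ _ k]
  unfolding par_def by (auto simp: add_monoid_pow)

lemma par_inv [simp]: assumes "g \<in> carrier G" shows "par k (inv g) = par k g"
proof -
  have "par k (inv g) + par k g = 0" using par_mult[of "inv g" g k] assms by simp
  then show ?thesis by (simp add: bit_add_eq_0_iff)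
qed

lemma par_conj [simp]: "g \<in> carrier G \<Longrightarrow> h \<in> carrier G \<Longrightarrow> par k (g \<otimes> h \<otimes> inv g) = par k h"
  by (simp add: add.commute[of "par k g"] add.assoc)

section \<open>Standard parabolic subgroups and their retractions\<close>

definition W :: "nat set \<Rightarrow> 'a set" where "W J = ev ` lists J"

lemma W_subset: "J \<subseteq> {..<n} \<Longrightarrow> W J \<subseteq> carrier G"
  unfolding W_def using lists_mono[of J "{..<n}"] ev_closed by blast

lemma W_closed: "g \<in> W J \<Longrightarrow> J \<subseteq> {..<n} \<Longrightarrow> g \<in> carrier G"
  using W_subset by blast

lemma W_one [simp]: "\<one> \<in> W J" unfolding W_def by (auto intro!: image_eqI[of _ _ "[]"])

lemma W_s: "i \<in> J \<Longrightarrow> J \<subseteq> {..<n} \<Longrightarrow> s i \<in> W J"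
  unfolding W_def by (auto intro!: image_eqI[of _ _ "[i]"])

lemma W_mono: "J \<subseteq> K \<Longrightarrow> W J \<subseteq> W K" unfolding W_def using lists_mono[of J K] by auto

lemma W_mult: assumes "J \<subseteq> {..<n}" "g \<in> W J" "h \<in> W J" shows "g \<otimes> h \<in> W J"
proof -
  obtain u v where uv: "u \<in> lists J" "v \<in> lists J" "g = ev u" "h = ev v" using assms unfolding W_def by auto
  have "lists J \<subseteq> lists {..<n}" using assms by (intro lists_mono)
  then have "g \<otimes> h = ev (u @ v)" using uv by (subst ev_append) auto
  then show ?thesis unfolding W_def using uv by auto
qed

lemma W_inv: assumes "J \<subseteq> {..<n}" "g \<in> W J" shows "inv g \<in> W J"
proof -
  obtain u where uv: "u \<in> lists J" "g = ev u" using assms unfolding W_def by auto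
  have "lists J \<subseteq> lists {..<n}" using assms by (intro lists_mono)
  then have "inv g = ev (rev u)" using uv by (subst ev_rev) auto
  then show ?thesis unfolding W_def using uv by auto
qed

lemma W_subgroup: "J \<subseteq> {..<n} \<Longrightarrow> subgroup (W J) G"
  using W_subset W_mult W_inv by unfold_locales auto

lemma W_induct [consumes 2, case_names one mult]:
  assumes "g \<in> W J" "J \<subseteq> {..<n}" "P \<one>" "\<And>i h. i \<in> J \<Longrightarrow> h \<in> W J \<Longrightarrow> P h \<Longrightarrow> P (s i \<otimes> h)"
  shows "P g"
proof -
  have "w \<in> lists J \<Longrightarrow> P (ev w) \<and> ev w \<in> W J" for w
  proof (induction w)
    case (Cons a w)
    then have "ev (a # w) \<in> W J" unfolding W_def by (intro image_eqI[of _ _ "a # w"]) auto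
    then show ?case using Cons assms by auto
  qed (use assms in auto)
  then show ?thesis using assms(1) unfolding W_def by blast
qed

lemma par_W:
  assumes "g \<in> W J" "J \<subseteq> {..<n}" "k \<notin> J"
  shows "par k g = 0"
  using assms(1,2)
proof (induction rule: W_induct)
  case (mult i h)
  then have "i < n" "h \<in> carrier G" "i \<noteq> k" using assms W_closed by auto
  then show ?case using mult by (simp add: par_s)
qed auto

definition ret :: "nat set \<Rightarrow> 'a \<Rightarrow> 'a" where "ret J = lift G (\<lambda>i. if i \<in> J then s i else \<one>)"

text \<open>When just one of the two letters survives, the relator becomes an even power of an
  involution. With an odd label the surviving letter would be forced to be trivial.\<close>

lemma ret_rels:
  assumes "i < n" "j < n"
  shows "((if i \<in> J then s i else \<one>) \<otimes> (if j \<in> J then s j else \<one>)) [^] d i j = \<one>"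
proof (cases "i = j")
  case False
  then obtain k where k: "d i j = 2 * k" using d_even[OF assms False] by blast
  have "s i [^] (2 * k) = \<one>" "s j [^] (2 * k) = \<one>"
    using assms by (simp_all add: nat_pow_pow[symmetric] numeral_2_eq_2 del: mult_Suc)
  then show ?thesis using s_pow[OF assms] assms k by auto
qed (use assms in auto)

lemma ret_s [simp]: "i < n \<Longrightarrow> ret J (s i) = (if i \<in> J then s i else \<one>)"
  unfolding ret_def by (rule lift_s[OF monoid_axioms]) (use ret_rels in auto)

lemma ret_hom: "ret J \<in> hom G G"
  unfolding ret_def by (rule lift_hom[OF monoid_axioms]) (use ret_rels in auto)

lemma ret_one [simp]: "ret J \<one> = \<one>"
  using hom_one[OF ret_hom is_group is_group] .

lemma ret_closed [simp]: "g \<in> carrier G \<Longrightarrow> ret J g \<in> carrier G"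
  using ret_hom by (auto simp: hom_def)

lemma ret_mult [simp]: "g \<in> carrier G \<Longrightarrow> h \<in> carrier G \<Longrightarrow> ret J (g \<otimes> h) = ret J g \<otimes> ret J h"
  using ret_hom by (auto simp: hom_def)

lemma ret_inv [simp]: "g \<in> carrier G \<Longrightarrow> ret J (inv g) = inv (ret J g)"
  using group_hom.hom_inv[of G G "ret J" g] ret_hom by (simp add: group_hom_def group_hom_axioms_def is_group)

lemma ret_in_W: "g \<in> carrier G \<Longrightarrow> ret J g \<in> W (J \<inter> {..<n})"
  by (induction rule: word_induct) (auto simp: W_mult W_s)

lemma ret_id:
  assumes "g \<in> W J" "J \<subseteq> {..<n}"
  shows "ret J g = g"
  using assms
proof (induction rule: W_induct)
  case (mult i h)
  then have "i < n" "h \<in> carrier G" using assms W_closed by auto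
  then show ?case using mult by simp
qed auto

lemma ret_ret: "g \<in> carrier G \<Longrightarrow> ret J (ret K g) = ret (J \<inter> K) g"
  by (induction rule: word_induct) auto

lemma ret_par: "g \<in> carrier G \<Longrightarrow> par k (ret J g) = (if k \<in> J then par k g else 0)"
  by (induction rule: word_induct) (auto simp: par_s)

lemma ret_conj: "g \<in> carrier G \<Longrightarrow> h \<in> carrier G \<Longrightarrow> ret J (g \<otimes> h \<otimes> inv g) = ret J g \<otimes> ret J h \<otimes> inv (ret J g)"
  by simp

section \<open>Word length\<close>

definition len :: "'a \<Rightarrow> nat" where "len g = (LEAST k. \<exists>w \<in> lists {..<n}. ev w = g \<and> length w = k)"

lemma len_le: "w \<in> lists {..<n} \<Longrightarrow> len (ev w) \<le> length w"
  unfolding len_def by (rule Least_le) auto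

lemma len_word: assumes "g \<in> carrier G" obtains w where "w \<in> lists {..<n}" "ev w = g" "length w = len g"
proof -
  have "\<exists>k. \<exists>w \<in> lists {..<n}. ev w = g \<and> length w = k" using wd[OF assms] by blast
  then have "\<exists>w \<in> lists {..<n}. ev w = g \<and> length w = len g" unfolding len_def by (rule LeastI_ex)
  then show ?thesis using that by blast
qed

lemma len_one [simp]: "len \<one> = 0" using len_le[of "[]"] by simp

lemma len_mult_le: assumes "g \<in> carrier G" "h \<in> carrier G" shows "len (g \<otimes> h) \<le> len g + len h"
proof -
  obtain u where "u \<in> lists {..<n}" "ev u = g" "length u = len g" using len_word[OF assms(1)] .
  moreover obtain v where "v \<in> lists {..<n}" "ev v = h" "length v = len h" using len_word[OF assms(2)] .
  ultimately show ?thesis using len_le[of "u @ v"] by (simp add: ev_append)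
qed

lemma len_s: "i < n \<Longrightarrow> len (s i) \<le> 1" using len_le[of "[i]"] by simp

text \<open>The letter is the last one of a shortest word. If \<open>g\<close> lies in
  \<open>W J\<close> and this letter were outside \<open>J\<close>, retracting to \<open>J\<close>
  would fix \<open>g\<close> and delete the letter, leaving a shorter word. So one letter works for
  all \<open>J\<close> simultaneously.\<close>

lemma last_letter:
  assumes g: "g \<in> carrier G" "g \<noteq> \<one>"
  obtains i where "i < n" "len (g \<otimes> s i) < len g" "\<And>J. J \<subseteq> {..<n} \<Longrightarrow> g \<in> W J \<Longrightarrow> i \<in> J"
proof -
  obtain w where w: "w \<in> lists {..<n}" "ev w = g" "length w = len g" using len_word[OF assms(1)] .
  then have "w \<noteq> []" using assms by auto
  then obtain u i where u: "w = u @ [i]" by (metis append_butlast_last_id)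
  then have ui: "u \<in> lists {..<n}" "i < n" using w by auto
  have g_eq: "g = ev u \<otimes> s i" using w u ui by (auto simp: ev_append)
  then have gu: "g \<otimes> s i = ev u" using ui ev_closed[OF ui(1)] by (simp add: m_assoc)
  then have l: "len (g \<otimes> s i) < len g" using len_le[OF ui(1)] w u by simp
  have "i \<in> J" if J: "J \<subseteq> {..<n}" and gJ: "g \<in> W J" for J
  proof (rule ccontr)
    assume i: "i \<notin> J"
    have fl: "v \<in> lists {..<n} \<Longrightarrow> ret J (ev v) = ev (filter (\<lambda>x. x \<in> J) v)" for v
    proof (induction v)
      case (Cons a v)
      then have "filter (\<lambda>x. x \<in> J) v \<in> lists {..<n}" by auto
      then show ?case using Cons by (auto simp: ev_closed)
    qed auto
    have "g = ret J (ev w)" using w ret_id[OF gJ J] by simp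
    also have "\<dots> = ev (filter (\<lambda>x. x \<in> J) u)" using fl[OF w(1)] u i by simp
    also have "filter (\<lambda>x. x \<in> J) u \<in> lists {..<n}" using ui by auto
    note len_le[OF this]
    finally have "len g \<le> length (filter (\<lambda>x. x \<in> J) u)" .
    also have "\<dots> \<le> length u" by simp
    finally show False using w u by simp
  qed
  then show ?thesis using that ui(2) l by blast
qed

end

section \<open>The geometric representation\<close>

definition fun_monoid :: "('v \<Rightarrow> 'v) monoid" where
  "fun_monoid = \<lparr>carrier = UNIV, monoid.mult = (\<circ>), one = id\<rparr>"

lemma monoid_fun_monoid: "monoid fun_monoid"
  by unfold_locales (auto simp: fun_monoid_def)

lemma fun_monoid_simps [simp]:
  "carrier fun_monoid = UNIV" "f \<otimes>\<^bsub>fun_monoid\<^esub> g = f \<circ> g" "\<one>\<^bsub>fun_monoid\<^esub> = id"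
  by (auto simp: fun_monoid_def)

lemma fun_monoid_pow [simp]: "f [^]\<^bsub>fun_monoid\<^esub> (k::nat) = f ^^ k"
proof (induction k)
  case 0 then show ?case using monoid.nat_pow_0[OF monoid_fun_monoid, of f] by simp
next
  case (Suc k)
  then show ?case using monoid.nat_pow_Suc[OF monoid_fun_monoid, of f k] by (simp add: funpow_Suc_right del: funpow.simps)
qed

text \<open>Chebyshev polynomials of the second kind with shifted index: U_{k-1}(c), which is sin(k
  theta) / sin(theta) at c = cos theta. The recursion also covers c = 1, where the value is k; this
  is the case of the label \<infinity>.\<close>

fun cheb :: "real \<Rightarrow> nat \<Rightarrow> real" where
  "cheb c 0 = 0"
| "cheb c (Suc 0) = 1"
| "cheb c (Suc (Suc k)) = 2 * c * cheb c (Suc k) - cheb c k"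

lemma cheb_cos: "cheb (cos \<theta>) k * sin \<theta> = sin (real k * \<theta>)"
proof (induction "cos \<theta>" k rule: cheb.induct)
  case (3 k)
  have "sin (real (Suc (Suc k)) * \<theta>) + sin (real k * \<theta>) = 2 * cos \<theta> * sin (real (Suc k) * \<theta>)"
  proof -
    have "real (Suc (Suc k)) * \<theta> = real (Suc k) * \<theta> + \<theta>" "real k * \<theta> = real (Suc k) * \<theta> - \<theta>"
      by (simp_all add: algebra_simps)
    then show ?thesis by (simp only: sin_add sin_diff) simp
  qed
  then show ?case using 3 by (simp add: algebra_simps)
qed auto

lemma cheb_1: "cheb 1 k = real k"
  by (induction "1::real" k rule: cheb.induct) auto

lemma sin_pi_div_pos: "2 \<le> k \<Longrightarrow> 0 < sin (pi / real k)"
  by (intro sin_gt_zero) (auto simp: field_simps)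

text \<open>For a finite label the angle k pi / l stays within [0, pi], where the sine is
  nonnegative. The value \<open>l = 0\<close> stands for \<infinity>, and pi / 0 = 0 turns the
  argument into 1.\<close>

lemma cheb_nonneg:
  assumes "k \<le> l \<or> l = 0" "l \<noteq> 1"
  shows "0 \<le> cheb (cos (pi / real l)) k"
proof (cases "l = 0")
  case False
  then have l: "2 \<le> l" "k \<le> l" using assms by auto
  have "0 \<le> sin (real k * (pi / real l))" using l by (intro sin_ge_zero) (auto simp: field_simps)
  then show ?thesis using sin_pi_div_pos[OF l(1)] cheb_cos[of "pi / real l" k] by (metis mult_neg_pos not_le)
qed (simp add: cheb_1)

text \<open>Indexed from the right: the last letter is \<open>j\<close>.\<close>
primrec alt :: "'x \<Rightarrow> 'x \<Rightarrow> nat \<Rightarrow> 'x list" where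
  "alt i j 0 = []"
| "alt i j (Suc r) = (if even r then j else i) # alt i j r"

lemma length_alt [simp]: "length (alt i j r) = r" by (induction r) auto

lemma alt_in_lists: "i \<in> J \<Longrightarrow> j \<in> J \<Longrightarrow> alt i j r \<in> lists J" by (induction r) auto

lemma alt_snoc: "alt i j (Suc r) = alt j i r @ [j]"
  by (induction r) auto

lemma alt_add: "alt i j (a + b) = (if even b then alt i j a else alt j i a) @ alt i j b"
  by (induction a) auto

text \<open>Simple roots. Vectors are arbitrary functions on \<open>nat\<close>: the bilinear form
  reads only the coordinates below \<open>n\<close>, and the simple reflections change only
  those.\<close>

definition al :: "nat \<Rightarrow> nat \<Rightarrow> real" where "al i = (\<lambda>k. if k = i then 1 else 0)"

definition linear_fun :: "((nat \<Rightarrow> real) \<Rightarrow> nat \<Rightarrow> real) \<Rightarrow> bool" where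
  "linear_fun f \<longleftrightarrow> (\<forall>a b u v. f (\<lambda>k. a * u k + b * v k) = (\<lambda>k. a * f u k + b * f v k))"

lemma linear_funD: "linear_fun f \<Longrightarrow> f (\<lambda>k. a * u k + b * v k) = (\<lambda>k. a * f u k + b * f v k)"
  by (simp add: linear_fun_def)

context even_coxeter begin

definition B :: "nat \<Rightarrow> nat \<Rightarrow> real" where
  \<comment> \<open>For \<open>d i j = 0\<close> the junk value \<open>pi / 0 = 0\<close> yields the usual entry \<open>-1\<close>.\<close>
  "B i j = - cos (pi / real (d i j))"

definition form :: "nat \<Rightarrow> (nat \<Rightarrow> real) \<Rightarrow> real" where "form i v = (\<Sum>j<n. B i j * v j)"

definition bil :: "(nat \<Rightarrow> real) \<Rightarrow> (nat \<Rightarrow> real) \<Rightarrow> real" where "bil u v = (\<Sum>i<n. u i * form i v)"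

definition sg :: "nat \<Rightarrow> (nat \<Rightarrow> real) \<Rightarrow> nat \<Rightarrow> real" where
  "sg i v = (\<lambda>k. v k - 2 * form i v * al i k)"

lemma B_sym: "i < n \<Longrightarrow> j < n \<Longrightarrow> B i j = B j i" by (simp add: B_def d_sym)

lemma B_self: "i < n \<Longrightarrow> B i i = 1" by (simp add: B_def)

lemma form_lin [simp]: "form i (\<lambda>k. a * u k + b * v k) = a * form i u + b * form i v"
  by (simp add: form_def sum_distrib_left sum.distrib algebra_simps)

lemma form_al [simp]: "i < n \<Longrightarrow> form j (al i) = B j i"
  by (simp add: form_def al_def if_distrib sum.delta cong: if_cong)

lemma form_add_al: "i < n \<Longrightarrow> form j (\<lambda>k. u k + x * al i k) = form j u + x * B j i"
  using form_lin[of j 1 u x "al i"] by simp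

lemma form_diff_al: "i < n \<Longrightarrow> form j (\<lambda>k. u k - x * al i k) = form j u - x * B j i"
  using form_lin[of j 1 u "-x" "al i"] by simp

lemma bil_lin: "bil u (\<lambda>k. a * x k + b * y k) = a * bil u x + b * bil u y"
  by (simp add: bil_def sum_distrib_left sum.distrib algebra_simps)

lemma bil_sym: "bil u v = bil v u"
proof -
  have "bil u v = (\<Sum>i<n. \<Sum>j<n. u i * B i j * v j)"
    by (simp add: bil_def form_def sum_distrib_left mult.assoc)
  also have "\<dots> = (\<Sum>j<n. \<Sum>i<n. u i * B i j * v j)" by (rule sum.swap)
  also have "\<dots> = (\<Sum>j<n. \<Sum>i<n. v j * B j i * u i)"
    by (rule sum.cong[OF HOL.refl], rule sum.cong[OF HOL.refl]) (simp add: B_sym)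
  also have "\<dots> = bil v u" by (simp add: bil_def form_def sum_distrib_left mult.assoc)
  finally show ?thesis .
qed

lemma bil_lin_left: "bil (\<lambda>k. a * x k + b * y k) u = a * bil x u + b * bil y u"
  using bil_lin[of u] by (simp add: bil_sym)

lemma bil_al [simp]: "i < n \<Longrightarrow> bil (al i) v = form i v"
  by (simp add: bil_def al_def if_distrib[of "\<lambda>x. x * _"] sum.delta cong: if_cong)

lemma sg_eq: "sg i v = (\<lambda>k. 1 * v k + (- 2 * form i v) * al i k)"
  by (simp add: sg_def)

lemma linear_sg: "linear_fun (sg i)"
  unfolding linear_fun_def sg_def by (auto simp: fun_eq_iff algebra_simps)

lemma bil_sg: assumes "i < n" shows "bil (sg i u) (sg i v) = bil u v"
proof -
  have 1: "bil u (al i) = form i u" for u using assms by (subst bil_sym) simp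
  show ?thesis unfolding sg_eq bil_lin bil_lin_left using assms B_self[of i] 1
    by (simp add: algebra_simps)
qed

text \<open>The offset \<open>u\<close>, orthogonal to alpha_i, lets one formula serve both the
  plane of the two roots (\<open>u = 0\<close>) and a general vector split into an orthogonal part
  and a part in that plane.\<close>

lemma sg_plane:
  assumes "i < n" "j < n" and i: "form i u = 0" and c: "c = - B i j"
  shows "sg i (\<lambda>k. u k + x * al i k + y * al j k) = (\<lambda>k. u k + (2 * c * y - x) * al i k + y * al j k)"
proof -
  have "form i (\<lambda>k. u k + x * al i k + y * al j k) = x - c * y"
    using assms by (simp add: form_add_al B_self)
  then have "sg i (\<lambda>k. u k + x * al i k + y * al j k) =
      (\<lambda>k. u k + x * al i k + y * al j k - 2 * (x - c * y) * al i k)"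
    by (simp add: sg_def)
  then show ?thesis by (simp add: algebra_simps)
qed

lemma sg_pow:
  assumes ij: "i < n" "j < n" "i \<noteq> j" and d: "d i j \<noteq> 0"
  shows "(sg i \<circ> sg j) ^^ d i j = id"
proof
  fix v
  define \<theta> where "\<theta> = pi / real (d i j)"
  define c where "c = cos \<theta>"
  have d2: "2 \<le> d i j" using d d_even[OF ij] by (cases "d i j = 1") auto
  have S: "sin \<theta> > 0" unfolding \<theta>_def using sin_pi_div_pos[OF d2] .
  have c1: "1 - c\<^sup>2 \<noteq> 0" using S sin_squared_eq[of \<theta>] by (auto simp: c_def power2_eq_square)
  have Bij: "B i j = - c" "B j i = - c" using ij by (auto simp: B_def c_def \<theta>_def d_sym)
  \<comment> \<open>The Chebyshev value as a function of a real index, because the index 2k - 1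
    below equals -1 at k = 0.\<close>
  define us where "us t = sin (t * \<theta>) / sin \<theta>" for t
  have us_rec: "us (t + 1) = 2 * c * us t - us (t - 1)" for t
    using S by (simp add: us_def c_def field_simps sin_add sin_diff distrib_right left_diff_distrib)
  define p where "p = form i v"
  define q where "q = form j v"
  \<comment> \<open>The Gram determinant of the two roots is 1 - c^2, nonzero for a finite label.
    \<open>x\<close> and \<open>y\<close> solve the linear system that makes \<open>u\<close>
    orthogonal to both roots.\<close>
  define x where "x = (p + c * q) / (1 - c\<^sup>2)"
  define y where "y = (q + c * p) / (1 - c\<^sup>2)"
  define u where "u = (\<lambda>k. v k - x * al i k - y * al j k)"
  have xy: "x - c * y = p" "y - c * x = q"
  proof -
    have "x - c * y = ((p + c * q) - c * (q + c * p)) / (1 - c\<^sup>2)"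
      "y - c * x = ((q + c * p) - c * (p + c * q)) / (1 - c\<^sup>2)"
      unfolding x_def y_def by (simp_all add: diff_divide_distrib)
    moreover have "(p + c * q) - c * (q + c * p) = p * (1 - c\<^sup>2)"
      "(q + c * p) - c * (p + c * q) = q * (1 - c\<^sup>2)"
      by (simp_all add: algebra_simps power2_eq_square)
    ultimately show "x - c * y = p" "y - c * x = q" using c1 by simp_all
  qed
  have "form i u = p - x + c * y" "form j u = q + c * x - y"
    using ij Bij unfolding u_def by (simp_all add: form_diff_al B_self p_def q_def)
  then have u0: "form i u = 0" "form j u = 0" using xy by auto
  let ?P = "\<lambda>x y. \<lambda>k. u k + x * al i k + y * al j k"
  have j: "sg j (?P x y) = ?P x (2 * c * x - y)" for x y
    using sg_plane[OF ij(2,1) u0(2), of c y x] Bij by (simp add: algebra_simps)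
  have i: "sg i (?P x y) = ?P (2 * c * y - x) y" for x y
    using sg_plane[OF ij(1,2) u0(1), of c x y] Bij by (simp add: algebra_simps)
  have pow: "((sg i \<circ> sg j) ^^ k) (?P x y) =
      ?P (x * us (2 * real k + 1) - y * us (2 * real k)) (x * us (2 * real k) - y * us (2 * real k - 1))" for k
  proof (induction k)
    case 0
    have "us 0 = 0" "us 1 = 1" "us (-1) = -1" using S by (auto simp: us_def)
    then show ?case by simp
  next
    case (Suc k)
    have r1: "us (2 * real (Suc k)) = 2 * c * us (2 * real k + 1) - us (2 * real k)"
      using us_rec[of "2 * real k + 1"] by (simp add: algebra_simps)
    have r2: "us (2 * real (Suc k) + 1) = 2 * c * us (2 * real (Suc k)) - us (2 * real k + 1)"
      using us_rec[of "2 * real (Suc k)"] by (simp add: algebra_simps)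
    have r3: "us (2 * real (Suc k) - 1) = 2 * c * us (2 * real k) - us (2 * real k - 1)"
      using us_rec[of "2 * real k"] by (simp add: algebra_simps)
    have r3': "us (2 * real k + 1) = 2 * c * us (2 * real k) - us (2 * real k - 1)"
      using us_rec[of "2 * real k"] by (simp add: algebra_simps)
    have "((sg i \<circ> sg j) ^^ Suc k) (?P x y) = sg i (sg j (((sg i \<circ> sg j) ^^ k) (?P x y)))" by simp
    also have "\<dots> = ?P (x * us (2 * real (Suc k) + 1) - y * us (2 * real (Suc k)))
        (x * us (2 * real (Suc k)) - y * us (2 * real (Suc k) - 1))"
      unfolding Suc i j r1 r2 r3 r3' by (simp add: algebra_simps)
    finally show ?case .
  qed
  have t: "real (d i j) * \<theta> = pi" using d by (simp add: \<theta>_def)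
  have a: "(2 * real (d i j) + 1) * \<theta> = 2 * pi + \<theta>" "2 * real (d i j) * \<theta> = 2 * pi"
    "(2 * real (d i j) - 1) * \<theta> = 2 * pi - \<theta>" using t by (simp_all add: algebra_simps)
  have "us (2 * real (d i j) + 1) = 1" "us (2 * real (d i j)) = 0" "us (2 * real (d i j) - 1) = -1"
    unfolding us_def a using S by (simp_all add: sin_diff sin_add)
  then have "((sg i \<circ> sg j) ^^ d i j) (?P x y) = ?P x y" unfolding pow by simp
  moreover have "?P x y = v" by (simp add: u_def)
  ultimately show "((sg i \<circ> sg j) ^^ d i j) v = id v" by simp
qed

lemma sg_sg [simp]: assumes "i < n" shows "sg i (sg i v) = v"
proof -
  have "form i (sg i v) = - form i v"
    unfolding sg_eq form_lin using assms by (simp add: B_self)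
  then show ?thesis by (simp add: sg_def[of i "sg i v"]) (simp add: sg_def)
qed

definition gact :: "'a \<Rightarrow> (nat \<Rightarrow> real) \<Rightarrow> nat \<Rightarrow> real" where "gact = lift fun_monoid sg"

lemma sg_rels: assumes "i < n" "j < n" shows "(sg i \<circ> sg j) ^^ d i j = id"
proof (cases "i = j")
  case True then show ?thesis using assms by (auto simp: fun_eq_iff)
next
  case False then show ?thesis using sg_pow[OF assms False] by (cases "d i j = 0") auto
qed

lemma gact_s [simp]: "i < n \<Longrightarrow> gact (s i) = sg i"
  unfolding gact_def by (rule lift_s[OF monoid_fun_monoid]) (use sg_rels in auto)

lemma gact_one [simp]: "gact \<one> = id"
  unfolding gact_def by (subst lift_one[OF monoid_fun_monoid]) (use sg_rels in auto)

lemma gact_mult: "g \<in> carrier G \<Longrightarrow> h \<in> carrier G \<Longrightarrow> gact (g \<otimes> h) = gact g \<circ> gact h"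
  using hom_mult[OF lift_hom[OF monoid_fun_monoid, of sg], of g h] sg_rels
  unfolding gact_def by auto

lemma gact_mult_app [simp]: "g \<in> carrier G \<Longrightarrow> h \<in> carrier G \<Longrightarrow> gact (g \<otimes> h) v = gact g (gact h v)"
  by (simp add: gact_mult)

lemma gact_inv [simp]:
  assumes "g \<in> carrier G" shows "gact (inv g) (gact g v) = v" "gact g (gact (inv g) v) = v"
  using gact_mult_app[of "inv g" g v] gact_mult_app[of g "inv g" v] assms by auto

lemma linear_gact: "g \<in> carrier G \<Longrightarrow> linear_fun (gact g)"
proof (induction rule: word_induct)
  case one then show ?case by (simp add: linear_fun_def)
next
  case (mult i h)
  then show ?case using linear_sg[of i] by (simp add: linear_fun_def)
qed

lemma gact_lin: "g \<in> carrier G \<Longrightarrow> gact g (\<lambda>k. a * u k + b * v k) = (\<lambda>k. a * gact g u k + b * gact g v k)"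
  using linear_gact linear_funD by blast

lemma gact_scale: "g \<in> carrier G \<Longrightarrow> gact g (\<lambda>k. a * u k) = (\<lambda>k. a * gact g u k)"
  using gact_lin[of g a u 0 u] by simp

lemma gact_uminus: "g \<in> carrier G \<Longrightarrow> gact g (\<lambda>k. - u k) = (\<lambda>k. - gact g u k)"
  using gact_scale[of g "-1" u] by simp

lemma gact_zero: "g \<in> carrier G \<Longrightarrow> gact g (\<lambda>k. 0) = (\<lambda>k. 0)"
  using gact_scale[of g 0 "\<lambda>k. 0"] by simp

lemma gact_sum:
  assumes "g \<in> carrier G" "finite I"
  shows "gact g (\<lambda>k. \<Sum>i\<in>I. c i * u i k) = (\<lambda>k. \<Sum>i\<in>I. c i * gact g (u i) k)"
  using assms(2)
proof induction
  case (insert x F)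
  have "gact g (\<lambda>k. c x * u x k + 1 * (\<Sum>i\<in>F. c i * u i k)) = (\<lambda>k. c x * gact g (u x) k + 1 * gact g (\<lambda>k. \<Sum>i\<in>F. c i * u i k) k)"
    using assms(1) by (rule gact_lin)
  then show ?case using insert by simp
qed (simp add: gact_zero assms)

lemma gact_bil: "g \<in> carrier G \<Longrightarrow> bil (gact g u) (gact g v) = bil u v"
  by (induction arbitrary: u v rule: word_induct) (auto simp: bil_sg)

lemma gact_alt:
  assumes ij: "i < n" "j < n" "i \<noteq> j" and c: "c = - B i j"
  shows "gact (ev (alt i j r)) (al i) = (if even r
     then (\<lambda>k. cheb c (Suc r) * al i k + cheb c r * al j k)
     else (\<lambda>k. cheb c r * al i k + cheb c (Suc r) * al j k))"
proof (induction r)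
  case (Suc r)
  have z: "form l (\<lambda>k. 0) = 0" for l by (simp add: form_def)
  have i: "sg i (\<lambda>k. x * al i k + y * al j k) = (\<lambda>k. (2 * c * y - x) * al i k + y * al j k)" for x y
    using sg_plane[OF ij(1,2) z c] by simp
  have j: "sg j (\<lambda>k. x * al i k + y * al j k) = (\<lambda>k. x * al i k + (2 * c * x - y) * al j k)" for x y
    using sg_plane[OF ij(2,1) z, of c y x] c ij by (simp add: B_sym add.commute)
  have "alt i j r \<in> lists {..<n}" using ij by (intro alt_in_lists) auto
  then have "ev (alt i j r) \<in> carrier G" by (rule ev_closed)
  then show ?case using Suc ij by (auto simp: i j)
qed (auto simp: al_def)

lemma ev_alt_even: "i < n \<Longrightarrow> j < n \<Longrightarrow> ev (alt i j (2 * k)) = (s i \<otimes> s j) [^] k"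
proof -
  assume ij: "i < n" "j < n"
  have "alt i j (2 * k) = concat (replicate k [i, j])" by (induction k) auto
  then show ?thesis using word_eval_concat_replicate[of s i j k] ij by simp
qed

lemma alt_swap:
  assumes ij: "i < n" "j < n" "i \<noteq> j"
  shows "ev (alt i j (d i j)) = ev (alt j i (d i j))"
proof -
  obtain k where k: "d i j = 2 * k" using d_even[OF ij] by blast
  have "ev (alt i j (2 * k)) \<otimes> ev (alt i j (2 * k)) = \<one>"
    using s_pow[OF ij(1,2)] ij k by (simp add: ev_alt_even nat_pow_mult mult_2[symmetric])
  moreover have "ev (alt j i (2 * k)) \<otimes> ev (alt i j (2 * k)) = \<one>"
  proof -
    have "s j \<otimes> s i = inv (s i \<otimes> s j)" using ij by (simp add: inv_mult_group)
    then show ?thesis using ij by (simp add: ev_alt_even nat_pow_inv)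
  qed
  moreover have "ev (alt i j (2 * k)) \<in> carrier G" "ev (alt j i (2 * k)) \<in> carrier G"
    using ij by (simp_all add: ev_alt_even)
  ultimately show ?thesis using k by (metis r_cancel)
qed

section \<open>Signs of roots and word length\<close>

definition nonneg :: "(nat \<Rightarrow> real) \<Rightarrow> bool" where "nonneg v \<longleftrightarrow> (\<forall>k. 0 \<le> v k)"

lemma al_nonneg [simp]: "nonneg (al i)" by (simp add: nonneg_def al_def)

text \<open>Reduction to a dihedral subgroup. Let \<open>j\<close> shorten \<open>g\<close>, and
  strip from \<open>g\<close> a longest alternating suffix in \<open>i\<close> and \<open>j\<close>
  ending in \<open>j\<close>. Neither letter shortens the remaining factor, so by induction it keeps
  both simple roots nonnegative. The suffix maps alpha_i to a combination of the two with Chebyshev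
  coefficients, which are nonnegative as long as the suffix is shorter than the label.\<close>

theorem root_nonneg:
  assumes "g \<in> carrier G" "i < n" "\<not> len (g \<otimes> s i) < len g"
  shows "nonneg (gact g (al i))"
  using assms
proof (induction "len g" arbitrary: g i rule: less_induct)
  case less
  show ?case
  proof (cases "g = \<one>")
    case False
    from last_letter[OF less.prems(1) False] obtain j where j: "j < n" "len (g \<otimes> s j) < len g" by metis
    have ij: "i \<noteq> j" using j less.prems by auto
    have alc: "ev (alt i j r) \<in> carrier G" "ev (alt j i r) \<in> carrier G" for r
      using alt_in_lists[of i "{..<n}" j r] alt_in_lists[of j "{..<n}" i r] ev_closed j less.prems by auto
    have all: "alt i j r \<in> lists {..<n}" "alt j i r \<in> lists {..<n}" for r
      using alt_in_lists[of i "{..<n}" j r] alt_in_lists[of j "{..<n}" i r] j less.prems by auto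
    define P where "P r \<longleftrightarrow> (\<exists>v\<in>carrier G. g = v \<otimes> ev (alt i j r) \<and> len g = len v + r)" for r
    have drop: "len v = len (v \<otimes> s k) + 1" if "v \<in> carrier G" "k < n" "len (v \<otimes> s k) < len v" for v k
    proof -
      have "v = (v \<otimes> s k) \<otimes> s k" using that by (simp add: m_assoc)
      then have "len v \<le> len (v \<otimes> s k) + len (s k)" using len_mult_le[of "v \<otimes> s k" "s k"] that by simp
      then show ?thesis using that len_s[of k] by simp
    qed
    have "P 1" unfolding P_def using less.prems j drop[OF _ j]
      by (intro bexI[of _ "g \<otimes> s j"]) (auto simp: m_assoc)
    moreover have bd: "\<And>r. P r \<Longrightarrow> r \<le> len g" unfolding P_def by auto
    ultimately obtain r where r: "P r" "1 \<le> r" "\<And>q. P q \<Longrightarrow> q \<le> r"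
      by (metis GreatestI_nat Greatest_le_nat)
    then obtain v where v: "v \<in> carrier G" "g = v \<otimes> ev (alt i j r)" "len g = len v + r" unfolding P_def by auto
    \<comment> \<open>\<open>e\<close> is the letter that would prolong the alternating suffix to
      the left, \<open>t\<close> is its present leftmost letter. Shortening by \<open>e\<close>
      contradicts maximality of the suffix, shortening by \<open>t\<close> contradicts additivity of
      lengths.\<close>
    define e where "e = (if even r then j else i)"
    define t where "t = (if even r then i else j)"
    have et: "e < n" "t < n" "{e, t} = {i, j}" using j less.prems by (auto simp: e_def t_def)
    obtain r' where r': "r = Suc r'" using r(2) by (cases r) auto
    have "\<not> len (v \<otimes> s e) < len v"
    proof
      assume l: "len (v \<otimes> s e) < len v"
      have "(v \<otimes> s e) \<otimes> ev (alt i j (Suc r)) = v \<otimes> (s e \<otimes> (s e \<otimes> ev (alt i j r)))"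
        using v(1) et alc by (simp add: e_def[symmetric] m_assoc)
      also have "s e \<otimes> (s e \<otimes> ev (alt i j r)) = ev (alt i j r)"
        using et alc by (simp add: m_assoc[symmetric])
      finally have "g = (v \<otimes> s e) \<otimes> ev (alt i j (Suc r))" using v by simp
      moreover have "len g = len (v \<otimes> s e) + Suc r" using drop[OF v(1) et(1) l] v(3) by simp
      ultimately have "P (Suc r)" unfolding P_def using v(1) et by blast
      then show False using r(3) by fastforce
    qed
    moreover have "\<not> len (v \<otimes> s t) < len v"
    proof
      assume l: "len (v \<otimes> s t) < len v"
      have "g = (v \<otimes> s t) \<otimes> ev (alt i j r')"
        using v(1,2) et alc r' by (simp add: t_def m_assoc)
      then have "len g \<le> len (v \<otimes> s t) + r'"
        using len_mult_le[of "v \<otimes> s t" "ev (alt i j r')"] len_le[OF all(1), of r'] v(1) et alc by simp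
      then show False using l v(3) r' by simp
    qed
    moreover have "len v < len g" using v(3) r(2) by simp
    ultimately have "nonneg (gact v (al e))" "nonneg (gact v (al t))"
      using less.hyps[of v] v(1) et by auto
    then have nn: "nonneg (gact v (al i))" "nonneg (gact v (al j))" using et(3) by (auto simp: doubleton_eq_iff)
    \<comment> \<open>A suffix at least as long as the label ends in the longest alternating word,
      which can be rewritten to end in \<open>i\<close>; then \<open>s i\<close> would shorten
      \<open>g\<close>.\<close>
    have rd: "r < d i j \<or> d i j = 0"
    proof (rule ccontr)
      assume "\<not> ?thesis"
      then have d0: "d i j \<noteq> 0" "d i j \<le> r" by auto
      obtain a where a: "r = a + d i j" using d0 by (metis le_add_diff_inverse2)
      obtain b where b: "d i j = Suc b" using d0 by (cases "d i j") auto
      have "alt i j r = alt i j a @ alt i j (d i j)"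
        using alt_add[of i j a "d i j"] a d_even[of i j] ij j less.prems by simp
      then have "ev (alt i j r) = ev (alt i j a) \<otimes> ev (alt i j (d i j))"
        using all by (simp add: ev_append)
      also have "\<dots> = ev (alt i j a) \<otimes> (ev (alt i j b) \<otimes> s i)"
        using alt_swap[of i j] ij j less.prems(2) all alc unfolding b alt_snoc[of j i]
        by (simp add: ev_append)
      finally have "g \<otimes> s i = v \<otimes> (ev (alt i j a) \<otimes> ev (alt i j b))"
        using v(1,2) alc less.prems(2) by (simp add: m_assoc)
      also have "ev (alt i j a) \<otimes> ev (alt i j b) = ev (alt i j a @ alt i j b)" using all by (simp add: ev_append)
      finally have "len (g \<otimes> s i) \<le> len v + len (ev (alt i j a @ alt i j b))"
        using len_mult_le[of v "ev (alt i j a @ alt i j b)"] v(1) all by (simp add: ev_closed)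
      also have "alt i j a @ alt i j b \<in> lists {..<n}" using all by auto
      note len_le[OF this]
      finally have "len (g \<otimes> s i) < len g" using v(3) a b by simp
      then show False using less.prems by simp
    qed
    define x where "x = (if even r then cheb (- B i j) (Suc r) else cheb (- B i j) r)"
    define y where "y = (if even r then cheb (- B i j) r else cheb (- B i j) (Suc r))"
    have xy: "0 \<le> x" "0 \<le> y"
      using cheb_nonneg[of "r" "d i j"] cheb_nonneg[of "Suc r" "d i j"] rd d_even[of i j] ij j less.prems(2)
      by (auto simp: x_def y_def B_def)
    have "gact (ev (alt i j r)) (al i) = (\<lambda>k. x * al i k + y * al j k)"
      using gact_alt[OF less.prems(2) j(1) ij HOL.refl] by (auto simp: x_def y_def)
    then have "gact g (al i) = (\<lambda>k. x * gact v (al i) k + y * gact v (al j) k)"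
      using v(1,2) alc by (simp add: gact_lin)
    then show ?thesis using nn xy by (auto simp: nonneg_def)
  qed simp
qed

lemma root_nonpos:
  assumes "g \<in> carrier G" "i < n" "len (g \<otimes> s i) < len g"
  shows "nonneg (\<lambda>k. - gact g (al i) k)"
proof -
  have "g \<otimes> s i \<otimes> s i = g" using assms by (simp add: m_assoc)
  then have "nonneg (gact (g \<otimes> s i) (al i))" using assms by (intro root_nonneg) auto
  moreover have "sg i (al i) = (\<lambda>k. - al i k)" using assms by (auto simp: sg_def B_self)
  ultimately show ?thesis using assms by (simp add: gact_uminus)
qed

section \<open>Roots and inversion sets\<close>

definition Phi :: "(nat \<Rightarrow> real) set" where "Phi = {gact g (al i) | g i. g \<in> carrier G \<and> i < n}"

lemma PhiI: "g \<in> carrier G \<Longrightarrow> i < n \<Longrightarrow> gact g (al i) \<in> Phi" by (auto simp: Phi_def)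

lemma al_Phi: "i < n \<Longrightarrow> al i \<in> Phi" using PhiI[of \<one> i] by simp

lemma PhiE: assumes "b \<in> Phi" obtains g i where "g \<in> carrier G" "i < n" "b = gact g (al i)"
  using assms by (auto simp: Phi_def)

lemma Phi_gact: "b \<in> Phi \<Longrightarrow> g \<in> carrier G \<Longrightarrow> gact g b \<in> Phi"
  by (erule PhiE) (metis PhiI gact_mult_app m_closed)

lemma Phi_uminus: assumes "b \<in> Phi" shows "(\<lambda>k. - b k) \<in> Phi"
proof -
  obtain g i where g: "g \<in> carrier G" "i < n" "b = gact g (al i)" using PhiE[OF assms] .
  have "sg i (al i) = (\<lambda>k. - al i k)" using g by (auto simp: sg_def B_self)
  then have "gact (g \<otimes> s i) (al i) = (\<lambda>k. - b k)" using g by (simp add: gact_uminus)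
  then show ?thesis using PhiI[of "g \<otimes> s i" i] g by simp
qed

lemma Phi_cases: assumes "b \<in> Phi" shows "nonneg b \<or> nonneg (\<lambda>k. - b k)"
  using PhiE[OF assms] root_nonneg root_nonpos by metis

lemma bil_Phi: "b \<in> Phi \<Longrightarrow> bil b b = 1"
  by (erule PhiE) (simp add: gact_bil B_self)

lemma Phi_nonzero: "b \<in> Phi \<Longrightarrow> b \<noteq> (\<lambda>k. 0)"
  using bil_Phi[of b] by (auto simp: bil_def form_def)

lemma nonneg_both: "nonneg b \<Longrightarrow> nonneg (\<lambda>k. - b k) \<Longrightarrow> b = (\<lambda>k. 0)"
  by (auto simp: nonneg_def fun_eq_iff intro: antisym)

lemma Phi_neg: "b \<in> Phi \<Longrightarrow> nonneg (\<lambda>k. - b k) \<longleftrightarrow> \<not> nonneg b"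
  using Phi_cases nonneg_both Phi_nonzero by blast

lemma len_iff: "g \<in> carrier G \<Longrightarrow> i < n \<Longrightarrow> nonneg (gact g (al i)) \<longleftrightarrow> \<not> len (g \<otimes> s i) < len g"
  using root_nonneg root_nonpos Phi_neg[OF PhiI] by blast

lemma Phi_support: assumes "b \<in> Phi" "\<not> k < n" shows "b k = 0"
proof -
  have "gact g v k = v k" if "g \<in> carrier G" for g v
    using that assms(2) by (induction arbitrary: v rule: word_induct) (auto simp: sg_def al_def)
  then show ?thesis using assms by (elim PhiE) (auto simp: al_def)
qed

lemma faithful: assumes "g \<in> carrier G" "\<And>i. i < n \<Longrightarrow> gact g (al i) = al i" shows "g = \<one>"
proof (rule ccontr)
  assume "g \<noteq> \<one>"
  then obtain i where "i < n" "len (g \<otimes> s i) < len g" using last_letter[OF assms(1)] by metis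
  then show False using len_iff[of g i] assms by simp
qed

text \<open>A positive root supported on coordinate \<open>i\<close> alone has norm 1 and is
  therefore alpha_i. Any other positive root has a positive coordinate untouched by the reflection,
  and one positive coordinate decides the sign of a root.\<close>

lemma sg_pos: assumes b: "b \<in> Phi" "nonneg b" "b \<noteq> al i" and i: "i < n" shows "nonneg (sg i b)"
proof -
  have "\<exists>k. k \<noteq> i \<and> b k > 0"
  proof (rule ccontr)
    assume "\<not> ?thesis"
    then have z: "b k = 0" if "k \<noteq> i" for k using b(2) that unfolding nonneg_def by (metis less_eq_real_def)
    then have eq: "b = (\<lambda>k. b i * al i k)" by (auto simp: al_def)
    have "bil (\<lambda>k. b i * al i k) (\<lambda>k. b i * al i k) = b i * b i"
      using bil_lin[of _ "b i" "al i" 0 "al i"] bil_lin_left[of "b i" "al i" 0 "al i"] i by (simp add: B_self)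
    then have "b i * b i = 1" using bil_Phi[OF b(1)] eq by simp
    then have "b i = 1" using b(2) by (auto simp: nonneg_def square_eq_1_iff dest: spec[of _ i])
    then have "b = al i" using z by (auto simp: al_def)
    then show False using b(3) by simp
  qed
  then obtain k where k: "k \<noteq> i" "b k > 0" by auto
  then have "sg i b k > 0" by (simp add: sg_def al_def)
  then have "\<not> nonneg (\<lambda>k. - sg i b k)" by (auto simp: nonneg_def not_le intro!: exI[of _ k])
  moreover have "sg i b \<in> Phi" using Phi_gact[of b "s i"] b i by simp
  ultimately show ?thesis using Phi_neg by blast
qed

definition Inv :: "'a \<Rightarrow> (nat \<Rightarrow> real) set" where "Inv g = {b \<in> Phi. nonneg b \<and> \<not> nonneg (gact g b)}"

lemma Inv_s_mult: "i < n \<Longrightarrow> h \<in> carrier G \<Longrightarrow> Inv (s i \<otimes> h) \<subseteq> insert (gact (inv h) (al i)) (Inv h)"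
proof
  fix b assume ih: "i < n" "h \<in> carrier G" and b: "b \<in> Inv (s i \<otimes> h)"
  then have b': "b \<in> Phi" "nonneg b" "\<not> nonneg (sg i (gact h b))" by (auto simp: Inv_def)
  show "b \<in> insert (gact (inv h) (al i)) (Inv h)"
  proof (cases "nonneg (gact h b)")
    case True
    then have "gact h b = al i" using sg_pos[of "gact h b" i] b' ih Phi_gact by blast
    then have "b = gact (inv h) (al i)" using gact_inv(1)[OF ih(2), of b] by simp
    then show ?thesis by simp
  qed (use b' in \<open>auto simp: Inv_def\<close>)
qed

lemma finite_Inv: "g \<in> carrier G \<Longrightarrow> finite (Inv g)"
proof (induction rule: word_induct)
  case one then show ?case by (simp add: Inv_def)
next
  case (mult i h) then show ?case using Inv_s_mult[of i h] finite_subset by blast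
qed

text \<open>The action of the power on alpha_i has Chebyshev coefficients, so a trivial power forces
  a value of the sine to vanish. The exponent is first reduced modulo the label; for label 0 the
  reduction changes nothing, and the coefficient \<open>2 * k\<close> excludes every positive
  power.\<close>

lemma s_order:
  assumes ij: "i < n" "j < n" shows "(s i \<otimes> s j) [^] k = \<one> \<longleftrightarrow> d i j dvd k"
proof (cases "i = j")
  case False
  let ?t = "s i \<otimes> s j"
  let ?c = "cos (pi / real (d i j))"
  have key: "k = 0" if k: "?t [^] k = \<one>" "k < d i j \<or> d i j = 0" for k
  proof (rule ccontr)
    assume k0: "k \<noteq> 0"
    have "gact (ev (alt i j (2 * k))) (al i) = al i" using k ij by (simp add: ev_alt_even)
    then have "(\<lambda>l. cheb ?c (Suc (2 * k)) * al i l + cheb ?c (2 * k) * al j l) = al i"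
      using gact_alt[OF ij False HOL.refl, of "2 * k"] by (simp add: B_def)
    then have "cheb ?c (Suc (2 * k)) * al i i + cheb ?c (2 * k) * al j i = al i i"
      "cheb ?c (Suc (2 * k)) * al i j + cheb ?c (2 * k) * al j j = al i j" by metis+
    then have U: "cheb ?c (Suc (2 * k)) = 1" "cheb ?c (2 * k) = 0" using False by (auto simp: al_def)
    show False
    proof (cases "d i j = 0")
      case True then show ?thesis using U k0 by (simp add: cheb_1)
    next
      case d0: False
      define \<theta> where "\<theta> = pi / real (d i j)"
      have d2: "2 \<le> d i j" using d0 d_even[OF ij False] by (cases "d i j = 1") auto
      have S: "sin \<theta> > 0" unfolding \<theta>_def by (rule sin_pi_div_pos[OF d2])
      have s0: "sin (2 * k * \<theta>) = 0" "sin (2 * k * \<theta> + \<theta>) = sin \<theta>"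
        using cheb_cos[of \<theta> "2 * k"] cheb_cos[of \<theta> "Suc (2 * k)"] U
        unfolding \<theta>_def[symmetric] by (simp_all add: algebra_simps)
      then have "cos (2 * k * \<theta>) = 1" using S by (simp add: sin_add)
      \<comment> \<open>Halving the angle: k theta lies strictly between 0 and pi, where the sine
        does not vanish.\<close>
      then have "cos (k * \<theta> + k * \<theta>) = 1" by (simp add: algebra_simps)
      then have "sin (k * \<theta>) = 0"
        using cos_double_sin[of "k * \<theta>"] by (simp add: mult_2[symmetric])
      moreover have "0 < k * \<theta>" "k * \<theta> < pi"
        using k0 d0 k(2) by (auto simp: \<theta>_def field_simps)
      ultimately show False using sin_gt_zero[of "k * \<theta>"] by simp
    qed
  qed
  have md: "?t [^] k = ?t [^] (k mod d i j)"
  proof -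
    have "?t [^] k = ?t [^] (d i j * (k div d i j) + k mod d i j)" by simp
    also have "\<dots> = (?t [^] d i j) [^] (k div d i j) \<otimes> ?t [^] (k mod d i j)"
      using ij by (simp add: nat_pow_pow nat_pow_mult)
    finally show ?thesis using s_pow[OF ij] ij by simp
  qed
  show ?thesis
  proof
    assume "?t [^] k = \<one>"
    then have "?t [^] (k mod d i j) = \<one>" using md by argo
    moreover have "k mod d i j < d i j \<or> d i j = 0" by (cases "d i j = 0") auto
    ultimately have "k mod d i j = 0" by (rule key)
    then show "d i j dvd k" by (rule mod_0_imp_dvd)
  next
    assume "d i j dvd k"
    then have "k mod d i j = 0" by simp
    then show "?t [^] k = \<one>" unfolding md by simp
  qed
next
  case True
  then have "s i \<otimes> s j = \<one>" "d i j = Suc 0" using ij by simp_all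
  then show ?thesis by (simp only: nat_pow_one one_dvd One_nat_def[symmetric] HOL.simp_thms)
qed

end

section \<open>Finite subgroups\<close>

context even_coxeter begin

definition rho :: "(nat \<Rightarrow> real) \<Rightarrow> real" where "rho v = (\<Sum>k<n. v k)"

lemma rho_lin: "rho (\<lambda>k. a * u k + b * v k) = a * rho u + b * rho v"
  by (simp add: rho_def sum.distrib sum_distrib_left)

lemma rho_pos: assumes "b \<in> Phi" "nonneg b" shows "rho b > 0"
proof -
  have "\<exists>k. b k \<noteq> 0" using Phi_nonzero[OF assms(1)] by auto
  then obtain k where "b k \<noteq> 0" by auto
  then have "k < n" "b k > 0" using Phi_support[OF assms(1), of k] assms(2)
    by (auto simp: nonneg_def less_le)
  then show ?thesis using assms(2) unfolding rho_def nonneg_def by (intro sum_pos2[of _ k]) auto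
qed

text \<open>If the last letter \<open>i\<close> shortens \<open>g\<close> to \<open>h\<close>, then
  \<open>Inv g\<close> contains alpha_i in addition to a reflected copy of \<open>Inv h\<close>.
  Each letter thus costs an inversion, and a bound on inversions bounds lengths.\<close>

lemma len_le_Inv: assumes "g \<in> carrier G" shows "len g \<le> card (Inv g)"
  using assms
proof (induction "len g" arbitrary: g rule: less_induct)
  case less
  show ?case
  proof (cases "g = \<one>")
    case False
    obtain i where i: "i < n" "len (g \<otimes> s i) < len g" using last_letter[OF less.prems False] by metis
    define h where "h = g \<otimes> s i"
    have h: "h \<in> carrier G" "h \<otimes> s i = g" using less.prems i by (auto simp: h_def m_assoc)
    have neg: "\<not> nonneg (gact g (al i))" using len_iff less.prems i by blast
    have sgal: "sg i (al i) = (\<lambda>k. - al i k)" using i by (auto simp: sg_def B_self)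
    have gb: "gact g b = gact h (sg i b)" for b using h i by (metis gact_mult_app gact_s s_closed)
    have "al i \<notin> Inv h"
    proof
      assume "al i \<in> Inv h"
      then have "\<not> nonneg (gact h (al i))" by (simp add: Inv_def)
      moreover have "gact g (al i) = (\<lambda>k. - gact h (al i) k)" unfolding gb sgal using h by (simp add: gact_uminus)
      ultimately show False using neg Phi_cases[OF PhiI[OF h(1) i(1)]] by auto
    qed
    then have sub: "insert (al i) (sg i ` Inv h) \<subseteq> Inv g"
      using neg al_Phi[OF i(1)] sg_pos[OF _ _ _ i(1)] Phi_gact[of _ "s i"] i gb unfolding Inv_def by auto
    have "al i \<notin> sg i ` Inv h"
    proof
      assume "al i \<in> sg i ` Inv h"
      then obtain b where "b \<in> Inv h" "al i = sg i b" by auto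
      then have "b = sg i (al i)" "nonneg b" using i by (auto simp: Inv_def)
      then show False unfolding sgal by (auto simp: nonneg_def al_def dest: spec[of _ i])
    qed
    moreover have "inj_on (sg i) (Inv h)" using i by (metis inj_onI sg_sg)
    ultimately have "card (insert (al i) (sg i ` Inv h)) = Suc (card (Inv h))"
      using finite_Inv[OF h(1)] by (simp add: card_image)
    then have "Suc (card (Inv h)) \<le> card (Inv g)" using card_mono[OF finite_Inv[OF less.prems] sub] by simp
    moreover have "len h \<le> card (Inv h)" using less.hyps[of h] h i by (simp add: h_def)
    moreover have "len g \<le> len h + 1" using len_mult_le[OF h(1), of "s i"] h i len_s[of i] by simp
    ultimately show ?thesis by simp
  qed simp
qed

lemma finite_len_le: "finite {g \<in> carrier G. len g \<le> c}"
proof (rule finite_subset)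
  show "{g \<in> carrier G. len g \<le> c} \<subseteq> ev ` {w. set w \<subseteq> {..<n} \<and> length w \<le> c}"
  proof
    fix g assume "g \<in> {g \<in> carrier G. len g \<le> c}"
    then have g: "g \<in> carrier G" "len g \<le> c" by auto
    obtain w where "w \<in> lists {..<n}" "ev w = g" "length w = len g" using len_word[OF g(1)] .
    with g show "g \<in> ev ` {w. set w \<subseteq> {..<n} \<and> length w \<le> c}" by auto
  qed
qed (simp add: finite_lists_length_le)

text \<open>Tits' argument: the orbit sum \<open>Z\<close> of the functional \<open>rho\<close> is fixed by \<open>F\<close>, and it is negative on
  only finitely many positive roots, so some translate of it lies in the closed fundamental chamber.
  The stabiliser of that translate is the standard parabolic subgroup of the simple roots it kills.\<close>

theorem finite_subgroup_parabolic:
  assumes F: "subgroup F G" "finite F"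
  obtains w J where "w \<in> carrier G" "J \<subseteq> {..<n}" "finite (W J)" "\<And>g. g \<in> F \<Longrightarrow> inv w \<otimes> g \<otimes> w \<in> W J"
proof -
  have Fc: "g \<in> carrier G" if "g \<in> F" for g using F(1) that subgroup.mem_carrier by metis
  define Z where "Z v = (\<Sum>g\<in>F. rho (gact g v))" for v
  have Z_lin: "Z (\<lambda>k. a * u k + b * v k) = a * Z u + b * Z v" for a b u v
    unfolding Z_def using Fc by (simp add: gact_lin rho_lin sum.distrib sum_distrib_left)
  have Z_inv: "Z (gact h v) = Z v" if h: "h \<in> F" for h v
  proof -
    have "Z (gact h v) = (\<Sum>g\<in>F. rho (gact (g \<otimes> h) v))" unfolding Z_def using Fc h by simp
    also have "\<dots> = (\<Sum>g\<in>(\<lambda>g. g \<otimes> h) ` F. rho (gact g v))"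
      using Fc h by (subst sum.reindex) (auto simp: inj_on_def)
    also have "(\<lambda>g. g \<otimes> h) ` F = F"
    proof
      show "(\<lambda>g. g \<otimes> h) ` F \<subseteq> F" using h F(1) by (auto intro: subgroup.m_closed)
      show "F \<subseteq> (\<lambda>g. g \<otimes> h) ` F"
      proof
        fix g assume g: "g \<in> F"
        then have "g = (g \<otimes> inv h) \<otimes> h" using Fc h by (simp add: m_assoc)
        moreover have "g \<otimes> inv h \<in> F" using g h F(1) by (simp add: subgroup.m_closed subgroup.m_inv_closed)
        ultimately show "g \<in> (\<lambda>g. g \<otimes> h) ` F" by blast
      qed
    qed
    finally show ?thesis by (simp add: Z_def)
  qed
  \<comment> \<open>The positive roots on which the translate by \<open>w\<close> is negative. Such
    a root is an inversion of \<open>g \<otimes> w\<close> for some \<open>g\<close> in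
    \<open>F\<close>, so there are finitely many.\<close>
  define S where "S w = {b \<in> Phi. nonneg b \<and> Z (gact w b) < 0}" for w
  have finC: "finite (\<Union>g\<in>F. Inv (g \<otimes> w))" if "w \<in> carrier G" for w
    using F(2) Fc that finite_Inv by auto
  have inC: "b \<in> (\<Union>g\<in>F. Inv (g \<otimes> w))" if w: "w \<in> carrier G" and b: "b \<in> Phi" "nonneg b" "Z (gact w b) \<le> 0" for b w
  proof (rule ccontr)
    assume "\<not> ?thesis"
    then have "nonneg (gact g (gact w b))" if "g \<in> F" for g
      using that w b Fc by (auto simp: Inv_def)
    then have pos: "rho (gact g (gact w b)) > 0" if "g \<in> F" for g
      using that w b Fc Phi_gact by (intro rho_pos) auto
    have "F \<noteq> {}" using F(1) subgroup.one_closed by blast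
    then have "Z (gact w b) > 0" unfolding Z_def using pos F(2) by (intro sum_pos) auto
    then show False using b by simp
  qed
  have finS: "finite (S w)" if "w \<in> carrier G" for w
    by (rule finite_subset[OF _ finC[OF that]]) (use inC[OF that] in \<open>force simp: S_def\<close>)
  \<comment> \<open>A translate with the fewest such roots is dominant: if alpha_i were negative on
    it, passing to \<open>w \<otimes> s i\<close> would lose alpha_i and merely reflect the
    others.\<close>
  obtain w where w: "w \<in> carrier G" "\<And>v. v \<in> carrier G \<Longrightarrow> card (S w) \<le> card (S v)"
    using ex_has_least_nat[of "\<lambda>w. w \<in> carrier G" \<one> "\<lambda>w. card (S w)"] by auto
  define y where "y v = Z (gact w v)" for v
  have y_lin: "y (\<lambda>k. a * u k + b * v k) = a * y u + b * y v" for a b u v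
    unfolding y_def using w by (simp add: gact_lin Z_lin)
  have y_sg: "y (sg i v) = y v - 2 * form i v * y (al i)" for i v
    unfolding sg_eq y_lin by simp
  have y_pos: "0 \<le> y (al i)" if i: "i < n" for i
  proof (rule ccontr)
    assume neg: "\<not> 0 \<le> y (al i)"
    have fi: "form i (al i) = 1" using i B_self by simp
    have sub: "S (w \<otimes> s i) \<subseteq> sg i ` (S w - {al i})"
    proof
      fix b assume "b \<in> S (w \<otimes> s i)"
      then have b: "b \<in> Phi" "nonneg b" "y (sg i b) < 0" using w i by (auto simp: S_def y_def)
      have "b \<noteq> al i" using b(3) neg fi by (auto simp: y_sg)
      then have "nonneg (sg i b)" using sg_pos b i by blast
      moreover have "sg i b \<in> Phi" using Phi_gact[of b "s i"] b i by simp
      moreover have "sg i b \<noteq> al i"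
      proof
        assume "sg i b = al i"
        then have "b = sg i (al i)" using i by (metis sg_sg)
        then have "b i = - 1" using fi by (simp add: sg_def al_def)
        then show False using b(2) by (auto simp: nonneg_def dest: spec[of _ i])
      qed
      ultimately have "sg i b \<in> S w - {al i}" using b(3) by (simp add: S_def y_def)
      then show "b \<in> sg i ` (S w - {al i})" using i by (metis imageI sg_sg)
    qed
    have "al i \<in> S w" using neg al_Phi[OF i] by (simp add: S_def y_def)
    then have "card (S w - {al i}) < card (S w)" using finS[OF w(1)] by (metis card_Diff1_less)
    moreover have "card (S (w \<otimes> s i)) \<le> card (S w - {al i})"
      using card_mono[OF _ sub] card_image_le[of "S w - {al i}" "sg i"] finS[OF w(1)] by simp
    ultimately show False using w i by (metis m_closed not_less s_closed order.strict_trans2)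
  qed
  define J where "J = {i. i < n \<and> y (al i) = 0}"
  have J: "J \<subseteq> {..<n}" by (auto simp: J_def)
  \<comment> \<open>Let \<open>i\<close> be a last letter of \<open>h\<close>. Then \<open>h\<close>
    sends alpha_i to a negative root, where the dominant functional is at most 0; invariance equates
    this with its nonnegative value at alpha_i. Hence the value is 0, and \<open>i\<close> lies in
    \<open>J\<close>.\<close>
  have stab: "h \<in> W J" if "h \<in> carrier G" "\<And>v. y (gact h v) = y v" for h
    using that
  proof (induction "len h" arbitrary: h rule: less_induct)
    case less
    show ?case
    proof (cases "h = \<one>")
      case False
      obtain i where i: "i < n" "len (h \<otimes> s i) < len h" using last_letter[OF less.prems(1) False] by metis
      have neg: "nonneg (\<lambda>k. - gact h (al i) k)" using root_nonpos less.prems i by blast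
      have yneg: "y v \<ge> 0" if "nonneg v" "\<And>k. \<not> k < n \<Longrightarrow> v k = 0" for v
      proof -
        have ysum: "y (\<lambda>k. \<Sum>j\<in>I. v j * al j k) = (\<Sum>j\<in>I. v j * y (al j))" if "finite I" for I
          using that
        proof induction
          case empty
          have "y (\<lambda>k. 0 * (0::real) + 0 * 0) = 0" by (subst y_lin) simp
          then show ?case by simp
        next
          case (insert a I)
          have "y (\<lambda>k. v a * al a k + 1 * (\<Sum>j\<in>I. v j * al j k)) = v a * y (al a) + 1 * y (\<lambda>k. \<Sum>j\<in>I. v j * al j k)"
            by (rule y_lin)
          then show ?case using insert by simp
        qed
        have "v = (\<lambda>k. \<Sum>j<n. v j * al j k)"
          using that(2) by (auto simp: al_def fun_eq_iff if_distrib cong: if_cong)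
        then have "y v = (\<Sum>j<n. v j * y (al j))" using ysum[of "{..<n}"] by simp
        then show ?thesis using that(1) y_pos by (auto simp: nonneg_def intro!: sum_nonneg)
      qed
      have "y (\<lambda>k. - gact h (al i) k) \<ge> 0"
        using neg Phi_support[OF PhiI[OF less.prems(1) i(1)]] by (intro yneg) auto
      then have "- y (gact h (al i)) \<ge> 0" using y_lin[of "-1" "gact h (al i)" 0 "gact h (al i)"] by simp
      then have y0: "y (al i) = 0" using less.prems(2)[of "al i"] y_pos[OF i(1)] by simp
      then have iJ: "i \<in> J" using i by (simp add: J_def)
      have "h \<otimes> s i \<in> W J"
        using less.hyps[of "h \<otimes> s i"] i less.prems y0 by (simp add: y_sg)
      then have "(h \<otimes> s i) \<otimes> s i \<in> W J" using W_mult[OF J] W_s[OF iJ J] by blast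
      then show ?thesis using less.prems i by (simp add: m_assoc)
    qed simp
  qed
  have y_W: "y (gact u v) = y v" if "u \<in> W J" for u v
    using that J
  proof (induction arbitrary: v rule: W_induct)
    case (mult i h)
    then have "i < n" "h \<in> carrier G" "y (al i) = 0" using J W_closed by (auto simp: J_def)
    then show ?case using mult by (simp add: y_sg)
  qed simp
  \<comment> \<open>The inversions of an element of \<open>W J\<close> are roots on which the
    dominant functional vanishes, so all of them lie in one finite set. This bounds the lengths in
    \<open>W J\<close>.\<close>
  have InvC: "Inv u \<subseteq> (\<Union>g\<in>F. Inv (g \<otimes> w))" if "u \<in> W J" for u
    using that J
  proof (induction rule: W_induct)
    case one then show ?case by (auto simp: Inv_def)
  next
    case (mult i h)
    then have h: "h \<in> carrier G" and i: "i < n" using J W_closed by auto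
    show ?case
    proof
      fix b assume b: "b \<in> Inv (s i \<otimes> h)"
      then consider "b = gact (inv h) (al i)" | "b \<in> Inv h" using Inv_s_mult[OF i h] by blast
      then show "b \<in> (\<Union>g\<in>F. Inv (g \<otimes> w))"
      proof cases
        case 1
        have "y b = y (al i)" unfolding 1 using y_W[OF W_inv[OF J mult(2)]] .
        then have "Z (gact w b) \<le> 0" using mult(1) by (simp add: J_def y_def)
        then show ?thesis using inC[OF w(1), of b] b by (simp add: Inv_def)
      next
        case 2 then show ?thesis using mult(3) by blast
      qed
    qed
  qed
  have "W J \<subseteq> {g \<in> carrier G. len g \<le> card (\<Union>g\<in>F. Inv (g \<otimes> w))}"
  proof
    fix u assume u: "u \<in> W J"
    then have "len u \<le> card (Inv u)" using len_le_Inv W_closed J by blast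
    also have "\<dots> \<le> card (\<Union>g\<in>F. Inv (g \<otimes> w))" using InvC[OF u] finC[OF w(1)] by (rule card_mono[rotated])
    finally show "u \<in> {g \<in> carrier G. len g \<le> card (\<Union>g\<in>F. Inv (g \<otimes> w))}" using u W_closed J by blast
  qed
  then have "finite (W J)" using finite_len_le finite_subset by blast
  moreover have "inv w \<otimes> g \<otimes> w \<in> W J" if "g \<in> F" for g
    using that w(1) Fc Z_inv by (intro stab) (auto simp: y_def)
  ultimately show ?thesis using that w(1) J by blast
qed

lemma finite_W_d: assumes "finite (W J)" "J \<subseteq> {..<n}" "i \<in> J" "j \<in> J" shows "d i j \<noteq> 0"
proof
  assume d0: "d i j = 0"
  have ij: "i < n" "j < n" using assms by auto
  let ?t = "s i \<otimes> s j"
  have "?t [^] (k::nat) \<in> W J" for k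
    by (induction k) (use assms W_mult W_s in auto)
  then have "range (\<lambda>k::nat. ?t [^] k) \<subseteq> W J" by blast
  then have "finite (range (\<lambda>k::nat. ?t [^] k))" using assms(1) finite_subset by blast
  then have "\<not> inj (\<lambda>k::nat. ?t [^] k)" using finite_imageD infinite_UNIV_nat by blast
  then obtain a b :: nat where ab: "a < b" "?t [^] a = ?t [^] b"
    unfolding inj_on_def by (metis linorder_neqE_nat)
  have "?t [^] a \<otimes> ?t [^] (b - a) = ?t [^] (a + (b - a))" using ij by (intro nat_pow_mult) simp
  then have "?t [^] a \<otimes> ?t [^] (b - a) = ?t [^] a \<otimes> \<one>" using ab ij by simp
  then have "?t [^] (b - a) = \<one>" using ij by (subst (asm) l_cancel) auto
  then show False using s_order[OF ij] d0 ab by simp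
qed

section \<open>Structure of finite parabolic subgroups\<close>

lemma cos_pi_div_ge: assumes "4 \<le> k" shows "sqrt 2 / 2 \<le> cos (pi / real k)"
proof -
  have "cos (pi / 4) \<le> cos (pi / real k)"
    using assms by (intro cos_monotone_0_pi_le) (auto simp: field_simps)
  then show ?thesis by (simp add: cos_45)
qed

lemma cos_pi_div_nonneg: assumes "k \<noteq> 1" shows "0 \<le> cos (pi / real k)"
proof (cases "k = 0")
  case False
  then have "2 \<le> k" using assms by auto
  then show ?thesis by (intro cos_ge_zero) (auto simp: field_simps intro: order_trans[of _ 0])
qed simp

text \<open>If both labels exceeded 2, the vector \<open>\<alpha>\<^sub>i + sqrt 2 \<alpha>\<^sub>j + \<alpha>\<^sub>k\<close> would only grow under the parabolic
  subgroup, but its longest element sends it to a negative vector.\<close>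

lemma finite_W_matching:
  assumes fin: "finite (W J)" and J: "J \<subseteq> {..<n}" and ijk: "i \<in> J" "j \<in> J" "k \<in> J" "i \<noteq> j" "j \<noteq> k" "i \<noteq> k"
  shows "\<not> (2 < d i j \<and> 2 < d j k)"
proof
  assume d: "2 < d i j \<and> 2 < d j k"
  have lt: "i < n" "j < n" "k < n" using J ijk by auto
  have d4: "4 \<le> d i j" "4 \<le> d j k"
  proof -
    have "4 \<le> a" if "2 < a" "even a" for a :: nat using that by presburger
    then show "4 \<le> d i j" "4 \<le> d j k" using d d_even[OF lt(1,2)] d_even[OF lt(2,3)] ijk by auto
  qed
  define T where "T = {i, j, k}"
  have T: "T \<subseteq> J" "T \<subseteq> {..<n}" using ijk J by (auto simp: T_def)
  have finT: "finite (W T)" using fin W_mono[OF T(1)] finite_subset by blast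
  \<comment> \<open>The coefficients 1, sqrt 2, 1 form the null vector of the affine diagram with
    two labels 4. Evenness raises labels above 2 to at least 4, and then the form pairs
    \<open>v\<close> with each of the three simple roots to at most 0.\<close>
  define v where "v = (\<lambda>l. al i l + sqrt 2 * al j l + al k l)"
  have Bge: "B i j \<le> - (sqrt 2 / 2)" "B j k \<le> - (sqrt 2 / 2)" "B i k \<le> 0"
    using cos_pi_div_ge d4 cos_pi_div_nonneg[of "d i k"] d_even[of i k] lt ijk unfolding B_def by auto
  have fv: "form x v = B x i + sqrt 2 * B x j + B x k" for x
  proof -
    have "form x v = form x (\<lambda>l. 1 * (1 * al i l + sqrt 2 * al j l) + 1 * al k l)" by (simp add: v_def)
    also have "\<dots> = B x i + sqrt 2 * B x j + B x k" unfolding form_lin using lt by simp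
    finally show ?thesis .
  qed
  have sq: "sqrt 2 * b \<le> - 1" if "b \<le> - (sqrt 2 / 2)" for b
  proof -
    have "sqrt 2 * b \<le> sqrt 2 * (- (sqrt 2 / 2))" using that by (intro mult_left_mono) auto
    then show ?thesis by simp
  qed
  have fneg: "form x v \<le> 0" if "x \<in> T" for x
  proof -
    have "x = i \<or> x = j \<or> x = k" using that by (auto simp: T_def)
    then consider "x = i" | "x = j" | "x = k" by blast
    then show ?thesis
    proof cases
      case 1 then show ?thesis using Bge sq[of "B i j"] lt by (simp add: fv B_self)
    next
      case 2
      have "sqrt 2 / 2 + sqrt 2 / 2 = sqrt 2" by simp
      then show ?thesis using 2 Bge lt B_sym[of j i] by (simp add: fv B_self)
    next
      case 3 then show ?thesis using Bge sq[of "B j k"] lt B_sym[of k j] B_sym[of k i] by (simp add: fv B_self)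
    qed
  qed
  have mono: "nonneg (\<lambda>l. gact g v l - v l)" if "g \<in> W T" for g
    using that
  proof (induction "len g" arbitrary: g rule: less_induct)
    case less
    have gc: "g \<in> carrier G" using less.prems W_closed T by blast
    show ?case
    proof (cases "g = \<one>")
      case False
      obtain x where x: "x < n" "len (g \<otimes> s x) < len g" "x \<in> T"
        using last_letter[OF gc False] less.prems T by metis
      define h where "h = g \<otimes> s x"
      have h: "h \<in> carrier G" "h \<otimes> s x = g" "h \<in> W T"
        using gc x W_mult[OF T(2) less.prems W_s[OF x(3) T(2)]] by (auto simp: h_def m_assoc)
      have "nonneg (gact h (al x))" using len_iff[of h x] h x by (simp add: h_def)
      moreover have "gact g v = (\<lambda>l. gact h v l + (- 2 * form x v) * gact h (al x) l)"
      proof -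
        have "gact g v = gact h (sg x v)" using h x by (metis gact_mult_app gact_s s_closed)
        then show ?thesis unfolding sg_eq using gact_lin[OF h(1), of 1 v "- 2 * form x v" "al x"] by simp
      qed
      moreover have "nonneg (\<lambda>l. gact h v l - v l)" using less.hyps[of h] h x by (simp add: h_def)
      ultimately show ?thesis using fneg[OF x(3)] unfolding nonneg_def
        by (smt (verit, best) mult_nonneg_nonneg)
    qed (simp add: nonneg_def)
  qed
  have "W T \<noteq> {}" using W_one by blast
  then have "Max (len ` W T) \<in> len ` W T" using finT by (intro Max_in) auto
  then obtain u where u: "u \<in> W T" "Max (len ` W T) = len u" by auto
  have u_max: "len g \<le> len u" if "g \<in> W T" for g using that finT unfolding u(2)[symmetric] by simp
  have uc: "u \<in> carrier G" using u W_closed T by blast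
  have neg: "nonneg (\<lambda>l. - gact u (al x) l)" if x: "x \<in> T" for x
  proof (rule ccontr)
    assume a: "\<not> ?thesis"
    have xn: "x < n" using x T by auto
    then have "nonneg (gact u (al x))" using a Phi_cases[OF PhiI[OF uc xn]] by blast
    moreover have "gact (u \<otimes> s x) (al x) = (\<lambda>l. - gact u (al x) l)"
      using uc xn by (simp add: sg_def B_self gact_uminus)
    ultimately have "\<not> nonneg (gact (u \<otimes> s x) (al x))" using a by simp
    then have "len (u \<otimes> s x \<otimes> s x) < len (u \<otimes> s x)" using len_iff[of "u \<otimes> s x" x] uc xn by simp
    then have "len u < len (u \<otimes> s x)" using uc xn by (simp add: m_assoc)
    moreover have "u \<otimes> s x \<in> W T" using W_mult[OF T(2) u(1) W_s[OF x T(2)]] .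
    ultimately show False using u_max by fastforce
  qed
  have "gact u v = (\<lambda>l. gact u (al i) l + sqrt 2 * gact u (al j) l + gact u (al k) l)"
  proof -
    have "gact u (\<lambda>l. 1 * (1 * al i l + sqrt 2 * al j l) + 1 * al k l) =
        (\<lambda>l. 1 * gact u (\<lambda>l. 1 * al i l + sqrt 2 * al j l) l + 1 * gact u (al k) l)"
      by (rule gact_lin[OF uc])
    also have "gact u (\<lambda>l. 1 * al i l + sqrt 2 * al j l) = (\<lambda>l. 1 * gact u (al i) l + sqrt 2 * gact u (al j) l)"
      by (rule gact_lin[OF uc])
    finally show ?thesis by (simp add: v_def)
  qed
  moreover have "gact u (al i) i \<le> 0" "gact u (al j) i \<le> 0" "gact u (al k) i \<le> 0"
    using neg by (auto simp: nonneg_def T_def)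
  ultimately have "gact u v i \<le> 0" by (simp add: add_nonpos_nonpos mult_nonneg_nonpos)
  moreover have "gact u v i - v i \<ge> 0" using mono[OF u(1)] by (simp add: nonneg_def)
  moreover have "v i = 1" using ijk by (simp add: v_def al_def)
  ultimately show False by simp
qed

lemma s_commute: assumes "i < n" "j < n" "d i j = 2" shows "s i \<otimes> s j = s j \<otimes> s i"
proof -
  have "(s i \<otimes> s j) \<otimes> (s i \<otimes> s j) = \<one>" using s_pow[of i j] assms by (simp add: numeral_2_eq_2)
  then have "inv (s i \<otimes> s j) = s i \<otimes> s j" using assms by (intro inv_equality) auto
  then show ?thesis using assms by (simp add: inv_mult_group)
qed

lemma W_commute:
  assumes "J \<subseteq> {..<n}" "l < n" "\<And>i. i \<in> J \<Longrightarrow> d i l = 2" "g \<in> W J"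
  shows "s l \<otimes> g = g \<otimes> s l"
  using assms(4,1)
proof (induction rule: W_induct)
  case one then show ?case using assms by simp
next
  case (mult i h)
  then have "i < n" "h \<in> carrier G" using assms W_closed by auto
  then show ?case using mult assms s_commute[of i l] by (metis m_assoc s_closed)
qed

text \<open>Since the labels above 2 form a matching, a finite standard parabolic subgroup is a
  direct product of dihedral groups and groups of order 2. The induction splits off one factor,
  whose component is recovered by its own retraction.\<close>

lemma finite_W_detect:
  assumes "finite (W K)" "K \<subseteq> {..<n}" "g \<in> W K" "\<And>i j. i \<in> K \<Longrightarrow> j \<in> K \<Longrightarrow> ret {i, j} g = \<one>"
  shows "g = \<one>"
  using assms
proof (induction "card K" arbitrary: K rule: less_induct)
  case less
  have finK: "finite K" using less.prems(2) finite_subset by blast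
  show ?case
  proof (cases "K = {}")
    case True
    then show ?thesis using less.prems(3) by (auto simp: W_def)
  next
    case False
    then obtain i where i: "i \<in> K" by blast
    have dd: "d a b = 2 \<or> 2 < d a b" if "a \<in> K" "b \<in> K" "a \<noteq> b" for a b
      using finite_W_d[OF less.prems(1,2) that(1,2)] d_even[of a b] that less.prems(2)
      by (cases "d a b = 1") auto
    \<comment> \<open>The partner of \<open>i\<close> in the matching, or \<open>i\<close> itself if
      \<open>i\<close> commutes with the rest of \<open>K\<close>.\<close>
    obtain j where j: "j \<in> K" "\<And>l. l \<in> K - {i, j} \<Longrightarrow> d i l = 2 \<and> d j l = 2"
    proof (cases "\<exists>j\<in>K. j \<noteq> i \<and> 2 < d i j")
      case True
      then obtain j where j: "j \<in> K" "j \<noteq> i" "2 < d i j" by blast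
      have "d i l = 2 \<and> d j l = 2" if l: "l \<in> K - {i, j}" for l
        using finite_W_matching[OF less.prems(1,2), of j i l] finite_W_matching[OF less.prems(1,2), of i j l]
          dd[of i l] dd[of j l] d_sym[of i j] l i j subsetD[OF less.prems(2), of i] subsetD[OF less.prems(2), of j]
        by auto
      then show ?thesis using that j by blast
    next
      case False
      then have "d i l = 2 \<and> d i l = 2" if "l \<in> K - {i, i}" for l using dd[of i l] that i by auto
      then show ?thesis using that[OF i] by blast
    qed
    let ?C = "{i, j}" let ?D = "K - {i, j}"
    have C: "?C \<subseteq> {..<n}" and D: "?D \<subseteq> {..<n}" using i j less.prems by auto
    have "\<exists>c\<in>W ?C. \<exists>h\<in>W ?D. g = c \<otimes> h"
      using less.prems(3,2)
    proof (induction rule: W_induct)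
      case one
      show ?case by (intro bexI[of _ \<one>]) auto
    next
      case (mult l g)
      then obtain c h where ch: "c \<in> W ?C" "h \<in> W ?D" "g = c \<otimes> h" by blast
      have cc: "c \<in> carrier G" "h \<in> carrier G" "l < n" using ch C D W_closed mult less.prems(2) by blast+
      show ?case
      proof (cases "l \<in> ?C")
        case True
        then have "s l \<otimes> c \<in> W ?C" using W_mult[OF C W_s[OF True C] ch(1)] by simp
        moreover have "s l \<otimes> g = (s l \<otimes> c) \<otimes> h" using ch cc by (simp add: m_assoc)
        ultimately show ?thesis using ch by blast
      next
        case False
        then have lD: "l \<in> ?D" using mult by simp
        then have "s l \<otimes> h \<in> W ?D" using W_mult[OF D W_s[OF lD D] ch(2)] by simp
        moreover have "s l \<otimes> c = c \<otimes> s l" using W_commute[OF C cc(3) _ ch(1)] j(2)[OF lD] by blast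
        then have "s l \<otimes> g = c \<otimes> (s l \<otimes> h)" using ch cc by (simp add: m_assoc[symmetric])
        ultimately show ?thesis using ch by blast
      qed
    qed
    then obtain c h where ch: "c \<in> W ?C" "h \<in> W ?D" "g = c \<otimes> h" by blast
    have cc: "c \<in> carrier G" "h \<in> carrier G" using ch C D W_closed by blast+
    have "ret ?C h = \<one>"
    proof -
      have "ret ?C h = ret ?C (ret ?D h)" using ret_id[OF ch(2) D] by simp
      also have "\<dots> = ret {} h" using cc ret_ret[of h ?C ?D] by (simp add: Diff_disjoint)
      also have "\<dots> = \<one>" using ret_in_W[OF cc(2), of "{}"] by (auto simp: W_def)
      finally show ?thesis .
    qed
    then have "c = \<one>" using less.prems(4)[OF i j(1)] ch cc ret_id[OF ch(1) C] by simp
    then have "g = h" using ch cc by simp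
    then show ?thesis
    proof -
      have "card ?D < card K" using i finK by (intro psubset_card_mono) auto
      moreover have "finite (W ?D)" using less.prems(1) W_mono[of ?D K] finite_subset by blast
      moreover have "ret {a, b} g = \<one>" if "a \<in> ?D" "b \<in> ?D" for a b using less.prems(4) that by blast
      ultimately show ?thesis using less.hyps[of ?D] D ch(2) \<open>g = h\<close> by blast
    qed
  qed
qed

section \<open>Rotations and reflections in dihedral subgroups\<close>

abbreviation rot :: "nat \<Rightarrow> nat \<Rightarrow> 'a" where "rot i j \<equiv> s i \<otimes> s j"

lemma rot_order_int: assumes "i < n" "j < n" shows "rot i j [^] (z::int) = \<one> \<longleftrightarrow> int (d i j) dvd z"
proof (cases "0 \<le> z")
  case True
  then obtain k where "z = int k" using nonneg_int_cases by blast
  then show ?thesis using s_order[OF assms] by (simp add: int_pow_int)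
next
  case False
  then obtain k where k: "z = - int k" by (metis int_cases2 nat_le_linear of_nat_0_le_iff)
  have "rot i j [^] (- int k) = \<one> \<longleftrightarrow> rot i j [^] int k = \<one>"
    using assms by (metis int_pow_neg int_pow_closed inv_inv inv_one m_closed s_closed)
  then show ?thesis using s_order[OF assms] k by (simp add: int_pow_int)
qed

lemma s_rot: assumes ij: "i < n" "j < n" shows "s i \<otimes> rot i j [^] (z::int) = rot i j [^] (- z) \<otimes> s i"
proof -
  let ?r = "rot i j"
  have r: "?r \<in> carrier G" using ij by simp
  have 1: "s i \<otimes> ?r = inv ?r \<otimes> s i" using ij by (simp add: inv_mult_group m_assoc[symmetric]) (simp add: m_assoc)
  have nat: "s i \<otimes> ?r [^] (k::nat) = inv ?r [^] k \<otimes> s i" for k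
  proof (induction k)
    case (Suc k)
    have "s i \<otimes> ?r [^] Suc k = (s i \<otimes> ?r [^] k) \<otimes> ?r" using ij by (simp add: m_assoc)
    also have "\<dots> = inv ?r [^] k \<otimes> (s i \<otimes> ?r)" unfolding Suc using ij r by (simp add: m_assoc)
    also have "\<dots> = inv ?r [^] Suc k \<otimes> s i" unfolding 1 using ij r by (simp add: m_assoc)
    finally show ?case .
  qed (use ij in simp)
  show ?thesis
  proof (cases "0 \<le> z")
    case True
    then obtain k where "z = int k" using nonneg_int_cases by blast
    then show ?thesis using nat[of k] r by (simp add: int_pow_int int_pow_neg_int nat_pow_inv)
  next
    case False
    then obtain k where k: "z = - int k" by (metis int_cases2 nat_le_linear of_nat_0_le_iff)
    have "s i \<otimes> inv ?r [^] k = s i \<otimes> inv ?r [^] k \<otimes> s i \<otimes> s i" using ij r by (simp add: m_assoc)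
    also have "\<dots> = s i \<otimes> (s i \<otimes> ?r [^] k) \<otimes> s i" using nat[of k] ij r by (simp add: m_assoc)
    also have "\<dots> = ?r [^] k \<otimes> s i" using ij r by (simp add: m_assoc[symmetric])
    finally show ?thesis using k r by (simp add: int_pow_int int_pow_neg_int nat_pow_inv)
  qed
qed

lemma dihedral_cases:
  assumes ij: "i < n" "j < n" and g: "g \<in> W {i, j}"
  obtains z :: int where "g = rot i j [^] z" | z :: int where "g = rot i j [^] z \<otimes> s i"
proof -
  let ?r = "rot i j"
  have r: "?r \<in> carrier G" using ij by simp
  have sub: "{i, j} \<subseteq> {..<n}" using ij by simp
  have si: "s i \<otimes> (?r [^] z \<otimes> s i) = ?r [^] (- z)" "s i \<otimes> ?r [^] z = ?r [^] (-z) \<otimes> s i" for z :: int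
    using s_rot[OF ij, of z] ij r by (simp_all add: m_assoc[symmetric]) (simp add: m_assoc)
  have sj: "s j \<otimes> h = ?r [^] (-1::int) \<otimes> (s i \<otimes> h)" if "h \<in> carrier G" for h
    using ij that r by (simp add: int_pow_neg inv_mult_group m_assoc) (simp add: m_assoc[symmetric])
  have "(\<exists>z::int. g = ?r [^] z) \<or> (\<exists>z::int. g = ?r [^] z \<otimes> s i)"
    using g sub
  proof (induction rule: W_induct)
    case one
    have "\<one> = ?r [^] (0::int)" by simp
    then show ?case by blast
  next
    case (mult k h)
    have hc: "h \<in> carrier G" using W_closed mult sub by blast
    have i: "(\<exists>z::int. s i \<otimes> h = ?r [^] z) \<or> (\<exists>z::int. s i \<otimes> h = ?r [^] z \<otimes> s i)"
      using mult(3) si by metis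
    have "(\<exists>z::int. s j \<otimes> h = ?r [^] z) \<or> (\<exists>z::int. s j \<otimes> h = ?r [^] z \<otimes> s i)"
    proof -
      have "?r [^] (-1::int) \<otimes> ?r [^] z = ?r [^] (-1 + z)"
        "?r [^] (-1::int) \<otimes> (?r [^] z \<otimes> s i) = ?r [^] (-1 + z) \<otimes> s i" for z :: int
        using r ij by (simp_all only: int_pow_mult m_assoc[symmetric] int_pow_closed s_closed)
      then show ?thesis using i sj[OF hc] by metis
    qed
    then show ?case using i mult(1) by auto
  qed
  then show ?thesis using that by blast
qed

lemma par_rot_pow: assumes "i < n" "j < n" "g \<in> carrier G" shows "par k (g [^] (z::int)) = of_int z * par k g"
proof -
  have n: "par k (g [^] (l::nat)) = of_nat l * par k g" for l
    by (induction l) (use assms in \<open>auto simp: algebra_simps\<close>)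
  show ?thesis
  proof (cases "0 \<le> z")
    case True
    then obtain l where "z = int l" using nonneg_int_cases by blast
    then show ?thesis using n by (simp add: int_pow_int)
  next
    case False
    then obtain l where "z = - int l" by (metis int_cases2 nat_le_linear of_nat_0_le_iff)
    then show ?thesis using n assms by (simp add: int_pow_neg int_pow_int)
  qed
qed

end

section \<open>Reflection subgroups\<close>

lemma alt_nth: "k < q \<Longrightarrow> alt x y q ! k = (if even (q - Suc k) then y else x)"
proof (induction q arbitrary: k)
  case (Suc q)
  show ?case
  proof (cases k)
    case (Suc l)
    then show ?thesis using Suc.IH[of l] Suc.prems by simp
  qed simp
qed simp

lemma map_alt: "map f (alt x y q) = alt (f x) (f y) q"
  by (induction q) auto

lemma (in group) inv_mult_cancel [simp]:
  assumes "x \<in> carrier G" "y \<in> carrier G"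
  shows "inv x \<otimes> (x \<otimes> y) = y" "x \<otimes> (inv x \<otimes> y) = y"
  using assms by (simp_all add: m_assoc[symmetric])

context even_coxeter begin

lemma s_s_mult [simp]: "i < n \<Longrightarrow> g \<in> carrier G \<Longrightarrow> s i \<otimes> (s i \<otimes> g) = g"
  by (simp add: m_assoc[symmetric])

definition rf :: "(nat \<Rightarrow> real) \<Rightarrow> 'a" where
  "rf b = (SOME r. \<exists>g i. g \<in> carrier G \<and> i < n \<and> b = gact g (al i) \<and> r = g \<otimes> s i \<otimes> inv g)"

lemma gact_conj_s:
  assumes "g \<in> carrier G" "i < n"
  shows "gact (g \<otimes> s i \<otimes> inv g) v = (\<lambda>k. v k - 2 * bil (gact g (al i)) v * gact g (al i) k)"
proof -
  have "form i (gact (inv g) v) = bil (gact g (al i)) v"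
    using assms gact_bil[OF assms(1), of "al i" "gact (inv g) v"] by simp
  then have "gact (g \<otimes> s i \<otimes> inv g) v = gact g (\<lambda>k. 1 * gact (inv g) v k + (- 2 * bil (gact g (al i)) v) * al i k)"
    using assms by (simp add: sg_def)
  also have "\<dots> = (\<lambda>k. 1 * gact g (gact (inv g) v) k + (- 2 * bil (gact g (al i)) v) * gact g (al i) k)"
    using assms(1) by (rule gact_lin)
  finally show ?thesis using assms by simp
qed

lemma gact_eqD:
  assumes "g \<in> carrier G" "h \<in> carrier G" "\<And>v. gact g v = gact h v" shows "g = h"
proof -
  have "inv h \<otimes> g = \<one>" using assms by (intro faithful) auto
  then show ?thesis using assms by (metis inv_closed inv_equality inv_inv)
qed

text \<open>The representation chosen for the root does not matter: the reflection acts on vectors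
  by a formula in the root alone, and the action is faithful.\<close>

lemma rf_gact:
  assumes "g \<in> carrier G" "i < n" shows "rf (gact g (al i)) = g \<otimes> s i \<otimes> inv g"
proof -
  let ?b = "gact g (al i)"
  have "\<exists>r g' i. g' \<in> carrier G \<and> i < n \<and> ?b = gact g' (al i) \<and> r = g' \<otimes> s i \<otimes> inv g'" using assms by blast
  from someI_ex[OF this] obtain g' j where g': "g' \<in> carrier G" "j < n" "?b = gact g' (al j)"
    "rf ?b = g' \<otimes> s j \<otimes> inv g'" unfolding rf_def[of ?b, symmetric] by blast
  have "rf ?b = g \<otimes> s i \<otimes> inv g" unfolding g'(4)
    using gact_conj_s[OF g'(1,2)] gact_conj_s[OF assms] g' assms by (intro gact_eqD) auto
  then show ?thesis .
qed

lemma rf_closed [simp]: "b \<in> Phi \<Longrightarrow> rf b \<in> carrier G"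
  by (erule PhiE) (simp add: rf_gact)

lemma gact_rf: "b \<in> Phi \<Longrightarrow> gact (rf b) v = (\<lambda>k. v k - 2 * bil b v * b k)"
  by (erule PhiE) (simp add: rf_gact gact_conj_s del: gact_mult_app)

lemma rf_sq [simp]: "b \<in> Phi \<Longrightarrow> rf b \<otimes> rf b = \<one>"
proof (erule PhiE)
  fix g i assume g: "g \<in> carrier G" "i < n" "b = gact g (al i)"
  have "(g \<otimes> s i \<otimes> inv g) \<otimes> (g \<otimes> s i \<otimes> inv g) = g \<otimes> (s i \<otimes> (inv g \<otimes> g) \<otimes> s i) \<otimes> inv g"
    using g by (simp add: m_assoc)
  then show "rf b \<otimes> rf b = \<one>" using g by (simp add: rf_gact)
qed

lemma rf_rf_mult [simp]: "b \<in> Phi \<Longrightarrow> g \<in> carrier G \<Longrightarrow> rf b \<otimes> (rf b \<otimes> g) = g"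
  by (simp add: m_assoc[symmetric])

lemma rf_inv [simp]: "b \<in> Phi \<Longrightarrow> inv (rf b) = rf b"
  by (simp add: inv_equality)

lemma rf_conj: "b \<in> Phi \<Longrightarrow> g \<in> carrier G \<Longrightarrow> rf (gact g b) = g \<otimes> rf b \<otimes> inv g"
proof (erule PhiE)
  fix h i assume g: "g \<in> carrier G" "h \<in> carrier G" "i < n" "b = gact h (al i)"
  then have "rf (gact (g \<otimes> h) (al i)) = g \<otimes> h \<otimes> s i \<otimes> inv (g \<otimes> h)" by (intro rf_gact) auto
  then show "rf (gact g b) = g \<otimes> rf b \<otimes> inv g" using g by (simp add: rf_gact inv_mult_group m_assoc)
qed

lemma rf_uminus: assumes "b \<in> Phi" shows "rf (\<lambda>k. - b k) = rf b"
proof -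
  have "bil (\<lambda>k. - b k) v = - bil b v" for v using bil_lin_left[of "-1" b 0 b v] by simp
  then show ?thesis using assms Phi_uminus by (intro gact_eqD) (auto simp: gact_rf)
qed

lemma rf_self: "b \<in> Phi \<Longrightarrow> gact (rf b) b = (\<lambda>k. - b k)"
  by (simp add: gact_rf bil_Phi)

lemma rf_inj: assumes "b \<in> Phi" "c \<in> Phi" "nonneg b" "nonneg c" "rf b = rf c" shows "b = c"
proof -
  have "gact (rf c) b = (\<lambda>k. - b k)" using rf_self assms by metis
  then have "- b k = b k - 2 * bil c b * c k" for k using gact_rf[OF assms(2), of b] by metis
  then have bc: "b k = bil c b * c k" for k by (simp add: mult.assoc eq_diff_eq[symmetric] add.commute)
  have "bil b b = bil c b * bil c b"
    using bc bil_lin_left[of "bil c b" c 0 c b] by (metis (no_types, lifting) add.right_neutral ext mult_zero_left)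
  then have "bil c b = 1 \<or> bil c b = -1" using bil_Phi[OF assms(1)] by (simp add: square_eq_1_iff)
  then show ?thesis
  proof
    assume "bil c b = -1"
    then have "c = (\<lambda>k. - b k)" using bc by auto
    then show ?thesis using assms Phi_neg by blast
  qed (use bc in auto)
qed

lemma rf_par: assumes "b \<in> Phi" obtains i where "i < n" "\<And>k. par k (rf b) = (if k = i then 1 else 0)"
  using assms by (elim PhiE) (simp add: rf_gact par_s)

text \<open>Strong exchange in terms of roots. Follow the root along the prefixes of the word: where
  it changes sign it is the simple root of the next letter, because a simple reflection makes no
  other positive root negative.\<close>

lemma Inv_split:
  assumes "w \<in> lists {..<n}" "c \<in> Phi" "nonneg c" "\<not> nonneg (gact (inv (ev w)) c)"
  shows "\<exists>w1 j w2. w = w1 @ j # w2 \<and> c = gact (ev w1) (al j)"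
  using assms(1,4)
proof (induction w rule: rev_induct)
  case (snoc j w)
  have w: "w \<in> lists {..<n}" "j < n" "ev w \<in> carrier G" using snoc.prems ev_closed by auto
  show ?case
  proof (cases "nonneg (gact (inv (ev w)) c)")
    case True
    have "inv (ev (w @ [j])) = s j \<otimes> inv (ev w)" using w by (simp add: ev_append inv_mult_group)
    then have "\<not> nonneg (sg j (gact (inv (ev w)) c))" using snoc.prems w by simp
    then have "gact (inv (ev w)) c = al j" using sg_pos[OF _ True _ w(2)] Phi_gact assms(2) w by blast
    then have "c = gact (ev w) (al j)" using gact_inv(2)[OF w(3), of c] by simp
    then show ?thesis by blast
  next
    case False
    then obtain w1 k w2 where "w = w1 @ k # w2" "c = gact (ev w1) (al k)" using snoc.IH w by blast
    then show ?thesis by (intro exI[of _ w1] exI[of _ k] exI[of _ "w2 @ [j]"]) simp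
  qed
qed (use assms in simp)

definition depth :: "(nat \<Rightarrow> real) \<Rightarrow> nat" where
  "depth b = (LEAST k. \<exists>u i. u \<in> carrier G \<and> i < n \<and> b = gact u (al i) \<and> len u = k)"

lemma depth_le: "u \<in> carrier G \<Longrightarrow> i < n \<Longrightarrow> depth (gact u (al i)) \<le> len u"
  unfolding depth_def by (rule Least_le) blast

lemma depth_obtain:
  assumes "b \<in> Phi" obtains u i where "u \<in> carrier G" "i < n" "b = gact u (al i)" "len u = depth b"
proof -
  have "\<exists>k. \<exists>u i. u \<in> carrier G \<and> i < n \<and> b = gact u (al i) \<and> len u = k" using PhiE[OF assms] by metis
  then have "\<exists>u i. u \<in> carrier G \<and> i < n \<and> b = gact u (al i) \<and> len u = depth b"
    unfolding depth_def by (rule LeastI_ex)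
  then show ?thesis using that by blast
qed

end

text \<open>Following Dyer, a reflection subgroup \<open>H\<close> has the canonical simple roots \<open>Del\<close>:
  the positive roots of \<open>H\<close> whose reflection makes no other positive root of \<open>H\<close> negative.\<close>

locale refl_subgroup = even_coxeter +
  fixes H :: "'a set"
  assumes H: "subgroup H G"
begin

lemma H_closed [intro]: "h \<in> H \<Longrightarrow> h \<in> carrier G" using H subgroup.mem_carrier by metis
lemma H_mult [intro]: "g \<in> H \<Longrightarrow> h \<in> H \<Longrightarrow> g \<otimes> h \<in> H" using H subgroup.m_closed by metis
lemma H_inv [intro]: "g \<in> H \<Longrightarrow> inv g \<in> H" using H subgroup.m_inv_closed by metis
lemma H_one [simp]: "\<one> \<in> H" using H subgroup.one_closed by metis

definition Pos :: "(nat \<Rightarrow> real) set" where "Pos = {b \<in> Phi. nonneg b \<and> rf b \<in> H}"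

definition Del :: "(nat \<Rightarrow> real) set" where
  "Del = {b \<in> Pos. \<forall>c\<in>Pos. c \<noteq> b \<longrightarrow> nonneg (gact (rf b) c)}"

lemma Pos_D: "b \<in> Pos \<Longrightarrow> b \<in> Phi" "b \<in> Pos \<Longrightarrow> nonneg b" "b \<in> Pos \<Longrightarrow> rf b \<in> H"
  by (auto simp: Pos_def)

lemma Del_D: "b \<in> Del \<Longrightarrow> b \<in> Pos" "b \<in> Del \<Longrightarrow> b \<in> Phi" "b \<in> Del \<Longrightarrow> nonneg b" "b \<in> Del \<Longrightarrow> rf b \<in> H"
  by (auto simp: Pos_def Del_def)

lemma Pos_gact: "b \<in> Pos \<Longrightarrow> h \<in> H \<Longrightarrow> nonneg (gact h b) \<Longrightarrow> gact h b \<in> Pos"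
  unfolding Pos_def using Phi_gact rf_conj[of b h] H_closed[of h] by (auto intro!: H_mult H_inv)

lemma Pos_gact_neg: "b \<in> Pos \<Longrightarrow> h \<in> H \<Longrightarrow> \<not> nonneg (gact h b) \<Longrightarrow> (\<lambda>k. - gact h b k) \<in> Pos"
  unfolding Pos_def using Phi_gact[of b h] rf_conj[of b h] Phi_uminus[of "gact h b"] rf_uminus[of "gact h b"] Phi_neg[of "gact h b"] H_closed[of h]
  by (auto intro!: H_mult H_inv)

definition GD :: "'a set" where "GD = generate G (rf ` Del)"

lemma GD_subgroup: "subgroup GD G"
  unfolding GD_def using Del_D by (intro generate_is_subgroup) auto

lemma GD_closed: "h \<in> GD \<Longrightarrow> h \<in> carrier G" using GD_subgroup subgroup.mem_carrier by metis

lemma GD_mult: "g \<in> GD \<Longrightarrow> h \<in> GD \<Longrightarrow> g \<otimes> h \<in> GD" using GD_subgroup subgroup.m_closed by metis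

lemma GD_inv: "g \<in> GD \<Longrightarrow> inv g \<in> GD" using GD_subgroup subgroup.m_inv_closed by metis

lemma GD_rf: "b \<in> Del \<Longrightarrow> rf b \<in> GD" unfolding GD_def by (auto intro: generate.incl)

lemma GD_H: "GD \<subseteq> H"
  unfolding GD_def by (rule generate_subgroup_incl) (use H Del_D in auto)

text \<open>Induction on the depth of \<open>b\<close>, the image of alpha_i under a shortest
  possible \<open>u\<close>. If \<open>b\<close> is not canonical, its reflection makes another
  positive root of \<open>H\<close> negative, and this produces a positive root \<open>e\<close> of
  \<open>H\<close> that the inverse of \<open>u\<close> makes negative. Such an \<open>e\<close>
  belongs to a letter in a word for \<open>u\<close>: its depth is smaller, and its reflection
  deletes that letter, so conjugating by it also lowers the depth of \<open>b\<close>.\<close>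

theorem conj_canonical:
  assumes "b \<in> Pos" shows "\<exists>h\<in>GD. \<exists>c\<in>Del. rf b = h \<otimes> rf c \<otimes> inv h"
  using assms
proof (induction "depth b" arbitrary: b rule: less_induct)
  case less
  note b = Pos_D[OF less.prems]
  show ?case
  proof (cases "b \<in> Del")
    case True
    then show ?thesis using b GD_subgroup subgroup.one_closed
      by (intro bexI[of _ \<one>] bexI[of _ b]) auto
  next
    case False
    then obtain c where c: "c \<in> Pos" "c \<noteq> b" "\<not> nonneg (gact (rf b) c)" using less.prems by (auto simp: Del_def)
    note c' = Pos_D[OF c(1)]
    obtain u i where u: "u \<in> carrier G" "i < n" "b = gact u (al i)" "len u = depth b" using depth_obtain[OF b(1)] .
    have rfb: "rf b = u \<otimes> s i \<otimes> inv u" using u rf_gact by simp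
    \<comment> \<open>Either \<open>c\<close> itself is made negative by the inverse of
      \<open>u\<close>, or the negative of its image under \<open>rf b\<close> is.\<close>
    obtain e where e: "e \<in> Pos" "\<not> nonneg (gact (inv u) e)"
    proof (cases "nonneg (gact (inv u) c)")
      case True
      let ?e = "sg i (gact (inv u) c)"
      have "gact (inv u) c \<noteq> al i" using c u by (metis gact_inv(2))
      then have pe: "nonneg ?e" using sg_pos[OF _ True _ u(2)] Phi_gact[OF c'(1)] u(1) by blast
      have eq: "gact (rf b) c = gact u ?e" using u c' unfolding rfb by simp
      have ePhi: "?e \<in> Phi" using Phi_gact[of "gact (inv u) c" "s i"] Phi_gact[OF c'(1)] u by simp
      have "gact (inv u) (\<lambda>k. - gact (rf b) c k) = (\<lambda>k. - ?e k)" using u unfolding eq by (simp add: gact_uminus)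
      then have "\<not> nonneg (gact (inv u) (\<lambda>k. - gact (rf b) c k))" using pe Phi_neg[OF ePhi] by simp
      then show ?thesis using that Pos_gact_neg[OF c(1) b(3) c(3)] by blast
    qed (use that c in blast)
    note e' = Pos_D[OF e(1)]
    obtain w where w: "w \<in> lists {..<n}" "ev w = u" "length w = len u" using len_word[OF u(1)] .
    obtain w1 j w2 where spl: "w = w1 @ j # w2" "e = gact (ev w1) (al j)"
      using Inv_split[OF w(1) e'(1,2)] e(2) w(2) by blast
    have ws: "w1 \<in> lists {..<n}" "j < n" "w2 \<in> lists {..<n}" using w(1) spl by auto
    note wc = ev_closed[OF ws(1)] ev_closed[OF ws(3)]
    have "depth e \<le> length w1" unfolding spl(2) using depth_le[OF wc(1) ws(2)] len_le[OF ws(1)] by simp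
    then have "depth e < depth b" using w u spl by simp
    then have eGD: "rf e \<in> GD" using less.hyps[OF _ e(1)] GD_rf GD_mult GD_inv by (metis (no_types))
    define b' where "b' = gact (rf e) b"
    have "u = ev w1 \<otimes> (s j \<otimes> ev w2)" using w ws spl by (subst w(2)[symmetric]) (simp add: ev_append)
    moreover have "rf e = ev w1 \<otimes> s j \<otimes> inv (ev w1)" using spl rf_gact wc ws by simp
    ultimately have "rf e \<otimes> u = ev w1 \<otimes> (s j \<otimes> (inv (ev w1) \<otimes> ev w1) \<otimes> s j) \<otimes> ev w2"
      using wc ws by (simp add: m_assoc)
    then have "rf e \<otimes> u = ev (w1 @ w2)" using wc ws by (simp add: ev_append)
    then have b'_eq: "b' = gact (ev (w1 @ w2)) (al i)" using u e'(1) unfolding b'_def by (metis gact_mult_app rf_closed)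
    have w12: "w1 @ w2 \<in> lists {..<n}" using ws by auto
    note v = ev_closed[OF w12]
    have lv: "len (ev (w1 @ w2)) < depth b" using len_le[OF w12] w u spl by simp
    have rfb': "rf b' = rf e \<otimes> rf b \<otimes> inv (rf e)" unfolding b'_def using b e' by (simp add: rf_conj)
    obtain b'' where b'': "b'' \<in> Pos" "depth b'' < depth b" "rf b'' = rf b'"
    proof (cases "nonneg b'")
      case True
      then have "b' \<in> Pos" using Pos_gact less.prems e' unfolding b'_def by blast
      moreover have "depth b' < depth b" unfolding b'_eq using depth_le[OF v u(2)] lv by simp
      ultimately show ?thesis using that by blast
    next
      case False
      then have "(\<lambda>k. - b' k) \<in> Pos" using Pos_gact_neg less.prems e' unfolding b'_def by blast
      moreover have "gact (ev (w1 @ w2) \<otimes> s i) (al i) = (\<lambda>k. - b' k)"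
        unfolding b'_eq using v u by (simp add: sg_def B_self gact_uminus)
      then have "depth (\<lambda>k. - b' k) \<le> len (ev (w1 @ w2) \<otimes> s i)"
        using depth_le[of "ev (w1 @ w2) \<otimes> s i" i] v u by simp
      moreover have "len (ev (w1 @ w2) \<otimes> s i) < len (ev (w1 @ w2))"
        using len_iff[OF v u(2)] False b'_eq by simp
      moreover have "rf (\<lambda>k. - b' k) = rf b'" using rf_uminus Phi_gact b e' unfolding b'_def by simp
      ultimately show ?thesis using that lv by simp
    qed
    obtain h c2 where h: "h \<in> GD" "c2 \<in> Del" "rf b'' = h \<otimes> rf c2 \<otimes> inv h"
      using less.hyps[OF b''(2,1)] by blast
    have cl: "rf e \<in> carrier G" "rf b \<in> carrier G" "h \<in> carrier G" "rf c2 \<in> carrier G"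
      using e' b h GD_closed Del_D by auto
    have "rf b = rf e \<otimes> (rf e \<otimes> rf b \<otimes> inv (rf e)) \<otimes> rf e"
    proof -
      have "rf e \<otimes> (rf e \<otimes> rf b \<otimes> inv (rf e)) \<otimes> rf e = (rf e \<otimes> rf e) \<otimes> rf b \<otimes> (rf e \<otimes> rf e)"
        using e' cl by (simp only: rf_inv m_assoc m_closed)
      then show ?thesis using e' cl by simp
    qed
    also have "\<dots> = rf e \<otimes> (h \<otimes> rf c2 \<otimes> inv h) \<otimes> rf e" using rfb' b'' h by simp
    also have "\<dots> = (rf e \<otimes> h) \<otimes> rf c2 \<otimes> inv (rf e \<otimes> h)" using cl e' by (simp add: inv_mult_group m_assoc)
    finally show ?thesis using GD_mult[OF eGD h(1)] h(2) by blast
  qed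
qed

section \<open>Exchange and the word problem for the canonical generators\<close>

definition pr :: "(nat \<Rightarrow> real) list \<Rightarrow> 'a" where "pr ws = foldr (\<lambda>b g. rf b \<otimes> g) ws \<one>"

lemma pr_Nil [simp]: "pr [] = \<one>" by (simp add: pr_def)
lemma pr_Cons [simp]: "pr (b # ws) = rf b \<otimes> pr ws" by (simp add: pr_def)

lemma pr_H [simp]: "ws \<in> lists Del \<Longrightarrow> pr ws \<in> H"
  by (induction ws) (use Del_D in auto)

lemma pr_closed [simp]: "ws \<in> lists Del \<Longrightarrow> pr ws \<in> carrier G"
  using pr_H H_closed by blast

lemma pr_append: "us \<in> lists Del \<Longrightarrow> vs \<in> lists Del \<Longrightarrow> pr (us @ vs) = pr us \<otimes> pr vs"
  by (induction us) (use Del_D in \<open>auto simp: m_assoc\<close>)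

text \<open>The root changes sign at some letter \<open>b\<close> of the word. By the defining
  property of canonical roots it must equal \<open>b\<close> there, so conjugating
  \<open>rf a\<close> by the tail gives \<open>rf b\<close>, and the letter cancels.\<close>

lemma Del_exchange:
  assumes "ws \<in> lists Del" "a \<in> Del" "\<not> nonneg (gact (pr ws) a)"
  shows "\<exists>w1 b w2. ws = w1 @ b # w2 \<and> pr ws \<otimes> rf a = pr (w1 @ w2)"
  using assms(1,3)
proof (induction ws rule: list.induct)
  case Nil then show ?case using Del_D[OF assms(2)] by simp
next
  case (Cons b ws)
  note a = Del_D[OF assms(2)]
  have b: "b \<in> Del" "ws \<in> lists Del" using Cons.prems by auto
  note b' = Del_D[OF b(1)]
  have wc: "pr ws \<in> carrier G" using b by simp
  show ?case
  proof (cases "nonneg (gact (pr ws) a)")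
    case True
    then have "gact (pr ws) a \<in> Pos" using Pos_gact a b by simp
    moreover have "\<not> nonneg (gact (rf b) (gact (pr ws) a))" using Cons.prems b' b by simp
    ultimately have "gact (pr ws) a = b" using b(1) by (auto simp: Del_def)
    then have "rf b = pr ws \<otimes> rf a \<otimes> inv (pr ws)" using rf_conj a wc by metis
    then have "rf b \<otimes> pr ws = pr ws \<otimes> rf a" using a wc by (simp add: m_assoc)
    then have "pr (b # ws) \<otimes> rf a = pr ws \<otimes> (rf a \<otimes> rf a)" using a wc by (simp add: m_assoc)
    then show ?thesis using a wc by (intro exI[of _ "[]"]) auto
  next
    case False
    then obtain w1 c w2 where IH: "ws = w1 @ c # w2" "pr ws \<otimes> rf a = pr (w1 @ w2)"
      using Cons.IH b by blast
    then have "pr (b # ws) \<otimes> rf a = pr (b # w1 @ w2)" using a b' wc by (simp add: m_assoc)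
    then show ?thesis using IH by (intro exI[of _ "b # w1"]) auto
  qed
qed

definition red :: "(nat \<Rightarrow> real) list \<Rightarrow> bool" where
  "red ws \<longleftrightarrow> ws \<in> lists Del \<and> (\<forall>vs\<in>lists Del. pr vs = pr ws \<longrightarrow> length ws \<le> length vs)"

lemma red_lists: "red ws \<Longrightarrow> ws \<in> lists Del" by (simp add: red_def)

lemma red_le: "red ws \<Longrightarrow> vs \<in> lists Del \<Longrightarrow> pr vs = pr ws \<Longrightarrow> length ws \<le> length vs" by (simp add: red_def)

lemma red_length: "red us \<Longrightarrow> red vs \<Longrightarrow> pr us = pr vs \<Longrightarrow> length us = length vs"
  by (simp add: red_def le_antisym)

lemma red_transfer: "red us \<Longrightarrow> vs \<in> lists Del \<Longrightarrow> pr us = pr vs \<Longrightarrow> length vs \<le> length us \<Longrightarrow> red vs"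
  unfolding red_def by fastforce

lemma red_prefix: assumes "red (us @ vs)" shows "red us"
  unfolding red_def
proof (intro conjI ballI impI)
  have l: "us \<in> lists Del" "vs \<in> lists Del" using red_lists[OF assms] by auto
  then show "us \<in> lists Del" by simp
  fix xs assume xs: "xs \<in> lists Del" "pr xs = pr us"
  then have "pr (xs @ vs) = pr (us @ vs)" using l by (simp add: pr_append)
  then show "length us \<le> length xs" using red_le[OF assms, of "xs @ vs"] xs l by simp
qed

lemma pr_rf_rf: "ws \<in> lists Del \<Longrightarrow> a \<in> Del \<Longrightarrow> pr ws \<otimes> rf a \<otimes> rf a = pr ws"
  using Del_D by (simp add: m_assoc)

lemma gact_pr_snoc: "ws \<in> lists Del \<Longrightarrow> a \<in> Del \<Longrightarrow> gact (pr (ws @ [a])) a = (\<lambda>k. - gact (pr ws) a k)"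
  using Del_D by (simp add: pr_append rf_self gact_uminus)

lemma red_descent: assumes "red (us @ [a])" shows "\<not> nonneg (gact (pr (us @ [a])) a)"
proof
  assume nn: "nonneg (gact (pr (us @ [a])) a)"
  have l: "us \<in> lists Del" "a \<in> Del" using red_lists[OF assms] by auto
  have "gact (pr us) a \<in> Phi" using l Del_D Phi_gact by simp
  then have "\<not> nonneg (gact (pr us) a)" using nn Phi_neg gact_pr_snoc[OF l] by metis
  then obtain w1 b w2 where w: "us = w1 @ b # w2" "pr us \<otimes> rf a = pr (w1 @ w2)" using Del_exchange l by blast
  moreover have "pr (us @ [a]) = pr us \<otimes> rf a" using l Del_D by (simp add: pr_append)
  ultimately have "pr (w1 @ w2) = pr (us @ [a])" by simp
  then show False using red_le[OF assms, of "w1 @ w2"] l w by auto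
qed

lemma red_snoc: assumes "red us" "a \<in> Del" "nonneg (gact (pr us) a)" shows "red (us @ [a])"
  unfolding red_def
proof (intro conjI ballI impI)
  have l: "us \<in> lists Del" using assms red_lists by auto
  then show "us @ [a] \<in> lists Del" using assms by auto
  fix vs assume vs: "vs \<in> lists Del" "pr vs = pr (us @ [a])"
  have "gact (pr us) a \<in> Phi" using l assms Del_D Phi_gact by simp
  then have "\<not> nonneg (gact (pr vs) a)" unfolding vs(2) gact_pr_snoc[OF l assms(2)] using assms(3) Phi_neg by metis
  then obtain w1 b w2 where w: "vs = w1 @ b # w2" "pr vs \<otimes> rf a = pr (w1 @ w2)" using Del_exchange vs assms by blast
  have "pr (w1 @ w2) = pr us" using w(2) vs l assms Del_D pr_rf_rf[OF l assms(2)] by (simp add: pr_append)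
  then show "length (us @ [a]) \<le> length vs" using red_le[OF assms(1), of "w1 @ w2"] vs(1) w(1) by auto
qed

text \<open>The congruence \<open>E\<close> is kept abstract because it has two instances: the
  Coxeter congruence on types, which gives a presentation, and equality of products after deleting
  all letters not of a given type. Braid relations are required for alternating words with equal
  products, so no label has to be named.\<close>

context
  fixes E :: "(nat \<Rightarrow> real) list \<Rightarrow> (nat \<Rightarrow> real) list \<Rightarrow> bool"
  assumes E_refl: "\<And>u. u \<in> lists Del \<Longrightarrow> E u u"
    and E_sym: "\<And>u v. E u v \<Longrightarrow> E v u"
    and E_trans: "\<And>u v w. E u v \<Longrightarrow> E v w \<Longrightarrow> E u w"
    and E_ctxt: "\<And>u v a b. E u v \<Longrightarrow> u \<in> lists Del \<Longrightarrow> v \<in> lists Del \<Longrightarrow> a \<in> lists Del \<Longrightarrow> b \<in> lists Del \<Longrightarrow> E (a @ u @ b) (a @ v @ b)"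
    and E_sq: "\<And>b. b \<in> Del \<Longrightarrow> E [b, b] []"
    and E_braid: "\<And>a b q. a \<in> Del \<Longrightarrow> b \<in> Del \<Longrightarrow> a \<noteq> b \<Longrightarrow> pr (alt a b q) = pr (alt b a q) \<Longrightarrow> E (alt a b q) (alt b a q)"
begin

text \<open>Tits' solution of the word problem: by maximality of the alternating suffix, the letter
  removed by the exchange condition can only be the first letter of that suffix.\<close>

lemma Matsumoto: "red us \<Longrightarrow> red vs \<Longrightarrow> pr us = pr vs \<Longrightarrow> E us vs"
proof (induction "length us" arbitrary: us vs rule: less_induct)
  case less
  note len_eq = red_length[OF less.prems]
  have same: "E xs ys" if xy: "red xs" "red ys" "pr xs = pr ys" "length xs = length us" "xs = xs' @ [a]" "ys = ys' @ [a]" for xs ys xs' ys' a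
  proof -
    have l: "xs' \<in> lists Del" "ys' \<in> lists Del" "a \<in> Del" using xy(5,6) red_lists[OF xy(1)] red_lists[OF xy(2)] by auto
    have "pr xs' \<otimes> rf a = pr ys' \<otimes> rf a" using xy l Del_D by (simp add: pr_append)
    then have "pr xs' = pr ys'" using l Del_D by simp
    then have "E xs' ys'" using less.hyps[of xs' ys'] xy red_prefix by simp
    then show ?thesis using E_ctxt[of xs' ys' "[]" "[a]"] l xy by simp
  qed
  show ?case
  proof (cases "us = []")
    case True
    then show ?thesis using len_eq E_refl by simp
  next
    case False
    then obtain us' a where us: "us = us' @ [a]" by (metis append_butlast_last_id)
    have "vs \<noteq> []" using False len_eq by auto
    then obtain vs' b where vs: "vs = vs' @ [b]" by (metis append_butlast_last_id)
    show ?thesis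
    proof (cases "a = b")
      case True
      then show ?thesis using same[OF less.prems HOL.refl us] vs by simp
    next
      case ab: False
      have abD: "a \<in> Del" "b \<in> Del" using red_lists[OF less.prems(1)] red_lists[OF less.prems(2)] us vs by auto
      \<comment> \<open>\<open>Q q\<close> records a reduced word for the element whose last
        \<open>q\<close> letters alternate between \<open>a\<close> and \<open>b\<close>.\<close>
      define Q where "Q q \<longleftrightarrow> (\<exists>c x y. {x, y} = {a, b} \<and> red (c @ alt x y q) \<and> pr (c @ alt x y q) = pr us)" for q
      have "Q 1" unfolding Q_def using us less.prems by (intro exI[of _ us'] exI[of _ b] exI[of _ a]) auto
      moreover have bd: "q \<le> length us" if Qq: "Q q" for q
      proof -
        obtain c x y where c: "red (c @ alt x y q)" "pr (c @ alt x y q) = pr us" using Qq unfolding Q_def by blast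
        then show ?thesis using red_length[OF c(1) less.prems(1) c(2)] by simp
      qed
      ultimately obtain q where q: "Q q" "1 \<le> q" "\<And>q'. Q q' \<Longrightarrow> q' \<le> q"
        by (metis GreatestI_nat Greatest_le_nat)
      then obtain c x y where c: "{x, y} = {a, b}" "red (c @ alt x y q)" "pr (c @ alt x y q) = pr us"
        unfolding Q_def by blast
      have xy: "x \<in> Del" "y \<in> Del" "x \<noteq> y" "x = a \<and> y = b \<or> x = b \<and> y = a"
        using c(1) ab abD by (auto simp: doubleton_eq_iff)
      have cl: "c \<in> lists Del" using red_lists[OF c(2)] by auto
      have altl: "alt x y k \<in> lists Del" "alt y x k \<in> lists Del" for k using xy alt_in_lists by metis+
      let ?w = "c @ alt x y q"
      have lw: "length ?w = length us" using red_length[OF c(2) less.prems(1) c(3)] .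
      have "\<not> nonneg (gact (pr us) a)" "\<not> nonneg (gact (pr us) b)"
        using red_descent less.prems us vs by metis+
      \<comment> \<open>Both \<open>a\<close> and \<open>b\<close> shorten the element, so besides
        the last letter \<open>y\<close> the other letter \<open>x\<close> can also be moved to the
        end by exchange.\<close>
      then have "\<not> nonneg (gact (pr ?w) x)" using c(3) xy by auto
      then obtain w1 z w2 where ex: "?w = w1 @ z # w2" "pr ?w \<otimes> rf x = pr (w1 @ w2)"
        using Del_exchange[OF red_lists[OF c(2)] xy(1)] by blast
      have w12: "w1 \<in> lists Del" "w2 \<in> lists Del" using red_lists[OF c(2)] unfolding ex(1) by auto
      have prw: "pr ?w = pr (w1 @ w2 @ [x])"
      proof -
        have "pr (w1 @ w2 @ [x]) = pr (w1 @ w2) \<otimes> rf x" using w12 xy Del_D by (simp add: pr_append m_assoc)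
        also have "\<dots> = pr ?w \<otimes> rf x \<otimes> rf x" using ex(2) by simp
        also have "\<dots> = pr ?w" using red_lists[OF c(2)] xy by (intro pr_rf_rf) auto
        finally show ?thesis by simp
      qed
      have short: False if "xs \<in> lists Del" "pr xs = pr ?w" "length xs < length ?w" for xs
        using red_le[OF c(2) that(1,2)] that(3) by simp
      have "(\<exists>c2. c = w1 @ z # c2 \<and> w2 = c2 @ alt x y q) \<or> (\<exists>p. w1 = c @ p \<and> alt x y q = p @ z # w2)"
        using ex(1) by (auto simp: append_eq_append_conv2 append_eq_Cons_conv)
      then consider c2 where "c = w1 @ z # c2" "w2 = c2 @ alt x y q"
        | p where "w1 = c @ p" "alt x y q = p @ z # w2" by blast
      then show ?thesis
      proof cases
        case 1
        have eq: "w1 @ w2 @ [x] = (w1 @ c2) @ alt y x (Suc q)" unfolding 1(2) alt_snoc by simp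
        have "w1 @ w2 @ [x] \<in> lists Del" using w12 xy by auto
        moreover have "length (w1 @ w2 @ [x]) \<le> length ?w" using arg_cong[OF ex(1), of length] by simp
        ultimately have "red (w1 @ w2 @ [x])" using red_transfer[OF c(2) _ prw] by blast
        then have "red ((w1 @ c2) @ alt y x (Suc q))" "pr ((w1 @ c2) @ alt y x (Suc q)) = pr us"
          using prw c(3) unfolding eq by auto
        moreover have "{y, x} = {a, b}" using c(1) by (simp add: insert_commute)
        ultimately have "Q (Suc q)" unfolding Q_def by blast
        then show ?thesis using q(3) by fastforce
      next
        case 2
        show ?thesis
        proof (cases "p = []")
          case True
          obtain q' where q': "q = Suc q'" using q(2) by (cases q) auto
          have "w2 = alt x y q'" using 2(2) True q' by simp
          then have w': "pr ?w = pr (c @ alt y x q)" using prw 2 True q' by (simp add: alt_snoc del: alt.simps)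
          then have "pr (alt x y q) = pr (alt y x q)" using cl altl by (simp add: pr_append)
          then have "E (alt x y q) (alt y x q)" using E_braid xy by blast
          then have Ew: "E ?w (c @ alt y x q)" using E_ctxt[of _ _ c "[]"] cl altl by simp
          have r': "red (c @ alt y x q)" using red_transfer[OF c(2) _ w'] cl altl by simp
          have ends: "?w = (c @ alt y x q') @ [y]" "c @ alt y x q = (c @ alt x y q') @ [x]"
            unfolding q' alt_snoc by simp_all
          have l': "length (c @ alt y x q) = length us" using lw by simp
          have prs: "pr us = pr (c @ alt y x q)" "pr (c @ alt y x q) = pr vs" "pr ?w = pr vs"
            using w' c(3) less.prems(3) by simp_all
          show ?thesis
          proof (cases "y = a")
            case True
            then have "x = b" using xy by auto
            have "?w = (c @ alt y x q') @ [a]" "c @ alt y x q = (c @ alt x y q') @ [b]"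
              using ends True \<open>x = b\<close> by metis+
            then have "E us ?w" "E (c @ alt y x q) vs"
              using same[OF less.prems(1) c(2) c(3)[symmetric] HOL.refl us] same[OF r' less.prems(2) prs(2) l' _ vs] by blast+
            then show ?thesis using Ew E_trans by blast
          next
            case False
            then have "x = a" "y = b" using xy by auto
            have "?w = (c @ alt y x q') @ [b]" "c @ alt y x q = (c @ alt x y q') @ [a]"
              using ends \<open>x = a\<close> \<open>y = b\<close> by metis+
            then have "E us (c @ alt y x q)" "E ?w vs"
              using same[OF less.prems(1) r' prs(1) HOL.refl us] same[OF c(2) less.prems(2) prs(3) lw _ vs] by blast+
            then show ?thesis using Ew E_trans E_sym by blast
          qed
        next
          case False
          \<comment> \<open>Removing a letter further inside the suffix leaves two equal neighbours,
            whose cancellation contradicts reducedness.\<close>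
          then obtain p' t where p: "p = p' @ [t]" by (metis append_butlast_last_id)
          have p'l: "p' \<in> lists Del" "t \<in> Del" using w12 2 p by auto
          have lenq: "q = length p + Suc (length w2)" using arg_cong[OF 2(2), of length] by simp
          then have tq: "alt x y q ! length p' = t" "length p' < q"
            using 2(2) p by (simp_all add: nth_append)
          show ?thesis
          proof (cases w2)
            case Nil
            then have "q = Suc (Suc (length p'))" using lenq p by simp
            then have "t = x" using alt_nth[OF tq(2), of x y] tq(1) by simp
            then have "pr (c @ p') = pr ?w"
              using prw Nil 2 p cl p'l Del_D pr_rf_rf[of "c @ p'" x] by (simp add: pr_append m_assoc)
            then show ?thesis using short[of "c @ p'"] cl p'l 2 p by auto
          next
            case (Cons t' w3)
            have w3l: "w3 \<in> lists Del" using w12 Cons by auto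
            have lq: "q = length p' + length w3 + 3" using lenq p Cons by simp
            have "alt x y q ! (length p' + 2) = t'" using 2(2) p Cons by (simp add: nth_append)
            moreover have "alt x y q ! (length p' + 2) = alt x y q ! length p'"
              using alt_nth[of "length p'" q x y] alt_nth[of "length p' + 2" q x y] lq by simp
            ultimately have "t' = t" using tq by simp
            have "pr (c @ p' @ w3 @ [x]) = pr ?w"
            proof -
              have "pr (w1 @ w2 @ [x]) = pr (c @ p' @ w3 @ [x])"
                using 2 p Cons \<open>t' = t\<close> cl p'l w3l xy Del_D by (simp add: pr_append m_assoc)
              then show ?thesis using prw by simp
            qed
            then show ?thesis using short[of "c @ p' @ w3 @ [x]"] cl p'l w3l xy lq by simp
          qed
        qed
      qed
    qed
  qed
qed

lemma reduce_word: "ws \<in> lists Del \<Longrightarrow> \<exists>vs. red vs \<and> pr vs = pr ws \<and> E ws vs"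
proof (induction ws rule: rev_induct)
  case Nil
  then show ?case using E_refl[of "[]"] by (intro exI[of _ "[]"]) (simp add: red_def)
next
  case (snoc a ws)
  then have l: "ws \<in> lists Del" "a \<in> Del" by auto
  obtain vs where vs: "red vs" "pr vs = pr ws" "E ws vs" using snoc.IH l by blast
  note vl = red_lists[OF vs(1)]
  have E1: "E (ws @ [a]) (vs @ [a])" using E_ctxt[OF vs(3), of "[]" "[a]"] l vl by simp
  have p1: "pr (vs @ [a]) = pr (ws @ [a])" using vs l vl by (simp add: pr_append)
  show ?case
  proof (cases "nonneg (gact (pr vs) a)")
    case True
    then show ?thesis using red_snoc[OF vs(1) l(2)] E1 p1 by blast
  next
    case False
    then obtain w1 b w2 where w: "vs = w1 @ b # w2" "pr vs \<otimes> rf a = pr (w1 @ w2)" using Del_exchange vl l by blast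
    have wl: "w1 @ w2 \<in> lists Del" using vl w by auto
    have pv: "pr vs = pr ((w1 @ w2) @ [a])"
    proof -
      have "pr ((w1 @ w2) @ [a]) = pr (w1 @ w2) \<otimes> rf a" using wl l Del_D by (subst pr_append) auto
      also have "\<dots> = pr vs" unfolding w(2)[symmetric] by (rule pr_rf_rf[OF vl l(2)])
      finally show ?thesis by simp
    qed
    have r: "red ((w1 @ w2) @ [a])" using red_transfer[OF vs(1) _ pv] wl l w by simp
    have "E vs ((w1 @ w2) @ [a])" by (rule Matsumoto[OF vs(1) r pv])
    then have "E (vs @ [a]) ((w1 @ w2) @ [a, a])" using E_ctxt[of vs "(w1 @ w2) @ [a]" "[]" "[a]"] vl wl l by simp
    moreover have "E ((w1 @ w2) @ [a, a]) (w1 @ w2)" using E_ctxt[OF E_sq[OF l(2)], of "w1 @ w2" "[]"] wl l by simp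
    ultimately have "E (ws @ [a]) (w1 @ w2)" using E1 E_trans by blast
    moreover have "pr (w1 @ w2) = pr (ws @ [a])" using w(2) p1 vl l Del_D by (simp add: pr_append)
    ultimately show ?thesis using red_prefix[OF r] by blast
  qed
qed

theorem Tits_word_problem: assumes "us \<in> lists Del" "vs \<in> lists Del" "pr us = pr vs" shows "E us vs"
proof -
  obtain u v where "red u" "pr u = pr us" "E us u" "red v" "pr v = pr vs" "E vs v"
    using reduce_word assms by metis
  then show ?thesis using Matsumoto[of u v] assms E_trans E_sym by metis
qed

end

end

section \<open>Residual finiteness and the Hopf property\<close>

definition zspan :: "real set \<Rightarrow> real set" where
  "zspan C = {(\<Sum>c\<in>C. of_int (z c) * c) | z :: real \<Rightarrow> int. True}"

lemma zspan_0 [simp]: "0 \<in> zspan C"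
  unfolding zspan_def by (auto intro!: exI[of _ "\<lambda>c. 0"])

lemma zspan_add: "a \<in> zspan C \<Longrightarrow> b \<in> zspan C \<Longrightarrow> a + b \<in> zspan C"
  unfolding zspan_def
proof clarify
  fix y z :: "real \<Rightarrow> int"
  show "\<exists>x :: real \<Rightarrow> int. (\<Sum>c\<in>C. of_int (y c) * c) + (\<Sum>c\<in>C. of_int (z c) * c) = (\<Sum>c\<in>C. of_int (x c) * c) \<and> True"
    by (rule exI[of _ "\<lambda>c. y c + z c"]) (simp add: sum.distrib algebra_simps)
qed

lemma zspan_int: "a \<in> zspan C \<Longrightarrow> of_int k * a \<in> zspan C"
  unfolding zspan_def
proof clarify
  fix y :: "real \<Rightarrow> int"
  show "\<exists>x :: real \<Rightarrow> int. of_int k * (\<Sum>c\<in>C. of_int (y c) * c) = (\<Sum>c\<in>C. of_int (x c) * c) \<and> True"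
    by (rule exI[of _ "\<lambda>c. k * y c"]) (simp add: sum_distrib_left algebra_simps)
qed

lemma zspan_diff: "a \<in> zspan C \<Longrightarrow> b \<in> zspan C \<Longrightarrow> a - b \<in> zspan C"
  using zspan_add[of a C "of_int (-1) * b"] zspan_int[of b C "-1"] by simp

lemma zspan_in: assumes "finite C" "c \<in> C" shows "c \<in> zspan C"
proof -
  have "(\<Sum>x\<in>C. of_int (if x = c then 1 else 0) * x) = (\<Sum>x\<in>C. if x = c then c else 0)"
    by (intro sum.cong) auto
  also have "\<dots> = c" using assms by simp
  finally show ?thesis unfolding zspan_def by (auto intro!: exI[of _ "\<lambda>x. if x = c then 1 else 0"])
qed

lemma zspan_sum: "(\<And>i. i \<in> I \<Longrightarrow> f i \<in> zspan C) \<Longrightarrow> sum f I \<in> zspan C"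
  by (induction I rule: infinite_finite_induct) (auto intro: zspan_add)

lemma zspan_mult:
  assumes mult: "\<And>c c'. c \<in> C \<Longrightarrow> c' \<in> C \<Longrightarrow> c * c' \<in> zspan C" and "a \<in> zspan C" "b \<in> zspan C"
  shows "a * b \<in> zspan C"
proof -
  obtain y z :: "real \<Rightarrow> int" where "a = (\<Sum>c\<in>C. of_int (y c) * c)" "b = (\<Sum>c\<in>C. of_int (z c) * c)"
    using assms unfolding zspan_def by auto
  then have "a * b = (\<Sum>c\<in>C. \<Sum>c'\<in>C. of_int (y c * z c') * (c * c'))"
    by (simp add: sum_product algebra_simps)
  then show ?thesis using mult zspan_int by (simp only:) (intro zspan_sum, blast)
qed

text \<open>Generators are added one at a time. If a nonzero multiple of \<open>c\<close> lies in
  the old span, that multiple carries the problem back to the old span. Otherwise the coefficient of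
  \<open>c\<close> is unique, hence divisible by every positive integer, hence 0.\<close>

lemma zspan_divisible:
  assumes "finite C" "a \<in> zspan C" "\<And>q::nat. q > 0 \<Longrightarrow> \<exists>b\<in>zspan C. a = of_nat q * b"
  shows "a = 0"
  using assms
proof (induction C arbitrary: a)
  case empty then show ?case by (auto simp: zspan_def)
next
  case (insert c C)
  have ins: "\<exists>k::int. \<exists>u\<in>zspan C. b = of_int k * c + u" if b: "b \<in> zspan (insert c C)" for b
  proof -
    obtain y :: "real \<Rightarrow> int" where "b = (\<Sum>x\<in>insert c C. of_int (y x) * x)" using b unfolding zspan_def by auto
    then have "b = of_int (y c) * c + (\<Sum>x\<in>C. of_int (y x) * x)" using insert.hyps by simp
    then show ?thesis unfolding zspan_def by blast
  qed
  show ?case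
  proof (cases "\<exists>D::int. D \<noteq> 0 \<and> of_int D * c \<in> zspan C")
    case True
    then obtain D :: int where D: "D \<noteq> 0" "of_int D * c \<in> zspan C" by blast
    have Dz: "of_int D * b \<in> zspan C" if b: "b \<in> zspan (insert c C)" for b
    proof -
      obtain k :: int and u where u: "u \<in> zspan C" "b = of_int k * c + u" using ins[OF b] by blast
      then have "of_int D * b = of_int k * (of_int D * c) + of_int D * u" by (simp add: algebra_simps)
      then show ?thesis using D u zspan_add zspan_int by simp
    qed
    have "of_int D * a = 0"
    proof (rule insert.IH)
      fix q :: nat assume "q > 0"
      then obtain b where b: "b \<in> zspan (insert c C)" "a = of_nat q * b" using insert.prems(2) by blast
      then have "of_int D * a = of_nat q * (of_int D * b)" by simp
      then show "\<exists>b\<in>zspan C. of_int D * a = of_nat q * b" using Dz b by blast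
    qed (use Dz insert.prems in blast)
    then show ?thesis using D by simp
  next
    case False
    obtain k :: int and u where u: "u \<in> zspan C" "a = of_int k * c + u" using ins[OF insert.prems(1)] by blast
    have uniq: "k1 = k2 \<and> u1 = u2" if "of_int k1 * c + u1 = of_int k2 * c + u2" "u1 \<in> zspan C" "u2 \<in> zspan C"
      for k1 k2 :: int and u1 u2
    proof -
      have "of_int (k1 - k2) * c = u2 - u1" using that by (simp add: algebra_simps)
      then have "of_int (k1 - k2) * c \<in> zspan C" using zspan_diff that by metis
      then have "k1 - k2 = 0" using False by blast
      then show ?thesis using that by simp
    qed
    have div: "\<exists>l::int. \<exists>v\<in>zspan C. k = int q * l \<and> u = of_nat q * v" if q: "q > 0" for q :: nat
    proof -
      obtain b where b: "b \<in> zspan (insert c C)" "a = of_nat q * b" using insert.prems(2) q by blast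
      obtain l :: int and v where v: "v \<in> zspan C" "b = of_int l * c + v" using ins[OF b(1)] by blast
      have "of_int k * c + u = of_int (int q * l) * c + of_int (int q) * v"
        using b v u by (simp add: algebra_simps)
      then have "k = int q * l \<and> u = of_int (int q) * v" using uniq u(1) zspan_int[OF v(1)] by blast
      then show ?thesis using v(1) by auto
    qed
    have "k = 0"
    proof (rule ccontr)
      assume k: "k \<noteq> 0"
      obtain l where "k = int (nat \<bar>k\<bar> + 1) * l" using div[of "nat \<bar>k\<bar> + 1"] by auto
      then have "int (nat \<bar>k\<bar> + 1) dvd k" by (metis dvd_triv_left)
      then have "int (nat \<bar>k\<bar> + 1) \<le> \<bar>k\<bar>" using k by (metis abs_of_nat dvd_imp_le_int)
      then show False by simp
    qed
    moreover have "u = 0" using insert.IH[OF u(1)] div by blast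
    ultimately show ?thesis using u by simp
  qed
qed

text \<open>A homomorphism to \<open>Q\<close> is determined on \<open>S\<close>, so there are
  finitely many. Precomposition with the surjective \<open>f\<close> is injective on them, hence a
  permutation; every \<open>p\<close> therefore factors through \<open>f\<close> and kills its
  kernel.\<close>

lemma (in group) hom_finite_kills_kernel:
  assumes Q: "group Q" "finite (carrier Q)" and S: "finite S" "S \<subseteq> carrier G"
    and gen: "\<And>p p'. p \<in> hom G Q \<Longrightarrow> p' \<in> hom G Q \<Longrightarrow> (\<And>x. x \<in> S \<Longrightarrow> p x = p' x) \<Longrightarrow> (\<And>x. x \<in> carrier G \<Longrightarrow> p x = p' x)"
    and f: "f \<in> hom G G" "f ` carrier G = carrier G" and p: "p \<in> hom G Q" and x: "x \<in> carrier G" "f x = \<one>"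
  shows "p x = \<one>\<^bsub>Q\<^esub>"
proof -
  define A where "A = (\<lambda>p. restrict p (carrier G)) ` hom G Q"
  define T where "T p = restrict (p \<circ> f) (carrier G)" for p :: "'a \<Rightarrow> 'c"
  have fc: "f y \<in> carrier G" if "y \<in> carrier G" for y using f that by (auto simp: hom_def)
  have restr: "restrict p (carrier G) \<in> hom G Q" if "p \<in> hom G Q" for p
    using that by (auto simp: hom_def Pi_def)
  have "finite (S \<rightarrow>\<^sub>E carrier Q)" using S Q by (simp add: finite_PiE)
  moreover have "(\<lambda>p. restrict p S) ` A \<subseteq> S \<rightarrow>\<^sub>E carrier Q"
    using S(2) by (auto simp: A_def hom_def Pi_def PiE_def extensional_def)
  moreover have "inj_on (\<lambda>p. restrict p S) A"
  proof (rule inj_onI)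
    fix p p' assume pA: "p \<in> A" "p' \<in> A" and eq: "restrict p S = restrict p' S"
    have ph: "p \<in> hom G Q" "p' \<in> hom G Q" using pA restr by (auto simp: A_def)
    have "p x = p' x" if "x \<in> S" for x using fun_cong[OF eq, of x] that by simp
    then have "p x = p' x" if "x \<in> carrier G" for x using gen[OF ph] that by blast
    moreover have "p \<in> extensional (carrier G)" "p' \<in> extensional (carrier G)" using pA by (auto simp: A_def)
    ultimately show "p = p'" by (meson extensionalityI)
  qed
  ultimately have finA: "finite A" by (metis finite_imageD finite_subset)
  have TA: "T ` A \<subseteq> A"
  proof
    fix p assume "p \<in> T ` A"
    then obtain p' where p': "p' \<in> hom G Q" "p = T (restrict p' (carrier G))" by (auto simp: A_def)
    have "p' \<circ> f \<in> hom G Q" using f(1) p'(1) by (auto simp: hom_def Pi_def)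
    moreover have "p = restrict (p' \<circ> f) (carrier G)" using p' fc by (auto simp: T_def fun_eq_iff)
    ultimately show "p \<in> A" by (auto simp: A_def)
  qed
  have "inj_on T A"
  proof (rule inj_onI)
    fix p p' assume pA: "p \<in> A" "p' \<in> A" and eq: "T p = T p'"
    have "p y = p' y" if "y \<in> carrier G" for y
    proof -
      have "y \<in> f ` carrier G" using that f(2) by simp
      then obtain z where z: "z \<in> carrier G" "y = f z" by blast
      then show ?thesis using fun_cong[OF eq, of z] by (simp add: T_def)
    qed
    moreover have "p \<in> extensional (carrier G)" "p' \<in> extensional (carrier G)" using pA by (auto simp: A_def)
    ultimately show "p = p'" by (meson extensionalityI)
  qed
  then have "T ` A = A" using finA TA by (simp add: endo_inj_surj)
  then have "restrict p (carrier G) \<in> T ` A" using p by (auto simp: A_def)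
  then obtain p' where p': "p' \<in> hom G Q" "restrict p (carrier G) = T (restrict p' (carrier G))" by (auto simp: A_def)
  have "p x = p' (f x)" using fun_cong[OF p'(2), of x] x fc by (simp add: T_def)
  then show ?thesis using x hom_one[OF p'(1) is_group Q(1)] by simp
qed

context even_coxeter begin

section \<open>The lattice preserved by the geometric representation\<close>

definition MM :: nat where "MM = (\<Prod>i<n. \<Prod>j<n. if d i j = 0 then 1 else d i j)"

lemma MM_pos: "MM > 0" unfolding MM_def by (auto intro!: prod_pos)

lemma d_dvd_MM: assumes "i < n" "j < n" "d i j \<noteq> 0" shows "d i j dvd MM"
proof -
  have "d i j dvd (\<Prod>j<n. if d i j = 0 then 1 else d i j)"
    using assms dvd_prodI[of "{..<n}" j "\<lambda>j. if d i j = 0 then 1 else d i j"] by simp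
  also have "\<dots> dvd MM" unfolding MM_def
    using assms dvd_prodI[of "{..<n}" i "\<lambda>i. \<Prod>j<n. if d i j = 0 then 1 else d i j"] by simp
  finally show ?thesis .
qed

text \<open>Twice the cosine, so that products expand with integer coefficients and the additive
  span becomes a ring. It contains every \<open>2 * B i j\<close>, as \<open>MM\<close> is a common
  multiple of the finite labels.\<close>

definition cs :: "int \<Rightarrow> real" where "cs k = 2 * cos (real_of_int k * pi / real MM)"

definition CC :: "real set" where "CC = insert 1 (range cs)"

definition A :: "real set" where "A = zspan CC"

lemma cs_mult: "cs j * cs k = cs (j + k) + cs (j - k)"
proof -
  define a b where "a = real_of_int j * pi / real MM" and "b = real_of_int k * pi / real MM"
  have "real_of_int (j + k) * pi / real MM = a + b" "real_of_int (j - k) * pi / real MM = a - b"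
    unfolding a_def b_def by (simp_all add: add_divide_distrib diff_divide_distrib algebra_simps)
  then show ?thesis unfolding cs_def a_def[symmetric] b_def[symmetric] by (simp add: cos_times_cos)
qed

lemma cs_mod: "cs (k mod (2 * int MM)) = cs k"
proof -
  let ?m = "2 * int MM"
  have "cs k = cs (k mod ?m + ?m * (k div ?m))" by simp
  also have "real_of_int (k mod ?m + ?m * (k div ?m)) * pi / real MM =
      real_of_int (k mod ?m) * pi / real MM + of_int (k div ?m) * (2 * pi)"
    using MM_pos by (simp add: field_simps)
  then have "cs (k mod ?m + ?m * (k div ?m)) = cs (k mod ?m)"
    unfolding cs_def by (simp only: cos_add sin_int_2pin cos_int_2pin mult.commute[of _ "2 * pi"]) simp
  finally show ?thesis by simp
qed

lemma finite_CC: "finite CC"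
proof -
  have "range cs \<subseteq> cs ` {0..<2 * int MM}"
  proof
    fix x assume "x \<in> range cs"
    then obtain k where "x = cs k" by blast
    then have "x = cs (k mod (2 * int MM))" by (simp add: cs_mod)
    moreover have "k mod (2 * int MM) \<in> {0..<2 * int MM}" using MM_pos by simp
    ultimately show "x \<in> cs ` {0..<2 * int MM}" by blast
  qed
  then show ?thesis unfolding CC_def using finite_subset by blast
qed

lemma A_1: "1 \<in> A" unfolding A_def by (rule zspan_in[OF finite_CC]) (simp add: CC_def)

lemma A_cs: "cs k \<in> A" unfolding A_def by (rule zspan_in[OF finite_CC]) (simp add: CC_def)

lemma A_mult: "a \<in> A \<Longrightarrow> b \<in> A \<Longrightarrow> a * b \<in> A"
proof -
  have "c * c' \<in> A" if "c \<in> CC" "c' \<in> CC" for c c'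
    using that A_1 A_cs cs_mult zspan_add by (auto simp: CC_def A_def)
  then show "a \<in> A \<Longrightarrow> b \<in> A \<Longrightarrow> a * b \<in> A" unfolding A_def by (rule zspan_mult)
qed

lemma A_B: assumes "i < n" "j < n" shows "2 * B i j \<in> A"
proof -
  have "\<exists>k. 2 * cos (pi / real (d i j)) = cs k"
  proof (cases "d i j = 0")
    case True then show ?thesis by (intro exI[of _ 0]) (simp add: cs_def)
  next
    case False
    then obtain k where k: "MM = d i j * k" using d_dvd_MM[OF assms] by blast
    then have "real k / real MM = 1 / real (d i j)" using False MM_pos by (auto simp: field_simps)
    then have "real_of_int (int k) * pi / real MM = pi / real (d i j)"
      by (metis of_int_of_nat_eq times_divide_eq_left mult_1)
    then show ?thesis by (intro exI[of _ "int k"]) (simp add: cs_def)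
  qed
  then obtain k where "2 * cos (pi / real (d i j)) = cs k" by blast
  then have "2 * B i j = of_int (-1) * cs k" by (simp add: B_def)
  then show ?thesis using A_cs zspan_int unfolding A_def by metis
qed

definition L :: "(nat \<Rightarrow> real) set" where "L = {v. (\<forall>k. v k \<in> A) \<and> (\<forall>k. \<not> k < n \<longrightarrow> v k = 0)}"

lemma L_al: "i < n \<Longrightarrow> al i \<in> L" using A_1 by (auto simp: L_def al_def A_def)

lemma L_sg: assumes "i < n" "v \<in> L" shows "sg i v \<in> L"
proof -
  have "2 * form i v = (\<Sum>j<n. 2 * B i j * v j)" by (simp add: form_def sum_distrib_left mult.assoc)
  also have "\<dots> \<in> A" unfolding A_def
    by (rule zspan_sum) (use assms A_B A_mult in \<open>auto simp: L_def A_def[symmetric]\<close>)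
  finally have "2 * form i v * al i k \<in> A" for k by (auto simp: al_def A_def)
  then show ?thesis using assms zspan_diff by (auto simp: L_def sg_def A_def) (simp add: al_def)
qed

lemma L_gact: "g \<in> carrier G \<Longrightarrow> v \<in> L \<Longrightarrow> gact g v \<in> L"
  by (induction arbitrary: v rule: word_induct) (auto intro: L_sg)

text \<open>Residual finiteness by Malcev's argument: the group preserves the lattice \<open>L\<close>, whose quotients
  modulo integers are finite.\<close>

theorem residually_finite:
  assumes g: "g \<in> carrier G" "g \<noteq> \<one>"
  obtains N where "N \<lhd> G" "finite (carrier (G Mod N))" "g \<notin> N"
proof -
  obtain i where i: "i < n" "gact g (al i) \<noteq> al i" using faithful[OF g(1)] g(2) by blast
  then obtain k where k: "gact g (al i) k - al i k \<noteq> 0" by (auto simp: fun_eq_iff)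
  have "gact g (al i) k - al i k \<in> A"
    using L_al[OF i(1)] L_gact[OF g(1) L_al[OF i(1)]] zspan_diff by (auto simp: L_def A_def)
  \<comment> \<open>A nonzero element of \<open>A\<close> is not divisible in \<open>A\<close> by
    every integer. Modulo this \<open>q\<close> the action of \<open>g\<close> is still
    nontrivial.\<close>
  then obtain q :: nat where q: "q > 0" "\<And>b. b \<in> A \<Longrightarrow> gact g (al i) k - al i k \<noteq> of_nat q * b"
    using zspan_divisible[OF finite_CC, of "gact g (al i) k - al i k"] k unfolding A_def by blast
  define eqv where "eqv u w \<longleftrightarrow> (\<exists>v\<in>L. \<forall>k. u k = w k + of_nat q * v k)" for u w :: "nat \<Rightarrow> real"
  have eqvI: "eqv u w" if "v \<in> L" "\<And>k. u k = w k + of_nat q * v k" for u v w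
    using that by (auto simp: eqv_def)
  have eqv_gact: "eqv (gact h u) (gact h w)" if uw: "eqv u w" and h: "h \<in> carrier G" for u w h
  proof -
    obtain v where v: "v \<in> L" "\<forall>k. u k = w k + of_nat q * v k" using uw by (auto simp: eqv_def)
    have u: "u = (\<lambda>k. 1 * w k + of_nat q * v k)" using v by auto
    have "gact h u = (\<lambda>k. 1 * gact h w k + of_nat q * gact h v k)" unfolding u by (rule gact_lin[OF h])
    then show ?thesis unfolding eqv_def using L_gact[OF h v(1)] by auto
  qed
  have L0: "(\<lambda>k. 0) \<in> L" by (simp add: L_def A_def)
  have L_add: "(\<lambda>k. u k + v k) \<in> L" if "u \<in> L" "v \<in> L" for u v
    using that zspan_add by (auto simp: L_def A_def)
  have L_scale: "(\<lambda>k. a * v k) \<in> L" if "a \<in> A" "v \<in> L" for a v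
    using that A_mult by (auto simp: L_def)
  have L_neg: "(\<lambda>k. - v k) \<in> L" if "v \<in> L" for v
    using L_scale[OF _ that, of "-1"] zspan_int[of 1 CC "-1"] A_1 by (simp add: A_def)
  have eqv_refl: "eqv u u" for u unfolding eqv_def using L0 by (auto intro!: bexI[of _ "\<lambda>k. 0"])
  have eqv_trans: "eqv u w" if uvw: "eqv u v" "eqv v w" for u v w
  proof -
    obtain x y where "x \<in> L" "y \<in> L" "\<forall>k. u k = v k + of_nat q * x k" "\<forall>k. v k = w k + of_nat q * y k"
      using uvw by (auto simp: eqv_def)
    then show ?thesis unfolding eqv_def using L_add[of x y] by (auto intro!: bexI[of _ "\<lambda>k. x k + y k"] simp: algebra_simps)
  qed
  have eqv_sym: "eqv w u" if uw: "eqv u w" for u w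
  proof -
    obtain x where "x \<in> L" "\<forall>k. u k = w k + of_nat q * x k" using uw by (auto simp: eqv_def)
    then show ?thesis unfolding eqv_def using L_neg[of x] by (auto intro!: bexI[of _ "\<lambda>k. - x k"])
  qed
  define N where "N = {h \<in> carrier G. \<forall>u\<in>L. eqv (gact h u) u}"
  have "subgroup N G"
  proof
    show "N \<subseteq> carrier G" "\<one> \<in> N" using eqv_refl by (auto simp: N_def)
  next
    fix x y assume x: "x \<in> N" and y: "y \<in> N"
    show "x \<otimes> y \<in> N" unfolding N_def
    proof (intro CollectI conjI ballI)
      fix u assume u: "u \<in> L"
      have "gact y u \<in> L" "eqv (gact x (gact y u)) (gact y u)" "eqv (gact y u) u"
        using x y u L_gact by (auto simp: N_def)
      then show "eqv (gact (x \<otimes> y) u) u" using x y eqv_trans by (auto simp: N_def)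
    qed (use x y in \<open>auto simp: N_def\<close>)
    show "inv x \<in> N" unfolding N_def
    proof (intro CollectI conjI ballI)
      fix u assume u: "u \<in> L"
      have xc: "x \<in> carrier G" using x by (simp add: N_def)
      have "gact (inv x) u \<in> L" using xc u L_gact by simp
      then have "eqv (gact x (gact (inv x) u)) (gact (inv x) u)" using x unfolding N_def by blast
      then show "eqv (gact (inv x) u) u" using xc eqv_sym by simp
    qed (use x in \<open>auto simp: N_def\<close>)
  qed
  moreover have "x \<otimes> h \<otimes> inv x \<in> N" if x: "x \<in> carrier G" and h: "h \<in> N" for x h
    unfolding N_def
  proof (intro CollectI conjI ballI)
    have hc: "h \<in> carrier G" using h by (simp add: N_def)
    then show "x \<otimes> h \<otimes> inv x \<in> carrier G" using x by simp
    fix u assume u: "u \<in> L"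
    have "gact (inv x) u \<in> L" using x u L_gact by simp
    then have "eqv (gact h (gact (inv x) u)) (gact (inv x) u)" using h unfolding N_def by blast
    then have "eqv (gact x (gact h (gact (inv x) u))) (gact x (gact (inv x) u))" using eqv_gact x by blast
    then show "eqv (gact (x \<otimes> h \<otimes> inv x) u) u" using x hc by simp
  qed
  ultimately have N: "N \<lhd> G" by (simp add: normal_inv_iff)
  \<comment> \<open>The elements of \<open>CC\<close> may be linearly dependent, so integer
    coordinates need not be unique. A choice of coordinates is enough: equal codes imply congruence
    modulo \<open>q\<close>, and there are finitely many codes.\<close>
  define code where "code a = (SOME f. \<exists>z :: real \<Rightarrow> int. a = (\<Sum>c\<in>CC. of_int (z c) * c) \<and> f = restrict (\<lambda>c. z c mod int q) CC)" for a
  have code: "\<exists>z :: real \<Rightarrow> int. a = (\<Sum>c\<in>CC. of_int (z c) * c) \<and> code a = restrict (\<lambda>c. z c mod int q) CC" if "a \<in> A" for a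
  proof -
    have "\<exists>f. \<exists>z :: real \<Rightarrow> int. a = (\<Sum>c\<in>CC. of_int (z c) * c) \<and> f = restrict (\<lambda>c. z c mod int q) CC"
      using that by (auto simp: A_def zspan_def)
    from someI_ex[OF this] show ?thesis unfolding code_def .
  qed
  have code_eq: "\<exists>c\<in>A. a = b + of_nat q * c" if ab: "a \<in> A" "b \<in> A" "code a = code b" for a b
  proof -
    obtain y :: "real \<Rightarrow> int" where y: "a = (\<Sum>c\<in>CC. of_int (y c) * c)" "code a = restrict (\<lambda>c. y c mod int q) CC"
      using code[OF ab(1)] by blast
    obtain z :: "real \<Rightarrow> int" where z: "b = (\<Sum>c\<in>CC. of_int (z c) * c)" "code b = restrict (\<lambda>c. z c mod int q) CC"
      using code[OF ab(2)] by blast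
    have "y c mod int q = z c mod int q" if "c \<in> CC" for c
      using fun_cong[OF ab(3), of c] that unfolding y(2) z(2) by simp
    then have yz: "y c = z c + int q * ((y c - z c) div int q)" if "c \<in> CC" for c
    proof -
      have "int q dvd y c - z c" using \<open>\<And>c. c \<in> CC \<Longrightarrow> y c mod int q = z c mod int q\<close> that by (simp add: mod_eq_dvd_iff)
      then show ?thesis by simp
    qed
    have "a = (\<Sum>c\<in>CC. of_int (z c) * c + of_nat q * (of_int ((y c - z c) div int q) * c))"
      unfolding y(1)
    proof (rule sum.cong[OF HOL.refl])
      fix c assume "c \<in> CC"
      from yz[OF this] have "real_of_int (y c) = of_int (z c) + of_nat q * of_int ((y c - z c) div int q)"
        by (metis of_int_add of_int_mult of_int_of_nat_eq)
      then show "of_int (y c) * c = of_int (z c) * c + of_nat q * (of_int ((y c - z c) div int q) * c)"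
        by (simp add: algebra_simps)
    qed
    also have "\<dots> = b + of_nat q * (\<Sum>c\<in>CC. of_int ((y c - z c) div int q) * c)"
      unfolding z(1) by (simp add: sum.distrib sum_distrib_left)
    finally have "a = b + of_nat q * (\<Sum>c\<in>CC. of_int ((y c - z c) div int q) * c)" .
    moreover have "(\<Sum>c\<in>CC. of_int ((y c - z c) div int q) * c) \<in> A"
      unfolding A_def zspan_def by (rule CollectI, rule exI[of _ "\<lambda>c. (y c - z c) div int q"]) simp
    ultimately show ?thesis by blast
  qed
  define K where "K h = restrict (\<lambda>(i, k). code (gact h (al i) k)) ({..<n} \<times> {..<n})" for h
  have Aentry: "gact h (al i) k \<in> A" if "h \<in> carrier G" "i < n" for h i k
    using L_gact[OF that(1) L_al[OF that(2)]] by (simp add: L_def)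
  have code_PiE: "code a \<in> CC \<rightarrow>\<^sub>E {0..<int q}" if a: "a \<in> A" for a
  proof -
    obtain z :: "real \<Rightarrow> int" where "code a = restrict (\<lambda>c. z c mod int q) CC" using code[OF a] by blast
    then show ?thesis using q(1) by auto
  qed
  have "K ` carrier G \<subseteq> ({..<n} \<times> {..<n}) \<rightarrow>\<^sub>E (CC \<rightarrow>\<^sub>E {0..<int q})"
  proof (rule image_subsetI)
    fix h assume h: "h \<in> carrier G"
    show "K h \<in> ({..<n} \<times> {..<n}) \<rightarrow>\<^sub>E (CC \<rightarrow>\<^sub>E {0..<int q})"
    proof (rule PiE_I)
      fix p assume "p \<in> {..<n} \<times> {..<n}"
      then obtain i k where p: "p = (i, k)" "i < n" "k < n" by auto
      show "K h p \<in> CC \<rightarrow>\<^sub>E {0..<int q}" unfolding K_def using code_PiE[OF Aentry[OF h p(2), of k]] p by simp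
    qed (simp add: K_def)
  qed
  moreover have "finite (({..<n} \<times> {..<n}) \<rightarrow>\<^sub>E (CC \<rightarrow>\<^sub>E {0..<int q}))"
    by (intro finite_PiE finite_SigmaI) (simp_all add: finite_CC)
  ultimately have finK: "finite (K ` carrier G)" using finite_subset by blast
  have coset: "N #> h = N #> h'" if h: "h \<in> carrier G" "h' \<in> carrier G" and KK: "K h = K h'" for h h'
  proof -
    have al: "eqv (gact h (al i)) (gact h' (al i))" if i: "i < n" for i
    proof -
      have "\<exists>c\<in>A. gact h (al i) k = gact h' (al i) k + of_nat q * c" if "k < n" for k
        using fun_cong[OF KK, of "(i, k)"] i that by (intro code_eq Aentry h) (auto simp: K_def)
      then obtain c where c: "\<And>k. k < n \<Longrightarrow> c k \<in> A \<and> gact h (al i) k = gact h' (al i) k + of_nat q * c k" by metis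
      have "(\<lambda>k. if k < n then c k else 0) \<in> L" using c by (auto simp: L_def A_def)
      moreover have "gact h (al i) k = gact h' (al i) k + of_nat q * (if k < n then c k else 0)" for k
        using c[of k] Phi_support[OF PhiI[OF h(1) i], of k] Phi_support[OF PhiI[OF h(2) i], of k] by auto
      ultimately show ?thesis by (rule eqvI)
    qed
    have ext: "eqv (gact h u) (gact h' u)" if u: "u \<in> L" for u
    proof -
      obtain v where v: "\<And>j. j < n \<Longrightarrow> v j \<in> L \<and> (\<forall>k. gact h (al j) k = gact h' (al j) k + of_nat q * v j k)"
        using al unfolding eqv_def by metis
      have ueq: "u = (\<lambda>k. \<Sum>j\<in>{..<n}. u j * al j k)"
        using u by (auto simp: L_def al_def fun_eq_iff if_distrib cong: if_cong)
      have exp: "gact x u = (\<lambda>k. \<Sum>j\<in>{..<n}. u j * gact x (al j) k)" if "x \<in> carrier G" for x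
        by (subst ueq) (rule gact_sum[OF that], simp)
      have "gact h u k = gact h' u k + of_nat q * (\<Sum>j<n. u j * v j k)" for k
        unfolding exp[OF h(1)] exp[OF h(2)] using v by (simp add: sum.distrib sum_distrib_left algebra_simps)
      moreover have vL: "(\<lambda>k. \<Sum>j<n. u j * v j k) \<in> L"
        unfolding L_def
      proof (intro CollectI conjI allI impI)
        fix k
        show "(\<Sum>j<n. u j * v j k) \<in> A"
          unfolding A_def by (rule zspan_sum) (use u v A_mult in \<open>auto simp: L_def A_def[symmetric]\<close>)
        assume "\<not> k < n"
        then show "(\<Sum>j<n. u j * v j k) = 0" using v by (auto simp: L_def intro!: sum.neutral)
      qed
      ultimately show ?thesis by (intro eqvI[OF vL])
    qed
    have "h \<otimes> inv h' \<in> N" unfolding N_def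
    proof (intro CollectI conjI ballI)
      fix u assume u: "u \<in> L"
      have "gact (inv h') u \<in> L" using u h L_gact by simp
      then have "eqv (gact h (gact (inv h') u)) (gact h' (gact (inv h') u))" by (rule ext)
      then show "eqv (gact (h \<otimes> inv h') u) u" using h by simp
    qed (use h in simp)
    then have "N #> (h \<otimes> inv h') = N"
      using h normal_imp_subgroup[OF N] by (intro coset_join2) auto
    moreover have "(N #> (h \<otimes> inv h')) #> h' = N #> (h \<otimes> inv h' \<otimes> h')"
      using h by (intro coset_mult_assoc) (auto simp: N_def)
    ultimately show ?thesis using h by (simp add: m_assoc)
  qed
  have "carrier (G Mod N) \<subseteq> (\<lambda>y. N #> (SOME h. h \<in> carrier G \<and> K h = y)) ` (K ` carrier G)"
  proof
    fix c assume "c \<in> carrier (G Mod N)"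
    then obtain h where h: "h \<in> carrier G" "c = N #> h" by (auto simp: FactGroup_def RCOSETS_def)
    have "\<exists>h'. h' \<in> carrier G \<and> K h' = K h" using h by blast
    from someI_ex[OF this] have "N #> h = N #> (SOME h'. h' \<in> carrier G \<and> K h' = K h)" using coset h by metis
    then show "c \<in> (\<lambda>y. N #> (SOME h. h \<in> carrier G \<and> K h = y)) ` (K ` carrier G)" using h by blast
  qed
  then have fin: "finite (carrier (G Mod N))" using finK finite_subset by blast
  have "g \<notin> N"
  proof
    assume "g \<in> N"
    then obtain v where v: "v \<in> L" "\<forall>k. gact g (al i) k = al i k + of_nat q * v k"
      using L_al[OF i(1)] by (auto simp: N_def eqv_def)
    then have "v k \<in> A" "gact g (al i) k - al i k = of_nat q * v k" by (auto simp: L_def)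
    then show False using q by blast
  qed
  then show ?thesis using that N fin by blast
qed

theorem hopfian:
  assumes f: "f \<in> hom G G" "f ` carrier G = carrier G" shows "inj_on f (carrier G)"
proof -
  have "x = \<one>" if x: "x \<in> carrier G" "f x = \<one>" for x
  proof (rule ccontr)
    assume "x \<noteq> \<one>"
    then obtain N where N: "N \<lhd> G" "finite (carrier (G Mod N))" "x \<notin> N" using residually_finite x by blast
    interpret N: normal N G by (rule N(1))
    have "N #> x = \<one>\<^bsub>G Mod N\<^esub>"
    proof (rule hom_finite_kills_kernel[OF N.factorgroup_is_group N(2) _ _ _ f _ x, of "s ` {..<n}"])
      fix p p' y assume p: "p \<in> hom G (G Mod N)" "p' \<in> hom G (G Mod N)"
        and eq: "\<And>x. x \<in> s ` {..<n} \<Longrightarrow> p x = p' x" and y: "y \<in> carrier G"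
      show "p y = p' y" by (rule hom_eqI[OF p N.factorgroup_is_group _ y]) (use eq in auto)
    qed (use N.r_coset_hom_Mod in auto)
    then have "N #> x = N" by (simp add: FactGroup_def)
    then have "x \<in> N" using x N.subgroup_axioms rcos_self by blast
    then show False using N by simp
  qed
  then have "kernel G G f = {\<one>}" using hom_one[OF f(1) is_group is_group] by (auto simp: kernel_def)
  moreover have "group_hom G G f" using f by (simp add: group_hom_def group_hom_axioms_def is_group)
  ultimately show ?thesis by (simp add: group_hom.inj_iff_trivial_ker)
qed

end

context even_coxeter begin

lemma par_pow: "g \<in> carrier G \<Longrightarrow> par k (g [^] (l::nat)) = of_nat l * par k g"
  by (induction l) (auto simp: algebra_simps)

lemma rot_mult_int:
  assumes "i < n" "j < n"
  shows "(rot i j [^] (a::int) \<otimes> s i) \<otimes> (rot i j [^] (b::int) \<otimes> s i) = rot i j [^] (a - b)"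
proof -
  let ?r = "rot i j"
  have "(?r [^] a \<otimes> s i) \<otimes> (?r [^] b \<otimes> s i) = ?r [^] a \<otimes> (s i \<otimes> ?r [^] b) \<otimes> s i"
    using assms by (simp add: m_assoc)
  also have "\<dots> = ?r [^] a \<otimes> (?r [^] (- b) \<otimes> s i) \<otimes> s i" using assms by (simp only: s_rot)
  also have "\<dots> = ?r [^] a \<otimes> ?r [^] (- b)" using assms by (simp add: m_assoc)
  also have "\<dots> = ?r [^] (a - b)" using assms by (simp add: int_pow_mult[symmetric])
  finally show ?thesis .
qed

lemma even_bit_iff: "of_int z = (0::bit) \<longleftrightarrow> even z"
proof (cases "0 \<le> z")
  case True
  then obtain k where "z = int k" using nonneg_int_cases by blast
  then show ?thesis by (simp add: of_nat_bit_eq_0_iff)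
next
  case False
  then obtain k where "z = - int k" by (metis int_cases2 nat_le_linear of_nat_0_le_iff)
  then show ?thesis by (simp add: of_nat_bit_eq_0_iff)
qed

lemma dihedral_par_cases:
  assumes ij: "i < n" "j < n" "i \<noteq> j" and g: "g \<in> W {i, j}"
  obtains z :: int where "g = rot i j [^] z" "par i g = of_int z" "par j g = of_int z"
  | z :: int where "g = rot i j [^] z \<otimes> s i" "par i g = of_int z + 1" "par j g = of_int z"
proof -
  have r: "par i (rot i j [^] z) = of_int z" "par j (rot i j [^] z) = of_int z" for z :: int
    using ij by (simp_all add: par_rot_pow par_s)
  show ?thesis
    using dihedral_cases[OF ij(1,2) g] r ij that by (metis int_pow_closed m_closed par_mult par_s s_closed add.right_neutral)
qed

text \<open>Both conjugates are a power of the rotation followed by \<open>s i\<close>. Parities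
  make the exponent even for the conjugate of \<open>s i\<close> and odd for that of
  \<open>s j\<close>; the product is the rotation by the difference.\<close>

lemma conj_pair:
  assumes ij: "i < n" "j < n" "i \<noteq> j" and gh: "g \<in> W {i, j}" "h \<in> W {i, j}"
  obtains z :: int where "odd z" "(g \<otimes> s i \<otimes> inv g) \<otimes> (h \<otimes> s j \<otimes> inv h) = rot i j [^] z"
proof -
  have sub: "{i, j} \<subseteq> {..<n}" using ij by simp
  have c: "g \<in> carrier G" "h \<in> carrier G" using gh sub W_closed by blast+
  let ?u = "g \<otimes> s i \<otimes> inv g" let ?v = "h \<otimes> s j \<otimes> inv h"
  have W: "?u \<in> W {i, j}" "?v \<in> W {i, j}"
    using gh sub by (auto intro!: W_mult W_inv W_s)
  have p: "par i ?u = 1" "par j ?u = 0" "par i ?v = 0" "par j ?v = 1"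
    using c ij by (simp_all add: par_s)
  obtain a where a: "?u = rot i j [^] (a::int) \<otimes> s i" "even a"
    using dihedral_par_cases[OF ij W(1)] p by (metis even_bit_iff zero_neq_one)
  obtain b where b: "?v = rot i j [^] (b::int) \<otimes> s i" "odd b"
    using dihedral_par_cases[OF ij W(2)] p by (metis even_bit_iff zero_neq_one)
  have "?u \<otimes> ?v = rot i j [^] (a - b)" unfolding a(1) b(1) using ij by (intro rot_mult_int)
  moreover have "odd (a - b)" using a b by simp
  ultimately show ?thesis using that by blast
qed

lemma finite_W_pair: assumes ij: "i < n" "j < n" "d i j \<noteq> 0" shows "finite (W {i, j})"
proof -
  let ?r = "rot i j" let ?D = "{0..<int (d i j)}"
  have md: "?r [^] z = ?r [^] (z mod int (d i j))" for z :: int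
  proof -
    have "?r [^] z = ?r [^] (z div int (d i j) * int (d i j) + z mod int (d i j))" by simp
    also have "\<dots> = ?r [^] (z div int (d i j) * int (d i j)) \<otimes> ?r [^] (z mod int (d i j))"
      using ij by (intro int_pow_mult) simp
    also have "?r [^] (z div int (d i j) * int (d i j)) = \<one>" using rot_order_int[OF ij(1,2)] by simp
    finally show ?thesis using ij by simp
  qed
  have "W {i, j} \<subseteq> (\<lambda>z. ?r [^] z) ` ?D \<union> (\<lambda>z. ?r [^] z \<otimes> s i) ` ?D"
  proof
    fix g assume g: "g \<in> W {i, j}"
    have m: "z mod int (d i j) \<in> ?D" for z using ij(3) by simp
    show "g \<in> (\<lambda>z. ?r [^] z) ` ?D \<union> (\<lambda>z. ?r [^] z \<otimes> s i) ` ?D"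
      using dihedral_cases[OF ij(1,2) g] md m by (metis (mono_tags, lifting) UnI1 UnI2 image_eqI)
  qed
  then show ?thesis by (rule finite_subset) simp
qed

end

section \<open>Locally inner endomorphisms\<close>

context refl_subgroup begin

lemma GD_word: assumes "g \<in> GD" obtains ws where "ws \<in> lists Del" "pr ws = g"
proof -
  have "\<exists>ws\<in>lists Del. pr ws = g"
    using assms unfolding GD_def
  proof induction
    case one then show ?case by (intro bexI[of _ "[]"]) auto
  next
    case (incl h)
    then obtain b where "b \<in> Del" "h = rf b" by blast
    then show ?case using Del_D by (intro bexI[of _ "[b]"]) auto
  next
    case (inv h)
    then obtain b where "b \<in> Del" "h = rf b" by blast
    then show ?case using Del_D by (intro bexI[of _ "[b]"]) auto
  next
    case (eng h1 h2)
    then obtain u v where "u \<in> lists Del" "pr u = h1" "v \<in> lists Del" "pr v = h2" by auto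
    then show ?case by (intro bexI[of _ "u @ v"]) (auto simp: pr_append)
  qed
  then show ?thesis using that by blast
qed

lemma pr_rev: "ws \<in> lists Del \<Longrightarrow> pr (rev ws) = inv (pr ws)"
proof (induction ws rule: list.induct)
  case (Cons b ws)
  then have l: "b \<in> Del" "ws \<in> lists Del" "rev ws \<in> lists Del" by auto
  then show ?case using Cons.IH Del_D by (simp add: pr_append inv_mult_group)
qed simp

lemma pr_conj:
  assumes "ws \<in> lists Del" "c \<in> Del"
  shows "pr (ws @ c # rev ws) = pr ws \<otimes> rf c \<otimes> inv (pr ws)" "pr (ws @ rev ws) = \<one>"
proof -
  have l: "rev ws \<in> lists Del" "c # rev ws \<in> lists Del" using assms by auto
  have "rf c \<in> carrier G" "pr ws \<in> carrier G" using assms Del_D by auto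
  then show "pr (ws @ c # rev ws) = pr ws \<otimes> rf c \<otimes> inv (pr ws)" "pr (ws @ rev ws) = \<one>"
    by (simp_all only: pr_append[OF assms(1) l(1)] pr_append[OF assms(1) l(2)] pr_Cons pr_rev[OF assms(1)] m_assoc inv_closed r_inv)
qed

lemma pr_alt_even: "a \<in> Del \<Longrightarrow> b \<in> Del \<Longrightarrow> pr (alt a b (2 * k)) = (rf a \<otimes> rf b) [^] k"
proof (induction k)
  case (Suc k)
  have "alt a b (2 * k) \<in> lists Del" using Suc by (intro alt_in_lists)
  moreover have "(rf a \<otimes> rf b) [^] Suc k = (rf a \<otimes> rf b) \<otimes> (rf a \<otimes> rf b) [^] k"
    using Suc.prems Del_D by (intro nat_pow_Suc2) simp
  ultimately show ?case using Suc Del_D by (simp add: m_assoc del: nat_pow_Suc)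
qed simp

text \<open>The generator to which the reflection is conjugate; in an even system parity detects
  it.\<close>

definition tp :: "(nat \<Rightarrow> real) \<Rightarrow> nat" where "tp b = (THE i. i < n \<and> par i (rf b) = 1)"

lemma tp: assumes "b \<in> Phi" shows "tp b < n" "par k (rf b) = (if k = tp b then 1 else 0)"
proof -
  obtain i where i: "i < n" "\<And>k. par k (rf b) = (if k = i then 1 else 0)" using rf_par[OF assms] by blast
  then have "tp b = i" unfolding tp_def by (intro the_equality) (auto split: if_splits)
  then show "tp b < n" "par k (rf b) = (if k = tp b then 1 else 0)" using i by auto
qed

text \<open>A retraction on the level of words. Deletion respects squares, and it respects a braid
  relation: if the two types agree, everything or nothing is deleted; if they differ, at most one of
  the letters survives, and the parity of its occurrences is read off the product.\<close>

lemma filter_type: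
  assumes "us \<in> lists Del" "vs \<in> lists Del" "pr us = pr vs"
  shows "pr (filter (\<lambda>b. tp b = i) us) = pr (filter (\<lambda>b. tp b = i) vs)"
proof -
  let ?P = "\<lambda>b. tp b = i"
  have fl: "filter ?P u \<in> lists Del" if "u \<in> lists Del" for u using that by auto
  show ?thesis
  proof (rule Tits_word_problem[where E = "\<lambda>u v. pr (filter ?P u) = pr (filter ?P v)"])
    fix u v a b assume E: "pr (filter ?P u) = pr (filter ?P v)"
      and l: "u \<in> lists Del" "v \<in> lists Del" "a \<in> lists Del" "b \<in> lists Del"
    then show "pr (filter ?P (a @ u @ b)) = pr (filter ?P (a @ v @ b))"
      by (simp add: pr_append[OF fl fl] pr_append[OF fl] fl del: filter_append add: filter_append)
  next
    fix b assume "b \<in> Del"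
    then show "pr (filter ?P [b, b]) = pr (filter ?P [])" using Del_D by simp
  next
    fix a b q assume ab: "a \<in> Del" "b \<in> Del" "a \<noteq> b" and eq: "pr (alt a b q) = pr (alt b a q)"
    have one: "pr (filter ?P u) = (if par i (pr u) = 1 then rf a else \<one>)"
      if "a \<in> Del" "b \<in> Del" "tp a = i" "tp b \<noteq> i" "u \<in> lists {a, b}" for u a b
      using that(5)
    proof (induction u rule: list.induct)
      case (Cons c u)
      have "u \<in> lists Del" using Cons.prems that by auto
      moreover from this have "pr u \<in> carrier G" by (rule pr_closed)
      moreover have "c \<in> Del" using Cons.prems that by auto
      ultimately have "par i (pr (c # u)) = par i (rf c) + par i (pr u)" using Del_D by simp
      then show ?case using Cons that Del_D tp(2)[of c i] by (auto simp: bit_add_eq_0_iff)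
    qed simp
    have l: "alt a b q \<in> lists {a, b}" "alt b a q \<in> lists {a, b}"
      "alt a b q \<in> lists {b, a}" "alt b a q \<in> lists {b, a}"
      by (rule alt_in_lists; simp)+
    have all: "filter ?P u = (if tp a = i then u else [])" if "tp a = i \<longleftrightarrow> tp b = i" "u \<in> lists {a, b}" for u
      using that(2,1) by (induction u rule: list.induct) auto
    show "pr (filter ?P (alt a b q)) = pr (filter ?P (alt b a q))"
    proof (cases "tp a = i \<longleftrightarrow> tp b = i")
      case True
      then show ?thesis using all l eq by simp
    next
      case False
      then consider "tp a = i" "tp b \<noteq> i" | "tp b = i" "tp a \<noteq> i" by blast
      then show ?thesis
      proof cases
        case 1 then show ?thesis using one[OF ab(1,2) 1 l(1)] one[OF ab(1,2) 1 l(2)] eq by simp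
      next
        case 2 then show ?thesis using one[OF ab(2,1) 2 l(3)] one[OF ab(2,1) 2 l(4)] eq by simp
      qed
    qed
  qed (use assms in auto)
qed

end

text \<open>The image of \<open>e\<close> is a reflection subgroup with exactly one canonical generator \<open>y\<^sub>i\<close> of each type \<open>i\<close>.
  The label of \<open>y\<^sub>i\<close>, \<open>y\<^sub>j\<close> is a multiple of \<open>d i j\<close>, so \<open>y\<^sub>i \<mapsto> s\<^sub>i\<close> extends to a homomorphism; its
  composite with \<open>e\<close> is a surjective endomorphism, hence injective by the Hopf property.\<close>

locale locally_inner = even_coxeter +
  fixes e :: "'a \<Rightarrow> 'a"
  assumes e_hom: "e \<in> hom G G"
    and e_conj: "i < n \<Longrightarrow> \<exists>w\<in>carrier G. e (s i) = w \<otimes> s i \<otimes> inv w"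
    and e_pair: "i < n \<Longrightarrow> j < n \<Longrightarrow> d i j \<noteq> 0 \<Longrightarrow>
      \<exists>w\<in>carrier G. e (s i) = w \<otimes> s i \<otimes> inv w \<and> e (s j) = w \<otimes> s j \<otimes> inv w"
begin

lemma e_group_hom: "group_hom G G e"
  using e_hom by (simp add: group_hom_def group_hom_axioms_def is_group)

sublocale refl_subgroup G n s m "e ` carrier G"
  by (intro refl_subgroup.intro even_coxeter_axioms refl_subgroup_axioms.intro
      group_hom.img_is_subgroup[OF e_group_hom])

lemma e_closed [simp]: "g \<in> carrier G \<Longrightarrow> e g \<in> carrier G" using e_hom by (auto simp: hom_def)

lemma e_mult: "g \<in> carrier G \<Longrightarrow> h \<in> carrier G \<Longrightarrow> e (g \<otimes> h) = e g \<otimes> e h" using e_hom by (auto simp: hom_def)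

lemma e_s_sq: "i < n \<Longrightarrow> e (s i) \<otimes> e (s i) = \<one>"
  using e_mult[of "s i" "s i"] hom_one[OF e_hom is_group is_group] by simp

lemma e_s_Pos: assumes "i < n" obtains b where "b \<in> Pos" "e (s i) = rf b" "tp b = i"
proof -
  obtain w where w: "w \<in> carrier G" "e (s i) = w \<otimes> s i \<otimes> inv w" using e_conj assms by blast
  let ?b = "gact w (al i)"
  have b: "?b \<in> Phi" "rf ?b = e (s i)" using PhiI w assms by (auto simp: rf_gact)
  obtain c where c: "c \<in> Phi" "nonneg c" "rf c = e (s i)"
    using Phi_cases[OF b(1)] b rf_uminus Phi_uminus by metis
  then have "c \<in> Pos" using assms by (auto simp: Pos_def)
  moreover have "tp c = i"
    using tp(2)[OF c(1), of i] c(3) w assms by (simp add: par_s split: if_splits)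
  ultimately show ?thesis using that c by metis
qed

lemma H_gen: "g \<in> e ` carrier G \<Longrightarrow> P \<one> \<Longrightarrow> (\<And>i h. i < n \<Longrightarrow> h \<in> e ` carrier G \<Longrightarrow> P h \<Longrightarrow> P (e (s i) \<otimes> h)) \<Longrightarrow> P g"
proof -
  assume g: "g \<in> e ` carrier G" and P: "P \<one>" "\<And>i h. i < n \<Longrightarrow> h \<in> e ` carrier G \<Longrightarrow> P h \<Longrightarrow> P (e (s i) \<otimes> h)"
  have "P (e x)" if "x \<in> carrier G" for x
    using that
  proof (induction rule: word_induct)
    case one then show ?case using P hom_one[OF e_hom is_group is_group] by simp
  next
    case (mult i h) then show ?case using P by (simp add: e_mult)
  qed
  then show "P g" using g by blast
qed

lemma H_eq_GD: "e ` carrier G = GD"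
proof
  show "e ` carrier G \<subseteq> GD"
  proof
    fix g assume "g \<in> e ` carrier G"
    then show "g \<in> GD"
    proof (rule H_gen)
      show "\<one> \<in> GD" using GD_subgroup subgroup.one_closed by blast
      fix i h assume i: "i < n" and h: "h \<in> GD"
      obtain b where b: "b \<in> Pos" "e (s i) = rf b" using e_s_Pos[OF i] by metis
      then have "e (s i) \<in> GD" using conj_canonical[OF b(1)] GD_mult GD_inv GD_rf by metis
      then show "e (s i) \<otimes> h \<in> GD" using h GD_mult by blast
    qed
  qed
qed (rule GD_H)

lemma e_s_canonical:
  assumes "i < n"
  obtains h c where "h \<in> e ` carrier G" "c \<in> Del" "e (s i) = h \<otimes> rf c \<otimes> inv h" "tp c = i"
proof -
  obtain b where b: "b \<in> Pos" "e (s i) = rf b" "tp b = i" using e_s_Pos[OF assms] .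
  then obtain h c where h: "h \<in> GD" "c \<in> Del" "rf b = h \<otimes> rf c \<otimes> inv h" using conj_canonical[OF b(1)] by blast
  have "par i (rf c) = par i (rf b)" unfolding h(3) using h GD_closed Del_D by simp
  then have "tp c = i" using tp(2)[of b i] tp(2)[of c i] b h Pos_D Del_D by (simp split: if_splits)
  then show ?thesis using that h b H_eq_GD by simp
qed

text \<open>Deletion of all types but \<open>i\<close> sends words for \<open>e (s j)\<close> with
  \<open>j \<noteq> i\<close> to 1 and words for \<open>e (s i)\<close> to one involution
  \<open>t\<close>, so it sends every word over \<open>Del\<close> to 1 or \<open>t\<close>. A
  one-letter word of type \<open>i\<close> is unchanged and nontrivial, so its reflection is
  \<open>t\<close>.\<close>

lemma Del_type_unique:
  assumes c: "c \<in> Del" "c' \<in> Del" "tp c = tp c'"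
  shows "c = c'"
proof -
  define i where "i = tp c"
  let ?P = "\<lambda>b. tp b = i"
  have i: "i < n" using c tp Del_D by (auto simp: i_def)
  have fl: "filter ?P u \<in> lists Del" if "u \<in> lists Del" for u using that by auto
  obtain h c0 where h: "h \<in> e ` carrier G" "c0 \<in> Del" "e (s i) = h \<otimes> rf c0 \<otimes> inv h" "tp c0 = i"
    using e_s_canonical[OF i] .
  obtain wh where wh: "wh \<in> lists Del" "pr wh = h" using GD_word h(1) H_eq_GD by metis
  define t where "t = pr (filter ?P (wh @ [c0] @ rev wh))"
  have t_eq: "t = pr (filter ?P wh) \<otimes> rf c0 \<otimes> inv (pr (filter ?P wh))"
    unfolding t_def using h pr_conj(1)[OF fl[OF wh(1)] h(2)] by (simp add: rev_filter)
  have fc: "pr (filter ?P wh) \<in> carrier G" "rf c0 \<in> carrier G" using fl[OF wh(1)] h Del_D by auto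
  have tc: "t \<in> carrier G" "t \<otimes> t = \<one>"
    unfolding t_eq using fc h Del_D by (simp_all add: m_assoc)
  have key: "\<forall>ws\<in>lists Del. pr ws = g \<longrightarrow> pr (filter ?P ws) \<in> {\<one>, t}" if "g \<in> e ` carrier G" for g
    using that
  proof (rule H_gen)
    show "\<forall>ws\<in>lists Del. pr ws = \<one> \<longrightarrow> pr (filter ?P ws) \<in> {\<one>, t}"
      using filter_type[of _ "[]" i] by auto
  next
    fix j g assume j: "j < n" and g: "g \<in> e ` carrier G"
      and IH: "\<forall>ws\<in>lists Del. pr ws = g \<longrightarrow> pr (filter ?P ws) \<in> {\<one>, t}"
    show "\<forall>ws\<in>lists Del. pr ws = e (s j) \<otimes> g \<longrightarrow> pr (filter ?P ws) \<in> {\<one>, t}"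
    proof (intro ballI impI)
      fix ws assume ws: "ws \<in> lists Del" "pr ws = e (s j) \<otimes> g"
      obtain wg where wg: "wg \<in> lists Del" "pr wg = g" using GD_word g H_eq_GD by metis
      obtain wj where wj: "wj \<in> lists Del" "pr wj = e (s j)" "pr (filter ?P wj) \<in> {\<one>, t}"
      proof (cases "j = i")
        case True
        have l: "wh @ [c0] @ rev wh \<in> lists Del" using wh h by auto
        moreover have "pr (wh @ [c0] @ rev wh) = e (s j)"
          using True h wh pr_conj(1)[OF wh(1) h(2)] by simp
        ultimately show ?thesis using that t_def by blast
      next
        case False
        obtain h' c1 where h': "h' \<in> e ` carrier G" "c1 \<in> Del" "e (s j) = h' \<otimes> rf c1 \<otimes> inv h'" "tp c1 = j"
          using e_s_canonical[OF j] .
        obtain w' where w': "w' \<in> lists Del" "pr w' = h'" using GD_word h'(1) H_eq_GD by metis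
        have l: "w' @ [c1] @ rev w' \<in> lists Del" using w' h' by auto
        moreover have "pr (w' @ [c1] @ rev w') = e (s j)"
          using h' w' pr_conj(1)[OF w'(1) h'(2)] by simp
        moreover have "pr (filter ?P (w' @ [c1] @ rev w')) = \<one>"
          using False h' pr_conj(2)[OF fl[OF w'(1)] h'(2)] by (simp add: rev_filter)
        ultimately show ?thesis using that by blast
      qed
      have "pr ws = pr (wj @ wg)" using ws wj wg by (simp add: pr_append)
      then have "pr (filter ?P ws) = pr (filter ?P (wj @ wg))" using ws wj wg by (intro filter_type) auto
      also have "\<dots> = pr (filter ?P wj) \<otimes> pr (filter ?P wg)" using fl wj wg by (simp add: pr_append)
      also have "\<dots> \<in> {\<one>, t}" using wj(3) IH wg tc by auto
      finally show "pr (filter ?P ws) \<in> {\<one>, t}" .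
    qed
  qed
  have rt: "rf b = t" if b: "b \<in> Del" "tp b = i" for b
  proof -
    have "rf b \<in> {\<one>, t}" using key[of "rf b"] b Del_D[OF b(1)] by (auto dest!: bspec[of _ _ "[b]"])
    moreover have "rf b \<noteq> \<one>" using tp(2)[of b i] b Del_D(2)[OF b(1)] by auto
    ultimately show ?thesis by simp
  qed
  show ?thesis using rf_inj Del_D c rt[OF c(1)] rt[OF c(2)] by (simp add: i_def)
qed

definition y :: "nat \<Rightarrow> nat \<Rightarrow> real" where "y i = (THE c. c \<in> Del \<and> tp c = i)"

lemma y: assumes "i < n" shows "y i \<in> Del" "tp (y i) = i"
proof -
  have "\<exists>c. c \<in> Del \<and> tp c = i" using e_s_canonical[OF assms] by metis
  then have "\<exists>!c. c \<in> Del \<and> tp c = i" using Del_type_unique by blast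
  from theI'[OF this] show "y i \<in> Del" "tp (y i) = i" unfolding y_def by auto
qed

lemma y_tp: "c \<in> Del \<Longrightarrow> y (tp c) = c"
  using Del_type_unique y tp Del_D by metis

abbreviation yr :: "nat \<Rightarrow> 'a" where "yr i \<equiv> rf (y i)"

lemma yr [simp]: assumes "i < n"
  shows "yr i \<in> carrier G" "yr i \<in> e ` carrier G" "yr i \<otimes> yr i = \<one>" "inv (yr i) = yr i"
    "par k (yr i) = (if k = i then 1 else 0)"
  using y[OF assms] Del_D[OF y(1)[OF assms]] tp(2) by auto

lemma yr_conj:
  assumes "i < n" shows "\<exists>h\<in>e ` carrier G. e (s i) = h \<otimes> yr i \<otimes> inv h"
  using e_s_canonical[OF assms] y_tp by metis

lemma yr_conj_s:
  assumes i: "i < n" shows "\<exists>g\<in>carrier G. yr i = g \<otimes> s i \<otimes> inv g"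
proof -
  have "y i \<in> Phi" using Del_D y i by blast
  then obtain g j where g: "g \<in> carrier G" "j < n" "y i = gact g (al j)" by (rule PhiE)
  then have eq: "yr i = g \<otimes> s j \<otimes> inv g" by (simp add: rf_gact)
  have "par i (g \<otimes> s j \<otimes> inv g) = 1" unfolding eq[symmetric] using i by simp
  then have "i = j" using g by (simp add: par_s split: if_splits)
  then show ?thesis using eq g by blast
qed

section \<open>The image of \<open>e\<close> as an even Coxeter group\<close>

definition d' :: "nat \<Rightarrow> nat \<Rightarrow> nat" where "d' i j = ord (yr i \<otimes> yr j)"

definition m' :: "nat \<Rightarrow> nat \<Rightarrow> enat" where "m' i j = (if d' i j = 0 then \<infinity> else enat (d' i j))"

lemma d'_pow: "i < n \<Longrightarrow> j < n \<Longrightarrow> (yr i \<otimes> yr j) [^] (k::nat) = \<one> \<longleftrightarrow> d' i j dvd k"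
  unfolding d'_def by (intro pow_eq_id) simp

lemma d'_self: "i < n \<Longrightarrow> d' i i = 1"
  unfolding d'_def by simp

lemma d'_sym: assumes "i < n" "j < n" shows "d' i j = d' j i"
proof -
  have "yr j \<otimes> yr i = inv (yr i \<otimes> yr j)" using assms by (simp add: inv_mult_group)
  then have "(yr j \<otimes> yr i) [^] k = \<one> \<longleftrightarrow> (yr i \<otimes> yr j) [^] k = \<one>" for k :: nat
    using assms by (simp add: nat_pow_inv inv_eq_1_iff)
  then have "d' j i dvd k \<longleftrightarrow> d' i j dvd k" for k using d'_pow assms by blast
  then show ?thesis by (meson dvd_antisym dvd_refl)
qed

lemma d'_even: assumes "i < n" "j < n" "i \<noteq> j" shows "even (d' i j)"
proof -
  have "(yr i \<otimes> yr j) [^] d' i j = \<one>" using d'_pow assms by simp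
  then have "par i ((yr i \<otimes> yr j) [^] d' i j) = 0" by simp
  then show ?thesis using assms by (simp add: par_pow of_nat_bit_eq_0_iff)
qed

lemma m'_even: "even_coxeter_matrix n m'"
proof -
  have "m' i j \<ge> 2" if "i < n" "j < n" "i \<noteq> j" for i j
    using d'_even[OF that] by (auto simp: m'_def numeral_eq_enat)
  then show ?thesis
    unfolding even_coxeter_matrix_def coxeter_matrix_def
    using d'_self d'_sym d'_even by (auto simp: m'_def one_enat_def)
qed

lemma cox_equiv_cong:
  "cox_equiv n m' u v \<Longrightarrow> a \<in> lists {..<n} \<Longrightarrow> b \<in> lists {..<n} \<Longrightarrow> cox_equiv n m' (a @ u @ b) (a @ v @ b)"
  by (rule cox_equiv.ctxt) auto

lemma cox_equiv_sq: "i < n \<Longrightarrow> cox_equiv n m' [i, i] []"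
  using cox_equiv.rel[of i n i m' 1] d'_self by (simp add: m'_def)

text \<open>Parity forces \<open>q\<close> to be even. Equality of the two products then says that
  the rotation to the power \<open>q\<close> is trivial, so the label divides \<open>q\<close>, and
  the braid relation follows formally from this power and the squares.\<close>

lemma cox_equiv_braid:
  assumes ij: "i < n" "j < n" "i \<noteq> j" and eq: "pr (alt (y i) (y j) q) = pr (alt (y j) (y i) q)"
  shows "cox_equiv n m' (alt i j q) (alt j i q)"
proof -
  let ?a = "yr i" let ?b = "yr j"
  have yD: "y i \<in> Del" "y j \<in> Del" using ij y by auto
  have ev: "pr (alt (y i) (y j) (2 * k)) = (?a \<otimes> ?b) [^] k" "pr (alt (y j) (y i) (2 * k)) = (?b \<otimes> ?a) [^] k" for k
    using pr_alt_even yD by auto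
  have "even q"
  proof (rule ccontr)
    assume "odd q"
    then obtain k where k: "q = Suc (2 * k)" by (metis oddE Suc_eq_plus1)
    have "pr (alt (y i) (y j) q) = ?b \<otimes> (?a \<otimes> ?b) [^] k" "pr (alt (y j) (y i) q) = ?a \<otimes> (?b \<otimes> ?a) [^] k"
      using ev by (simp_all add: k)
    then have "par i (?b \<otimes> (?a \<otimes> ?b) [^] k) = par i (?a \<otimes> (?b \<otimes> ?a) [^] k)" using eq by simp
    then show False using ij by (simp add: par_pow)
  qed
  then obtain k where k: "q = 2 * k" by blast
  have "?b \<otimes> ?a = inv (?a \<otimes> ?b)" using ij by (simp add: inv_mult_group)
  then have "(?a \<otimes> ?b) [^] k = inv ((?a \<otimes> ?b) [^] k)" using eq ij unfolding k ev by (simp add: nat_pow_inv)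
  then have "(?a \<otimes> ?b) [^] k \<otimes> (?a \<otimes> ?b) [^] k = \<one>" using ij by (metis m_closed nat_pow_closed r_inv yr(1))
  then have dv: "d' i j dvd 2 * k" using d'_pow ij by (simp add: nat_pow_mult mult_2)
  let ?R = "concat (replicate k [i, j])" let ?R' = "concat (replicate k [j, i])"
  have al: "alt i j q = ?R" "alt j i q = ?R'" unfolding k by (induction k) auto
  have lR: "concat (replicate l [i, j]) \<in> lists {..<n}" "concat (replicate l [j, i]) \<in> lists {..<n}" for l
    using ij by (induction l) auto
  have 1: "cox_equiv n m' (?R @ ?R) []"
  proof (cases "d' i j = 0")
    case True
    then show ?thesis using dv by (auto intro: cox_equiv.refl)
  next
    case False
    then have r: "cox_equiv n m' (concat (replicate (d' i j) [i, j])) []"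
      using ij by (intro cox_equiv.rel) (auto simp: m'_def)
    obtain t where t: "2 * k = d' i j * t" using dv by blast
    have "cox_equiv n m' (concat (replicate (d' i j * t) [i, j])) []"
    proof (induction t)
      case (Suc t)
      have "concat (replicate (d' i j * Suc t) [i, j]) = concat (replicate (d' i j) [i, j]) @ concat (replicate (d' i j * t) [i, j])"
        by (simp add: replicate_add)
      moreover have "cox_equiv n m' \<dots> (concat (replicate (d' i j) [i, j]))"
        using cox_equiv_cong[OF Suc, of "concat (replicate (d' i j) [i, j])" "[]"] lR by simp
      ultimately show ?case using r cox_equiv.trans by metis
    qed (simp add: cox_equiv.refl)
    moreover have "?R @ ?R = concat (replicate (2 * k) [i, j])" by (simp add: mult_2 replicate_add)
    ultimately show ?thesis using t by simp
  qed
  have 2: "cox_equiv n m' (concat (replicate l [i, j]) @ concat (replicate l [j, i])) []" for l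
  proof (induction l)
    case (Suc l)
    let ?A = "concat (replicate l [i, j])" let ?A' = "concat (replicate l [j, i])"
    have snoc: "concat (replicate (Suc l) [i, j]) = ?A @ [i, j]"
      by (metis append_Nil2 concat.simps(1,2) concat_append replicate_Suc replicate_append_same)
    have a: "cox_equiv n m' (?A @ [i, j, j, i] @ ?A') (?A @ [i, i] @ ?A')"
      using cox_equiv_cong[OF cox_equiv_sq[OF ij(2)], of "?A @ [i]" "[i] @ ?A'"] lR ij by simp
    have b: "cox_equiv n m' (?A @ [i, i] @ ?A') (?A @ ?A')"
      using cox_equiv_cong[OF cox_equiv_sq[OF ij(1)], of ?A ?A'] lR by simp
    show ?case unfolding snoc using cox_equiv.trans[OF a cox_equiv.trans[OF b Suc]] by simp
  qed (simp add: cox_equiv.refl)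
  have a: "cox_equiv n m' (?R @ ?R @ ?R') ?R" using cox_equiv_cong[OF 2, of ?R "[]"] lR by simp
  have b: "cox_equiv n m' (?R @ ?R @ ?R') ?R'" using cox_equiv_cong[OF 1, of "[]" ?R'] lR by simp
  show ?thesis unfolding al by (rule cox_equiv.trans[OF cox_equiv.sym[OF a] b])
qed

abbreviation HH :: "('a, 'b) monoid_scheme" where "HH \<equiv> G\<lparr>carrier := e ` carrier G\<rparr>"

lemma HH_simps [simp]: "carrier HH = e ` carrier G" "monoid.mult HH = monoid.mult G" "one HH = one G"
  by auto

lemma HH_group: "group HH" using subgroup.subgroup_is_group[OF H is_group] by simp

lemma HH_pow [simp]: "g [^]\<^bsub>HH\<^esub> (k::nat) = g [^] k"
  by (simp add: nat_pow_def)

lemma HH_eval: "word_eval HH x w = word_eval G x w"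
  by (induction w) auto

lemma HH_inv: "h \<in> e ` carrier G \<Longrightarrow> inv\<^bsub>HH\<^esub> h = inv h"
  using m_inv_consistent[OF H] by simp

lemma pr_map_y: "w \<in> lists {..<n} \<Longrightarrow> pr (map y w) = word_eval G yr w"
  by (induction w) auto

text \<open>That no further relations hold is the word problem for the canonical generators,
  translated to types. Types name these generators faithfully because each type occurs exactly once.
  The theory of even systems thus becomes available inside the image.\<close>

lemma HH_system: "coxeter_system HH n yr m'"
  unfolding coxeter_system_def
proof (intro conjI allI impI)
  show "coxeter_matrix n m'" using m'_even by (simp add: even_coxeter_matrix_def)
  show "group HH" by (rule HH_group)
  show "yr i \<in> carrier HH" if "i < n" for i using that by simp
  have Deq: "rf ` Del = yr ` {..<n}"
    using y y_tp tp(1) Del_D(2) by (force simp: image_iff)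
  have sub: "yr ` {..<n} \<subseteq> e ` carrier G" by auto
  have "generate HH (yr ` {..<n}) = generate G (yr ` {..<n})"
    using generate_consistent[OF sub H] by simp
  also have "\<dots> = e ` carrier G" using H_eq_GD Deq by (simp add: GD_def)
  finally show "generate HH (yr ` {..<n}) = carrier HH" by simp
  fix u v assume uv: "set u \<subseteq> {..<n}" "set v \<subseteq> {..<n}"
  then have l: "u \<in> lists {..<n}" "v \<in> lists {..<n}" by auto
  have yl: "map y w \<in> lists Del" "map tp (map y w) = w" if "w \<in> lists {..<n}" for w
    using that y by (induction w) auto
  show "word_eval HH yr u = word_eval HH yr v \<longleftrightarrow> cox_equiv n m' u v"
  proof
    assume "word_eval HH yr u = word_eval HH yr v"
    then have eq: "pr (map y u) = pr (map y v)" using l by (simp add: pr_map_y HH_eval)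
    have tl: "map tp w \<in> lists {..<n}" if "w \<in> lists Del" for w using that tp Del_D by auto
    have "cox_equiv n m' (map tp (map y u)) (map tp (map y v))"
    proof (rule Tits_word_problem[where E = "\<lambda>u v. cox_equiv n m' (map tp u) (map tp v)"])
      fix a b q assume ab: "a \<in> Del" "b \<in> Del" "a \<noteq> b" "pr (alt a b q) = pr (alt b a q)"
      then have "tp a \<noteq> tp b" using Del_type_unique by blast
      then show "cox_equiv n m' (map tp (alt a b q)) (map tp (alt b a q))"
        unfolding map_alt using ab tp Del_D y_tp by (intro cox_equiv_braid) auto
    next
      fix b assume "b \<in> Del"
      then show "cox_equiv n m' (map tp [b, b]) (map tp [])" using cox_equiv_sq tp Del_D by simp
    next
      fix u v a b assume "cox_equiv n m' (map tp u) (map tp v)" "a \<in> lists Del" "b \<in> lists Del"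
      then show "cox_equiv n m' (map tp (a @ u @ b)) (map tp (a @ v @ b))"
        using cox_equiv_cong tl by simp
    qed (use eq yl l in \<open>auto intro: cox_equiv.intros\<close>)
    then show "cox_equiv n m' u v" using yl l by simp
  next
    assume ce: "cox_equiv n m' u v"
    have "(yr i \<otimes> yr j) [^] k = \<one>" if "i < n" "j < n" "m' i j = enat k" for i j k
      using that d'_pow[OF that(1,2), of k] by (auto simp: m'_def split: if_splits)
    then show "word_eval HH yr u = word_eval HH yr v"
      unfolding HH_eval using word_eval_cox_equiv[OF ce, of yr] by auto
  qed
qed

interpretation HH: even_coxeter HH n yr m'
  by (simp add: even_coxeter_def even_coxeter_axioms_def HH_group HH_system m'_even)

lemma HH_d: "i < n \<Longrightarrow> j < n \<Longrightarrow> HH.d i j = d' i j"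
  by (simp add: HH.d_def m'_def)

text \<open>If \<open>d i j\<close> is infinite, retracting to the pair turns
  \<open>yr i \<otimes> yr j\<close> into an odd power of a rotation of infinite order, which
  excludes a finite \<open>d' i j\<close>. If it is finite, \<open>e\<close> conjugates
  \<open>s i\<close> and \<open>s j\<close> simultaneously, so it suffices that the power
  \<open>d' i j\<close> of the image of the rotation is trivial. That power lies in a finite
  subgroup of the image, where retractions to pairs of the generators \<open>yr\<close> detect
  it.\<close>

lemma d_dvd_d': assumes ij: "i < n" "j < n" shows "d' i j \<noteq> 0 \<Longrightarrow> d i j dvd d' i j"
proof (cases "i = j")
  case False
  assume o0: "d' i j \<noteq> 0"
  have sub: "{i, j} \<subseteq> {..<n}" using ij by simp
  show "d i j dvd d' i j"
  proof (cases "d i j = 0")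
    case True
    obtain gi where gi: "gi \<in> carrier G" "yr i = gi \<otimes> s i \<otimes> inv gi"
      using yr_conj_s[OF ij(1)] by blast
    obtain gj where gj: "gj \<in> carrier G" "yr j = gj \<otimes> s j \<otimes> inv gj"
      using yr_conj_s[OF ij(2)] by blast
    let ?r = "ret {i, j}"
    have W: "?r gi \<in> W {i, j}" "?r gj \<in> W {i, j}"
      using ret_in_W[OF gi(1), of "{i, j}"] ret_in_W[OF gj(1), of "{i, j}"] sub by (simp_all add: Int_absorb2)
    obtain z :: int where z: "odd z" "?r (yr i) \<otimes> ?r (yr j) = rot i j [^] z"
      using conj_pair[OF ij False W] gi gj ij by (metis (no_types, lifting) ret_conj ret_s insertI1 insertI2 s_closed)
    have "(yr i \<otimes> yr j) [^] d' i j = \<one>" using d'_pow[OF ij] by simp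
    then have "?r ((yr i \<otimes> yr j) [^] d' i j) = \<one>" by (simp only: ret_one)
    moreover have "?r (g [^] (k::nat)) = ?r g [^] k" if "g \<in> carrier G" for g k
      by (induction k) (use that in auto)
    ultimately have "(rot i j [^] z) [^] d' i j = \<one>" using z ij by simp
    then have "rot i j [^] (z * int (d' i j)) = \<one>" using ij by (simp add: int_pow_pow int_pow_int[symmetric])
    then have "z * int (d' i j) = 0" using rot_order_int[OF ij] True by simp
    then show ?thesis using z o0 by auto
  next
    case dn: False
    let ?o = "d' i j" let ?xi = "e (s i)" let ?xj = "e (s j)" let ?F = "e ` W {i, j}"
    obtain w where w: "w \<in> carrier G" "?xi = w \<otimes> s i \<otimes> inv w" "?xj = w \<otimes> s j \<otimes> inv w"
      using e_pair[OF ij dn] by blast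
    have FG: "subgroup ?F G" using group_hom.subgroup_img_is_subgroup[OF e_group_hom W_subgroup[OF sub]] .
    have "?F \<subseteq> e ` carrier G" using W_subset[OF sub] by blast
    then have F: "subgroup ?F HH" using subgroup_incl[OF FG H] by simp
    have finF: "finite ?F" using finite_W_pair[OF ij dn] by simp
    obtain u J where u: "u \<in> carrier HH" "J \<subseteq> {..<n}" "finite (HH.W J)"
      "\<And>g. g \<in> ?F \<Longrightarrow> inv\<^bsub>HH\<^esub> u \<otimes>\<^bsub>HH\<^esub> g \<otimes>\<^bsub>HH\<^esub> u \<in> HH.W J"
      using HH.finite_subgroup_parabolic[OF F finF] by blast
    define g where "g = (?xi \<otimes> ?xj) [^] ?o"
    have xF: "?xi \<in> ?F" "?xj \<in> ?F" using W_s[OF _ sub] by auto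
    then have xc: "?xi \<in> carrier HH" "?xj \<in> carrier HH" using ij by auto
    have "(?xi \<otimes> ?xj) [^] (k::nat) \<in> ?F" for k
      by (induction k) (use xF FG in \<open>auto intro!: subgroup.m_closed[OF FG] subgroup.one_closed[OF FG]\<close>)
    then have gF: "g \<in> ?F" "g \<in> carrier HH" using F subgroup.mem_carrier unfolding g_def by metis+
    \<comment> \<open>On the pair \<open>i\<close>, \<open>j\<close> the retraction of the product
      is a power of \<open>yr i \<otimes> yr j\<close>, killed by the exponent. On any other pair at
      most one factor survives, and it squares to 1, so the even exponent kills it.\<close>
    have retg: "HH.ret {k, l} g = \<one>" for k l
    proof -
      let ?r = "HH.ret {k, l}"
      have rc: "?r x \<in> carrier HH" if "x \<in> carrier HH" for x using HH.ret_closed that by blast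
      have rG: "?r x \<in> carrier G" if "x \<in> carrier HH" for x using rc[OF that] by auto
      have rmult: "?r (x \<otimes> z) = ?r x \<otimes> ?r z" if "x \<in> carrier HH" "z \<in> carrier HH" for x z
        using HH.ret_mult[OF that, of "{k, l}"] by simp
      have rpow: "?r (x [^] (q::nat)) = ?r x [^] q \<and> x [^] q \<in> carrier HH" if x: "x \<in> carrier HH" for x q
      proof (induction q)
        case 0 then show ?case using HH.ret_one[of "{k, l}"] HH.one_closed by simp
      next
        case (Suc q) then show ?case using rmult[of "x [^] q" x] x HH.m_closed[of "x [^] q" x] by simp
      qed
      have rsq: "?r x \<otimes> ?r x = \<one>" if "x \<in> carrier HH" "x \<otimes> x = \<one>" for x
        using rmult[OF that(1,1)] that(2) HH.ret_one[of "{k, l}"] by simp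
      have xsq: "?xi \<otimes> ?xi = \<one>" "?xj \<otimes> ?xj = \<one>" using e_s_sq ij by auto
      have rg: "?r g = (?r ?xi \<otimes> ?r ?xj) [^] ?o"
        unfolding g_def using rpow[of "?xi \<otimes> ?xj" ?o] rmult[OF xc] HH.m_closed[OF xc] by simp
      have evo: "x [^] ?o = \<one>" if x: "x \<in> carrier G" "x \<otimes> x = \<one>" for x
      proof -
        obtain q where q: "?o = 2 * q" using d'_even[OF ij False] by blast
        have "x [^] (2 * q) = (x [^] (2::nat)) [^] q" using x by (simp add: nat_pow_pow)
        then show ?thesis using x q by (simp add: numeral_2_eq_2)
      qed
      obtain hi where hi: "hi \<in> carrier HH" "?xi = hi \<otimes> yr i \<otimes> inv hi" using yr_conj[OF ij(1)] by auto
      obtain hj where hj: "hj \<in> carrier HH" "?xj = hj \<otimes> yr j \<otimes> inv hj" using yr_conj[OF ij(2)] by auto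
      have rconj: "?r (h \<otimes> yr a \<otimes> inv h) = ?r h \<otimes> (if a \<in> {k, l} then yr a else \<one>) \<otimes> inv (?r h)"
        if h: "h \<in> carrier HH" and a: "a < n" for h a
        using HH.ret_conj[OF h, of "yr a" "{k, l}"] HH.ret_s[OF a, of "{k, l}"] HH_inv h rc[OF h] a
        by (simp split: if_splits)
      show ?thesis
      proof (cases "i \<in> {k, l} \<and> j \<in> {k, l}")
        case True
        then have kl: "{k, l} = {i, j}" using False by auto
        have "{i, j} \<inter> {..<n} = {i, j}" using sub by blast
        then have W: "?r hi \<in> HH.W {i, j}" "?r hj \<in> HH.W {i, j}"
          using HH.ret_in_W[OF hi(1), of "{i, j}"] HH.ret_in_W[OF hj(1), of "{i, j}"] unfolding kl by simp_all
        obtain z0 :: int where z0: "(?r hi \<otimes>\<^bsub>HH\<^esub> yr i \<otimes>\<^bsub>HH\<^esub> inv\<^bsub>HH\<^esub> (?r hi)) \<otimes>\<^bsub>HH\<^esub>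
            (?r hj \<otimes>\<^bsub>HH\<^esub> yr j \<otimes>\<^bsub>HH\<^esub> inv\<^bsub>HH\<^esub> (?r hj)) = (yr i \<otimes>\<^bsub>HH\<^esub> yr j) [^]\<^bsub>HH\<^esub> z0"
          by (rule HH.conj_pair[OF ij False W])
        have "?r ?xi = ?r hi \<otimes> yr i \<otimes> inv (?r hi)" "?r ?xj = ?r hj \<otimes> yr j \<otimes> inv (?r hj)"
          using rconj[OF hi(1) ij(1)] rconj[OF hj(1) ij(2)] True hi(2) hj(2) by simp_all
        then obtain z :: int where z: "?r ?xi \<otimes> ?r ?xj = (yr i \<otimes> yr j) [^]\<^bsub>HH\<^esub> z"
          using z0 HH_inv rc[OF hi(1)] rc[OF hj(1)] by auto
        have yc: "yr i \<otimes> yr j \<in> carrier HH" using HH.m_closed[of "yr i" "yr j"] ij by simp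
        have "((yr i \<otimes> yr j) [^]\<^bsub>HH\<^esub> z) [^]\<^bsub>HH\<^esub> (int ?o) = (yr i \<otimes> yr j) [^]\<^bsub>HH\<^esub> (z * int ?o)"
          using HH.int_pow_pow[OF yc] .
        also have "\<dots> = \<one>" using HH.rot_order_int[OF ij, of "z * int ?o"] HH_d[OF ij] by simp
        finally show ?thesis unfolding rg z by (simp add: int_pow_int)
      next
        case F: False
        show ?thesis
        proof (cases "i \<in> {k, l}")
          case True
          then have "?r ?xj = \<one>" using F hj rconj[OF hj(1) ij(2)] rG[OF hj(1)] by simp
          then show ?thesis unfolding rg using evo[OF rG[OF xc(1)] rsq[OF xc(1) xsq(1)]] rG[OF xc(1)] by simp
        next
          case False
          then have "?r ?xi = \<one>" using F hi rconj[OF hi(1) ij(1)] rG[OF hi(1)] by simp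
          then show ?thesis unfolding rg using evo[OF rG[OF xc(2)] rsq[OF xc(2) xsq(2)]] rG[OF xc(2)] by simp
        qed
      qed
    qed
    define g0 where "g0 = inv u \<otimes> g \<otimes> u"
    have uc: "u \<in> carrier G" "g \<in> carrier G" using u(1) gF by auto
    have g0W: "g0 \<in> HH.W J" using u(4)[OF gF(1)] u(1) HH_inv unfolding g0_def by simp
    have "HH.ret {k, l} g0 = \<one>" for k l
    proof -
      have ui: "inv u \<in> carrier HH" using HH.inv_closed[OF u(1)] HH_inv u(1) by simp
      have "HH.ret {k, l} g0 = HH.ret {k, l} (inv u) \<otimes> HH.ret {k, l} u"
        unfolding g0_def using HH.ret_mult[of "inv u \<otimes> g" u "{k, l}"] HH.ret_mult[OF ui gF(2), of "{k, l}"]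
          HH.m_closed[OF ui gF(2)] u(1) retg HH.ret_closed[OF ui, of "{k, l}"] by auto
      also have "\<dots> = HH.ret {k, l} (inv u \<otimes> u)" using HH.ret_mult[OF ui u(1), of "{k, l}"] by simp
      finally show ?thesis using uc HH.ret_one[of "{k, l}"] by simp
    qed
    then have "g0 = \<one>" using HH.finite_W_detect[OF u(3,2) g0W] by simp
    moreover have "u \<otimes> g0 \<otimes> inv u = g" unfolding g0_def using uc by (simp add: m_assoc)
    ultimately have "g = \<one>" using uc by simp
    moreover have "(?xi \<otimes> ?xj) [^] (k::nat) = w \<otimes> (s i \<otimes> s j) [^] k \<otimes> inv w" for k
      by (induction k) (use w ij in \<open>simp_all add: m_assoc\<close>)
    ultimately have "w \<otimes> (s i \<otimes> s j) [^] ?o \<otimes> inv w = \<one>" by (simp add: g_def)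
    then have "inv w \<otimes> (w \<otimes> (s i \<otimes> s j) [^] ?o \<otimes> inv w) \<otimes> w = inv w \<otimes> \<one> \<otimes> w" by simp
    then have "(s i \<otimes> s j) [^] ?o = \<one>" using w ij by (simp add: m_assoc)
    then show ?thesis using s_order[OF ij] by simp
  qed
qed (use ij d'_self in simp)

theorem locally_inner_injective: "inj_on e (carrier G)"
proof -
  define h where "h = HH.lift G s"
  have rels: "(s i \<otimes> s j) [^] HH.d i j = \<one>" if "i < n" "j < n" for i j
    using d_dvd_d'[OF that] that s_order[OF that] by (cases "d' i j = 0") (simp_all add: HH_d)
  have h: "h \<in> hom HH G" "\<And>i. i < n \<Longrightarrow> h (yr i) = s i"
    unfolding h_def using HH.lift_hom[OF monoid_axioms, of s] HH.lift_s[OF monoid_axioms, of s] rels by auto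
  have he: "h \<circ> e \<in> hom G G"
    using h(1) e_hom by (auto simp: hom_def Pi_def)
  have "(h \<circ> e) ` carrier G = carrier G"
  proof
    show "(h \<circ> e) ` carrier G \<subseteq> carrier G" using he by (auto simp: hom_def)
    show "carrier G \<subseteq> (h \<circ> e) ` carrier G"
    proof
      fix g assume "g \<in> carrier G"
      then show "g \<in> (h \<circ> e) ` carrier G"
      proof (induction rule: word_induct)
        case one
        then show ?case using hom_one[OF he is_group is_group] by (metis image_eqI one_closed)
      next
        case (mult i g)
        obtain a where a: "a \<in> carrier G" "yr i = e a" using yr(2)[OF mult(1)] by blast
        obtain b where b: "b \<in> carrier G" "g = (h \<circ> e) b" using mult by blast
        have "(h \<circ> e) (a \<otimes> b) = s i \<otimes> g" using hom_mult[OF he a(1) b(1)] a b h(2)[OF mult(1)] by simp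
        then show ?case using a b by (metis image_eqI m_closed)
      qed
    qed
  qed
  then have "inj_on (h \<circ> e) (carrier G)" using hopfian he by blast
  then show ?thesis by (rule inj_on_imageI2)
qed

end

section \<open>Conjugacy classes of tuples generating finite subgroups\<close>

definition fin_tuples :: "('a, 'b) monoid_scheme \<Rightarrow> nat \<Rightarrow> (nat \<Rightarrow> 'a) set" where
  "fin_tuples G N = {t. t \<in> {..<N} \<rightarrow> carrier G \<and> finite (generate G (t ` {..<N}))}"

definition tconj :: "('a, 'b) monoid_scheme \<Rightarrow> nat \<Rightarrow> (nat \<Rightarrow> 'a) \<Rightarrow> (nat \<Rightarrow> 'a) \<Rightarrow> bool" where
  "tconj G N t t' \<longleftrightarrow> (\<exists>g\<in>carrier G. \<forall>k<N. t' k = g \<otimes>\<^bsub>G\<^esub> t k \<otimes>\<^bsub>G\<^esub> inv\<^bsub>G\<^esub> g)"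

definition class_inj :: "nat \<Rightarrow> ('a, 'b) monoid_scheme \<Rightarrow> ('c, 'd) monoid_scheme \<Rightarrow> ('a \<Rightarrow> 'c) \<Rightarrow> bool" where
  "class_inj N G G' f \<longleftrightarrow>
     (\<forall>t\<in>fin_tuples G N. \<forall>t'\<in>fin_tuples G N. tconj G' N (f \<circ> t) (f \<circ> t') \<longrightarrow> tconj G N t t')"

lemma fin_tuples_closed: "t \<in> fin_tuples G N \<Longrightarrow> k < N \<Longrightarrow> t k \<in> carrier G"
  by (auto simp: fin_tuples_def)

lemma (in group) fin_tuplesI:
  assumes "subgroup F G" "finite F" "\<And>k. k < N \<Longrightarrow> t k \<in> F"
  shows "t \<in> fin_tuples G N"
proof -
  have "generate G (t ` {..<N}) \<subseteq> F" using assms by (intro generate_subgroup_incl) auto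
  then show ?thesis using assms subgroup.mem_carrier[OF assms(1)] finite_subset unfolding fin_tuples_def by blast
qed

context group begin

lemma tconj_refl: "t \<in> fin_tuples G N \<Longrightarrow> tconj G N t t"
  unfolding tconj_def by (intro bexI[of _ \<one>]) (auto simp: fin_tuples_closed)

lemma tconj_sym: assumes "t \<in> fin_tuples G N" "tconj G N t t'" shows "tconj G N t' t"
proof -
  obtain g where g: "g \<in> carrier G" "\<And>k. k < N \<Longrightarrow> t' k = g \<otimes> t k \<otimes> inv g" using assms by (auto simp: tconj_def)
  have "t k = inv g \<otimes> t' k \<otimes> inv (inv g)" if "k < N" for k
    using g fin_tuples_closed[OF assms(1) that] by (simp add: m_assoc that)
  then show ?thesis unfolding tconj_def using g by blast
qed

lemma tconj_trans: assumes "t \<in> fin_tuples G N" "tconj G N t t'" "tconj G N t' t''" shows "tconj G N t t''"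
proof -
  obtain g where g: "g \<in> carrier G" "\<And>k. k < N \<Longrightarrow> t' k = g \<otimes> t k \<otimes> inv g" using assms by (auto simp: tconj_def)
  obtain h where h: "h \<in> carrier G" "\<And>k. k < N \<Longrightarrow> t'' k = h \<otimes> t' k \<otimes> inv h" using assms by (auto simp: tconj_def)
  have "t'' k = (h \<otimes> g) \<otimes> t k \<otimes> inv (h \<otimes> g)" if "k < N" for k
    using g h fin_tuples_closed[OF assms(1) that] by (simp add: m_assoc that inv_mult_group)
  then show ?thesis unfolding tconj_def using g h by blast
qed

end

lemma hom_fin_tuples:
  assumes "group G" "group G'" "f \<in> hom G G'" "t \<in> fin_tuples G N"
  shows "f \<circ> t \<in> fin_tuples G' N"
proof -
  interpret group_hom G G' f using assms by (simp add: group_hom_def group_hom_axioms_def)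
  have t: "t ` {..<N} \<subseteq> carrier G" using assms(4) by (auto simp: fin_tuples_def)
  then have "f ` generate G (t ` {..<N}) = generate G' (f ` t ` {..<N})" by (rule generate_img[symmetric])
  moreover have "finite (f ` generate G (t ` {..<N}))" using assms(4) by (simp add: fin_tuples_def)
  moreover have "(f \<circ> t) ` {..<N} = f ` t ` {..<N}" by (simp only: image_comp)
  ultimately show ?thesis using t unfolding fin_tuples_def by auto
qed

lemma hom_tconj:
  assumes "group G" "group G'" "f \<in> hom G G'" "t \<in> fin_tuples G N" "tconj G N t t'"
  shows "tconj G' N (f \<circ> t) (f \<circ> t')"
proof -
  interpret group_hom G G' f using assms by (simp add: group_hom_def group_hom_axioms_def)
  obtain g where g: "g \<in> carrier G" "\<And>k. k < N \<Longrightarrow> t' k = g \<otimes>\<^bsub>G\<^esub> t k \<otimes>\<^bsub>G\<^esub> inv\<^bsub>G\<^esub> g"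
    using assms by (auto simp: tconj_def)
  then show ?thesis using assms(4) unfolding tconj_def
    by (intro bexI[of _ "f g"]) (auto simp: fin_tuples_closed)
qed

lemma class_inj_comp:
  assumes "group G" "group G'" "f \<in> hom G G'" "class_inj N G G' f" "class_inj N G' G'' g"
  shows "class_inj N G G'' (g \<circ> f)"
  unfolding class_inj_def
proof (intro ballI impI)
  fix t t' assume t: "t \<in> fin_tuples G N" "t' \<in> fin_tuples G N" "tconj G'' N (g \<circ> f \<circ> t) (g \<circ> f \<circ> t')"
  then have "tconj G' N (f \<circ> t) (f \<circ> t')"
    using assms(5) hom_fin_tuples[OF assms(1-3)] unfolding class_inj_def by (simp add: comp_assoc)
  then show "tconj G N t t'" using assms(4) t unfolding class_inj_def by blast
qed

lemma hom_comp: "f \<in> hom G G' \<Longrightarrow> g \<in> hom G' G'' \<Longrightarrow> g \<circ> f \<in> hom G G''"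
  by (auto simp: hom_def Pi_def)

lemma hom_id: "id \<in> hom G G" by (auto simp: hom_def)

lemma hom_funpow: "f \<in> hom G G \<Longrightarrow> f ^^ k \<in> hom G G"
  by (induction k) (auto intro: hom_comp hom_id simp: id_def[symmetric])

lemma class_inj_funpow:
  assumes "group G" "e \<in> hom G G" "class_inj N G G e" shows "class_inj N G G (e ^^ i)"
proof (induction i)
  case 0 then show ?case by (simp add: class_inj_def comp_def)
next
  case (Suc i)
  show ?case unfolding funpow.simps
    by (rule class_inj_comp[OF assms(1,1) hom_funpow[OF assms(2)] Suc assms(3)])
qed

text \<open>An endomorphism that is injective on a finite set of classes permutes it, so a power of it
  acts trivially.\<close>

lemma class_inj_power_trivial:
  assumes G: "group G" and e: "e \<in> hom G G" "class_inj N G G e"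
    and R: "finite R" "R \<subseteq> fin_tuples G N" "\<And>t. t \<in> fin_tuples G N \<Longrightarrow> \<exists>r\<in>R. tconj G N r t"
  obtains k where "k > 0" "\<And>t. t \<in> fin_tuples G N \<Longrightarrow> tconj G N ((e ^^ k) \<circ> t) t"
proof -
  interpret group G by (rule G)
  have ft: "(e ^^ i) \<circ> t \<in> fin_tuples G N" if "t \<in> fin_tuples G N" for i t
    by (rule hom_fin_tuples[OF G G hom_funpow[OF e(1)] that])
  note ci = class_inj_funpow[OF G e]
  have period: "\<exists>p. 0 < p \<and> p \<le> card R \<and> tconj G N ((e ^^ p) \<circ> t) t" if t: "t \<in> fin_tuples G N" for t
  proof -
    define c where "c i = (SOME r. r \<in> R \<and> tconj G N r ((e ^^ i) \<circ> t))" for i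
    have c: "c i \<in> R \<and> tconj G N (c i) ((e ^^ i) \<circ> t)" for i
    proof -
      have "\<exists>r. r \<in> R \<and> tconj G N r ((e ^^ i) \<circ> t)" using R(3)[OF ft[OF t]] by blast
      from someI_ex[OF this] show ?thesis unfolding c_def .
    qed
    have "\<not> inj_on c {..card R}"
    proof
      assume "inj_on c {..card R}"
      then have "card (c ` {..card R}) = Suc (card R)" by (simp add: card_image)
      moreover have "card (c ` {..card R}) \<le> card R" using c R(1) by (intro card_mono) auto
      ultimately show False by simp
    qed
    then obtain i j where ij: "i < j" "j \<le> card R" "c i = c j"
      unfolding inj_on_def by (metis atMost_iff linorder_neqE_nat)
    have "tconj G N ((e ^^ i) \<circ> t) (c i)" using tconj_sym c R(2) by blast
    then have "tconj G N ((e ^^ i) \<circ> t) ((e ^^ j) \<circ> t)"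
      using tconj_trans[OF ft[OF t]] c[of j] ij(3) by metis
    moreover have "e ^^ j = e ^^ (i + (j - i))" using ij by simp
    then have "e ^^ j = (e ^^ i) \<circ> (e ^^ (j - i))" by (simp only: funpow_add)
    ultimately have "tconj G N ((e ^^ i) \<circ> t) ((e ^^ i) \<circ> ((e ^^ (j - i)) \<circ> t))" by (simp add: comp_assoc)
    then have "tconj G N t ((e ^^ (j - i)) \<circ> t)" using ci[of i] t ft[OF t] unfolding class_inj_def by blast
    then have "tconj G N ((e ^^ (j - i)) \<circ> t) t" using tconj_sym t by blast
    then show ?thesis using ij by (intro exI[of _ "j - i"]) auto
  qed
  have mult: "tconj G N ((e ^^ (p * l)) \<circ> t) t" if t: "t \<in> fin_tuples G N" and p: "tconj G N ((e ^^ p) \<circ> t) t" for t p l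
  proof (induction l)
    case 0 then show ?case using tconj_refl t by simp
  next
    case (Suc l)
    have "tconj G N ((e ^^ (p * l)) \<circ> ((e ^^ p) \<circ> t)) ((e ^^ (p * l)) \<circ> t)"
      by (rule hom_tconj[OF G G hom_funpow[OF e(1)] ft[OF t] p])
    moreover have "(e ^^ (p * Suc l)) \<circ> t = (e ^^ (p * l)) \<circ> ((e ^^ p) \<circ> t)"
      using funpow_add[of "p * l" p e] by (simp add: comp_assoc add.commute)
    ultimately show ?case using tconj_trans[OF _ _ Suc] ft[OF t] by metis
  qed
  have "tconj G N ((e ^^ fact (card R)) \<circ> t) t" if t: "t \<in> fin_tuples G N" for t
  proof -
    obtain p where p: "0 < p" "p \<le> card R" "tconj G N ((e ^^ p) \<circ> t) t" using period[OF t] by blast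
    then have "p dvd fact (card R)" by (intro dvd_fact) auto
    then obtain l where "fact (card R) = p * l" by (metis dvdE)
    then show ?thesis using mult[OF t p(3), of l] by simp
  qed
  then show ?thesis using that[of "fact (card R)"] by simp
qed

text \<open>A power e^k of \<open>g \<circ> f\<close> acts trivially on classes, and
  \<open>h\<close> is e^(k-1) followed after \<open>g\<close>. This makes \<open>h\<close> an
  inverse on one side. The other side follows by cancelling \<open>h\<close>: it maps
  \<open>f \<circ> h \<circ> t\<close> to a conjugate of \<open>h \<circ> t\<close>, and it merges
  no classes.\<close>

lemma class_inj_mutual:
  assumes G: "group G" "group G'" and f: "f \<in> hom G G'" "class_inj N G G' f"
    and g: "g \<in> hom G' G" "class_inj N G' G g"
    and R: "finite R" "R \<subseteq> fin_tuples G N" "\<And>t. t \<in> fin_tuples G N \<Longrightarrow> \<exists>r\<in>R. tconj G N r t"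
  obtains h where "h \<in> hom G' G" "\<And>t. t \<in> fin_tuples G N \<Longrightarrow> tconj G N (h \<circ> f \<circ> t) t"
    "\<And>t. t \<in> fin_tuples G' N \<Longrightarrow> tconj G' N (f \<circ> h \<circ> t) t"
proof -
  let ?e = "g \<circ> f"
  have e: "?e \<in> hom G G" "class_inj N G G ?e"
    using hom_comp[OF f(1) g(1)] class_inj_comp[OF G f g(2)] by auto
  obtain k where k: "k > 0" "\<And>t. t \<in> fin_tuples G N \<Longrightarrow> tconj G N ((?e ^^ k) \<circ> t) t"
    using class_inj_power_trivial[OF G(1) e R] by blast
  obtain l where l: "k = Suc l" using k(1) by (cases k) auto
  define h where "h = (?e ^^ l) \<circ> g"
  note ci = class_inj_funpow[OF G(1) e]
  have h: "h \<in> hom G' G" "class_inj N G' G h"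
    unfolding h_def using hom_comp[OF g(1) hom_funpow[OF e(1)]] class_inj_comp[OF G(2,1) g ci] by auto
  have hf: "h \<circ> f = ?e ^^ k" unfolding h_def l funpow_Suc_right by (simp add: comp_assoc)
  have 1: "tconj G N (h \<circ> f \<circ> t) t" if "t \<in> fin_tuples G N" for t using k(2)[OF that] hf by simp
  have 2: "tconj G' N (f \<circ> h \<circ> t) t" if t: "t \<in> fin_tuples G' N" for t
  proof -
    have ht: "h \<circ> t \<in> fin_tuples G N" by (rule hom_fin_tuples[OF G(2,1) h(1) t])
    then have "f \<circ> h \<circ> t \<in> fin_tuples G' N" using hom_fin_tuples[OF G f(1) ht] by (simp add: comp_assoc)
    moreover have "tconj G N (h \<circ> (f \<circ> h \<circ> t)) (h \<circ> t)" using 1[OF ht] by (simp add: comp_assoc)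
    ultimately show ?thesis using h(2) t unfolding class_inj_def by blast
  qed
  show ?thesis using that h(1) 1 2 by blast
qed

context even_coxeter begin

text \<open>Every finite subgroup is conjugate into one of the finitely many finite standard
  parabolic subgroups, and each of these has finitely many \<open>N\<close>-tuples.\<close>

lemma finite_tuple_classes:
  obtains R where "finite R" "R \<subseteq> fin_tuples G N" "\<And>t. t \<in> fin_tuples G N \<Longrightarrow> \<exists>r\<in>R. tconj G N r t"
proof -
  define R where "R = (\<Union>J\<in>{J. J \<subseteq> {..<n} \<and> finite (W J)}. {..<N} \<rightarrow>\<^sub>E W J)"
  have "finite {J. J \<subseteq> {..<n} \<and> finite (W J)}" by (rule finite_subset[of _ "Pow {..<n}"]) auto
  then have "finite R" unfolding R_def by (auto intro!: finite_PiE)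
  moreover have "R \<subseteq> fin_tuples G N"
  proof
    fix t assume "t \<in> R"
    then obtain J where "J \<subseteq> {..<n}" "finite (W J)" "t \<in> {..<N} \<rightarrow>\<^sub>E W J" by (auto simp: R_def)
    then show "t \<in> fin_tuples G N" by (intro fin_tuplesI[OF W_subgroup[of J]]) auto
  qed
  moreover have "\<exists>r\<in>R. tconj G N r t" if t: "t \<in> fin_tuples G N" for t
  proof -
    let ?F = "generate G (t ` {..<N})"
    have tc: "t ` {..<N} \<subseteq> carrier G" "finite ?F" using t by (auto simp: fin_tuples_def)
    obtain w J where w: "w \<in> carrier G" "J \<subseteq> {..<n}" "finite (W J)" "\<And>g. g \<in> ?F \<Longrightarrow> inv w \<otimes> g \<otimes> w \<in> W J"
      using finite_subgroup_parabolic[OF generate_is_subgroup[OF tc(1)] tc(2)] by blast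
    define r where "r = restrict (\<lambda>k. inv w \<otimes> t k \<otimes> w) {..<N}"
    have tF: "t k \<in> ?F" "t k \<in> carrier G" if "k < N" for k using that tc(1) by (auto intro: generate.incl)
    have "r \<in> {..<N} \<rightarrow>\<^sub>E W J" unfolding r_def using w(4) tF by auto
    then have "r \<in> R" using w by (auto simp: R_def)
    moreover have "tconj G N r t" unfolding tconj_def
      using w(1) tF by (intro bexI[of _ w]) (auto simp: r_def m_assoc)
    ultimately show ?thesis by blast
  qed
  ultimately show ?thesis using that by blast
qed

lemma W_tuple: "finite (W J) \<Longrightarrow> J \<subseteq> {..<n} \<Longrightarrow> (\<lambda>k. if k \<in> J then s k else \<one>) \<in> fin_tuples G N"
  by (intro fin_tuplesI[OF W_subgroup[of J]]) (auto intro: W_s)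

text \<open>The mutual-inverse construction is applied with the identity as second homomorphism. As
  \<open>n \<le> N\<close>, a tuple can list two generators at their own positions, so
  \<open>h \<circ> f\<close> conjugates every pair with finite label simultaneously and is locally
  inner.\<close>

theorem class_inj_injective:
  assumes f: "f \<in> hom G G" "class_inj N G G f" and N: "n \<le> N"
  shows "inj_on f (carrier G)"
proof -
  obtain R where R: "finite R" "R \<subseteq> fin_tuples G N" "\<And>t. t \<in> fin_tuples G N \<Longrightarrow> \<exists>r\<in>R. tconj G N r t"
    using finite_tuple_classes by blast
  have "class_inj N G G id" by (simp add: class_inj_def)
  from class_inj_mutual[OF is_group is_group f hom_id this R] obtain h where
    h: "h \<in> hom G G" "\<And>t. t \<in> fin_tuples G N \<Longrightarrow> tconj G N (h \<circ> f \<circ> t) t" by blast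
  let ?e = "h \<circ> f"
  have e: "?e \<in> hom G G" by (rule hom_comp[OF f(1) h(1)])
  have pair: "\<exists>w\<in>carrier G. ?e (s i) = w \<otimes> s i \<otimes> inv w \<and> ?e (s j) = w \<otimes> s j \<otimes> inv w"
    if ij: "i < n" "j < n" "d i j \<noteq> 0" for i j
  proof -
    let ?t = "\<lambda>k. if k \<in> {i, j} then s k else \<one>"
    have t: "?t \<in> fin_tuples G N" using W_tuple[OF finite_W_pair[OF ij]] ij by simp
    have "tconj G N ?t (?e \<circ> ?t)" using tconj_sym[OF hom_fin_tuples[OF is_group is_group e t]] h(2)[OF t] by simp
    then obtain w where "w \<in> carrier G" "\<And>k. k < N \<Longrightarrow> (?e \<circ> ?t) k = w \<otimes> ?t k \<otimes> inv w" unfolding tconj_def by blast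
    from this(1) this(2)[of i] this(2)[of j] show ?thesis using ij N by (intro bexI[of _ w]) auto
  qed
  interpret locally_inner G n s m ?e
  proof (intro locally_inner.intro even_coxeter_axioms locally_inner_axioms.intro e)
    show "\<exists>w\<in>carrier G. ?e (s i) = w \<otimes> s i \<otimes> inv w" if "i < n" for i
      using pair[of i i] that by auto
  qed (rule pair)
  show ?thesis using locally_inner_injective by (rule inj_on_imageI2)
qed

end

section \<open>First-order sentences\<close>

primrec exs :: "nat \<Rightarrow> gform \<Rightarrow> gform" where
  "exs 0 \<phi> = \<phi>"
| "exs (Suc k) \<phi> = exs k (GEx k \<phi>)"

definition conjs :: "gform list \<Rightarrow> gform" where
  "conjs \<phi>s = foldr GAnd \<phi>s (GEq GOne GOne)"

definition wterm :: "nat list \<Rightarrow> gterm" where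
  "wterm w = foldr (\<lambda>i t. GMul (GVar i) t) w GOne"

definition gmon :: "'a gstruct \<Rightarrow> 'a monoid" where
  "gmon M = \<lparr>carrier = gdom M, monoid.mult = gmul M, one = gone M\<rparr>"

lemma gmon_simps [simp]:
  "carrier (gmon M) = gdom M" "x \<otimes>\<^bsub>gmon M\<^esub> y = gmul M x y" "\<one>\<^bsub>gmon M\<^esub> = gone M"
  by (auto simp: gmon_def)

lemma group_struct_simps [simp]:
  "gdom (group_struct G) = carrier G" "gmul (group_struct G) x y = x \<otimes>\<^bsub>G\<^esub> y"
  "gone (group_struct G) = \<one>\<^bsub>G\<^esub>" "ginv (group_struct G) x = inv\<^bsub>G\<^esub> x"
  by (auto simp: group_struct_def)

lemma gmon_group_struct [simp]: "gmon (group_struct G) = (G :: 'a monoid)"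
  by (cases G) (simp add: gmon_def group_struct_def)

lemma teval_wterm: "teval M x (wterm w) = word_eval (gmon M) x w"
  by (induction w) (auto simp: wterm_def)

lemma tvars_wterm: "tvars (wterm w) = set w"
  by (induction w) (auto simp: wterm_def)

lemma sat_conjs: "sat M x (conjs \<phi>s) \<longleftrightarrow> (\<forall>\<phi>\<in>set \<phi>s. sat M x \<phi>)"
  by (induction \<phi>s) (auto simp: conjs_def)

lemma fvars_conjs: "fvars (conjs \<phi>s) = \<Union> (fvars ` set \<phi>s)"
  by (induction \<phi>s) (auto simp: conjs_def)

lemma teval_cong: "(\<And>i. i \<in> tvars t \<Longrightarrow> x i = y i) \<Longrightarrow> teval M x t = teval M y t"
  by (induction t) auto

lemma sat_cong: "(\<And>i. i \<in> fvars \<phi> \<Longrightarrow> x i = y i) \<Longrightarrow> sat M x \<phi> = sat M y \<phi>"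
proof (induction \<phi> arbitrary: x y)
  case (GEq t u) then show ?case using teval_cong[of t x y M] teval_cong[of u x y M] by auto
next
  case (GNot \<phi>) then show ?case by (metis fvars.simps(2) sat.simps(2))
next
  case (GAnd \<phi> \<psi>)
  have "sat M x \<phi> = sat M y \<phi>" "sat M x \<psi> = sat M y \<psi>"
    by (rule GAnd.IH(1), use GAnd.prems in simp) (rule GAnd.IH(2), use GAnd.prems in simp)
  then show ?case by simp
next
  case (GEx k \<phi>)
  have "sat M (x(k := a)) \<phi> = sat M (y(k := a)) \<phi>" for a using GEx.prems by (intro GEx.IH) auto
  then show ?case by simp
qed

lemma fvars_exs: "fvars (exs k \<phi>) = fvars \<phi> - {..<k}"
  by (induction k arbitrary: \<phi>) auto

lemma sat_exs:
  "sat M y (exs k \<phi>) \<longleftrightarrow> (\<exists>x. (\<forall>i<k. x i \<in> gdom M) \<and> (\<forall>i. \<not> i < k \<longrightarrow> x i = y i) \<and> sat M x \<phi>)"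
proof (induction k arbitrary: \<phi>)
  case 0
  have "sat M y \<phi> = (\<exists>x. x = y \<and> sat M x \<phi>)" by simp
  also have "\<dots> = (\<exists>x. (\<forall>i. x i = y i) \<and> sat M x \<phi>)" by (simp only: fun_eq_iff)
  finally show ?case by simp
next
  case (Suc k)
  show ?case
  proof
    assume "sat M y (exs (Suc k) \<phi>)"
    then obtain x a where x: "\<forall>i<k. x i \<in> gdom M" "\<forall>i. \<not> i < k \<longrightarrow> x i = y i" "a \<in> gdom M" "sat M (x(k := a)) \<phi>"
      by (auto simp: Suc)
    then show "\<exists>x. (\<forall>i<Suc k. x i \<in> gdom M) \<and> (\<forall>i. \<not> i < Suc k \<longrightarrow> x i = y i) \<and> sat M x \<phi>"
      by (intro exI[of _ "x(k := a)"]) auto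
  next
    assume "\<exists>x. (\<forall>i<Suc k. x i \<in> gdom M) \<and> (\<forall>i. \<not> i < Suc k \<longrightarrow> x i = y i) \<and> sat M x \<phi>"
    then obtain x where x: "\<forall>i<Suc k. x i \<in> gdom M" "\<forall>i. \<not> i < Suc k \<longrightarrow> x i = y i" "sat M x \<phi>" by blast
    then show "sat M y (exs (Suc k) \<phi>)"
      by (auto simp: Suc intro!: exI[of _ "x(k := y k)"] bexI[of _ "x k"])
  qed
qed

lemma holds_exs:
  assumes "fvars \<phi> \<subseteq> {..<k}" "gdom M \<noteq> {}"
  shows "holds M (exs k \<phi>) \<longleftrightarrow> (\<exists>x. (\<forall>i. x i \<in> gdom M) \<and> sat M x \<phi>)"
proof -
  obtain a where a: "a \<in> gdom M" using assms by blast
  show ?thesis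
  proof
    assume "holds M (exs k \<phi>)"
    then have "sat M (\<lambda>_. a) (exs k \<phi>)" using a by (simp add: holds_def)
    then obtain x where x: "\<forall>i<k. x i \<in> gdom M" "\<forall>i. \<not> i < k \<longrightarrow> x i = a" "sat M x \<phi>" by (auto simp: sat_exs)
    then have "\<forall>i. x i \<in> gdom M" using a by metis
    then show "\<exists>x. (\<forall>i. x i \<in> gdom M) \<and> sat M x \<phi>" using x by blast
  next
    assume "\<exists>x. (\<forall>i. x i \<in> gdom M) \<and> sat M x \<phi>"
    then obtain x where x: "\<forall>i. x i \<in> gdom M" "sat M x \<phi>" by blast
    show "holds M (exs k \<phi>)" unfolding holds_def sat_exs
    proof (intro allI impI)
      fix y
      have "sat M (\<lambda>i. if i < k then x i else y i) \<phi>"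
        using x(2) assms(1) by (subst sat_cong[of _ _ x]) auto
      then show "\<exists>z. (\<forall>i<k. z i \<in> gdom M) \<and> (\<forall>i. \<not> i < k \<longrightarrow> z i = y i) \<and> sat M z \<phi>"
        using x(1) by (intro exI[of _ "\<lambda>i. if i < k then x i else y i"]) auto
    qed
  qed
qed

lemma holds_not_exs:
  fixes M :: "'a gstruct"
  assumes "fvars \<phi> \<subseteq> {..<k}"
  shows "holds M (GNot (exs k \<phi>)) \<longleftrightarrow> (\<forall>x. (\<forall>i. x i \<in> gdom M) \<longrightarrow> \<not> sat M x \<phi>)"
proof
  assume h: "holds M (GNot (exs k \<phi>))"
  show "\<forall>x. (\<forall>i. x i \<in> gdom M) \<longrightarrow> \<not> sat M x \<phi>"
  proof (intro allI impI notI)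
    fix x assume x: "\<forall>i. x i \<in> gdom M" "sat M x \<phi>"
    then have "\<not> sat M x (exs k \<phi>)" using h by (simp add: holds_def)
    moreover have "sat M x (exs k \<phi>)" unfolding sat_exs by (rule exI[of _ x]) (use x in simp)
    ultimately show False by simp
  qed
next
  assume h: "\<forall>x. (\<forall>i. x i \<in> gdom M) \<longrightarrow> \<not> sat M x \<phi>"
  show "holds M (GNot (exs k \<phi>))" unfolding holds_def
  proof (intro allI impI)
    fix y :: "nat \<Rightarrow> 'a" assume y: "\<forall>i. y i \<in> gdom M"
    have "\<not> sat M x \<phi>" if x: "\<forall>i<k. x i \<in> gdom M" "\<forall>i. \<not> i < k \<longrightarrow> x i = y i" for x
    proof -
      have "x i \<in> gdom M" for i using x y by (cases "i < k") auto
      then show "\<not> sat M x \<phi>" using h by simp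
    qed
    then show "sat M y (GNot (exs k \<phi>))" unfolding sat.simps sat_exs by blast
  qed
qed

text \<open>A model is given only as a structure for the language, so the group axioms are
  transferred as sentences, each a negated existential in three variables.\<close>

lemma model_is_group:
  fixes M :: "'c gstruct"
  assumes G: "group G" and M: "model_of_theory M (group_struct G)"
  shows "group (gmon M)" "x \<in> gdom M \<Longrightarrow> inv\<^bsub>gmon M\<^esub> x = ginv M x"
proof -
  interpret group G by (rule G)
  have ax: "\<forall>x. (\<forall>i. x i \<in> gdom M) \<longrightarrow> teval M x t = teval M x u"
    if tu: "tvars t \<union> tvars u \<subseteq> {..<3}" "\<And>x. (\<forall>i. x i \<in> carrier G) \<Longrightarrow> teval (group_struct G) x t = teval (group_struct G) x u"
    for t u
  proof -
    let ?\<phi> = "GNot (GEq t u)"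
    have f: "fvars ?\<phi> \<subseteq> {..<3}" using tu(1) by simp
    have "sentence (GNot (exs 3 ?\<phi>))" using f by (auto simp: sentence_def fvars_exs)
    moreover have "holds (group_struct G) (GNot (exs 3 ?\<phi>))" using tu(2) by (simp add: holds_not_exs[OF f])
    ultimately have "holds M (GNot (exs 3 ?\<phi>))" using M by (simp add: model_of_theory_def)
    then show ?thesis by (simp add: holds_not_exs[OF f])
  qed
  define env where "env x y z i = (if i = 0 then x else if i = 1 then y else z)" for x y z :: 'c and i :: nat
  have env: "\<forall>i. env x y z i \<in> gdom M" if "x \<in> gdom M" "y \<in> gdom M" "z \<in> gdom M" for x y z
    using that by (simp add: env_def)
  have e [simp]: "env x y z 0 = x" "env x y z (Suc 0) = y" "env x y z 2 = z" for x y z by (auto simp: env_def)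
  have st: "is_gstruct M" using M by (simp add: model_of_theory_def)
  have assoc: "gmul M (gmul M x y) z = gmul M x (gmul M y z)" if "x \<in> gdom M" "y \<in> gdom M" "z \<in> gdom M" for x y z
    using ax[of "GMul (GMul (GVar 0) (GVar 1)) (GVar 2)" "GMul (GVar 0) (GMul (GVar 1) (GVar 2))", THEN spec, of "env x y z"] env[OF that]
    by (auto simp: m_assoc)
  have one: "gmul M (gone M) x = x" "gmul M x (gone M) = x" if "x \<in> gdom M" for x
    using ax[of "GMul GOne (GVar 0)" "GVar 0", THEN spec, of "env x x x"]
      ax[of "GMul (GVar 0) GOne" "GVar 0", THEN spec, of "env x x x"] env[OF that that that] by auto
  have inv: "gmul M (ginv M x) x = gone M" if "x \<in> gdom M" for x
    using ax[of "GMul (GInv (GVar 0)) (GVar 0)" "GOne", THEN spec, of "env x x x"] env[OF that that that] by auto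
  have ic: "ginv M x \<in> gdom M" if "x \<in> gdom M" for x using st that by (simp add: is_gstruct_def)
  show g: "group (gmon M)"
  proof (rule groupI)
    fix x assume "x \<in> carrier (gmon M)"
    then show "\<exists>y\<in>carrier (gmon M). y \<otimes>\<^bsub>gmon M\<^esub> x = \<one>\<^bsub>gmon M\<^esub>"
      using inv ic by (intro bexI[of _ "ginv M x"]) auto
  qed (use st assoc one in \<open>auto simp: is_gstruct_def\<close>)
  show "inv\<^bsub>gmon M\<^esub> x = ginv M x" if "x \<in> gdom M"
    by (rule group.inv_equality[OF g]) (use inv ic that in auto)
qed

context even_coxeter begin

section \<open>Conjugacy classes of tuples inside a formula\<close>

definition reps :: "nat \<Rightarrow> (nat \<Rightarrow> 'a) set" where
  "reps N = (SOME R. finite R \<and> R \<subseteq> fin_tuples G N \<and> (\<forall>t\<in>fin_tuples G N. \<exists>r\<in>R. tconj G N r t))"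

lemma reps: "finite (reps N)" "reps N \<subseteq> fin_tuples G N" "t \<in> fin_tuples G N \<Longrightarrow> \<exists>r\<in>reps N. tconj G N r t"
proof -
  have "\<exists>R. finite R \<and> R \<subseteq> fin_tuples G N \<and> (\<forall>t\<in>fin_tuples G N. \<exists>r\<in>R. tconj G N r t)"
    using finite_tuple_classes[of N] by metis
  from someI_ex[OF this]
  show "finite (reps N)" "reps N \<subseteq> fin_tuples G N" "t \<in> fin_tuples G N \<Longrightarrow> \<exists>r\<in>reps N. tconj G N r t"
    unfolding reps_def by auto
qed

definition bad_pairs :: "nat \<Rightarrow> ((nat \<Rightarrow> nat list) \<times> (nat \<Rightarrow> nat list)) list" where
  "bad_pairs N = (SOME xs. set xs = (\<lambda>(r, r'). (\<lambda>k. wd (r k), \<lambda>k. wd (r' k))) `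
     {(r, r') \<in> reps N \<times> reps N. \<not> tconj G N r r'})"

lemma bad_pairs: "set (bad_pairs N) = (\<lambda>(r, r'). (\<lambda>k. wd (r k), \<lambda>k. wd (r' k))) `
     {(r, r') \<in> reps N \<times> reps N. \<not> tconj G N r r'}" (is "_ = ?S")
proof -
  have "finite {(r, r') \<in> reps N \<times> reps N. \<not> tconj G N r r'}"
    by (rule finite_subset[of _ "reps N \<times> reps N"]) (use reps(1)[of N] in auto)
  then have "finite ?S" by (rule finite_imageI)
  then have "\<exists>xs. set xs = ?S" by (rule finite_list)
  then show ?thesis unfolding bad_pairs_def by (rule someI_ex)
qed

definition conj_form :: "nat \<Rightarrow> (nat \<Rightarrow> nat list) \<Rightarrow> (nat \<Rightarrow> nat list) \<Rightarrow> gform" where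
  "conj_form N c c' = GEx n (conjs (map (\<lambda>k. GEq (GMul (GVar n) (wterm (c k))) (GMul (wterm (c' k)) (GVar n))) [0..<N]))"

text \<open>The formula \<open>chi N\<close> says that \<open>s\<^sub>i \<mapsto> x\<^sub>i\<close> respects the Coxeter relations and keeps non-conjugate
  \<open>N\<close>-tuples generating finite subgroups non-conjugate.\<close>

definition chi :: "nat \<Rightarrow> gform" where
  "chi N = GAnd
     (conjs (concat (map (\<lambda>i. map (\<lambda>j. GEq (wterm (concat (replicate (d i j) [i, j]))) GOne) [0..<n]) [0..<n])))
     (conjs (map (\<lambda>(c, c'). GNot (conj_form N c c')) (bad_pairs N)))"

lemma reps_wd: "r \<in> reps N \<Longrightarrow> k < N \<Longrightarrow> wd (r k) \<in> lists {..<n} \<and> ev (wd (r k)) = r k"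
  using reps(2)[of N] fin_tuples_closed[of r G N k] wd[of "r k"] by (auto simp del: in_lists_conv_set)

lemma bad_pairs_lists:
  "(c, c') \<in> set (bad_pairs N) \<Longrightarrow> k < N \<Longrightarrow> c k \<in> lists {..<n} \<and> c' k \<in> lists {..<n}"
proof -
  assume "(c, c') \<in> set (bad_pairs N)" "k < N"
  then obtain r r' where "r \<in> reps N" "r' \<in> reps N" "c = (\<lambda>k. wd (r k))" "c' = (\<lambda>k. wd (r' k))"
    unfolding bad_pairs by auto
  then show ?thesis using reps_wd \<open>k < N\<close> by simp
qed

lemma fvars_conj_form:
  assumes "\<And>k. k < N \<Longrightarrow> c k \<in> lists {..<n} \<and> c' k \<in> lists {..<n}"
  shows "fvars (conj_form N c c') \<subseteq> {..<n}"
proof -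
  have "x < n" if "k < N" "x \<in> set (c k) \<union> set (c' k)" for k x using assms[OF that(1)] that(2) by auto
  then show ?thesis by (auto simp: conj_form_def fvars_conjs tvars_wterm)
qed

lemma fvars_chi: "fvars (chi N) \<subseteq> {..<n}"
proof -
  have "set (concat (replicate k [i, j])) \<subseteq> {..<n}" if "i < n" "j < n" for i j k
    using that by (induction k) auto
  moreover have "fvars (conj_form N c c') \<subseteq> {..<n}" if "(c, c') \<in> set (bad_pairs N)" for c c'
    using bad_pairs_lists[OF that] by (intro fvars_conj_form) auto
  ultimately show ?thesis unfolding chi_def by (force simp: fvars_conjs tvars_wterm wterm_def[of "[]", simplified])
qed

lemma sat_conj_form:
  assumes M: "group (gmon M)" "\<And>i. x i \<in> gdom M" and c: "\<And>k. k < N \<Longrightarrow> c k \<in> lists {..<n} \<and> c' k \<in> lists {..<n}"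
  shows "sat M x (conj_form N c c') \<longleftrightarrow> tconj (gmon M) N (\<lambda>k. word_eval (gmon M) x (c k)) (\<lambda>k. word_eval (gmon M) x (c' k))"
proof -
  interpret M: group "gmon M" by (rule M(1))
  have upd: "word_eval (gmon M) (x(n := a)) w = word_eval (gmon M) x w" if "w \<in> lists {..<n}" for a w
    using that by (induction w rule: list.induct) auto
  have cl: "word_eval (gmon M) x w \<in> carrier (gmon M)" for w using M(2) by (intro M.word_eval_closed) auto
  have eq: "gmul M a u = gmul M v a \<longleftrightarrow> v = gmul M (gmul M a u) (inv\<^bsub>gmon M\<^esub> a)" if "a \<in> gdom M" "u \<in> gdom M" "v \<in> gdom M" for a u v
    using M.inv_solve_right[of v "gmul M a u" a] M.m_closed[of a u] that by auto
  have "sat M x (conj_form N c c') \<longleftrightarrow> (\<exists>a\<in>gdom M. \<forall>k<N. gmul M a (word_eval (gmon M) x (c k)) = gmul M (word_eval (gmon M) x (c' k)) a)"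
    unfolding conj_form_def using c by (simp add: sat_conjs teval_wterm upd del: in_lists_conv_set; simp add: Ball_def)
  also have "\<dots> \<longleftrightarrow> (\<exists>a\<in>gdom M. \<forall>k<N. word_eval (gmon M) x (c' k) = gmul M (gmul M a (word_eval (gmon M) x (c k))) (inv\<^bsub>gmon M\<^esub> a))"
    using eq[OF _ cl[simplified] cl[simplified]] by (intro bex_cong HOL.refl all_cong) blast
  finally show ?thesis unfolding tconj_def by simp
qed

text \<open>For the label \<infinity>, encoded as 0, the relator in \<open>chi\<close> is the empty
  word and imposes nothing.\<close>

lemma sat_chi:
  assumes M: "group (gmon M)" "\<And>i. x i \<in> gdom M"
  shows "sat M x (chi N) \<longleftrightarrow> (\<forall>i<n. \<forall>j<n. (x i \<otimes>\<^bsub>gmon M\<^esub> x j) [^]\<^bsub>gmon M\<^esub> d i j = \<one>\<^bsub>gmon M\<^esub>) \<and>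
    (\<forall>r\<in>reps N. \<forall>r'\<in>reps N. \<not> tconj G N r r' \<longrightarrow>
      \<not> tconj (gmon M) N (\<lambda>k. word_eval (gmon M) x (wd (r k))) (\<lambda>k. word_eval (gmon M) x (wd (r' k))))"
proof -
  interpret M: group "gmon M" by (rule M(1))
  have 1: "teval M x (wterm (concat (replicate k [i, j]))) = (x i \<otimes>\<^bsub>gmon M\<^esub> x j) [^]\<^bsub>gmon M\<^esub> k" for i j k
    unfolding teval_wterm using M(2) by (intro M.word_eval_concat_replicate) auto
  have 2: "(\<forall>p\<in>set (bad_pairs N). sat M x ((\<lambda>(c, c'). GNot (conj_form N c c')) p)) \<longleftrightarrow>
     (\<forall>r\<in>reps N. \<forall>r'\<in>reps N. \<not> tconj G N r r' \<longrightarrow>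
      \<not> tconj (gmon M) N (\<lambda>k. word_eval (gmon M) x (wd (r k))) (\<lambda>k. word_eval (gmon M) x (wd (r' k))))"
  proof -
    have "sat M x (conj_form N (\<lambda>k. wd (r k)) (\<lambda>k. wd (r' k))) \<longleftrightarrow>
        tconj (gmon M) N (\<lambda>k. word_eval (gmon M) x (wd (r k))) (\<lambda>k. word_eval (gmon M) x (wd (r' k)))"
      if "r \<in> reps N" "r' \<in> reps N" for r r'
      by (rule sat_conj_form[OF M]) (use reps_wd that in simp)
    then show ?thesis unfolding bad_pairs by auto
  qed
  have 3: "sat M x (conjs (concat (map (\<lambda>i. map (\<lambda>j. GEq (wterm (concat (replicate (d i j) [i, j]))) GOne) [0..<n]) [0..<n])))
     \<longleftrightarrow> (\<forall>i<n. \<forall>j<n. (x i \<otimes>\<^bsub>gmon M\<^esub> x j) [^]\<^bsub>gmon M\<^esub> d i j = \<one>\<^bsub>gmon M\<^esub>)"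
    by (auto simp: sat_conjs 1)
  have 4: "sat M x (conjs (map (\<lambda>(c, c'). GNot (conj_form N c c')) (bad_pairs N))) \<longleftrightarrow>
    (\<forall>p\<in>set (bad_pairs N). sat M x ((\<lambda>(c, c'). GNot (conj_form N c c')) p))"
    by (simp add: sat_conjs)
  show ?thesis unfolding chi_def sat.simps 3 4 2 ..
qed

text \<open>Testing representatives suffices: homomorphisms preserve conjugacy of tuples, so merging
  two classes would merge their representatives.\<close>

lemma chi_hom:
  assumes M: "group (gmon M)" "\<And>i. x i \<in> gdom M" "sat M x (chi N)"
  shows "lift (gmon M) x \<in> hom G (gmon M)" "class_inj N G (gmon M) (lift (gmon M) x)"
    "w \<in> lists {..<n} \<Longrightarrow> lift (gmon M) x (ev w) = word_eval (gmon M) x w"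
proof -
  interpret M: group "gmon M" by (rule M(1))
  let ?f = "lift (gmon M) x"
  have rels: "(x i \<otimes>\<^bsub>gmon M\<^esub> x j) [^]\<^bsub>gmon M\<^esub> d i j = \<one>\<^bsub>gmon M\<^esub>" if "i < n" "j < n" for i j
    using M(3) that unfolding sat_chi[OF M(1,2)] by blast
  show f: "?f \<in> hom G (gmon M)" by (rule lift_hom[OF M.monoid_axioms]) (use M(2) rels in auto)
  have fw: "?f (ev w) = word_eval (gmon M) x w" if "w \<in> lists {..<n}" for w
    by (rule lift_ev[OF M.monoid_axioms]) (use M(2) rels that in auto)
  then show "w \<in> lists {..<n} \<Longrightarrow> ?f (ev w) = word_eval (gmon M) x w" .
  show "class_inj N G (gmon M) ?f" unfolding class_inj_def
  proof (intro ballI impI)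
    fix t t' assume t: "t \<in> fin_tuples G N" "t' \<in> fin_tuples G N" "tconj (gmon M) N (?f \<circ> t) (?f \<circ> t')"
    obtain r r' where r: "r \<in> reps N" "tconj G N r t" "r' \<in> reps N" "tconj G N r' t'" using reps(3) t by meson
    have rf: "r \<in> fin_tuples G N" "r' \<in> fin_tuples G N" using r reps(2) by auto
    note ht = hom_fin_tuples[OF is_group M(1) f]
    have "tconj (gmon M) N (?f \<circ> r) (?f \<circ> t)" "tconj (gmon M) N (?f \<circ> r') (?f \<circ> t')"
      using hom_tconj[OF is_group M(1) f] rf r by auto
    then have "tconj (gmon M) N (?f \<circ> r) (?f \<circ> r')"
      using t(3) M.tconj_trans M.tconj_sym ht rf t(1,2) by metis
    moreover have "tconj (gmon M) N (?f \<circ> r) (?f \<circ> r') \<longleftrightarrow>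
        tconj (gmon M) N (\<lambda>k. word_eval (gmon M) x (wd (r k))) (\<lambda>k. word_eval (gmon M) x (wd (r' k)))"
    proof -
      have "?f (r k) = word_eval (gmon M) x (wd (r k))" "?f (r' k) = word_eval (gmon M) x (wd (r' k))" if "k < N" for k
        using fw reps_wd r that by metis+
      then show ?thesis unfolding tconj_def by simp
    qed
    ultimately have "tconj G N r r'" using M(3) r unfolding sat_chi[OF M(1,2)] by blast
    then show "tconj G N t t'"
      using tconj_trans[OF t(1) tconj_trans[OF t(1) tconj_sym[OF rf(1) r(2)]] r(4)] by blast
  qed
qed

end

lemma sat_chi_self:
  fixes G :: "'a monoid"
  assumes "even_coxeter G n s m"
  shows "\<exists>x. (\<forall>i. x i \<in> carrier G) \<and> sat (group_struct G) x (even_coxeter.chi G n s m N)"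
proof -
  interpret even_coxeter G n s m by (rule assms)
  have G: "gmon (group_struct G) = G" by simp
  define x where "x i = (if i < n then s i else \<one>\<^bsub>G\<^esub>)" for i
  have x: "x i \<in> carrier G" for i by (simp add: x_def)
  have ev: "word_eval G x w = ev w" if "w \<in> lists {..<n}" for w
    using that by (induction w rule: list.induct) (auto simp: x_def)
  have "sat (group_struct G) x (chi N)"
  proof (subst sat_chi)
    show "group (gmon (group_struct G))" using G is_group by simp
    show "(\<forall>i<n. \<forall>j<n. (x i \<otimes>\<^bsub>gmon (group_struct G)\<^esub> x j) [^]\<^bsub>gmon (group_struct G)\<^esub> d i j = \<one>\<^bsub>gmon (group_struct G)\<^esub>) \<and>
      (\<forall>r\<in>reps N. \<forall>r'\<in>reps N. \<not> tconj G N r r' \<longrightarrow>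
      \<not> tconj (gmon (group_struct G)) N (\<lambda>k. word_eval (gmon (group_struct G)) x (wd (r k)))
         (\<lambda>k. word_eval (gmon (group_struct G)) x (wd (r' k))))"
      unfolding G
    proof (intro conjI allI impI ballI)
      fix r r' assume r: "r \<in> reps N" "r' \<in> reps N" "\<not> tconj G N r r'"
      have "word_eval G x (wd (r k)) = r k" "word_eval G x (wd (r' k)) = r' k" if "k < N" for k
        using ev reps_wd r that by metis+
      then show "\<not> tconj G N (\<lambda>k. word_eval G x (wd (r k))) (\<lambda>k. word_eval G x (wd (r' k)))"
        using r(3) unfolding tconj_def by simp
    qed (use s_pow in \<open>simp add: x_def\<close>)
  qed (use x in simp)
  then show ?thesis using x by blast
qed

lemma chi_sentence_transfer:
  fixes W :: "'a monoid" and W' :: "'b monoid"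
  assumes W: "even_coxeter W n s m" and W': "group W'" and eq: "elem_equiv (group_struct W) (group_struct W')"
  obtains f where "f \<in> hom W W'" "class_inj N W W' f"
proof -
  interpret even_coxeter W n s m by (rule W)
  interpret W': group W' by (rule W')
  let ?\<phi> = "exs n (chi N)"
  have "sentence ?\<phi>" using fvars_chi by (auto simp: sentence_def fvars_exs)
  moreover have "holds (group_struct W) ?\<phi>"
    using holds_exs[OF fvars_chi, of "group_struct W"] sat_chi_self[OF W] by auto
  ultimately have "holds (group_struct W') ?\<phi>" using eq by (simp add: elem_equiv_def)
  then obtain x where x: "\<forall>i. x i \<in> carrier W'" "sat (group_struct W') x (chi N)"
    using holds_exs[OF fvars_chi, of "group_struct W'"] W'.one_closed by auto
  then show ?thesis using that chi_hom[of "group_struct W'" x N] W' by auto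
qed

theorem embeds_in_models:
  fixes W :: "'a monoid" and M :: "'c gstruct"
  assumes W: "even_coxeter W n s m" and M: "model_of_theory M (group_struct W)"
  shows "\<exists>h. gembedding h (group_struct W) M"
proof -
  interpret even_coxeter W n s m by (rule W)
  note Mg = model_is_group[OF is_group M]
  interpret M: group "gmon M" by (rule Mg(1))
  have tr: "holds M \<phi>" if "sentence \<phi>" "holds (group_struct W) \<phi>" for \<phi>
    using M that by (simp add: model_of_theory_def)
  have "carrier W \<noteq> {}" using one_closed by blast
  then have "holds (group_struct W) (exs n (chi n))"
    using holds_exs[OF fvars_chi, of "group_struct W"] sat_chi_self[OF W] by simp
  moreover have "sentence (exs n (chi n))" using fvars_chi by (auto simp: sentence_def fvars_exs)
  ultimately have "holds M (exs n (chi n))" by (intro tr)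
  then obtain x where x: "\<And>i. x i \<in> gdom M" "sat M x (chi n)"
    using holds_exs[OF fvars_chi, of M] M.one_closed by auto
  let ?h = "lift (gmon M) x"
  note h = chi_hom[OF Mg(1) x]
  interpret h: group_hom W "gmon M" ?h
    using h(1) by (simp add: group_hom_def group_hom_axioms_def is_group Mg(1))
  have "g = \<one>\<^bsub>W\<^esub>" if g: "g \<in> carrier W" "?h g = gone M" for g
  proof (rule ccontr)
    assume g1: "g \<noteq> \<one>\<^bsub>W\<^esub>"
    \<comment> \<open>The solution \<open>x\<close> in \<open>M\<close> is fixed before the word.
      Each word gets its own sentence, which speaks about all solutions of \<open>chi n\<close> and
      hence about \<open>x\<close>.\<close>
    let ?\<phi> = "GAnd (chi n) (GEq (wterm (wd g)) GOne)"
    have fv: "fvars ?\<phi> \<subseteq> {..<n}" using fvars_chi wd(1)[OF g(1)] by (auto simp: tvars_wterm)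
    have "holds (group_struct W) (GNot (exs n ?\<phi>))"
      unfolding holds_not_exs[OF fv]
    proof (intro allI impI notI)
      fix z assume z: "\<forall>i. z i \<in> gdom (group_struct W)" "sat (group_struct W) z ?\<phi>"
      then have z': "\<And>i. z i \<in> gdom (group_struct W)" "sat (group_struct W) z (chi n)"
        "word_eval W z (wd g) = \<one>\<^bsub>W\<^esub>" by (auto simp: teval_wterm)
      have gw: "group (gmon (group_struct W))" by (simp add: is_group)
      note f = chi_hom[OF gw z'(1,2), simplified]
      have "inj_on (lift W z) (carrier W)" using class_inj_injective[OF f(1,2)] by simp
      moreover have "lift W z g = \<one>\<^bsub>W\<^esub>" using f(3)[of "wd g"] wd[OF g(1)] z'(3) by simp
      moreover have "lift W z \<one>\<^bsub>W\<^esub> = \<one>\<^bsub>W\<^esub>" using hom_one[OF f(1) is_group is_group] .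
      ultimately show False using g1 g(1) by (metis inj_onD one_closed)
    qed
    then have "holds M (GNot (exs n ?\<phi>))" by (intro tr) (use fv in \<open>auto simp: sentence_def fvars_exs\<close>)
    then have "\<not> sat M x ?\<phi>" using x(1) unfolding holds_not_exs[OF fv] by blast
    then show False using x(2) h(3)[of "wd g"] wd[OF g(1)] g(2) by (simp add: teval_wterm)
  qed
  then have "inj_on ?h (carrier W)" by (intro h.inj_iff_trivial_ker[THEN iffD2]) (auto simp: kernel_def)
  then have "gembedding ?h (group_struct W) M"
    unfolding gembedding_def using h.hom_closed h.hom_one h.hom_inv h.hom_mult Mg(2) by auto
  then show ?thesis by blast
qed

section \<open>Matching two systems of labels\<close>

lemma two_powers_zero: "(\<forall>t. 2 ^ t dvd (a::nat)) \<longleftrightarrow> a = 0"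
proof
  assume h: "\<forall>t. 2 ^ t dvd a"
  show "a = 0"
  proof (rule ccontr)
    assume "a \<noteq> 0"
    then have "2 ^ a \<le> a" using h dvd_imp_le by blast
    then show False using less_exp[of a] by simp
  qed
qed simp

lemma odd_part: assumes "(a::nat) \<noteq> 0" obtains t u where "a = 2 ^ t * u" "odd u"
proof -
  obtain u where "a = 2 ^ multiplicity 2 a * u" "\<not> 2 dvd u"
    by (rule multiplicity_decompose'[of a 2]) (use assms in auto)
  then show ?thesis using that by blast
qed

lemma dvd_via_parts:
  assumes "(a::nat) \<noteq> 0" "\<And>t. 2 ^ t dvd a \<Longrightarrow> 2 ^ t dvd b" "\<And>q. odd q \<Longrightarrow> q dvd a \<Longrightarrow> q dvd b"
  shows "a dvd b"
proof -
  obtain t u where a: "a = 2 ^ t * u" "odd u" by (rule odd_part[OF assms(1)])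
  have "coprime (2 ^ t) u" using a(2) by simp
  moreover have "2 ^ t dvd b" "u dvd b" using assms(2)[of t] assms(3)[OF a(2)] a(1) by auto
  ultimately show ?thesis unfolding a(1) by (rule divides_mult[rotated 2])
qed

text \<open>The given bijection uses equally many elements of each class on both sides, so the
  complements can be matched class by class.\<close>

lemma extend_class_bij:
  assumes A: "finite A" "U \<subseteq> A" "U' \<subseteq> A" and g: "bij_betw g U U'" "\<And>i. i \<in> U \<Longrightarrow> c (g i) = c i"
  obtains p where "bij_betw p A A" "\<And>i. i \<in> U \<Longrightarrow> p i = g i" "\<And>i. i \<in> A \<Longrightarrow> c (p i) = c i"
proof -
  let ?F = "\<lambda>Y y. {i \<in> Y. c i = y}"
  have "\<exists>t. bij_betw t (?F (A - U) y) (?F (A - U') y)" for y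
  proof (rule finite_same_card_bij)
    have "bij_betw g (?F U y) (?F U' y)"
      using g by (auto simp: bij_betw_def inj_on_def)
    then have "card (?F U y) = card (?F U' y)" by (rule bij_betw_same_card)
    moreover have "card (?F (A - U) y) = card (?F A y) - card (?F U y)" "card (?F (A - U') y) = card (?F A y) - card (?F U' y)"
    proof -
      have "?F (A - U) y = ?F A y - ?F U y" "?F (A - U') y = ?F A y - ?F U' y" by auto
      then show "card (?F (A - U) y) = card (?F A y) - card (?F U y)" "card (?F (A - U') y) = card (?F A y) - card (?F U' y)"
        using A finite_subset[of _ A] by (auto intro!: card_Diff_subset)
    qed
    ultimately show "card (?F (A - U) y) = card (?F (A - U') y)" by simp
  qed (use A in auto)
  then obtain t where t: "\<And>y. bij_betw (t y) (?F (A - U) y) (?F (A - U') y)" by metis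
  define p where "p i = (if i \<in> U then g i else t (c i) i)" for i
  have pt: "p i \<in> A - U'" "c (p i) = c i" if "i \<in> A - U" for i
  proof -
    have "t (c i) i \<in> ?F (A - U') (c i)" by (rule bij_betwE[OF t, rule_format]) (use that in auto)
    then show "p i \<in> A - U'" "c (p i) = c i" using that by (auto simp: p_def)
  qed
  have pu: "p i \<in> U'" "c (p i) = c i" if "i \<in> U" for i using that g by (auto simp: p_def bij_betw_def)
  have "inj_on p A"
  proof (rule inj_onI)
    fix i j assume ij: "i \<in> A" "j \<in> A" "p i = p j"
    have same: "c i = c j" using ij pt pu by (metis DiffI)
    have "(i \<in> U) = (j \<in> U)" using ij pt pu by (metis DiffI DiffD2)
    then show "i = j"
    proof (cases "i \<in> U")
      case True
      with \<open>(i \<in> U) = (j \<in> U)\<close> ij(3) g(1) show ?thesis by (simp add: p_def bij_betw_def inj_on_def)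
    next
      case False
      with \<open>(i \<in> U) = (j \<in> U)\<close> ij same have "t (c i) i = t (c i) j" "i \<in> ?F (A - U) (c i)" "j \<in> ?F (A - U) (c i)"
        by (auto simp: p_def)
      then show ?thesis using t[of "c i"] by (auto simp: bij_betw_def dest: inj_onD)
    qed
  qed
  moreover have "p ` A \<subseteq> A" using pt pu A by blast
  ultimately have "bij_betw p A A" using A(1) by (simp add: bij_betw_def endo_inj_surj)
  moreover have "c (p i) = c i" if "i \<in> A" for i using pt pu that by blast
  ultimately show ?thesis using that[of p] by (simp add: p_def)
qed

text \<open>The condition \<open>d i j \<noteq> 0\<close> excludes \<infinity>, since every
  \<open>q\<close> divides 0.\<close>

definition oddE :: "nat \<Rightarrow> (nat \<Rightarrow> nat \<Rightarrow> nat) \<Rightarrow> nat set set" where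
  "oddE n d = {{i, j} | i j. i < n \<and> j < n \<and> i \<noteq> j \<and> d i j \<noteq> 0 \<and> (\<exists>q. odd q \<and> 1 < q \<and> q dvd d i j)}"

text \<open>The 2-parts of the labels at \<open>b\<close> divide those at \<open>a\<close>; \<open>\<infinity>\<close>, encoded as \<open>0\<close>, is divisible by everything.\<close>

definition dom2 :: "nat \<Rightarrow> (nat \<Rightarrow> nat \<Rightarrow> nat) \<Rightarrow> nat \<Rightarrow> nat \<Rightarrow> bool" where
  "dom2 n d a b \<longleftrightarrow> (\<forall>y<n. y \<noteq> a \<longrightarrow> y \<noteq> b \<longrightarrow> (\<forall>t. 2 ^ t dvd d b y \<longrightarrow> 2 ^ t dvd d a y))"

text \<open>The definition leaves out the two vertices being compared, so \<open>y = b\<close> needs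
  a detour around the triangle: divisibility passes from the label of \<open>b\<close>,
  \<open>c\<close> to that of \<open>a\<close>, \<open>c\<close> and from there to that of
  \<open>a\<close>, \<open>b\<close>.\<close>

lemma dom2_transitive:
  assumes sym: "\<And>i j. i < n \<Longrightarrow> j < n \<Longrightarrow> d i j = d j i"
    and abc: "a < n" "b < n" "c < n" "dom2 n d a b" "dom2 n d b c"
  shows "dom2 n d a c"
  unfolding dom2_def
proof (intro allI impI)
  fix y t assume y: "y < n" "y \<noteq> a" "y \<noteq> c" "2 ^ t dvd d c y"
  show "2 ^ t dvd d a y"
  proof (cases "y = b")
    case True
    show ?thesis
    proof (cases "a = c")
      case False
      have "2 ^ t dvd d c b" using y True by simp
      then have "2 ^ t dvd d b c" using sym abc by simp
      then have "2 ^ t dvd d a c" using abc(3,4) False y True unfolding dom2_def by blast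
      then have "2 ^ t dvd d c a" using sym abc by simp
      then have "2 ^ t dvd d b a" using abc(1,5) False y True unfolding dom2_def by blast
      then show ?thesis using True sym abc by simp
    qed (use y in simp)
  qed (use y abc(4,5) in \<open>auto simp: dom2_def\<close>)
qed

text \<open>The endpoint of the image edge on which \<open>i\<close> has coefficient 1. It will not
  depend on the chosen edge at \<open>i\<close>: the images of two edges with common endpoint
  \<open>i\<close> share such an endpoint.\<close>

definition kap :: "nat \<Rightarrow> (nat \<Rightarrow> nat \<Rightarrow> nat) \<Rightarrow> (nat \<Rightarrow> nat \<Rightarrow> bit) \<Rightarrow> (nat set \<Rightarrow> nat set) \<Rightarrow> nat \<Rightarrow> nat" where
  "kap n d L eta i = (SOME k. \<exists>e\<in>oddE n d. i \<in> e \<and> k \<in> eta e \<and> L k i = 1)"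

text \<open>In the application, \<open>d\<close> and \<open>d'\<close> are the labels of the two systems (with \<open>0\<close> for \<open>\<infinity>\<close>), \<open>MK\<close> is the common
  family of maximal spherical subsets, \<open>L\<close> and \<open>L'\<close> describe the two homomorphisms on the abelianisations,
  and \<open>eta\<close> is the correspondence they induce between the edges whose label has a nontrivial odd part.
  These hypotheses are invariant under exchanging the two systems, which is used throughout.\<close>

locale half_matching =
  fixes n :: nat and d d' :: "nat \<Rightarrow> nat \<Rightarrow> nat" and MK :: "nat set set"
    and L L' :: "nat \<Rightarrow> nat \<Rightarrow> bit" and eta eta' :: "nat set \<Rightarrow> nat set"
  assumes self: "i < n \<Longrightarrow> d i i = 1"
    and sym: "i < n \<Longrightarrow> j < n \<Longrightarrow> d i j = d j i"
    and ev: "i < n \<Longrightarrow> j < n \<Longrightarrow> i \<noteq> j \<Longrightarrow> even (d i j)"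
    and eqD: "i < n \<Longrightarrow> j < n \<Longrightarrow> i \<noteq> j \<Longrightarrow> 2 ^ t dvd d i j \<longleftrightarrow> 2 ^ t dvd d' i j"
    and MK_ex: "i < n \<Longrightarrow> j < n \<Longrightarrow> i \<noteq> j \<Longrightarrow> d i j \<noteq> 0 \<Longrightarrow> \<exists>K\<in>MK. i \<in> K \<and> j \<in> K"
    and MK_fin: "K \<in> MK \<Longrightarrow> i \<in> K \<Longrightarrow> j \<in> K \<Longrightarrow> d i j \<noteq> 0"
    and MK_match: "K \<in> MK \<Longrightarrow> i \<in> K \<Longrightarrow> j \<in> K \<Longrightarrow> k \<in> K \<Longrightarrow> i \<noteq> j \<Longrightarrow> j \<noteq> k \<Longrightarrow> i \<noteq> k \<Longrightarrow> \<not> (2 < d i j \<and> 2 < d j k)"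
    and L_inv: "i < n \<Longrightarrow> j < n \<Longrightarrow> (\<Sum>k<n. L i k * L' k j) = of_bool (i = j)"
    and L_MK: "K \<in> MK \<Longrightarrow> i \<in> K \<Longrightarrow> k < n \<Longrightarrow> L k i \<noteq> 0 \<Longrightarrow> k \<in> K"
    and L_dom: "i < n \<Longrightarrow> k < n \<Longrightarrow> L k i \<noteq> 0 \<Longrightarrow> dom2 n d i k"
    and eta_E: "e \<in> oddE n d \<Longrightarrow> eta e \<in> oddE n d'" "e \<in> oddE n d \<Longrightarrow> eta' (eta e) = e"
    and eta_MK: "e \<in> oddE n d \<Longrightarrow> K \<in> MK \<Longrightarrow> eta e \<subseteq> K \<longleftrightarrow> e \<subseteq> K"
    and eta_L: "e \<in> oddE n d \<Longrightarrow> K \<in> MK \<Longrightarrow> e \<subseteq> K \<Longrightarrow> x \<in> K \<Longrightarrow> (\<Sum>k\<in>eta e. L k x) = of_bool (x \<in> e)"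
    and eta_four: "{i, j} \<in> oddE n d \<Longrightarrow> i \<noteq> j \<Longrightarrow> 4 dvd d i j \<Longrightarrow> eta {i, j} = {i, j}"
    and eta_odd: "{i, j} \<in> oddE n d \<Longrightarrow> i \<noteq> j \<Longrightarrow> eta {i, j} = {k, l} \<Longrightarrow> odd q \<Longrightarrow> q dvd d i j \<Longrightarrow> q dvd d' k l"
begin

lemma oddE_pair: assumes "e \<in> oddE n d" "i \<in> e" obtains j where "e = {i, j}" "i \<noteq> j" "i < n" "j < n" "2 < d i j"
proof -
  obtain a b q where e: "e = {a, b}" "a < n" "b < n" "a \<noteq> b" "d a b \<noteq> 0" "odd q" "1 < q" "q dvd d a b"
    using assms unfolding oddE_def by blast
  have "q \<le> d a b" "q \<noteq> 2" using e dvd_imp_le by auto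
  then have "2 < d a b" "2 < d b a" using e(7) sym[OF e(2,3)] by linarith+
  then show ?thesis using that e assms(2) by auto
qed

lemma oddE_pair_gt: assumes "{i, j} \<in> oddE n d" "i \<noteq> j" shows "i < n" "j < n" "2 < d i j"
  using oddE_pair[OF assms(1), of i] assms(2) by (auto simp: doubleton_eq_iff)

lemma oddE_MK: assumes "e \<in> oddE n d" obtains K where "K \<in> MK" "e \<subseteq> K"
proof -
  obtain i where "i \<in> e" using assms by (auto simp: oddE_def)
  then obtain j where "e = {i, j}" "i \<noteq> j" "i < n" "j < n" "2 < d i j" by (rule oddE_pair[OF assms])
  then show ?thesis using MK_ex[of i j] that by auto
qed

lemma oddE_eqI: "{i, j} \<in> oddE n d \<longleftrightarrow> i < n \<and> j < n \<and> i \<noteq> j \<and> d i j \<noteq> 0 \<and> (\<exists>q. odd q \<and> 1 < q \<and> q dvd d i j)"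
  if "i \<noteq> j"
proof
  assume "{i, j} \<in> oddE n d"
  then obtain a b where "{i, j} = {a, b}" "a < n" "b < n" "d a b \<noteq> 0" "\<exists>q. odd q \<and> 1 < q \<and> q dvd d a b"
    unfolding oddE_def by blast
  then show "i < n \<and> j < n \<and> i \<noteq> j \<and> d i j \<noteq> 0 \<and> (\<exists>q. odd q \<and> 1 < q \<and> q dvd d i j)"
    using sym[of a b] that by (auto simp: doubleton_eq_iff)
qed (auto simp: oddE_def)

lemma dom2_trans:
  "a < n \<Longrightarrow> b < n \<Longrightarrow> c < n \<Longrightarrow> dom2 n d a b \<Longrightarrow> dom2 n d b c \<Longrightarrow> dom2 n d a c"
  by (rule dom2_transitive[OF sym])

lemma dom2D: "dom2 n d a b \<Longrightarrow> y < n \<Longrightarrow> y \<noteq> a \<Longrightarrow> y \<noteq> b \<Longrightarrow> 2 ^ t dvd d b y \<Longrightarrow> 2 ^ t dvd d a y"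
  by (auto simp: dom2_def)

lemma dom2_zero: "dom2 n d a b \<Longrightarrow> y < n \<Longrightarrow> y \<noteq> a \<Longrightarrow> y \<noteq> b \<Longrightarrow> d b y = 0 \<Longrightarrow> d a y = 0"
  using two_powers_zero[of "d a y"] two_powers_zero[of "d b y"] dom2D by metis

lemma dom2_d': assumes "a < n" "b < n" shows "dom2 n d' a b \<longleftrightarrow> dom2 n d a b"
  unfolding dom2_def using eqD[OF assms(1)] eqD[OF assms(2)] by metis

lemma zero_d': "i < n \<Longrightarrow> j < n \<Longrightarrow> i \<noteq> j \<Longrightarrow> d' i j = 0 \<longleftrightarrow> d i j = 0"
  using two_powers_zero[of "d i j"] two_powers_zero[of "d' i j"] eqD by metis

lemma dom2_refl [simp]: "dom2 n d a a" by (simp add: dom2_def)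

end

locale odd_matching = half_matching + R: half_matching n d' d MK L' L eta' eta

context odd_matching begin

lemma swap: "odd_matching n d' d MK L' L eta' eta" by unfold_locales

text \<open>Over F_2 the coefficients at the two endpoints of \<open>eta e\<close> add up to 1, so
  exactly one of them is 1.\<close>

lemma hit:
  assumes e: "e \<in> oddE n d" "i \<in> e"
  obtains k l where "eta e = {k, l}" "k \<noteq> l" "k < n" "l < n" "L k i = 1" "L l i = 0"
proof -
  obtain K where K: "K \<in> MK" "e \<subseteq> K" by (rule oddE_MK[OF e(1)])
  obtain k where "k \<in> eta e" using eta_E(1)[OF e(1)] by (auto simp: oddE_def)
  then obtain l where kl: "eta e = {k, l}" "k \<noteq> l" "k < n" "l < n" by (rule R.oddE_pair[OF eta_E(1)[OF e(1)]])
  have s: "L k i + L l i = 1" using eta_L[OF e(1) K, of i] e K kl by auto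
  show ?thesis
  proof (cases "L k i = 0")
    case True then show ?thesis using s kl that[of l k] by auto
  next
    case False then have "L l i = 0" using s by (metis add_left_cancel bit_neq_1 add.right_neutral)
    then show ?thesis using False kl that[of k l] by auto
  qed
qed

text \<open>Restricted to \<open>K \<inter> K2\<close>, row \<open>l\<close> of \<open>L\<close> agrees with the sum of the rows \<open>k\<close> and \<open>l\<close>, which is known; the row
  cannot vanish because \<open>L\<close> is invertible on \<open>K \<inter> K2\<close>.\<close>

lemma row:
  assumes e: "e \<in> oddE n d" "eta e = {k, l}" "k \<noteq> l" and K: "K \<in> MK" "e \<subseteq> K"
    and K2: "K2 \<in> MK" "l \<in> K2" "k \<notin> K2"
  obtains x where "x \<in> e" "x \<in> K2" "L l x = 1" "\<And>v. v \<in> K \<Longrightarrow> v \<in> K2 \<Longrightarrow> L l v = of_bool (v = x)"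
proof -
  have kl: "k < n" "l < n" "l \<in> K"
    using R.oddE_pair_gt[of k l] eta_E(1)[OF e(1)] eta_MK[OF e(1) K(1)] e K by auto
  have r: "L l v = of_bool (v \<in> e)" if "v \<in> K" "v \<in> K2" for v
  proof -
    have "L k v = 0" using L_MK[OF K2(1) that(2) kl(1)] K2(3) by blast
    then show ?thesis using eta_L[OF e(1) K that(1)] e by simp
  qed
  have "e \<inter> K2 \<noteq> {}"
  proof
    assume em: "e \<inter> K2 = {}"
    have "L l v * L' v l = 0" if "v < n" for v
      using R.L_MK[OF K(1) kl(3) that] R.L_MK[OF K2(1,2) that] r em by (cases "L' v l = 0") auto
    then have "(\<Sum>v<n. L l v * L' v l) = 0" by (intro sum.neutral) simp
    then show False using L_inv[OF kl(2) kl(2)] by simp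
  qed
  then obtain x where x: "x \<in> e" "x \<in> K2" by blast
  obtain j where j: "e = {x, j}" by (rule oddE_pair[OF e(1) x(1)])
  have "\<not> e \<subseteq> K2" using eta_MK[OF e(1) K2(1)] e(2) K2 by simp
  then have i: "e \<inter> K2 = {x}" using j x by auto
  then have "v \<in> e \<longleftrightarrow> v = x" if "v \<in> K2" for v using that by blast
  moreover have "L l x = 1" using r x K by auto
  ultimately show ?thesis using that[OF x] r by simp
qed

text \<open>By the matching condition the two edges do not fit into one spherical set. On the
  intersection of spherical sets \<open>K1\<close> and \<open>K2\<close> around them, the rows of
  the two endpoints hit by \<open>i\<close> are both the indicator of \<open>i\<close>. The column
  of \<open>L'\<close> at \<open>k1\<close> is supported in that intersection, so multiplying by it
  shows that the endpoints agree.\<close>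

lemma star:
  assumes e: "e1 \<in> oddE n d" "e2 \<in> oddE n d" "e1 \<noteq> e2" "i \<in> e1" "i \<in> e2"
  obtains k where "k \<in> eta e1" "k \<in> eta e2" "L k i = 1"
proof -
  obtain K1 where K1: "K1 \<in> MK" "e1 \<subseteq> K1" by (rule oddE_MK[OF e(1)])
  obtain K2 where K2: "K2 \<in> MK" "e2 \<subseteq> K2" by (rule oddE_MK[OF e(2)])
  obtain j where j: "e1 = {i, j}" "i \<noteq> j" "i < n" "j < n" "2 < d i j" by (rule oddE_pair[OF e(1,4)])
  obtain y where y: "e2 = {i, y}" "i \<noteq> y" "y < n" "2 < d i y" by (rule oddE_pair[OF e(2,5)])
  have jy: "j \<noteq> y" using e j y by auto
  have nm: "\<not> {j, i, y} \<subseteq> K" if "K \<in> MK" for K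
    using MK_match[OF that, of j i y] j y jy sym[of i j] by auto
  then have ns: "\<not> e1 \<subseteq> K2" "\<not> e2 \<subseteq> K1" using K1 K2 j y by auto
  obtain k1 l1 where k1: "eta e1 = {k1, l1}" "k1 \<noteq> l1" "k1 < n" "L k1 i = 1" by (rule hit[OF e(1,4)])
  obtain k2 l2 where k2: "eta e2 = {k2, l2}" "k2 \<noteq> l2" "k2 < n" "L k2 i = 1" by (rule hit[OF e(2,5)])
  have iK: "i \<in> K1" "i \<in> K2" using e K1 K2 by auto
  have kK: "k1 \<in> K1" "k1 \<in> K2" "k2 \<in> K1" "k2 \<in> K2" using L_MK K1(1) K2(1) iK k1 k2 by (metis zero_neq_one)+
  have l: "l1 \<notin> K2" "l2 \<notin> K1" using ns kK k1 k2 eta_MK e K1 K2 by (metis insert_subset empty_subsetI)+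
  obtain x1 where x1: "x1 \<in> e1" "x1 \<in> K2" "\<And>v. v \<in> K1 \<Longrightarrow> v \<in> K2 \<Longrightarrow> L k1 v = of_bool (v = x1)"
    by (rule row[OF e(1) _ _ K1 K2(1) kK(2) l(1)]) (use k1 in auto)
  obtain x2 where x2: "x2 \<in> e2" "x2 \<in> K1" "\<And>v. v \<in> K2 \<Longrightarrow> v \<in> K1 \<Longrightarrow> L k2 v = of_bool (v = x2)"
    by (rule row[OF e(2) _ _ K2 K1(1) kK(3) l(2)]) (use k2 in auto)
  have xi: "x1 = i" "x2 = i" using x1(1,2) x2(1,2) ns iK j(1) y(1) by auto
  have "L k1 v * L' v k1 = L k2 v * L' v k1" if "v < n" for v
    using R.L_MK[OF K1(1) kK(1) that] R.L_MK[OF K2(1) kK(2) that] x1(3) x2(3) xi by (cases "L' v k1 = 0") auto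
  then have "(\<Sum>v<n. L k1 v * L' v k1) = (\<Sum>v<n. L k2 v * L' v k1)" by (intro sum.cong) auto
  then have "k1 = k2" using L_inv[OF k1(3) k1(3)] L_inv[OF k2(3) k1(3)] by (auto split: if_splits)
  then show ?thesis using that[of k1] k1 k2 by simp
qed

abbreviation "ka \<equiv> kap n d L eta"
abbreviation "ka' \<equiv> kap n d' L' eta'"

lemma hit_unique:
  assumes "e \<in> oddE n d" "i \<in> e" "k \<in> eta e" "L k i = 1" "l \<in> eta e" "L l i = 1" shows "k = l"
  using hit[OF assms(1,2)] assms(3-6) by (metis insert_iff singletonD zero_neq_one)

lemma ka: assumes e: "e \<in> oddE n d" "i \<in> e" shows "ka i \<in> eta e" "L (ka i) i = 1"
proof -
  have "\<exists>k. \<exists>e\<in>oddE n d. i \<in> e \<and> k \<in> eta e \<and> L k i = 1"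
    by (rule hit[OF e]) (use e in blast)
  from someI_ex[OF this] obtain e0 where e0: "e0 \<in> oddE n d" "i \<in> e0" "ka i \<in> eta e0" "L (ka i) i = 1"
    unfolding kap_def by blast
  have "ka i \<in> eta e"
  proof (cases "e0 = e")
    case False
    obtain k where "k \<in> eta e0" "k \<in> eta e" "L k i = 1" by (rule star[OF e0(1) e(1) False e0(2) e(2)])
    then show ?thesis using hit_unique[OF e0(1,2,3,4)] by simp
  qed (use e0 in simp)
  then show "ka i \<in> eta e" "L (ka i) i = 1" using e0 by auto
qed

lemma ka_dom: assumes e: "e \<in> oddE n d" "i \<in> e" shows "ka i < n" "dom2 n d i (ka i)"
proof -
  show k: "ka i < n" using ka(1)[OF e] R.oddE_pair[OF eta_E(1)[OF e(1)]] by metis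
  show "dom2 n d i (ka i)" using L_dom[OF _ k] ka(2)[OF e] oddE_pair[OF e] by (metis zero_neq_one)
qed

text \<open>Going back along \<open>eta'\<close> ends in both \<open>e1\<close> and
  \<open>e2\<close>, and two distinct edges share only the vertex \<open>i\<close>.\<close>

lemma ka'_ka:
  assumes e: "e1 \<in> oddE n d" "e2 \<in> oddE n d" "e1 \<noteq> e2" "i \<in> e1" "i \<in> e2"
  shows "ka' (ka i) = i"
proof -
  interpret S: odd_matching n d' d MK L' L eta' eta by (rule swap)
  have "ka' (ka i) \<in> eta' (eta e1)" by (rule S.ka[OF eta_E(1)[OF e(1)] ka(1)[OF e(1,4)]])
  moreover have "ka' (ka i) \<in> eta' (eta e2)" by (rule S.ka[OF eta_E(1)[OF e(2)] ka(1)[OF e(2,5)]])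
  moreover have "e1 \<inter> e2 = {i}"
  proof -
    obtain j where j: "e1 = {i, j}" by (rule oddE_pair[OF e(1,4)])
    obtain y where y: "e2 = {i, y}" by (rule oddE_pair[OF e(2,5)])
    show ?thesis using e(3) j y by auto
  qed
  ultimately show ?thesis using eta_E(2) e by auto
qed

section \<open>Twins: generators with equal 2-parts in their labels\<close>

definition twin :: "nat \<Rightarrow> nat \<Rightarrow> bool" where "twin a b \<longleftrightarrow> dom2 n d a b \<and> dom2 n d b a"

lemma twin_refl [simp]: "twin a a" by (simp add: twin_def)
lemma twin_sym: "twin a b \<Longrightarrow> twin b a" by (auto simp: twin_def)
lemma twin_trans: "a < n \<Longrightarrow> b < n \<Longrightarrow> c < n \<Longrightarrow> twin a b \<Longrightarrow> twin b c \<Longrightarrow> twin a c"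
  unfolding twin_def using dom2_trans by blast

lemma ka_twin:
  assumes e: "e1 \<in> oddE n d" "e2 \<in> oddE n d" "e1 \<noteq> e2" "i \<in> e1" "i \<in> e2" shows "twin i (ka i)"
proof -
  interpret S: odd_matching n d' d MK L' L eta' eta by (rule swap)
  have "dom2 n d' (ka i) (ka' (ka i))" by (rule S.ka_dom(2)[OF eta_E(1)[OF e(1)] ka(1)[OF e(1,4)]])
  moreover have "i < n" "ka i < n" using ka_dom[OF e(1,4)] oddE_pair[OF e(1,4)] by auto
  ultimately have "dom2 n d (ka i) i" using dom2_d' ka'_ka[OF e] by simp
  then show ?thesis using ka_dom(2)[OF e(1,4)] by (simp add: twin_def)
qed

text \<open>A spherical set containing \<open>l\<close> and \<open>y\<close> but not \<open>j\<close> cannot contain \<open>k\<close>, so the row lemma locates \<open>l\<close>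
  relative to \<open>i\<close> and \<open>j\<close>.\<close>

lemma type_aux:
  assumes e: "{i, j} \<in> oddE n d" "i \<noteq> j" "eta {i, j} = {k, l}" "k \<noteq> l"
    and dm: "dom2 n d i k" "dom2 n d k i" "dom2 n d j i" "dom2 n d l k"
    and y: "y < n" "y \<notin> {i, j, k, l}" and ly: "d l y \<noteq> 0"
  shows "d j y \<noteq> 0" "2 ^ t dvd d l y \<Longrightarrow> 2 ^ t dvd d j y"
proof -
  have ij: "i < n" "j < n" using oddE_pair_gt[OF e(1,2)] by auto
  have kl: "k < n" "l < n" "2 < d' k l" using R.oddE_pair_gt[of k l] eta_E(1)[OF e(1)] e by auto
  obtain K where K: "K \<in> MK" "{i, j} \<subseteq> K" by (rule oddE_MK[OF e(1)])
  obtain K2 where K2: "K2 \<in> MK" "l \<in> K2" "y \<in> K2" using MK_ex[OF kl(2) y(1)] y ly by auto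
  have dli: "dom2 n d l i" using dom2_trans[OF kl(2,1) ij(1)] dm by blast
  show jy: "d j y \<noteq> 0"
  proof
    assume 0: "d j y = 0"
    have no: "\<not> {i, j} \<subseteq> K" if "K \<in> MK" "y \<in> K" for K using MK_fin[OF that(1), of j y] that 0 by auto
    then have "k \<notin> K2" using eta_MK[OF e(1) K2(1)] K2 e(3) by auto
    then obtain x where x: "x \<in> {i, j}" "x \<in> K2" "L l x = 1"
      by (rule row[OF e(1,3,4) K K2(1,2)])
    have "j \<notin> K2" using MK_fin[OF K2(1), of j y] K2 0 by auto
    then have li: "L l i = 1" using x by auto
    have "d i y \<noteq> 0" using dom2_zero[OF dli y(1)] y ly by auto
    then have "d k y \<noteq> 0" using dom2_zero[OF dm(1) y(1)] y by auto
    then obtain K3 where K3: "K3 \<in> MK" "k \<in> K3" "y \<in> K3" using MK_ex[OF kl(1) y(1)] y by auto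
    then have "l \<notin> K3" using eta_MK[OF e(1) K3(1)] no e(3) by auto
    then obtain z where z: "z \<in> {i, j}" "z \<in> K3" "L k z = 1"
      by (rule row[OF e(1) _ _ K K3(1,2), of l, rotated 2]) (use e in auto)
    have "j \<notin> K3" using MK_fin[OF K3(1), of j y] K3 0 by auto
    then have "L k i = 1" using z by auto
    then show False using li hit_unique[OF e(1), of i k l] e by auto
  qed
  assume t: "2 ^ t dvd d l y"
  show "2 ^ t dvd d j y"
  proof (rule ccontr)
    assume nt: "\<not> 2 ^ t dvd d j y"
    \<comment> \<open>All labels are even, so a failure needs t \<ge> 2. Then the labels
      \<open>d' k l\<close> and \<open>d' l y\<close> both exceed 2, the matching condition keeps
      \<open>k\<close> out of \<open>K2\<close>, and the row lemma applies.\<close>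
    have "even (d j y)" using ev ij y by auto
    then have "t \<noteq> 0" "t \<noteq> 1" using nt by (auto intro: Nat.gr0I)
    then have "t \<ge> 2" by simp
    then have "(4::nat) dvd 2 ^ t" using le_imp_power_dvd[of 2 t "2::nat"] by simp
    then have "2 ^ 2 dvd d l y" using t by (auto intro: dvd_trans)
    then have "4 dvd d' l y" using eqD[of l y 2] kl y by auto
    moreover have "d' l y \<noteq> 0" using zero_d'[of l y] ly kl y by auto
    ultimately have "2 < d' l y" using dvd_imp_le[of 4 "d' l y"] by simp
    then have "k \<notin> K2" using R.MK_match[OF K2(1), of k l y] K2 kl y e(4) by auto
    then obtain x where x: "x \<in> {i, j}" "x \<in> K2" "L l x = 1"
      by (rule row[OF e(1,3,4) K K2(1,2)])
    have xn: "x < n" using x ij by auto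
    have "dom2 n d x l" using L_dom[OF xn(1) kl(2)] x by simp
    then have "2 ^ t dvd d x y" using t y xn x by (intro dom2D[of x l]) auto
    then have "x = i" using nt x by auto
    then have "2 ^ t dvd d j y" using dom2D[OF dm(3) y(1)] \<open>2 ^ t dvd d x y\<close> y by auto
    then show False using nt by simp
  qed
qed

text \<open>Neither edge has a label divisible by 4, so both 2-parts are exactly 2; this settles the
  vertices on the edges. For the other vertices \<open>type_aux\<close> is applied in both
  directions, with the two systems exchanged.\<close>

lemma type_aux_twin:
  assumes e: "{i, j} \<in> oddE n d" "i \<noteq> j" "eta {i, j} = {k, l}" "k \<noteq> l" "\<not> 4 dvd d i j" "\<not> 4 dvd d' k l"
    and dm: "dom2 n d i k" "dom2 n d k i" "dom2 n d j i" "dom2 n d l k"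
  shows "twin j l"
proof -
  interpret S: odd_matching n d' d MK L' L eta' eta by (rule swap)
  have ij: "i < n" "j < n" using oddE_pair_gt[OF e(1,2)] by auto
  have e': "{k, l} \<in> oddE n d'" "eta' {k, l} = {i, j}" using eta_E[OF e(1)] e by auto
  have kl: "k < n" "l < n" using R.oddE_pair_gt[OF e'(1) e(4)] by auto
  have two: "2 ^ t dvd a \<longleftrightarrow> t \<le> 1" if "even a" "\<not> 4 dvd a" for a t :: nat
  proof
    assume t: "2 ^ t dvd a"
    show "t \<le> 1"
    proof (rule ccontr)
      assume "\<not> t \<le> 1"
      then have "(4::nat) dvd 2 ^ t" using le_imp_power_dvd[of 2 t "2::nat"] by simp
      then show False using t that dvd_trans by blast
    qed
  next
    assume "t \<le> 1" then have "t = 0 \<or> t = 1" by auto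
    then show "2 ^ t dvd a" using that by auto
  qed
  have dij: "2 ^ t dvd d i j \<longleftrightarrow> t \<le> 1" for t using two ev[of i j] ij e by simp
  have dkl: "2 ^ t dvd d k l \<longleftrightarrow> t \<le> 1" for t using two R.ev[of k l] kl e eqD[of k l t] by simp
  have eq: "2 ^ t dvd d j y \<longleftrightarrow> 2 ^ t dvd d l y" if y: "y < n" "y \<noteq> j" "y \<noteq> l" for y t
  proof -
    consider "y = i" | "y = k" | "y \<notin> {i, j, k, l}" using y by auto
    then show ?thesis
    proof cases
      assume yi: "y = i"
      have "2 ^ t dvd d l i \<longleftrightarrow> 2 ^ t dvd d k l"
      proof (cases "i = k")
        case False
        then have "2 ^ t dvd d i l \<longleftrightarrow> 2 ^ t dvd d k l"
          using dom2D[OF dm(1), of l t] dom2D[OF dm(2), of l t] kl yi y e(4) by auto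
        then show ?thesis using sym ij kl by simp
      qed (use sym kl in simp)
      then show ?thesis using yi dij dkl sym ij by simp
    next
      assume yk: "y = k"
      have "2 ^ t dvd d j k \<longleftrightarrow> 2 ^ t dvd d i j"
      proof (cases "i = k")
        case False
        then have "2 ^ t dvd d k j \<longleftrightarrow> 2 ^ t dvd d i j"
          using dom2D[OF dm(1), of j t] dom2D[OF dm(2), of j t] ij yk y e(2) by auto
        then show ?thesis using sym ij kl by simp
      qed (use sym ij in simp)
      then show ?thesis using yk dij dkl sym kl by simp
    next
      assume yn: "y \<notin> {i, j, k, l}"
      note A = type_aux[OF e(1-4) dm y(1) yn]
      have dm': "dom2 n d' k i" "dom2 n d' i k" "dom2 n d' l k" "dom2 n d' j i"
        using dm dom2_d' ij kl by auto
      have yn': "y \<notin> {k, l, i, j}" using yn by auto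
      note B = S.type_aux[OF e'(1) e(4) e'(2) e(2) dm' y(1) yn']
      have z: "d' j y = 0 \<longleftrightarrow> d j y = 0" "d' l y = 0 \<longleftrightarrow> d l y = 0" using zero_d' ij kl y by auto
      have q: "2 ^ t dvd d' j y \<longleftrightarrow> 2 ^ t dvd d j y" "2 ^ t dvd d' l y \<longleftrightarrow> 2 ^ t dvd d l y" for t
        using eqD ij kl y by auto
      show ?thesis
      proof (cases "d l y = 0")
        case True
        then have "d j y = 0" using B(1) z by auto
        then show ?thesis using True by simp
      next
        case False
        then have "d j y \<noteq> 0" using A(1) by blast
        then have nz: "d' j y \<noteq> 0" using z by simp
        show ?thesis using A(2)[OF False, of t] B(2)[OF nz, of t] unfolding q by (rule iffI[rotated])
      qed
    qed
  qed
  then show ?thesis unfolding twin_def dom2_def by auto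
qed

text \<open>If 4 divides one of the labels, the edge is its own image. Otherwise every endpoint of
  one edge dominates some endpoint of the other edge, in both directions. Of the finitely many
  resulting patterns of the preorder on four vertices, each gives the claim directly or through one
  of four renamings of \<open>type_aux_twin\<close>.\<close>

lemma types:
  assumes e: "{i, j} \<in> oddE n d" "i \<noteq> j" "eta {i, j} = {k, l}" "k \<noteq> l"
  shows "(twin i k \<and> twin j l) \<or> (twin i l \<and> twin j k)"
proof -
  interpret S: odd_matching n d' d MK L' L eta' eta by (rule swap)
  have ij: "i < n" "j < n" using oddE_pair_gt[OF e(1,2)] by auto
  have e': "{k, l} \<in> oddE n d'" "eta' {k, l} = {i, j}" using eta_E[OF e(1)] e by auto
  have kl: "k < n" "l < n" using R.oddE_pair_gt[OF e'(1) e(4)] by auto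
  show ?thesis
  proof (cases "4 dvd d i j \<or> 4 dvd d' k l")
    case True
    then have "{i, j} = {k, l}" using eta_four[OF e(1,2)] R.eta_four[OF e'(1) e(4)] e e' by auto
    then show ?thesis by (auto simp: doubleton_eq_iff)
  next
    case False
    then have f: "\<not> 4 dvd d i j" "\<not> 4 dvd d' k l" "\<not> 4 dvd d j i" "\<not> 4 dvd d' l k"
      using sym ij R.sym kl by auto
    have tr: "dom2 n d a b \<Longrightarrow> dom2 n d b c \<Longrightarrow> dom2 n d a c" if "a \<in> {i, j, k, l}" "b \<in> {i, j, k, l}" "c \<in> {i, j, k, l}" for a b c
      using dom2_trans that ij kl by blast
    have D: "dom2 n d a k \<or> dom2 n d a l" if "a \<in> {i, j}" for a
      using ka_dom(2)[OF e(1) that] ka(1)[OF e(1) that] e(3) by auto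
    have D': "dom2 n d b i \<or> dom2 n d b j" if b: "b \<in> {k, l}" for b
      using S.ka_dom[OF e'(1) b] S.ka(1)[OF e'(1) b] e'(2) dom2_d' b ij kl by auto
    have sy: "{j, i} = {i, j}" "{l, k} = {k, l}" by auto
    have T1: "twin j l" if "dom2 n d i k" "dom2 n d k i" "dom2 n d j i" "dom2 n d l k"
      by (rule type_aux_twin[of i j k l]) (use that e f in auto)
    have T2: "twin i l" if "dom2 n d j k" "dom2 n d k j" "dom2 n d i j" "dom2 n d l k"
      by (rule type_aux_twin[of j i k l]) (use that e f sy in auto)
    have T3: "twin j k" if "dom2 n d i l" "dom2 n d l i" "dom2 n d j i" "dom2 n d k l"
      by (rule type_aux_twin[of i j l k]) (use that e f sy in auto)
    have T4: "twin i k" if "dom2 n d j l" "dom2 n d l j" "dom2 n d i j" "dom2 n d k l"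
      by (rule type_aux_twin[of j i l k]) (use that e f sy in auto)
    have t: "dom2 n d i k \<Longrightarrow> dom2 n d k j \<Longrightarrow> dom2 n d i j" "dom2 n d i l \<Longrightarrow> dom2 n d l j \<Longrightarrow> dom2 n d i j"
      "dom2 n d j k \<Longrightarrow> dom2 n d k i \<Longrightarrow> dom2 n d j i" "dom2 n d j l \<Longrightarrow> dom2 n d l i \<Longrightarrow> dom2 n d j i"
      "dom2 n d k i \<Longrightarrow> dom2 n d i l \<Longrightarrow> dom2 n d k l" "dom2 n d k j \<Longrightarrow> dom2 n d j l \<Longrightarrow> dom2 n d k l"
      "dom2 n d l i \<Longrightarrow> dom2 n d i k \<Longrightarrow> dom2 n d l k" "dom2 n d l j \<Longrightarrow> dom2 n d j k \<Longrightarrow> dom2 n d l k"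
      "dom2 n d i j \<Longrightarrow> dom2 n d j k \<Longrightarrow> dom2 n d i k" "dom2 n d i j \<Longrightarrow> dom2 n d j l \<Longrightarrow> dom2 n d i l"
      "dom2 n d j i \<Longrightarrow> dom2 n d i k \<Longrightarrow> dom2 n d j k" "dom2 n d j i \<Longrightarrow> dom2 n d i l \<Longrightarrow> dom2 n d j l"
      "dom2 n d k l \<Longrightarrow> dom2 n d l i \<Longrightarrow> dom2 n d k i" "dom2 n d k l \<Longrightarrow> dom2 n d l j \<Longrightarrow> dom2 n d k j"
      "dom2 n d l k \<Longrightarrow> dom2 n d k i \<Longrightarrow> dom2 n d l i" "dom2 n d l k \<Longrightarrow> dom2 n d k j \<Longrightarrow> dom2 n d l j"
      by (blast intro: tr)+
    have D4: "dom2 n d i k \<or> dom2 n d i l" "dom2 n d j k \<or> dom2 n d j l" "dom2 n d k i \<or> dom2 n d k j" "dom2 n d l i \<or> dom2 n d l j"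
      using D D' by auto
    show ?thesis using D4 T1 T2 T3 T4 t unfolding twin_def by argo
  qed
qed

section \<open>Gluing the bijections of the edges\<close>

definition shared :: "nat set \<Rightarrow> nat \<Rightarrow> bool" where
  "shared e i \<longleftrightarrow> (\<exists>e2\<in>oddE n d. e2 \<noteq> e \<and> i \<in> e2)"

lemma shared_ka:
  assumes "e \<in> oddE n d" "i \<in> e" "shared e i"
  shows "ka i \<in> eta e" "twin i (ka i)" "ka' (ka i) = i"
proof -
  obtain e2 where e2: "e2 \<in> oddE n d" "e \<noteq> e2" "i \<in> e2" using assms(3) unfolding shared_def by blast
  show "ka i \<in> eta e" by (rule ka(1)[OF assms(1,2)])
  show "twin i (ka i)" by (rule ka_twin[OF assms(1) e2(1,2) assms(2) e2(3)])
  show "ka' (ka i) = i" by (rule ka'_ka[OF assms(1) e2(1,2) assms(2) e2(3)])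
qed

text \<open>At an endpoint shared with another odd edge the bijection is forced, which makes the bijections of
  different edges compatible; elsewhere only the types matter.\<close>

lemma edge_bij:
  assumes e: "e \<in> oddE n d"
  shows "\<exists>b. bij_betw b e (eta e) \<and> (\<forall>i\<in>e. twin i (b i)) \<and> (\<forall>i\<in>e. shared e i \<longrightarrow> b i = ka i)"
proof -
  obtain i where "i \<in> e" using e by (auto simp: oddE_def)
  then obtain j where j: "e = {i, j}" "i \<noteq> j" "i < n" "j < n" by (rule oddE_pair[OF e])
  obtain k where "k \<in> eta e" using eta_E(1)[OF e] by (auto simp: oddE_def)
  then obtain l where kl: "eta e = {k, l}" "k \<noteq> l" "k < n" "l < n" by (rule R.oddE_pair[OF eta_E(1)[OF e]])
  have *: "\<exists>b. bij_betw b e (eta e) \<and> (\<forall>i\<in>e. twin i (b i)) \<and> (\<forall>i\<in>e. shared e i \<longrightarrow> b i = ka i)"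
    if "e = {i, j}" "i \<noteq> j" "eta e = {k, l}" "k \<noteq> l" "twin i k" "twin j l" "shared e i \<Longrightarrow> k = ka i" "shared e j \<Longrightarrow> l = ka j"
    for i j k l
    using that by (intro exI[of _ "\<lambda>x. if x = i then k else l"]) (auto simp: bij_betw_def inj_on_def)
  have ty: "(twin a k \<and> twin b l) \<or> (twin a l \<and> twin b k)" if "e = {a, b}" "a \<noteq> b" "eta e = {k, l}" "k \<noteq> l" for a b k l
    using types[of a b k l] that e by auto
  have one: ?thesis if a: "e = {a, b}" "a \<noteq> b" "shared e a" "\<not> shared e b" for a b
  proof -
    have ab: "a < n" "b < n" using oddE_pair_gt[of a b] e a by auto
    note s = shared_ka[OF e _ a(3)]
    obtain l where l: "eta e = {ka a, l}" "ka a \<noteq> l" "l < n" "ka a < n"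
      using s(1) a by (auto intro: R.oddE_pair[OF eta_E(1)[OF e], of "ka a"])
    have "twin b l"
      using ty[OF a(1,2) l(1,2)] s(2) a l ab twin_trans twin_sym by (metis insertI1)
    then show ?thesis using *[OF a(1,2) l(1,2)] s(2) a by auto
  qed
  show ?thesis
  proof (cases "shared e i"; cases "shared e j")
    assume s: "shared e i" "shared e j"
    have "ka i \<noteq> ka j" using shared_ka(3)[OF e _ s(1)] shared_ka(3)[OF e _ s(2)] j by (metis insertCI)
    moreover have "eta e = {ka i, ka j}"
      using shared_ka(1)[OF e _ s(1)] shared_ka(1)[OF e _ s(2)] j kl calculation by auto
    ultimately show ?thesis using *[OF j(1,2), of "ka i" "ka j"] shared_ka(2)[OF e _ s(1)] shared_ka(2)[OF e _ s(2)] j by auto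
  next
    assume "shared e i" "\<not> shared e j" then show ?thesis using one[OF j(1,2)] by blast
  next
    assume "\<not> shared e i" "shared e j" moreover have "e = {j, i}" using j by auto
    ultimately show ?thesis using one[of j i] j(2) by blast
  next
    assume "\<not> shared e i" "\<not> shared e j"
    moreover have "eta e = {l, k}" "l \<noteq> k" using kl by auto
    ultimately show ?thesis using ty[OF j(1,2) kl(1,2)] *[OF j(1,2) kl(1,2)] *[OF j(1,2), of l k] by blast
  qed
qed

text \<open>Twins are compared only on third vertices, so endpoints are replaced one at a time, and
  the overlap \<open>j = a\<close> is treated through transitivity.\<close>

lemma twin_labels:
  assumes "i < n" "j < n" "a < n" "b < n" "twin i a" "twin j b" "i \<noteq> j" "a \<noteq> b"
  shows "2 ^ t dvd d a b \<longleftrightarrow> 2 ^ t dvd d i j"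
proof -
  have tw: "2 ^ t dvd d x z \<longleftrightarrow> 2 ^ t dvd d y z" if "twin x y" "z < n" "z \<noteq> x" "z \<noteq> y" for x y z
    using that unfolding twin_def dom2_def by blast
  show ?thesis
  proof (cases "j = a")
    case False
    then have "2 ^ t dvd d i j \<longleftrightarrow> 2 ^ t dvd d a j" using tw[of i a j] assms by auto
    also have "\<dots> \<longleftrightarrow> 2 ^ t dvd d j a" using sym assms by simp
    also have "\<dots> \<longleftrightarrow> 2 ^ t dvd d b a" using tw[of j b a] assms False by auto
    finally show ?thesis using sym assms by simp
  next
    case True
    show ?thesis
    proof (cases "i = b")
      case False
      have "twin i b" using twin_trans[of i a b] assms True by simp
      then have "2 ^ t dvd d i a \<longleftrightarrow> 2 ^ t dvd d b a" using tw[of i b a] assms False True by auto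
      then show ?thesis using True sym assms by simp
    qed (use True sym assms in simp)
  qed
qed

text \<open>The edge bijections agree at common endpoints, where they are forced, and glue to a map
  \<open>g\<close> of all endpoints of odd edges. It preserves twin classes and extends to a
  permutation that does so too. Twin classes control the 2-parts of the labels, the edge
  correspondence controls the odd parts.\<close>

theorem matching:
  obtains p where "bij_betw p {..<n} {..<n}" "\<And>i j. i < n \<Longrightarrow> j < n \<Longrightarrow> d' (p i) (p j) = d i j"
proof -
  interpret S: odd_matching n d' d MK L' L eta' eta by (rule swap)
  obtain b where b: "\<And>e. e \<in> oddE n d \<Longrightarrow> bij_betw (b e) e (eta e) \<and> (\<forall>i\<in>e. twin i (b e i)) \<and> (\<forall>i\<in>e. shared e i \<longrightarrow> b e i = ka i)"
    using edge_bij by metis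
  let ?U = "\<Union> (oddE n d)" let ?U' = "\<Union> (oddE n d')"
  define E where "E i = (SOME e. e \<in> oddE n d \<and> i \<in> e)" for i
  define g where "g i = b (E i) i" for i
  have E: "E i \<in> oddE n d" "i \<in> E i" if "i \<in> ?U" for i
    using someI_ex[of "\<lambda>e. e \<in> oddE n d \<and> i \<in> e"] that unfolding E_def by auto
  have g: "g i = b e i" if e: "e \<in> oddE n d" "i \<in> e" for e i
  proof (cases "E i = e")
    case False
    have Ei: "E i \<in> oddE n d" "i \<in> E i" using E[of i] e by auto
    have "shared e i" "shared (E i) i" using False Ei e unfolding shared_def by blast+
    then show ?thesis unfolding g_def using b[OF Ei(1)] b[OF e(1)] Ei e by simp
  qed (simp add: g_def)
  have gE: "g ` e = eta e" if "e \<in> oddE n d" for e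
  proof -
    have "g ` e = b e ` e" using g[OF that] by simp
    then show ?thesis using b[OF that] by (simp add: bij_betw_def)
  qed
  have sub: "?U \<subseteq> {..<n}" "?U' \<subseteq> {..<n}" by (auto simp: oddE_def)
  have gt: "twin i (g i)" if "i \<in> ?U" for i using b[OF E(1)[OF that]] E[OF that] by (simp add: g_def)
  have inj: "inj_on g ?U"
  proof (rule inj_onI)
    fix i j assume ij: "i \<in> ?U" "j \<in> ?U" "g i = g j"
    note Ei = E[OF ij(1)] and Ej = E[OF ij(2)]
    show "i = j"
    proof (cases "E i = E j")
      case True
      then show ?thesis using b[OF Ei(1)] Ei Ej ij(3) unfolding g_def bij_betw_def inj_on_def by metis
    next
      case False
      let ?k = "g i"
      have k: "?k \<in> eta (E i)" "?k \<in> eta (E j)"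
        using imageI[OF Ei(2), of g] imageI[OF Ej(2), of g] gE[OF Ei(1)] gE[OF Ej(1)] ij(3) by simp_all
      have ne: "eta (E i) \<noteq> eta (E j)" using False eta_E(2)[OF Ei(1)] eta_E(2)[OF Ej(1)] by metis
      \<comment> \<open>The common image vertex lies on two distinct image edges, so its preimage
        \<open>?m\<close> is forced and lies on both original edges. Injectivity on each edge
        identifies \<open>i\<close> and \<open>j\<close> with it.\<close>
      let ?m = "ka' ?k"
      have m: "?m \<in> E i" "?m \<in> E j"
        using S.ka(1)[OF eta_E(1)[OF Ei(1)] k(1)] S.ka(1)[OF eta_E(1)[OF Ej(1)] k(2)] eta_E(2)[OF Ei(1)] eta_E(2)[OF Ej(1)] by auto
      have km: "ka ?m = ?k" by (rule S.ka'_ka[OF eta_E(1)[OF Ei(1)] eta_E(1)[OF Ej(1)] ne k])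
      have sh: "shared (E i) ?m" "shared (E j) ?m" using False m Ei Ej unfolding shared_def by blast+
      have "b (E i) ?m = b (E i) i" using b[OF Ei(1)] sh(1) m km by (simp add: g_def)
      then have 1: "?m = i" using b[OF Ei(1)] m Ei unfolding bij_betw_def inj_on_def by blast
      have "b (E j) ?m = b (E j) j" using b[OF Ej(1)] sh(2) m km ij(3) by (simp add: g_def)
      then have 2: "?m = j" using b[OF Ej(1)] m Ej unfolding bij_betw_def inj_on_def by blast
      show ?thesis using 1 2 by simp
    qed
  qed
  have img: "g ` ?U = ?U'"
  proof -
    have "g ` ?U = \<Union> (eta ` oddE n d)" using gE by (auto simp: image_Union)
    moreover have "eta ` oddE n d = oddE n d'" using eta_E R.eta_E by (auto simp: image_iff) metis
    ultimately show ?thesis by simp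
  qed
  have "bij_betw g ?U ?U'" using inj img by (simp add: bij_betw_def)
  \<comment> \<open>The twin class itself is the colour that the extension has to preserve.\<close>
  define c where "c i = {j. j < n \<and> twin i j}" for i
  have ceq: "c i = c j" if "i < n" "j < n" "twin i j" for i j
    using that twin_trans twin_sym unfolding c_def by blast
  have cg: "c (g i) = c i" if "i \<in> ?U" for i
    using gt[OF that] ceq[of i "g i"] sub that img by blast
  obtain p where p: "bij_betw p {..<n} {..<n}" "\<And>i. i \<in> ?U \<Longrightarrow> p i = g i" "\<And>i. i \<in> {..<n} \<Longrightarrow> c (p i) = c i"
    by (rule extend_class_bij[where c = c and g = g and U = ?U and U' = ?U' and A = "{..<n}"])
      (use sub cg \<open>bij_betw g ?U ?U'\<close> in auto)
  have pn: "p i < n" if "i < n" for i using p(1) that by (auto simp: bij_betw_def)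
  have pinj: "p i = p j \<longleftrightarrow> i = j" if "i < n" "j < n" for i j using p(1) that by (auto simp: bij_betw_def inj_on_def)
  have pt: "twin i (p i)" if "i < n" for i
  proof -
    have "p i \<in> c (p i)" using pn[OF that] by (simp add: c_def)
    then have "p i \<in> c i" using p(3)[of i] that by simp
    then show ?thesis by (simp add: c_def)
  qed
  have pe: "p ` e = eta e" if "e \<in> oddE n d" for e
    using gE[OF that] p(2) that by (metis (no_types, lifting) UnionI image_cong)
  have "d' (p i) (p j) = d i j" if ij: "i < n" "j < n" for i j
  proof (cases "i = j")
    case True then show ?thesis using self R.self pn ij by simp
  next
    case False
    then have pp: "p i \<noteq> p j" using pinj ij by simp
    have two: "2 ^ t dvd d' (p i) (p j) \<longleftrightarrow> 2 ^ t dvd d i j" for t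
      using twin_labels[OF ij pn[OF ij(1)] pn[OF ij(2)] pt[OF ij(1)] pt[OF ij(2)] False pp] eqD pn ij pp by simp
    have zero: "d' (p i) (p j) = 0 \<longleftrightarrow> d i j = 0" using two two_powers_zero by metis
    have edge: "{p i, p j} \<in> oddE n d' \<longleftrightarrow> {i, j} \<in> oddE n d"
    proof
      assume "{i, j} \<in> oddE n d" then show "{p i, p j} \<in> oddE n d'" using pe eta_E(1) by fastforce
    next
      assume h: "{p i, p j} \<in> oddE n d'"
      let ?e = "eta' {p i, p j}"
      have e: "?e \<in> oddE n d" "eta ?e = {p i, p j}" using R.eta_E[OF h] by auto
      have "p ` ?e = p ` {i, j}" using pe[OF e(1)] e(2) by simp
      moreover have "?e \<subseteq> {..<n}" using e(1) by (auto simp: oddE_def)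
      ultimately have "?e = {i, j}" using p(1) ij inj_on_image_eq_iff[of p "{..<n}" ?e "{i, j}"] by (auto simp: bij_betw_def)
      then show "{i, j} \<in> oddE n d" using e by simp
    qed
    have odd: "q dvd d' (p i) (p j) \<longleftrightarrow> q dvd d i j" if q: "odd q" "d i j \<noteq> 0" for q
    proof (cases "{i, j} \<in> oddE n d")
      case True
      have h: "eta {i, j} = {p i, p j}" "eta' {p i, p j} = {i, j}" using pe[OF True] eta_E(2)[OF True] by auto
      show ?thesis using eta_odd[OF True False h(1) q(1)] R.eta_odd[OF _ pp h(2) q(1)] edge True by blast
    next
      case f: False
      have "q dvd d i j \<Longrightarrow> q = 1" "q dvd d' (p i) (p j) \<Longrightarrow> q = 1"
        using f edge oddE_eqI[OF False] R.oddE_eqI[OF pp] ij pn False pp zero q by (metis One_nat_def less_one nat_neq_iff odd_pos)+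
      then show ?thesis by auto
    qed
    show ?thesis
    proof (cases "d i j = 0")
      case f: False
      show ?thesis
        by (rule dvd_antisym; rule dvd_via_parts) (use two odd zero f in auto)
    qed (use zero in simp)
  qed
  then show ?thesis using that p(1) by blast
qed

end

section \<open>Pairs of mutually inverse homomorphisms on conjugacy classes\<close>

lemma UNIV_bit_eq: "UNIV = {0, 1 :: bit}" by (auto simp: set_eq_iff)

lemma left_inverse_apply:
  fixes M M' :: "nat \<Rightarrow> nat \<Rightarrow> bit"
  assumes inv: "\<And>i j. i < n \<Longrightarrow> j < n \<Longrightarrow> (\<Sum>k<n'. M' i k * M k j) = of_bool (i = j)" and i: "i < n"
  shows "(\<Sum>k<n'. M' i k * (\<Sum>j<n. M k j * v j)) = v i"
proof -
  have "(\<Sum>k<n'. M' i k * (\<Sum>j<n. M k j * v j)) = (\<Sum>k<n'. \<Sum>j<n. M' i k * M k j * v j)"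
    by (simp add: sum_distrib_left mult.assoc)
  also have "\<dots> = (\<Sum>j<n. (\<Sum>k<n'. M' i k * M k j) * v j)"
    by (subst sum.swap) (simp add: sum_distrib_right)
  also have "\<dots> = (\<Sum>j<n. of_bool (i = j) * v j)" using inv i by (intro sum.cong) auto
  also have "\<dots> = (\<Sum>j<n. if j = i then v j else 0)" by (intro sum.cong) auto
  also have "\<dots> = v i" using i by simp
  finally show ?thesis .
qed

text \<open>A left inverse makes the map of F_2-vectors injective, so 2^n is at most 2^n'.\<close>

lemma left_inverse_dim_le:
  fixes M M' :: "nat \<Rightarrow> nat \<Rightarrow> bit"
  assumes inv: "\<And>i j. i < n \<Longrightarrow> j < n \<Longrightarrow> (\<Sum>k<n'. M' i k * M k j) = of_bool (i = j)"
  shows "n \<le> n'"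
proof -
  define F where "F v = (\<lambda>k\<in>{..<n'}. \<Sum>j<n. M k j * v j)" for v :: "nat \<Rightarrow> bit"
  have bk: "(\<Sum>k<n'. M' i k * F v k) = v i" if "i < n" for v i
    using left_inverse_apply[where n = n and n' = n' and M = M and M' = M' and v = v, OF inv that] by (simp add: F_def)
  have "inj_on F ({..<n} \<rightarrow>\<^sub>E UNIV)"
  proof (rule inj_onI)
    fix v w assume vw: "v \<in> {..<n} \<rightarrow>\<^sub>E UNIV" "w \<in> {..<n} \<rightarrow>\<^sub>E UNIV" "F v = F w"
    have "v i = w i" if "i < n" for i using bk[OF that, of v] bk[OF that, of w] vw(3) by simp
    then show "v = w" by (intro PiE_ext[OF vw(1,2)]) simp
  qed
  moreover have "F ` ({..<n} \<rightarrow>\<^sub>E UNIV) \<subseteq> {..<n'} \<rightarrow>\<^sub>E UNIV" unfolding F_def by (simp add: PiE_def image_subset_iff)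
  moreover have "finite ({..<n'} \<rightarrow>\<^sub>E (UNIV :: bit set))" by (intro finite_PiE) (simp_all add: UNIV_bit_eq)
  ultimately have "card ({..<n} \<rightarrow>\<^sub>E (UNIV :: bit set)) \<le> card ({..<n'} \<rightarrow>\<^sub>E (UNIV :: bit set))" by (rule card_inj_on_le)
  moreover have "card (UNIV :: bit set) = 2" by (simp add: UNIV_bit_eq)
  ultimately show ?thesis by (simp add: card_PiE)
qed

text \<open>Some term of the Leibniz formula for the determinant is nonzero.\<close>

lemma left_inverse_permutation:
  fixes M M' :: "nat \<Rightarrow> nat \<Rightarrow> bit"
  assumes inv: "\<And>i j. i < n \<Longrightarrow> j < n \<Longrightarrow> (\<Sum>k<n. M' i k * M k j) = of_bool (i = j)"
  obtains p where "p permutes {..<n}" "\<And>i. i < n \<Longrightarrow> M (p i) i = 1"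
proof -
  define A where "A = mat n n (\<lambda>(i, k). M k i)"
  define B where "B = mat n n (\<lambda>(k, i). M' i k)"
  have AB: "A \<in> carrier_mat n n" "B \<in> carrier_mat n n" by (auto simp: A_def B_def)
  have "A * B = 1\<^sub>m n"
  proof (rule eq_matI)
    fix i j assume ij: "i < dim_row (1\<^sub>m n)" "j < dim_col (1\<^sub>m n)"
    then have "(A * B) $$ (i, j) = (\<Sum>k = 0..<n. M k i * M' j k)"
      by (simp add: A_def B_def scalar_prod_def)
    also have "\<dots> = (\<Sum>k<n. M' j k * M k i)" by (simp add: atLeast0LessThan mult.commute)
    finally show "(A * B) $$ (i, j) = (1\<^sub>m n :: bit mat) $$ (i, j)" using inv ij by auto
  qed (simp_all add: A_def B_def)
  then have "det A * det B = 1" using det_mult[OF AB] by simp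
  then have "det A \<noteq> 0" by (metis mult_zero_left zero_neq_one)
  then obtain p where p: "p permutes {0..<n}" "signof p * (\<Prod>i = 0..<n. A $$ (i, p i)) \<noteq> 0"
    unfolding det_def'[OF AB(1)] by (blast elim: sum.not_neutral_contains_not_neutral)
  have "M (p i) i = 1" if "i < n" for i
  proof -
    have "A $$ (i, p i) \<noteq> 0" using p(2) that by (metis atLeast0LessThan finite_lessThan lessThan_iff mult_zero_right prod_zero)
    moreover have "p i < n" using permutes_in_image[OF p(1), of i] that by simp
    ultimately show ?thesis using that by (simp add: A_def)
  qed
  then show ?thesis using that p(1) by (simp add: atLeast0LessThan)
qed

lemma mutual_inj_image:
  assumes "finite S" "finite S'" "inj_on f S'" "f ` S' \<subseteq> S" "inj_on g S" "g ` S \<subseteq> S'"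
  shows "f ` S' = S"
proof -
  have "card S' = card S" using assms by (intro card_bij_eq[of f S' S g]) auto
  then have "card (f ` S') = card S" using assms(3) by (simp add: card_image)
  then show ?thesis using assms(1,4) card_subset_eq by blast
qed

context even_coxeter begin

text \<open>A rotation with trivial square has even exponent when 4 divides the label, so parity 1
  excludes it. The involution is therefore a reflection, and a reflection has different parities at
  \<open>i\<close> and \<open>j\<close>.\<close>

lemma dihedral_involution:
  assumes ij: "i < n" "j < n" "i \<noteq> j" "4 dvd d i j" and g: "g \<in> W {i, j}" "g \<otimes> g = \<one>" "par i g = 1"
  shows "par j g = 0"
proof (rule dihedral_par_cases[OF ij(1-3) g(1)])
  fix z :: int assume z: "g = rot i j [^] z" "par i g = of_int z" "par j g = of_int z"
  then have "rot i j [^] (z + z) = \<one>" using g(2) ij int_pow_mult[of "rot i j" z z] by simp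
  then have "int (d i j) dvd z + z" by (simp only: rot_order_int[OF ij(1,2)])
  moreover have "int 4 dvd int (d i j)" using ij(4) by (simp only: of_nat_dvd_iff)
  ultimately have "int 4 dvd z + z" by (rule dvd_trans[rotated])
  then have "even z" by presburger
  then show ?thesis using g(3) z(2) even_bit_iff[of z] by simp
next
  fix z :: int assume "par i g = of_int z + 1" "par j g = of_int z"
  then show ?thesis using g(3) by simp
qed

lemma dihedral_reflection_product:
  assumes ij: "i < n" "j < n" "i \<noteq> j" and g: "g \<in> W {i, j}" "par i g = 1" "par j g = 0"
    and h: "h \<in> W {i, j}" "par i h = 0" "par j h = 1"
  obtains z :: int where "odd z" "g \<otimes> h = rot i j [^] z"
proof -
  obtain a :: int where a: "g = rot i j [^] a \<otimes> s i" "even a"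
    using dihedral_par_cases[OF ij g(1)] g(2,3) by (metis even_bit_iff zero_neq_one)
  obtain b :: int where b: "h = rot i j [^] b \<otimes> s i" "odd b"
    using dihedral_par_cases[OF ij h(1)] h(2,3) by (metis even_bit_iff zero_neq_one)
  have "g \<otimes> h = rot i j [^] (a - b)" unfolding a(1) b(1) using ij by (intro rot_mult_int)
  then show ?thesis using a b that[of "a - b"] by simp
qed

lemma dihedral_conj_rot:
  assumes ij: "i < n" "j < n" "i \<noteq> j" and g: "g \<in> W {i, j}"
  shows "g \<otimes> rot i j [^] (z::int) \<otimes> inv g = rot i j [^] (if par i g + par j g = 0 then z else - z)"
proof (rule dihedral_par_cases[OF ij g])
  fix a :: int assume a: "g = rot i j [^] a" "par i g = of_int a" "par j g = of_int a"
  have "g \<otimes> rot i j [^] z = rot i j [^] z \<otimes> g" unfolding a(1) using ij by (simp add: int_pow_mult[symmetric] add.commute)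
  then have "g \<otimes> rot i j [^] z \<otimes> inv g = rot i j [^] z" using a(1) ij by (simp add: m_assoc)
  then show ?thesis using a by simp
next
  fix a :: int assume a: "g = rot i j [^] a \<otimes> s i" "par i g = of_int a + 1" "par j g = of_int a"
  have gc: "g \<in> carrier G" using a ij by simp
  have "g \<otimes> rot i j [^] z = rot i j [^] a \<otimes> (s i \<otimes> rot i j [^] z)" unfolding a(1) using ij by (simp add: m_assoc)
  also have "\<dots> = rot i j [^] a \<otimes> (rot i j [^] (- z) \<otimes> s i)" using ij by (simp only: s_rot)
  also have "\<dots> = (rot i j [^] a \<otimes> rot i j [^] (- z)) \<otimes> s i" using ij by (simp add: m_assoc)
  also have "\<dots> = (rot i j [^] (- z) \<otimes> rot i j [^] a) \<otimes> s i" using ij by (simp only: int_pow_mult[symmetric] m_closed s_closed add.commute)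
  also have "\<dots> = rot i j [^] (- z) \<otimes> g" using a(1) ij by (simp add: m_assoc)
  finally have "g \<otimes> rot i j [^] z \<otimes> inv g = rot i j [^] (- z)" using gc ij by (simp add: m_assoc)
  moreover have "par i g + par j g = 1" using a by (simp add: add.commute add.left_commute)
  ultimately show ?thesis by simp
qed

lemma dihedral_odd_order:
  assumes ij: "i < n" "j < n" "i \<noteq> j" and g: "g \<in> W {i, j}" "g [^] (q::nat) = \<one>" "odd q"
  obtains z :: int where "g = rot i j [^] z" "int (d i j) dvd z * int q"
proof -
  have gc: "g \<in> carrier G" using g(1) ij W_closed[of g "{i, j}"] by auto
  have p0: "par k g = 0" for k
  proof -
    have "of_nat q * par k g = 0" using par_pow[OF gc, of k q] g(2) by simp
    then show ?thesis using g(3) of_nat_bit_eq_0_iff[of q] by simp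
  qed
  show ?thesis
  proof (rule dihedral_par_cases[OF ij g(1)])
    fix z :: int assume z: "g = rot i j [^] z"
    have "rot i j [^] (z * int q) = \<one>"
      using g(2) ij int_pow_pow[of "rot i j" z "int q"] unfolding z by (simp add: int_pow_int)
    then show ?thesis using that z rot_order_int ij by simp
  next
    fix z :: int assume "par i g = of_int z + 1" "par j g = of_int z"
    then show ?thesis using p0 by simp
  qed
qed

lemma W_single: assumes "i < n" "g \<in> W {i}" shows "g \<otimes> g = \<one>"
proof -
  have "g = \<one> \<or> g = s i" using assms(2) by (rule W_induct) (use assms in auto)
  then show ?thesis using assms(1) by auto
qed

lemma odd_involution_trivial:
  assumes "g \<in> carrier G" "g \<otimes> g = \<one>" "g [^] (q::nat) = \<one>" "odd q" shows "g = \<one>"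
proof -
  obtain k where "q = Suc (k + k)" using assms(4) by (metis oddE Suc_eq_plus1 mult_2)
  then have "g [^] q = (g [^] k \<otimes> g [^] k) \<otimes> g" using assms(1) by (simp add: nat_pow_mult)
  moreover have "g [^] k \<otimes> g [^] k = (g \<otimes> g) [^] k" using assms(1) by (simp add: pow_mult_distrib)
  ultimately show ?thesis using assms by simp
qed

end

locale coxeter_pair = A: even_coxeter G n s m + B: even_coxeter G' n' s' m'
  for G :: "('a, 'b) monoid_scheme" and n s m and G' :: "('c, 'e) monoid_scheme" and n' s' m' +
  fixes f :: "'a \<Rightarrow> 'c" and h :: "'c \<Rightarrow> 'a" and N :: nat
  assumes f: "f \<in> hom G G'" and h: "h \<in> hom G' G" and N: "n \<le> N" "n' \<le> N"
    and hf: "t \<in> fin_tuples G N \<Longrightarrow> tconj G N (h \<circ> f \<circ> t) t"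
    and fh: "t' \<in> fin_tuples G' N \<Longrightarrow> tconj G' N (f \<circ> h \<circ> t') t'"
begin

text \<open>Whatever is proved about \<open>f\<close> becomes available for \<open>h\<close> through
  this exchange.\<close>

lemma swap: "coxeter_pair G' n' s' m' G n s m h f N"
  by unfold_locales (use f h N hf fh in auto)

abbreviation "L k i \<equiv> B.par k (f (s i))"
abbreviation "L' i k \<equiv> A.par i (h (s' k))"

lemma f_hom: "group_hom G G' f"
  using f by (simp add: group_hom_def group_hom_axioms_def A.is_group B.is_group)

lemma f_closed [simp]: "g \<in> carrier G \<Longrightarrow> f g \<in> carrier G'" using f by (auto simp: hom_def)

lemma f_mult [simp]: "g \<in> carrier G \<Longrightarrow> g' \<in> carrier G \<Longrightarrow> f (g \<otimes>\<^bsub>G\<^esub> g') = f g \<otimes>\<^bsub>G'\<^esub> f g'" using f by (auto simp: hom_def)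

lemma f_one [simp]: "f \<one>\<^bsub>G\<^esub> = \<one>\<^bsub>G'\<^esub>" using f_hom by (rule group_hom.hom_one)

lemma f_inv [simp]: "g \<in> carrier G \<Longrightarrow> f (inv\<^bsub>G\<^esub> g) = inv\<^bsub>G'\<^esub> (f g)" using f_hom by (rule group_hom.hom_inv)

lemma f_pow: "g \<in> carrier G \<Longrightarrow> f (g [^]\<^bsub>G\<^esub> (k::nat)) = f g [^]\<^bsub>G'\<^esub> k" using f_hom by (rule group_hom.hom_nat_pow)

lemma par_f:
  assumes "g \<in> carrier G" shows "B.par k (f g) = (\<Sum>i<n. L k i * A.par i g)"
  using assms
proof (induction rule: A.word_induct)
  case (mult i g)
  have "(\<Sum>j<n. L k j * A.par j (s i \<otimes>\<^bsub>G\<^esub> g)) = (\<Sum>j<n. L k j * of_bool (i = j) + L k j * A.par j g)"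
    using mult by (intro sum.cong) (auto simp: A.par_s algebra_simps)
  also have "\<dots> = (\<Sum>j<n. if j = i then L k j else 0) + (\<Sum>j<n. L k j * A.par j g)"
    unfolding sum.distrib by (intro arg_cong2[of _ _ _ _ "(+)"] sum.cong) auto
  also have "\<dots> = L k i + (\<Sum>j<n. L k j * A.par j g)" using mult(1) by simp
  finally show ?case using mult by simp
qed simp

text \<open>The hypothesis is applied to the tuple with the generators in \<open>K\<close> at their
  own positions and 1 elsewhere. One conjugating element then serves all these generators and hence
  all of \<open>W K\<close>.\<close>

lemma hf_conj:
  assumes K: "K \<subseteq> {..<n}" "finite (A.W K)"
  obtains w where "w \<in> carrier G" "\<And>g. g \<in> A.W K \<Longrightarrow> h (f g) = w \<otimes>\<^bsub>G\<^esub> g \<otimes>\<^bsub>G\<^esub> inv\<^bsub>G\<^esub> w"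
proof -
  interpret S: coxeter_pair G' n' s' m' G n s m h f N by (rule swap)
  let ?t = "\<lambda>k. if k \<in> K then s k else \<one>\<^bsub>G\<^esub>"
  have t: "?t \<in> fin_tuples G N" by (rule A.W_tuple[OF K(2,1)])
  have e: "h \<circ> f \<in> hom G G" by (rule hom_comp[OF f h])
  have "tconj G N ?t (h \<circ> f \<circ> ?t)"
    using A.tconj_sym[OF hom_fin_tuples[OF A.is_group A.is_group e t]] hf[OF t] by simp
  then obtain w where w: "w \<in> carrier G" "\<And>k. k < N \<Longrightarrow> (h \<circ> f \<circ> ?t) k = w \<otimes>\<^bsub>G\<^esub> ?t k \<otimes>\<^bsub>G\<^esub> inv\<^bsub>G\<^esub> w" unfolding tconj_def by blast
  have "h (f g) = w \<otimes>\<^bsub>G\<^esub> g \<otimes>\<^bsub>G\<^esub> inv\<^bsub>G\<^esub> w" if "g \<in> A.W K" for g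
    using that K(1)
  proof (induction rule: A.W_induct)
    case one then show ?case using w by simp
  next
    case (mult i g)
    have i: "i < n" "i < N" using mult(1) K(1) N by auto
    have gc: "g \<in> carrier G" using A.W_closed mult(2) K(1) by blast
    have "h (f (s i)) = w \<otimes>\<^bsub>G\<^esub> s i \<otimes>\<^bsub>G\<^esub> inv\<^bsub>G\<^esub> w" using w(2)[OF i(2)] mult(1) by simp
    then have "h (f (s i \<otimes>\<^bsub>G\<^esub> g)) = (w \<otimes>\<^bsub>G\<^esub> s i \<otimes>\<^bsub>G\<^esub> inv\<^bsub>G\<^esub> w) \<otimes>\<^bsub>G\<^esub> (w \<otimes>\<^bsub>G\<^esub> g \<otimes>\<^bsub>G\<^esub> inv\<^bsub>G\<^esub> w)"
      using mult(3) i gc by simp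
    also have "\<dots> = w \<otimes>\<^bsub>G\<^esub> (s i \<otimes>\<^bsub>G\<^esub> g) \<otimes>\<^bsub>G\<^esub> inv\<^bsub>G\<^esub> w"
      using w i gc by (simp add: A.m_assoc A.inv_solve_left')
    finally show ?case .
  qed
  then show ?thesis using that w by blast
qed

lemma L'L: assumes "i < n" "j < n" shows "(\<Sum>k<n'. L' i k * L k j) = of_bool (i = j)"
proof -
  interpret S: coxeter_pair G' n' s' m' G n s m h f N by (rule swap)
  have "finite (A.W {j})" using A.finite_W_pair[of j j] assms by simp
  then obtain w where w: "w \<in> carrier G" "\<And>g. g \<in> A.W {j} \<Longrightarrow> h (f g) = w \<otimes>\<^bsub>G\<^esub> g \<otimes>\<^bsub>G\<^esub> inv\<^bsub>G\<^esub> w"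
    using hf_conj[of "{j}"] assms by auto
  have "A.par i (h (f (s j))) = A.par i (s j)" using w A.W_s[of j "{j}"] assms by simp
  then show ?thesis using S.par_f[of "f (s j)" i] assms by (simp add: A.par_s)
qed

lemma rank_eq: "n = n'"
proof -
  interpret S: coxeter_pair G' n' s' m' G n s m h f N by (rule swap)
  show ?thesis using left_inverse_dim_le[where n = n and n' = n' and M = L and M' = L']
      left_inverse_dim_le[where n = n' and n' = n and M = L' and M' = L] L'L S.L'L by simp
qed

text \<open>If \<open>4 dvd B.d k l\<close>, the retraction to \<open>{k, l}\<close> sends \<open>s i\<close> and \<open>s j\<close> to reflections of the two types, whose
  product is an odd power of the basic rotation. For \<open>t \<le> 1\<close> the labels are even anyway.\<close>

lemma two_part:
  assumes ij: "i < n" "j < n" "i \<noteq> j" and kl: "k < n'" "l < n'" "k \<noteq> l" and L: "L k i = 1" "L l j = 1"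
    and t: "2 ^ t dvd B.d k l"
  shows "2 ^ t dvd A.d i j"
proof (cases "t \<le> 1")
  case True
  then have "t = 0 \<or> t = 1" by auto
  then show ?thesis using A.d_even[OF ij] by auto
next
  case False
  then have "(4::nat) dvd 2 ^ t" using le_imp_power_dvd[of 2 t "2::nat"] by simp
  then have d4: "4 dvd B.d k l" using t dvd_trans by blast
  have J: "{k, l} \<subseteq> {..<n'}" using kl by simp
  let ?r = "\<lambda>g. B.ret {k, l} (f g)"
  have rW: "?r g \<in> B.W {k, l}" if "g \<in> carrier G" for g
    using B.ret_in_W[of "f g" "{k, l}"] that J by (simp add: Int_absorb2)
  have rp: "B.par k (?r g) = B.par k (f g)" "B.par l (?r g) = B.par l (f g)" if "g \<in> carrier G" for g
    using B.ret_par[of "f g"] that by auto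
  have inv: "?r (s x) \<otimes>\<^bsub>G'\<^esub> ?r (s x) = \<one>\<^bsub>G'\<^esub>" if "x < n" for x
    using that A.s_sq[of x] by (metis A.s_closed B.ret_mult B.ret_one f_closed f_mult f_one)
  have p: "B.par l (?r (s i)) = 0" using B.dihedral_involution[OF kl d4 rW inv] ij rp L by simp
  have d4': "4 dvd B.d l k" using d4 B.d_sym kl by simp
  have "{l, k} = {k, l}" by auto
  then have p': "B.par k (?r (s j)) = 0" using B.dihedral_involution[OF kl(2,1) _ d4', of "?r (s j)"] rW inv ij rp L kl by simp
  obtain z :: int where z: "odd z" "?r (s i) \<otimes>\<^bsub>G'\<^esub> ?r (s j) = B.rot k l [^]\<^bsub>G'\<^esub> z"
    by (rule B.dihedral_reflection_product[OF kl rW _ p rW p']) (use ij rp L in auto)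
  have "?r (A.rot i j) = B.rot k l [^]\<^bsub>G'\<^esub> z" using z ij by simp
  then have "(B.rot k l [^]\<^bsub>G'\<^esub> z) [^]\<^bsub>G'\<^esub> A.d i j = ?r (A.rot i j [^]\<^bsub>G\<^esub> A.d i j)"
    using ij group_hom.hom_nat_pow[of G' G' "B.ret {k, l}"] B.ret_hom
    by (simp add: f_pow group_hom_def group_hom_axioms_def B.is_group)
  also have "\<dots> = \<one>\<^bsub>G'\<^esub>" using A.s_pow[OF ij(1,2)] by simp
  finally have "B.rot k l [^]\<^bsub>G'\<^esub> (z * int (A.d i j)) = \<one>\<^bsub>G'\<^esub>"
    using B.int_pow_pow[of "B.rot k l" z "int (A.d i j)"] kl by (simp add: int_pow_int)
  then have "int (B.d k l) dvd z * int (A.d i j)" using B.rot_order_int kl by simp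
  moreover have "int (2 ^ t) dvd int (B.d k l)" using t by (simp only: of_nat_dvd_iff)
  ultimately have "int (2 ^ t) dvd z * int (A.d i j)" using dvd_trans by blast
  moreover have "coprime (int (2 ^ t)) z" using z(1) by simp
  ultimately have "int (2 ^ t) dvd int (A.d i j)" using coprime_dvd_mult_right_iff by blast
  then show ?thesis by (simp only: of_nat_dvd_iff)
qed

text \<open>The image is a finite subgroup, hence conjugate into a finite parabolic subgroup of the
  other system. Conjugation does not change parities, and those of letters outside \<open>K'\<close>
  vanish there.\<close>

lemma spherical_image:
  assumes K: "K \<subseteq> {..<n}" "finite (A.W K)"
  obtains w K' where "w \<in> carrier G'" "K' \<subseteq> {..<n'}" "finite (B.W K')"
    "\<And>g. g \<in> A.W K \<Longrightarrow> inv\<^bsub>G'\<^esub> w \<otimes>\<^bsub>G'\<^esub> f g \<otimes>\<^bsub>G'\<^esub> w \<in> B.W K'"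
    "\<And>i k. i \<in> K \<Longrightarrow> L k i \<noteq> 0 \<Longrightarrow> k \<in> K'"
proof -
  interpret group_hom G G' f by (rule f_hom)
  have "subgroup (f ` A.W K) G'" by (rule subgroup_img_is_subgroup[OF A.W_subgroup[OF K(1)]])
  then obtain w K' where w: "w \<in> carrier G'" "K' \<subseteq> {..<n'}" "finite (B.W K')"
    "\<And>g. g \<in> f ` A.W K \<Longrightarrow> inv\<^bsub>G'\<^esub> w \<otimes>\<^bsub>G'\<^esub> g \<otimes>\<^bsub>G'\<^esub> w \<in> B.W K'"
    using B.finite_subgroup_parabolic[of "f ` A.W K"] K(2) by auto
  have "k \<in> K'" if i: "i \<in> K" "L k i \<noteq> 0" for i k
  proof (rule ccontr)
    assume k: "k \<notin> K'"
    have "i < n" using i K by auto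
    have "inv\<^bsub>G'\<^esub> w \<otimes>\<^bsub>G'\<^esub> f (s i) \<otimes>\<^bsub>G'\<^esub> w \<in> B.W K'" using w(4) A.W_s[OF i(1) K(1)] by blast
    then have "B.par k (inv\<^bsub>G'\<^esub> w \<otimes>\<^bsub>G'\<^esub> f (s i) \<otimes>\<^bsub>G'\<^esub> w) = 0" using B.par_W w(2) k by blast
    then have "L k i = 0" using B.par_conj[of "inv\<^bsub>G'\<^esub> w" "f (s i)" k] w(1) \<open>i < n\<close> by simp
    then show False using i by simp
  qed
  then show ?thesis using that[OF w(1-3)] w(4) by blast
qed

text \<open>Both homomorphisms induce injections between the same finite sets, so by counting all the
  implications of the preceding lemmas are equivalences.\<close>

lemma align:
  obtains p where "p permutes {..<n}" "\<And>i. i < n \<Longrightarrow> L (p i) i = 1"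
    "\<And>i j t. i < n \<Longrightarrow> j < n \<Longrightarrow> i \<noteq> j \<Longrightarrow> 2 ^ t dvd B.d (p i) (p j) \<longleftrightarrow> 2 ^ t dvd A.d i j"
    "\<And>K. K \<subseteq> {..<n} \<Longrightarrow> finite (B.W (p ` K)) \<longleftrightarrow> finite (A.W K)"
proof -
  interpret S: coxeter_pair G' n' s' m' G n s m h f N by (rule swap)
  have nn: "n' = n" using rank_eq by simp
  obtain p where p: "p permutes {..<n}" "\<And>i. i < n \<Longrightarrow> L (p i) i = 1"
    by (rule left_inverse_permutation[of n L' L]) (use L'L nn in auto)
  obtain p' where p': "p' permutes {..<n}" "\<And>i. i < n \<Longrightarrow> L' (p' i) i = 1"
    by (rule left_inverse_permutation[of n L L']) (use S.L'L nn in auto)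
  note pin = permutes_in_image[OF p(1), simplified] and pin' = permutes_in_image[OF p'(1), simplified]
  note pinj = inj_eq[OF permutes_inj[OF p(1)]] and pinj' = inj_eq[OF permutes_inj[OF p'(1)]]
  have two: "2 ^ t dvd B.d (p i) (p j) \<longleftrightarrow> 2 ^ t dvd A.d i j" if ij: "i < n" "j < n" "i \<noteq> j" for i j t
  proof
    have c1: "2 ^ t dvd A.d i j" if "i < n" "j < n" "i \<noteq> j" "2 ^ t dvd B.d (p i) (p j)" for i j
      using two_part[OF that(1-3), of "p i" "p j"] p(2) that nn pin pinj by simp
    have c2: "2 ^ t dvd B.d i j" if "i < n" "j < n" "i \<noteq> j" "2 ^ t dvd A.d (p' i) (p' j)" for i j
      using S.two_part[of i j "p' i" "p' j"] p'(2) that nn pin' pinj' by simp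
    show "2 ^ t dvd B.d (p i) (p j) \<Longrightarrow> 2 ^ t dvd A.d i j" by (rule c1[OF ij])
    let ?S = "{(i, j). i < n \<and> j < n \<and> i \<noteq> j \<and> \<not> 2 ^ t dvd A.d i j}"
    let ?S' = "{(i, j). i < n \<and> j < n \<and> i \<noteq> j \<and> \<not> 2 ^ t dvd B.d i j}"
    have fin: "finite ?S" "finite ?S'" by (rule finite_subset[of _ "{..<n} \<times> {..<n}"]; auto)+
    have "map_prod p p ` ?S \<subseteq> ?S'" using c1 pin pinj by auto
    moreover have "map_prod p' p' ` ?S' \<subseteq> ?S" using c2 pin' pinj' by auto
    moreover have "inj (map_prod p p)" "inj (map_prod p' p')" using permutes_inj p(1) p'(1) by (blast intro: prod.inj_map)+
    ultimately have im: "map_prod p p ` ?S = ?S'" using fin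
      by (intro mutual_inj_image[of _ _ _ "map_prod p' p'"]) (auto intro: inj_on_subset)
    assume t: "2 ^ t dvd A.d i j"
    show "2 ^ t dvd B.d (p i) (p j)"
    proof (rule ccontr)
      assume "\<not> 2 ^ t dvd B.d (p i) (p j)"
      then have "(p i, p j) \<in> ?S'" using ij pin pinj by simp
      then have "(p i, p j) \<in> map_prod p p ` ?S" using im by simp
      then show False using t pinj by auto
    qed
  qed
  have sph: "finite (B.W (p ` K)) \<longleftrightarrow> finite (A.W K)" if K: "K \<subseteq> {..<n}" for K
  proof -
    let ?S = "{K. K \<subseteq> {..<n} \<and> finite (A.W K)}"
    let ?S' = "{K. K \<subseteq> {..<n} \<and> finite (B.W K)}"
    have fin: "finite ?S" "finite ?S'" by (rule finite_subset[of _ "Pow {..<n}"]; auto)+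
    have 1: "(`) p ` ?S \<subseteq> ?S'"
    proof safe
      fix K assume K: "K \<subseteq> {..<n}" "finite (A.W K)"
      obtain K' where K': "K' \<subseteq> {..<n'}" "finite (B.W K')" "\<And>i k. i \<in> K \<Longrightarrow> L k i \<noteq> 0 \<Longrightarrow> k \<in> K'"
        using spherical_image[OF K] by metis
      have "p ` K \<subseteq> K'" using K'(3) p(2) K(1) by force
      then show "finite (B.W (p ` K))" by (rule finite_subset[OF B.W_mono K'(2)])
    qed (use pin in auto)
    have 2: "(`) p' ` ?S' \<subseteq> ?S"
    proof safe
      fix K assume K: "K \<subseteq> {..<n}" "finite (B.W K)"
      obtain K' where K': "K' \<subseteq> {..<n}" "finite (A.W K')" "\<And>i k. i \<in> K \<Longrightarrow> L' k i \<noteq> 0 \<Longrightarrow> k \<in> K'"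
        using S.spherical_image[of K] K nn by metis
      have "p' ` K \<subseteq> K'" using K'(3) p'(2) K(1) by force
      then show "finite (A.W (p' ` K))" by (rule finite_subset[OF A.W_mono K'(2)])
    qed (use pin' in auto)
    have "inj ((`) p)" "inj ((`) p')"
      by (simp_all add: inj_def inj_image_eq_iff[OF permutes_inj[OF p(1)]] inj_image_eq_iff[OF permutes_inj[OF p'(1)]])
    then have im: "(`) p ` ?S = ?S'" using fin 1 2
      by (intro mutual_inj_image[of _ _ _ "(`) p'"]) (auto intro: inj_on_subset)
    show ?thesis
    proof
      assume "finite (A.W K)" then show "finite (B.W (p ` K))" using 1 K by auto
    next
      assume "finite (B.W (p ` K))"
      then have "p ` K \<in> (`) p ` ?S" using K pin im by auto
      then show "finite (A.W K)" using \<open>inj ((`) p)\<close> by (auto dest: injD)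
    qed
  qed
  show ?thesis using that[OF p two sph] by blast
qed

end

text \<open>Renumbering the generators turns the permutation provided by \<open>align\<close> into
  the identity.\<close>

lemma (in even_coxeter) relabel:
  assumes p: "p permutes {..<n}"
  shows "even_coxeter G n (s \<circ> p) (\<lambda>i j. m (p i) (p j))"
proof -
  let ?m = "\<lambda>i j. m (p i) (p j)"
  let ?q = "inv_into UNIV p"
  have q: "?q permutes {..<n}" by (rule permutes_inv[OF p])
  have pin: "p i < n \<longleftrightarrow> i < n" "?q i < n \<longleftrightarrow> i < n" for i using permutes_in_image[OF p] permutes_in_image[OF q] by auto
  have pq: "p (?q i) = i" "?q (p i) = i" for i using permutes_inverses[OF p] by auto
  have cp: "cox_equiv n m u v" if "cox_equiv n (\<lambda>i j. m' (q i) (q j)) u' v'" "u = map q u'" "v = map q v'" "m' = m" "\<And>i. q i < n \<longleftrightarrow> i < n"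
    for u v u' v' q m'
    using that(1,2,3)
  proof (induction arbitrary: u v)
    case (rel i j k)
    then show ?case using that cox_equiv.rel[of "q i" n "q j" m k] by (simp add: map_concat)
  next
    case (ctxt u1 v1 a b)
    have "cox_equiv n m (map q u1) (map q v1)" using ctxt by blast
    moreover have "set (map q a) \<subseteq> {..<n}" "set (map q b) \<subseteq> {..<n}" using ctxt that(5) by auto
    ultimately show ?case using cox_equiv.ctxt ctxt by auto
  next
    case (trans u1 v1 w1)
    then show ?case using cox_equiv.trans[OF trans.IH(1)[OF HOL.refl HOL.refl] trans.IH(2)[OF HOL.refl HOL.refl]] by simp
  next
    case (sym u1 v1)
    then show ?case using cox_equiv.sym[OF sym.IH[OF HOL.refl HOL.refl]] by simp
  qed (auto intro: cox_equiv.refl)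
  have cq: "cox_equiv n ?m u v" if "cox_equiv n m u' v'" "u = map ?q u'" "v = map ?q v'" for u v u' v'
    using that
  proof (induction arbitrary: u v)
    case (rel i j k)
    then show ?case using cox_equiv.rel[of "?q i" n "?q j" ?m k] pin pq by (simp add: map_concat)
  next
    case (ctxt u1 v1 a b)
    have "cox_equiv n ?m (map ?q u1) (map ?q v1)" using ctxt by blast
    moreover have "set (map ?q a) \<subseteq> {..<n}" "set (map ?q b) \<subseteq> {..<n}" using ctxt pin by auto
    ultimately show ?case using cox_equiv.ctxt ctxt by auto
  next
    case (trans u1 v1 w1)
    then show ?case using cox_equiv.trans[OF trans.IH(1)[OF HOL.refl HOL.refl] trans.IH(2)[OF HOL.refl HOL.refl]] by simp
  next
    case (sym u1 v1)
    then show ?case using cox_equiv.sym[OF sym.IH[OF HOL.refl HOL.refl]] by simp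
  qed (auto intro: cox_equiv.refl)
  have we: "word_eval G (s \<circ> p) w = ev (map p w)" for w by (induction w) auto
  have "word_eval G (s \<circ> p) u = word_eval G (s \<circ> p) v \<longleftrightarrow> cox_equiv n ?m u v"
    if uv: "set u \<subseteq> {..<n}" "set v \<subseteq> {..<n}" for u v
  proof -
    have "x < n" if "x \<in> set u \<union> set v" for x using uv that by auto
    then have "map p u \<in> lists {..<n}" "map p v \<in> lists {..<n}" using pin by auto
    then have "word_eval G (s \<circ> p) u = word_eval G (s \<circ> p) v \<longleftrightarrow> cox_equiv n m (map p u) (map p v)"
      unfolding we by (rule cox_equiv_iff)
    also have "\<dots> \<longleftrightarrow> cox_equiv n ?m u v"
    proof
      assume "cox_equiv n m (map p u) (map p v)"
      then show "cox_equiv n ?m u v" by (rule cq) (simp_all add: pq comp_def)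
    next
      assume "cox_equiv n ?m u v"
      then show "cox_equiv n m (map p u) (map p v)" by (rule cp) (simp_all add: pin)
    qed
    finally show ?thesis .
  qed
  moreover have "(s \<circ> p) ` {..<n} = s ` {..<n}" using permutes_image[OF p] by (metis image_comp)
  moreover have "p i = p j \<longleftrightarrow> i = j" for i j using inj_eq[OF permutes_inj[OF p]] .
  ultimately show ?thesis
    using sys even_mat pin is_group
    by (auto simp: even_coxeter_def even_coxeter_axioms_def coxeter_system_def even_coxeter_matrix_def coxeter_matrix_def)
qed

section \<open>Odd rotations and the correspondence of edges\<close>

context even_coxeter begin

definition maxsph :: "nat set set" where
  "maxsph = {K. K \<subseteq> {..<n} \<and> finite (W K) \<and> (\<forall>K'. K \<subseteq> K' \<longrightarrow> K' \<subseteq> {..<n} \<longrightarrow> finite (W K') \<longrightarrow> K' = K)}"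

lemma maxsphD: assumes "K \<in> maxsph"
  shows "K \<subseteq> {..<n}" "finite (W K)" "\<And>K'. K \<subseteq> K' \<Longrightarrow> K' \<subseteq> {..<n} \<Longrightarrow> finite (W K') \<Longrightarrow> K' = K"
  using assms unfolding maxsph_def by blast+

lemma maxsph_ex: assumes "J \<subseteq> {..<n}" "finite (W J)" obtains K where "K \<in> maxsph" "J \<subseteq> K"
proof -
  let ?S = "{K. K \<subseteq> {..<n} \<and> finite (W K)}"
  have "finite ?S" by (rule finite_subset[of _ "Pow {..<n}"]; auto)
  then obtain K where K: "K \<in> ?S" "J \<le> K" "\<forall>K'\<in>?S. K \<le> K' \<longrightarrow> K = K'"
    using finite_has_maximal2[of ?S J] assms by auto
  then have "K \<in> maxsph" unfolding maxsph_def by blast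
  then show ?thesis using that K(2) by blast
qed

text \<open>A rotation of odd order that generates the odd part of the rotation subgroup attached to \<open>e\<close>.\<close>

definition cel :: "nat set \<Rightarrow> 'a" where
  "cel e = rot (Min e) (Max e) [^] (2 ^ multiplicity 2 (d (Min e) (Max e)) :: int)"

lemma oddE_cel:
  assumes "e \<in> oddE n d"
  obtains i j t u where "i < n" "j < n" "i \<noteq> j" "e = {i, j}" "d i j = 2 ^ t * u" "odd u" "1 < u"
    "cel e = rot i j [^] (2 ^ t :: int)"
proof -
  obtain a b q where e: "e = {a, b}" "a < n" "b < n" "a \<noteq> b" "d a b \<noteq> 0" "odd q" "1 < q" "q dvd d a b"
    using assms unfolding oddE_def by blast
  define i j where "i = min a b" and "j = max a b"
  have ij: "i < n" "j < n" "i \<noteq> j" "e = {i, j}" "Min e = i" "Max e = j" using e by (auto simp: i_def j_def min_def max_def)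
  have dij: "d i j = d a b" using e d_sym by (auto simp: i_def j_def min_def max_def)
  let ?t = "multiplicity 2 (d i j)"
  obtain u where u: "d i j = 2 ^ ?t * u" "\<not> 2 dvd u"
    by (rule multiplicity_decompose'[of "d i j" 2]) (use e dij in auto)
  have "coprime q (2 ^ ?t)" using e(6) by simp
  moreover have "q dvd 2 ^ ?t * u" using e(8) dij u(1) by simp
  ultimately have "q dvd u" using coprime_dvd_mult_right_iff by blast
  moreover have "u \<noteq> 0" using u(2) by (metis dvd_0_right)
  ultimately have "1 < u" using e(7) dvd_imp_le[of q u] by simp
  moreover have "cel e = rot i j [^] (2 ^ ?t :: int)" unfolding cel_def ij(5,6) ..
  ultimately show ?thesis using that[OF ij(1-4) u(1)] u(2) by blast
qed

lemma cel_closed: assumes "e \<in> oddE n d" shows "cel e \<in> W e" "cel e \<in> carrier G"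
proof -
  obtain i j t where e: "i < n" "j < n" "e = {i, j}" "cel e = rot i j [^] (2 ^ t :: int)" using oddE_cel[OF assms] by metis
  have sub: "e \<subseteq> {..<n}" using e by simp
  have "rot i j \<in> W e" using e sub by (intro W_mult W_s) auto
  then have "rot i j [^] (k :: nat) \<in> W e" for k
    using W_mult[OF sub] by (induction k) simp_all
  then have "rot i j [^] (2 ^ t :: nat) \<in> W e" .
  moreover have "rot i j [^] (2 ^ t :: int) = rot i j [^] (2 ^ t :: nat)" by (simp add: int_pow_int[symmetric])
  ultimately show "cel e \<in> W e" using e by simp
  then show "cel e \<in> carrier G" using W_closed sub by blast
qed

lemma cel_order:
  assumes "i < n" "j < n" "d i j = 2 ^ t * u" "cel e = rot i j [^] (2 ^ t :: int)"
  shows "cel e [^] (k::nat) = \<one> \<longleftrightarrow> u dvd k"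
proof -
  have "cel e [^] k = rot i j [^] (2 ^ t * int k)"
    unfolding assms(4) using assms by (simp add: int_pow_int[symmetric] int_pow_pow)
  then have "cel e [^] k = \<one> \<longleftrightarrow> int (2 ^ t * u) dvd int (2 ^ t * k)" using rot_order_int[OF assms(1,2)] assms(3) by simp
  also have "\<dots> \<longleftrightarrow> 2 ^ t * u dvd 2 ^ t * k" by (rule of_nat_dvd_iff)
  finally show ?thesis by simp
qed

text \<open>Inside a spherical set an edge with label above 2 is isolated by the matching condition,
  so the other generators commute with its rotations, while its own two endpoints invert
  them.\<close>

lemma cel_conj:
  assumes e: "e \<in> oddE n d" "e \<subseteq> K" and K: "K \<subseteq> {..<n}" "finite (W K)" and x: "x \<in> K"
  shows "s x \<otimes> cel e \<otimes> inv (s x) = (if x \<in> e then inv (cel e) else cel e)"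
proof -
  obtain i j t u where ij: "i < n" "j < n" "i \<noteq> j" "e = {i, j}" "d i j = 2 ^ t * u" "odd u" "1 < u"
    "cel e = rot i j [^] (2 ^ t :: int)" by (rule oddE_cel[OF e(1)])
  have xn: "x < n" using x K by auto
  have sub: "e \<subseteq> {..<n}" using ij by simp
  show ?thesis
  proof (cases "x \<in> e")
    case True
    have "par i (s x) + par j (s x) \<noteq> 0" using True ij by (auto simp: par_s)
    then have "s x \<otimes> cel e \<otimes> inv (s x) = rot i j [^] (- (2 ^ t) :: int)"
      using dihedral_conj_rot[OF ij(1-3), of "s x" "2 ^ t"] W_s[of x "{i, j}"] True ij by simp
    also have "\<dots> = inv (cel e)" using ij by (simp add: int_pow_neg)
    finally show ?thesis using True by simp
  next
    case False
    have d2: "2 < d i j"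
    proof -
      have "3 \<le> u" using ij(6,7) by presburger
      moreover have "u \<le> d i j" unfolding ij(5) by simp
      ultimately show ?thesis by simp
    qed
    have "d a x = 2" if a: "a \<in> e" for a
    proof -
      have an: "a < n" "a \<noteq> x" "a \<in> K" using a False e ij by auto
      have "\<not> 2 < d a x"
        using finite_W_matching[OF K(2,1), of i j x] finite_W_matching[OF K(2,1), of j i x] d2 d_sym[of i j] x False e ij a by auto
      moreover have "d a x \<noteq> 0" by (rule finite_W_d[OF K(2,1) an(3) x])
      moreover have "even (d a x)" by (rule d_even[OF an(1) xn an(2)])
      ultimately show ?thesis by (cases "d a x" rule: nat.exhaust; cases "d a x = 1") auto
    qed
    then have "s x \<otimes> cel e = cel e \<otimes> s x" using W_commute[OF sub xn _ cel_closed(1)[OF e(1)]] by blast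
    then show ?thesis using False xn cel_closed[OF e(1)] by (simp add: m_assoc)
  qed
qed

end

text \<open>A pair renumbered so that \<open>L\<close> has ones on the diagonal. Consequences of
  that condition are assumed in its place because they hold symmetrically for \<open>f\<close> and
  \<open>h\<close>, whereas nothing provides ones on the diagonal of \<open>L'\<close>.\<close>

locale aligned = coxeter_pair G n s m G' n s' m' f h N
  for G :: "('a, 'b) monoid_scheme" and n s m and G' :: "('c, 'e) monoid_scheme" and s' m' f h N +
  assumes two_eq: "i < n \<Longrightarrow> j < n \<Longrightarrow> i \<noteq> j \<Longrightarrow> 2 ^ t dvd B.d i j \<longleftrightarrow> 2 ^ t dvd A.d i j"
    and sph_eq: "K \<subseteq> {..<n} \<Longrightarrow> finite (B.W K) \<longleftrightarrow> finite (A.W K)"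
    and dom: "i < n \<Longrightarrow> k < n \<Longrightarrow> L k i \<noteq> 0 \<Longrightarrow> dom2 n A.d i k"
    and dom': "i < n \<Longrightarrow> k < n \<Longrightarrow> L' i k \<noteq> 0 \<Longrightarrow> dom2 n A.d k i"
    and fK: "K \<in> A.maxsph \<Longrightarrow> \<exists>w\<in>carrier G'. \<forall>g\<in>A.W K. inv\<^bsub>G'\<^esub> w \<otimes>\<^bsub>G'\<^esub> f g \<otimes>\<^bsub>G'\<^esub> w \<in> B.W K"
    and hK: "K \<in> A.maxsph \<Longrightarrow> \<exists>w\<in>carrier G. \<forall>g\<in>B.W K. inv\<^bsub>G\<^esub> w \<otimes>\<^bsub>G\<^esub> h g \<otimes>\<^bsub>G\<^esub> w \<in> A.W K"
    and four: "K \<in> A.maxsph \<Longrightarrow> i \<in> K \<Longrightarrow> j \<in> K \<Longrightarrow> i \<noteq> j \<Longrightarrow> 4 dvd A.d i j \<Longrightarrow> x \<in> K \<Longrightarrow> L i x + L j x = of_bool (x \<in> {i, j})"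
    and four': "K \<in> A.maxsph \<Longrightarrow> i \<in> K \<Longrightarrow> j \<in> K \<Longrightarrow> i \<noteq> j \<Longrightarrow> 4 dvd A.d i j \<Longrightarrow> x \<in> K \<Longrightarrow> L' i x + L' j x = of_bool (x \<in> {i, j})"
begin

lemma maxsph_eq: "B.maxsph = A.maxsph"
  unfolding A.maxsph_def B.maxsph_def by (simp add: sph_eq cong: conj_cong imp_cong)

lemma dom2_eq: "i < n \<Longrightarrow> j < n \<Longrightarrow> dom2 n B.d i j \<longleftrightarrow> dom2 n A.d i j"
  unfolding dom2_def by (simp add: two_eq cong: imp_cong)

lemma four_dvd_eq: "i < n \<Longrightarrow> j < n \<Longrightarrow> i \<noteq> j \<Longrightarrow> 4 dvd B.d i j \<longleftrightarrow> 4 dvd A.d i j"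
  using two_eq[of i j 2] by simp

lemma aligned_swap: "aligned G' n s' m' G s m h f N"
proof -
  have fd: "4 dvd A.d i j" if "K \<in> A.maxsph" "i \<in> K" "j \<in> K" "i \<noteq> j" "4 dvd B.d i j" for K i j
    using that four_dvd_eq A.maxsphD(1) by blast
  show ?thesis
  proof (intro aligned.intro aligned_axioms.intro, unfold maxsph_eq)
    show "coxeter_pair G' n s' m' G n s m h f N" by (rule swap)
    show "2 ^ t dvd A.d i j \<longleftrightarrow> 2 ^ t dvd B.d i j" if "i < n" "j < n" "i \<noteq> j" for i j t using two_eq that by simp
    show "finite (A.W K) \<longleftrightarrow> finite (B.W K)" if "K \<subseteq> {..<n}" for K using sph_eq that by simp
    show "dom2 n B.d i k" if "i < n" "k < n" "L' k i \<noteq> 0" for i k using dom'[of k i] dom2_eq that by simp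
    show "dom2 n B.d k i" if "i < n" "k < n" "L i k \<noteq> 0" for i k using dom[of k i] dom2_eq that by simp
    show "\<exists>w\<in>carrier G. \<forall>g\<in>B.W K. inv\<^bsub>G\<^esub> w \<otimes>\<^bsub>G\<^esub> h g \<otimes>\<^bsub>G\<^esub> w \<in> A.W K" if "K \<in> A.maxsph" for K
      by (rule hK[OF that])
    show "\<exists>w\<in>carrier G'. \<forall>g\<in>A.W K. inv\<^bsub>G'\<^esub> w \<otimes>\<^bsub>G'\<^esub> f g \<otimes>\<^bsub>G'\<^esub> w \<in> B.W K" if "K \<in> A.maxsph" for K
      by (rule fK[OF that])
    show "L' i x + L' j x = of_bool (x \<in> {i, j})" if "K \<in> A.maxsph" "i \<in> K" "j \<in> K" "i \<noteq> j" "4 dvd B.d i j" "x \<in> K" for K i j x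
      by (rule four'[OF that(1-4) fd[OF that(1-5)] that(6)])
    show "L i x + L j x = of_bool (x \<in> {i, j})" if "K \<in> A.maxsph" "i \<in> K" "j \<in> K" "i \<noteq> j" "4 dvd B.d i j" "x \<in> K" for K i j x
      by (rule four[OF that(1-4) fd[OF that(1-5)] that(6)])
  qed
qed

lemma L_MK: assumes "K \<in> A.maxsph" "i \<in> K" "L k i \<noteq> 0" shows "k \<in> K"
proof (rule ccontr)
  assume k: "k \<notin> K"
  note K = A.maxsphD[OF assms(1)]
  have "i < n" using assms K by auto
  obtain w where w: "w \<in> carrier G'" "inv\<^bsub>G'\<^esub> w \<otimes>\<^bsub>G'\<^esub> f (s i) \<otimes>\<^bsub>G'\<^esub> w \<in> B.W K"
    using fK[OF assms(1)] A.W_s[OF assms(2) K(1)] by blast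
  have "B.par k (inv\<^bsub>G'\<^esub> w \<otimes>\<^bsub>G'\<^esub> f (s i) \<otimes>\<^bsub>G'\<^esub> w) = 0" using B.par_W[OF w(2) K(1) k] .
  then have "L k i = 0" using B.par_conj[of "inv\<^bsub>G'\<^esub> w" "f (s i)" k] w(1) \<open>i < n\<close> by simp
  then show False using assms by simp
qed

lemma L'_MK: assumes "K \<in> A.maxsph" "k \<in> K" "L' i k \<noteq> 0" shows "i \<in> K"
proof -
  interpret S: aligned G' n s' m' G s m h f N by (rule aligned_swap)
  show ?thesis using S.L_MK assms maxsph_eq by blast
qed

lemma LL': "i < n \<Longrightarrow> j < n \<Longrightarrow> (\<Sum>k<n. L i k * L' k j) = of_bool (i = j)"
  by (rule coxeter_pair.L'L[OF swap])

section \<open>The edge detected by the image of an odd rotation\<close>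

definition hits :: "nat set \<Rightarrow> nat set \<Rightarrow> bool" where
  "hits e e' \<longleftrightarrow> e \<in> oddE n A.d \<and> (\<exists>k l. e' = {k, l} \<and> k < n \<and> l < n \<and> k \<noteq> l) \<and> B.ret e' (f (A.cel e)) \<noteq> \<one>\<^bsub>G'\<^esub>"

text \<open>The image stays nontrivial because \<open>h \<circ> f\<close> acts on
  \<open>A.W K\<close> as a conjugation.\<close>

lemma cel_image:
  assumes e: "e \<in> oddE n A.d" and K: "K \<in> A.maxsph" "e \<subseteq> K"
  obtains w y q where "w \<in> carrier G'" "y \<in> B.W K" "f (A.cel e) = w \<otimes>\<^bsub>G'\<^esub> y \<otimes>\<^bsub>G'\<^esub> inv\<^bsub>G'\<^esub> w" "odd q"
    "y [^]\<^bsub>G'\<^esub> (q::nat) = \<one>\<^bsub>G'\<^esub>" "f (A.cel e) [^]\<^bsub>G'\<^esub> q = \<one>\<^bsub>G'\<^esub>" "y \<noteq> \<one>\<^bsub>G'\<^esub>"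
proof -
  interpret S: aligned G' n s' m' G s m h f N by (rule aligned_swap)
  obtain i j t u where ij: "i < n" "j < n" "i \<noteq> j" "e = {i, j}" "A.d i j = 2 ^ t * u" "odd u" "1 < u"
    "A.cel e = A.rot i j [^]\<^bsub>G\<^esub> (2 ^ t :: int)" by (rule A.oddE_cel[OF e])
  note c = A.cel_closed[OF e]
  note Kd = A.maxsphD[OF K(1)]
  have cK: "A.cel e \<in> A.W K" using c(1) A.W_mono K(2) by blast
  obtain w where w: "w \<in> carrier G'" "inv\<^bsub>G'\<^esub> w \<otimes>\<^bsub>G'\<^esub> f (A.cel e) \<otimes>\<^bsub>G'\<^esub> w \<in> B.W K"
    using fK[OF K(1)] cK by blast
  let ?y = "inv\<^bsub>G'\<^esub> w \<otimes>\<^bsub>G'\<^esub> f (A.cel e) \<otimes>\<^bsub>G'\<^esub> w"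
  have yc: "?y \<in> carrier G'" using w c by simp
  have fy: "f (A.cel e) = w \<otimes>\<^bsub>G'\<^esub> ?y \<otimes>\<^bsub>G'\<^esub> inv\<^bsub>G'\<^esub> w"
    using w(1) c(2) by (simp add: B.m_assoc[symmetric]) (simp add: B.m_assoc)
  have cu: "A.cel e [^]\<^bsub>G\<^esub> u = \<one>\<^bsub>G\<^esub>" using A.cel_order[OF ij(1,2,5,8), of u] by simp
  have fu: "f (A.cel e) [^]\<^bsub>G'\<^esub> u = \<one>\<^bsub>G'\<^esub>" using f_pow[OF c(2), of u] cu by simp
  have conj_pow: "(inv\<^bsub>G'\<^esub> w \<otimes>\<^bsub>G'\<^esub> g \<otimes>\<^bsub>G'\<^esub> w) [^]\<^bsub>G'\<^esub> (k::nat) = inv\<^bsub>G'\<^esub> w \<otimes>\<^bsub>G'\<^esub> g [^]\<^bsub>G'\<^esub> k \<otimes>\<^bsub>G'\<^esub> w"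
    if "g \<in> carrier G'" for g k
  proof (induction k)
    case (Suc k)
    have "(inv\<^bsub>G'\<^esub> w \<otimes>\<^bsub>G'\<^esub> g [^]\<^bsub>G'\<^esub> k \<otimes>\<^bsub>G'\<^esub> w) \<otimes>\<^bsub>G'\<^esub> (inv\<^bsub>G'\<^esub> w \<otimes>\<^bsub>G'\<^esub> g \<otimes>\<^bsub>G'\<^esub> w)
      = inv\<^bsub>G'\<^esub> w \<otimes>\<^bsub>G'\<^esub> (g [^]\<^bsub>G'\<^esub> k \<otimes>\<^bsub>G'\<^esub> g) \<otimes>\<^bsub>G'\<^esub> w"
      using w(1) that by (simp add: B.m_assoc B.inv_solve_left')
    then show ?case using Suc by simp
  qed (use w in simp)
  have yu: "?y [^]\<^bsub>G'\<^esub> u = \<one>\<^bsub>G'\<^esub>" unfolding conj_pow[OF f_closed[OF c(2)]] fu using w(1) by simp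
  have "?y \<noteq> \<one>\<^bsub>G'\<^esub>"
  proof
    assume "?y = \<one>\<^bsub>G'\<^esub>"
    then have f1: "f (A.cel e) = \<one>\<^bsub>G'\<^esub>" using fy w(1) by simp
    obtain v where v: "v \<in> carrier G" "\<And>g. g \<in> A.W K \<Longrightarrow> h (f g) = v \<otimes>\<^bsub>G\<^esub> g \<otimes>\<^bsub>G\<^esub> inv\<^bsub>G\<^esub> v"
      using hf_conj[OF Kd(1,2)] by auto
    have "v \<otimes>\<^bsub>G\<^esub> A.cel e \<otimes>\<^bsub>G\<^esub> inv\<^bsub>G\<^esub> v = \<one>\<^bsub>G\<^esub>" using v(2)[OF cK] f1 by simp
    then have "v \<otimes>\<^bsub>G\<^esub> A.cel e = v" using v(1) c(2) by (simp add: A.inv_solve_right')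
    then have "A.cel e = \<one>\<^bsub>G\<^esub>" using v(1) c(2) by simp
    then have "A.cel e [^]\<^bsub>G\<^esub> (1::nat) = \<one>\<^bsub>G\<^esub>" by simp
    then show False using A.cel_order[OF ij(1,2,5,8), of 1] ij(7) by simp
  qed
  then show ?thesis using that[OF w fy ij(6) yu fu] by blast
qed

lemma ret_image:
  assumes "w \<in> carrier G'" "y \<in> carrier G'" "c = w \<otimes>\<^bsub>G'\<^esub> y \<otimes>\<^bsub>G'\<^esub> inv\<^bsub>G'\<^esub> w"
  shows "B.ret J c = \<one>\<^bsub>G'\<^esub> \<longleftrightarrow> B.ret J y = \<one>\<^bsub>G'\<^esub>"
proof
  assume "B.ret J c = \<one>\<^bsub>G'\<^esub>"
  then have "B.ret J w \<otimes>\<^bsub>G'\<^esub> B.ret J y \<otimes>\<^bsub>G'\<^esub> inv\<^bsub>G'\<^esub> (B.ret J w) = \<one>\<^bsub>G'\<^esub>" using assms by simp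
  then have "B.ret J w \<otimes>\<^bsub>G'\<^esub> B.ret J y = B.ret J w" using assms by (simp add: B.inv_solve_right')
  then show "B.ret J y = \<one>\<^bsub>G'\<^esub>" using assms by simp
next
  assume "B.ret J y = \<one>\<^bsub>G'\<^esub>" then show "B.ret J c = \<one>\<^bsub>G'\<^esub>" using assms by simp
qed

lemma ret_pow: "g \<in> carrier G' \<Longrightarrow> B.ret J (g [^]\<^bsub>G'\<^esub> (k::nat)) = B.ret J g [^]\<^bsub>G'\<^esub> k"
  using group_hom.hom_nat_pow[of G' G' "B.ret J"] B.ret_hom
  by (simp add: group_hom_def group_hom_axioms_def B.is_group)

text \<open>A parabolic subgroup of rank at most one has exponent dividing 2 and hence no nontrivial
  element of odd order.\<close>

lemma ret_single:
  assumes "y \<in> carrier G'" "y [^]\<^bsub>G'\<^esub> (q::nat) = \<one>\<^bsub>G'\<^esub>" "odd q" "l < n" "J \<inter> {..<n} \<subseteq> {l}"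
  shows "B.ret J y = \<one>\<^bsub>G'\<^esub>"
proof -
  have "B.ret J y \<in> B.W {l}" using B.ret_in_W[OF assms(1), of J] B.W_mono[OF assms(5)] by blast
  then have "B.ret J y \<otimes>\<^bsub>G'\<^esub> B.ret J y = \<one>\<^bsub>G'\<^esub>" by (rule B.W_single[OF assms(4)])
  then show ?thesis
    by (rule B.odd_involution_trivial[OF B.ret_closed[OF assms(1)] _ _ assms(3)])
      (use ret_pow[OF assms(1), of J q] assms(2) in simp)
qed

text \<open>After conjugation into \<open>B.W K\<close> the retraction to \<open>e'\<close> factors
  through \<open>e' \<inter> K\<close>. If \<open>e'\<close> were not inside \<open>K\<close>, at
  most one generator would remain, which an element of odd order does not survive.\<close>

lemma hits_sub: assumes h: "hits e e'" and K: "K \<in> A.maxsph" "e \<subseteq> K" shows "e' \<subseteq> K"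
proof (rule ccontr)
  assume ns: "\<not> e' \<subseteq> K"
  have e: "e \<in> oddE n A.d" using h by (simp add: hits_def)
  obtain w y q where y: "w \<in> carrier G'" "y \<in> B.W K" "f (A.cel e) = w \<otimes>\<^bsub>G'\<^esub> y \<otimes>\<^bsub>G'\<^esub> inv\<^bsub>G'\<^esub> w" "odd q"
    "y [^]\<^bsub>G'\<^esub> (q::nat) = \<one>\<^bsub>G'\<^esub>" by (rule cel_image[OF e K])
  note Kn = A.maxsphD(1)[OF K(1)]
  have yc: "y \<in> carrier G'" using B.W_closed[OF y(2) Kn] .
  obtain k l where kl: "e' = {k, l}" "k < n" "l < n" using h by (auto simp: hits_def)
  have "B.ret e' y = B.ret e' (B.ret K y)" using B.ret_id[OF y(2) Kn] by simp
  also have "\<dots> = B.ret (e' \<inter> K) y" by (rule B.ret_ret[OF yc])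
  also have "\<dots> = \<one>\<^bsub>G'\<^esub>"
  proof -
    have "e' \<inter> K \<inter> {..<n} \<subseteq> {l} \<or> e' \<inter> K \<inter> {..<n} \<subseteq> {k}" using ns kl by auto
    then show ?thesis using ret_single[OF yc y(5,4)] kl by blast
  qed
  finally show False using ret_image[OF y(1) yc y(3), of e'] h by (simp add: hits_def)
qed

lemma hits_rot:
  assumes h: "hits e e'" and kl: "e' = {k, l}" "k < n" "l < n" "k \<noteq> l"
  obtains z q where "B.ret e' (f (A.cel e)) = B.rot k l [^]\<^bsub>G'\<^esub> (z::int)" "int (B.d k l) dvd z * int q" "odd q"
    "B.ret e' (f (A.cel e)) \<otimes>\<^bsub>G'\<^esub> B.ret e' (f (A.cel e)) \<noteq> \<one>\<^bsub>G'\<^esub>"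
proof -
  have e: "e \<in> oddE n A.d" "B.ret e' (f (A.cel e)) \<noteq> \<one>\<^bsub>G'\<^esub>" using h by (auto simp: hits_def)
  obtain i j t u where ij: "i < n" "j < n" "i \<noteq> j" "e = {i, j}" "A.d i j = 2 ^ t * u" "odd u" "1 < u"
    "A.cel e = A.rot i j [^]\<^bsub>G\<^esub> (2 ^ t :: int)" by (rule A.oddE_cel[OF e(1)])
  note c = A.cel_closed[OF e(1)]
  let ?u = "B.ret e' (f (A.cel e))"
  have "f (A.cel e) [^]\<^bsub>G'\<^esub> u = \<one>\<^bsub>G'\<^esub>" using f_pow[OF c(2), of u] A.cel_order[OF ij(1,2,5,8), of u] by simp
  then have uu: "?u [^]\<^bsub>G'\<^esub> u = \<one>\<^bsub>G'\<^esub>" using ret_pow[OF f_closed[OF c(2)], of e' u] by simp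
  have "{k, l} \<inter> {..<n} = {k, l}" using kl by auto
  then have uW: "?u \<in> B.W {k, l}" using B.ret_in_W[OF f_closed[OF c(2)], of e'] kl by simp
  obtain z :: int where z: "?u = B.rot k l [^]\<^bsub>G'\<^esub> z" "int (B.d k l) dvd z * int u"
    by (rule B.dihedral_odd_order[OF kl(2-4) uW uu ij(6)])
  have "?u \<otimes>\<^bsub>G'\<^esub> ?u \<noteq> \<one>\<^bsub>G'\<^esub>"
    using B.odd_involution_trivial[OF B.ret_closed[OF f_closed[OF c(2)]] _ uu ij(6)] e(2) by blast
  then show ?thesis using that[OF z ij(6)] by blast
qed

text \<open>The retraction is a nontrivial rotation killed by an odd exponent. This is impossible
  for an infinite label and for a power of 2.\<close>

lemma hits_E: assumes h: "hits e e'" shows "e' \<in> oddE n B.d"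
proof -
  obtain k l where kl: "e' = {k, l}" "k < n" "l < n" "k \<noteq> l" using h by (auto simp: hits_def)
  obtain z q where z: "B.ret e' (f (A.cel e)) = B.rot k l [^]\<^bsub>G'\<^esub> (z::int)" "int (B.d k l) dvd z * int q" "odd q"
    by (rule hits_rot[OF h kl])
  have nz: "\<not> int (B.d k l) dvd z" using h z(1) B.rot_order_int[OF kl(2,3), of z] by (simp add: hits_def)
  have d0: "B.d k l \<noteq> 0"
  proof
    assume "B.d k l = 0"
    then have "z * int q = 0" using z(2) by simp
    then have "z = 0" using z(3) by auto
    then show False using nz by simp
  qed
  obtain a b where ab: "B.d k l = 2 ^ a * b" "odd b" by (rule odd_part[OF d0])
  have "b \<noteq> 1"
  proof
    assume "b = 1"
    then have "int (B.d k l) = 2 ^ a" using ab by simp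
    moreover have "coprime (2 ^ a) (int q)" using z(3) by simp
    ultimately show False using nz z(2) coprime_dvd_mult_left_iff by metis
  qed
  moreover have "b \<noteq> 0" using ab(2) by (metis even_zero)
  ultimately have "1 < b" by simp
  moreover have "b dvd B.d k l" using ab by simp
  ultimately show ?thesis using kl d0 ab(2) unfolding oddE_def by blast
qed

text \<open>The rotation of \<open>e\<close> is inverted precisely by the elements with odd total exponent in \<open>e\<close>. Its
  image has odd order and is not trivial, so whether it is inverted is visible in the image.\<close>

lemma hits_lam:
  assumes h: "hits e e'" and K: "K \<in> A.maxsph" "e \<subseteq> K" and x: "x \<in> K"
  shows "(\<Sum>k\<in>e'. L k x) = of_bool (x \<in> e)"
proof -
  note Kd = A.maxsphD[OF K(1)]
  have xn: "x < n" using x Kd by auto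
  obtain k l where kl: "e' = {k, l}" "k < n" "l < n" "k \<noteq> l" using h by (auto simp: hits_def)
  obtain z q where z: "B.ret e' (f (A.cel e)) = B.rot k l [^]\<^bsub>G'\<^esub> (z::int)" 
    "B.ret e' (f (A.cel e)) \<otimes>\<^bsub>G'\<^esub> B.ret e' (f (A.cel e)) \<noteq> \<one>\<^bsub>G'\<^esub>"
    using hits_rot[OF h kl] by metis
  have e: "e \<in> oddE n A.d" using h by (simp add: hits_def)
  note c = A.cel_closed[OF e]
  let ?R = "\<lambda>g. B.ret e' (f g)"
  let ?u = "?R (A.cel e)"
  have uc: "?u \<in> carrier G'" using c by simp
  have "?R (s x) \<otimes>\<^bsub>G'\<^esub> ?u \<otimes>\<^bsub>G'\<^esub> inv\<^bsub>G'\<^esub> (?R (s x)) = ?R (s x \<otimes>\<^bsub>G\<^esub> A.cel e \<otimes>\<^bsub>G\<^esub> inv\<^bsub>G\<^esub> (s x))"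
    using xn c by (simp del: A.s_inv)
  also have "\<dots> = (if x \<in> e then inv\<^bsub>G'\<^esub> ?u else ?u)" using A.cel_conj[OF e K(2) Kd(1,2) x] c by simp
  finally have 1: "?R (s x) \<otimes>\<^bsub>G'\<^esub> ?u \<otimes>\<^bsub>G'\<^esub> inv\<^bsub>G'\<^esub> (?R (s x)) = (if x \<in> e then inv\<^bsub>G'\<^esub> ?u else ?u)" .
  have "{k, l} \<inter> {..<n} = {k, l}" using kl by auto
  then have RW: "?R (s x) \<in> B.W {k, l}" using B.ret_in_W[of "f (s x)" e'] xn kl by simp
  have p: "B.par k (?R (s x)) = L k x" "B.par l (?R (s x)) = L l x" using B.ret_par[of "f (s x)"] xn kl by auto
  have "inv\<^bsub>G'\<^esub> ?u = B.rot k l [^]\<^bsub>G'\<^esub> (- z)" unfolding z(1) using kl by (simp add: B.int_pow_neg)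
  then have 2: "?R (s x) \<otimes>\<^bsub>G'\<^esub> ?u \<otimes>\<^bsub>G'\<^esub> inv\<^bsub>G'\<^esub> (?R (s x)) = (if L k x + L l x = 0 then ?u else inv\<^bsub>G'\<^esub> ?u)"
    using B.dihedral_conj_rot[OF kl(2-4) RW, of z] unfolding p using z(1) by (cases "L k x + L l x = 0") simp_all
  have "inv\<^bsub>G'\<^esub> ?u \<noteq> ?u"
  proof
    assume "inv\<^bsub>G'\<^esub> ?u = ?u"
    then have "?u \<otimes>\<^bsub>G'\<^esub> ?u = \<one>\<^bsub>G'\<^esub>" using B.l_inv[OF uc] by simp
    then show False using z(2) by simp
  qed
  then have "L k x + L l x = of_bool (x \<in> e)" using 1 2 by (auto split: if_splits)
  then show ?thesis using kl by simp
qed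

text \<open>\<open>L\<close> is invertible on the coordinates in \<open>K\<close>.\<close>

lemma lam_unique:
  assumes K: "K \<in> A.maxsph" and e: "e1 \<subseteq> K" "e2 \<subseteq> K" and eq: "\<And>x. x \<in> K \<Longrightarrow> (\<Sum>k\<in>e1. L k x) = (\<Sum>k\<in>e2. L k x)"
  shows "e1 = e2"
proof -
  note Kn = A.maxsphD(1)[OF K]
  have "finite K" by (rule finite_subset[OF Kn finite_lessThan])
  then have fin: "finite e1" "finite e2" using finite_subset e by auto
  have ind: "(\<Sum>x<n. (\<Sum>k\<in>a. L k x) * L' x j) = of_bool (j \<in> a)" if j: "j \<in> K" and a: "a \<subseteq> K" "finite a" for a j
  proof -
    have "(\<Sum>x<n. (\<Sum>k\<in>a. L k x) * L' x j) = (\<Sum>k\<in>a. \<Sum>x<n. L k x * L' x j)"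
      by (subst sum.swap) (simp add: sum_distrib_right)
    also have "\<dots> = (\<Sum>k\<in>a. of_bool (k = j))" using LL' a(1) j Kn by (intro sum.cong HOL.refl) (metis lessThan_iff subsetD)
    also have "\<dots> = (\<Sum>k\<in>a. if k = j then 1 else 0)" by (intro sum.cong) auto
    also have "\<dots> = of_bool (j \<in> a)" using a(2) by simp
    finally show ?thesis .
  qed
  have "j \<in> e1 \<longleftrightarrow> j \<in> e2" if j: "j \<in> K" for j
  proof -
    have eq2: "(\<Sum>k\<in>e1. L k x) * L' x j = (\<Sum>k\<in>e2. L k x) * L' x j" for x
      using eq L'_MK[OF K j, of x] by (cases "L' x j = 0") auto
    have "(of_bool (j \<in> e1) :: bit) = of_bool (j \<in> e2)"
      unfolding ind[OF j e(1) fin(1), symmetric] ind[OF j e(2) fin(2), symmetric] eq2 ..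
    then show ?thesis by (cases "j \<in> e1"; cases "j \<in> e2") simp_all
  qed
  then show ?thesis using e by blast
qed

lemma oddE_maxsph: assumes "e \<in> oddE n A.d" obtains K where "K \<in> A.maxsph" "e \<subseteq> K"
proof -
  obtain i j where "e = {i, j}" "i < n" "j < n" "A.d i j \<noteq> 0" using assms by (auto simp: oddE_def)
  then show ?thesis using A.maxsph_ex[of e] A.finite_W_pair[of i j] that by auto
qed

lemma hits_unique: assumes "hits e e1" "hits e e2" shows "e1 = e2"
proof -
  have e: "e \<in> oddE n A.d" using assms(1) by (simp add: hits_def)
  obtain K where K: "K \<in> A.maxsph" "e \<subseteq> K" by (rule oddE_maxsph[OF e])
  show ?thesis
    by (rule lam_unique[OF K(1) hits_sub[OF assms(1) K] hits_sub[OF assms(2) K]])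
      (use hits_lam[OF assms(1) K] hits_lam[OF assms(2) K] in simp)
qed

text \<open>A nontrivial element of the finite group \<open>B.W K\<close> survives some retraction
  to a pair; odd order makes the two members of the pair distinct.\<close>

lemma hits_ex: assumes e: "e \<in> oddE n A.d" shows "\<exists>e'. hits e e'"
proof -
  obtain K where K: "K \<in> A.maxsph" "e \<subseteq> K" by (rule oddE_maxsph[OF e])
  note Kd = A.maxsphD[OF K(1)]
  obtain w y q where y: "w \<in> carrier G'" "y \<in> B.W K" "f (A.cel e) = w \<otimes>\<^bsub>G'\<^esub> y \<otimes>\<^bsub>G'\<^esub> inv\<^bsub>G'\<^esub> w" "odd q"
    "y [^]\<^bsub>G'\<^esub> (q::nat) = \<one>\<^bsub>G'\<^esub>" "y \<noteq> \<one>\<^bsub>G'\<^esub>" by (rule cel_image[OF e K])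
  have yc: "y \<in> carrier G'" using B.W_closed[OF y(2) Kd(1)] .
  have "finite (B.W K)" using sph_eq Kd by blast
  then obtain a b where ab: "a \<in> K" "b \<in> K" "B.ret {a, b} y \<noteq> \<one>\<^bsub>G'\<^esub>"
    using B.finite_W_detect[OF _ Kd(1) y(2)] y(6) by blast
  have "a \<noteq> b" using ret_single[OF yc y(5,4), of a "{a, b}"] ab Kd(1) by auto
  moreover have "B.ret {a, b} (f (A.cel e)) \<noteq> \<one>\<^bsub>G'\<^esub>" using ret_image[OF y(1) yc y(3)] ab by simp
  ultimately show ?thesis using e ab Kd(1) unfolding hits_def by blast
qed

definition eta :: "nat set \<Rightarrow> nat set" where "eta e = (THE e'. hits e e')"

lemma eta_eqI: assumes "hits e e'" shows "eta e = e'"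
  unfolding eta_def by (rule the_equality[where P = "hits e", OF assms]) (rule hits_unique[OF _ assms])

lemma eta_hits: "e \<in> oddE n A.d \<Longrightarrow> hits e (eta e)"
  using hits_ex eta_eqI by blast

text \<open>The image of \<open>cel e\<close> is conjugate to an element \<open>y\<close> of
  \<open>B.W K\<close> whose retractions to pairs other than \<open>eta e\<close> are trivial. Hence
  \<open>y\<close> lies in the dihedral subgroup of \<open>eta e\<close> and is a power of
  \<open>cel (eta e)\<close>. Applying \<open>h\<close> returns a conjugate of \<open>cel e\<close>,
  so \<open>h\<close> cannot lose \<open>cel (eta e)\<close> on \<open>e\<close>, and every exponent
  killing \<open>cel (eta e)\<close> kills \<open>cel e\<close>.\<close>

lemma eta_back:
  assumes e: "e \<in> oddE n A.d"
  shows "A.ret e (h (B.cel (eta e))) \<noteq> \<one>\<^bsub>G\<^esub>"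
    "B.cel (eta e) [^]\<^bsub>G'\<^esub> (u'::nat) = \<one>\<^bsub>G'\<^esub> \<Longrightarrow> A.cel e [^]\<^bsub>G\<^esub> u' = \<one>\<^bsub>G\<^esub>"
proof -
  interpret S: aligned G' n s' m' G s m h f N by (rule aligned_swap)
  let ?e = "eta e"
  have h: "hits e ?e" by (rule eta_hits[OF e])
  have e': "?e \<in> oddE n B.d" by (rule hits_E[OF h])
  obtain K where K: "K \<in> A.maxsph" "e \<subseteq> K" by (rule oddE_maxsph[OF e])
  note Kd = A.maxsphD[OF K(1)]
  have eK: "?e \<subseteq> K" by (rule hits_sub[OF h K])
  note c = A.cel_closed[OF e] and c' = B.cel_closed[OF e']
  obtain w y q where y: "w \<in> carrier G'" "y \<in> B.W K" "f (A.cel e) = w \<otimes>\<^bsub>G'\<^esub> y \<otimes>\<^bsub>G'\<^esub> inv\<^bsub>G'\<^esub> w" "odd q"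
    "y [^]\<^bsub>G'\<^esub> (q::nat) = \<one>\<^bsub>G'\<^esub>" by (rule cel_image[OF e K])
  have yc: "y \<in> carrier G'" using B.W_closed[OF y(2) Kd(1)] .
  let ?v = "B.ret ?e y"
  have vc: "?v \<in> carrier G'" using yc by simp
  have en: "?e \<subseteq> {..<n}" using eK Kd by blast
  have vW: "?v \<in> B.W ?e" using B.ret_in_W[OF yc, of ?e] en by (simp add: Int_absorb2)
  have other: "B.ret {a, b} y = \<one>\<^bsub>G'\<^esub>" if ab: "a \<in> K" "b \<in> K" "{a, b} \<noteq> ?e" for a b
  proof (cases "a = b")
    case True
    then show ?thesis using ret_single[OF yc y(5,4), of a "{a, b}"] ab Kd(1) by auto
  next
    case False
    then have "\<not> hits e {a, b}" using hits_unique[OF h] ab by blast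
    then have "B.ret {a, b} (f (A.cel e)) = \<one>\<^bsub>G'\<^esub>" using e False ab Kd(1) unfolding hits_def by blast
    then show ?thesis using ret_image[OF y(1) yc y(3)] by simp
  qed
  have fin: "finite (B.W K)" using sph_eq Kd by blast
  have "y \<otimes>\<^bsub>G'\<^esub> inv\<^bsub>G'\<^esub> ?v = \<one>\<^bsub>G'\<^esub>"
  proof (rule B.finite_W_detect[OF fin Kd(1)])
    show "y \<otimes>\<^bsub>G'\<^esub> inv\<^bsub>G'\<^esub> ?v \<in> B.W K"
      using y(2) vW B.W_mono[OF eK] by (intro B.W_mult[OF Kd(1)] B.W_inv[OF Kd(1)]) auto
    fix a b assume ab: "a \<in> K" "b \<in> K"
    have "B.ret {a, b} ?v = B.ret {a, b} y"
    proof (cases "{a, b} = ?e")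
      case True
      then show ?thesis using B.ret_ret[OF yc, of ?e ?e] by simp
    next
      case False
      have "B.ret {a, b} ?v = B.ret ?e (B.ret {a, b} y)" using B.ret_ret[OF yc] by (simp add: Int_commute)
      then show ?thesis using other[OF ab False] by simp
    qed
    then show "B.ret {a, b} (y \<otimes>\<^bsub>G'\<^esub> inv\<^bsub>G'\<^esub> ?v) = \<one>\<^bsub>G'\<^esub>" using yc by simp
  qed
  then have yv: "y = ?v" using yc vc B.inv_solve_right'[of "\<one>\<^bsub>G'\<^esub>" y ?v] by simp
  obtain k l t u where kl: "k < n" "l < n" "k \<noteq> l" "?e = {k, l}" "B.d k l = 2 ^ t * u" "odd u" "1 < u"
    "B.cel ?e = B.rot k l [^]\<^bsub>G'\<^esub> (2 ^ t :: int)" by (rule B.oddE_cel[OF e'])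
  have yW: "y \<in> B.W {k, l}" using vW kl(4) yv by simp
  obtain z :: int where z: "y = B.rot k l [^]\<^bsub>G'\<^esub> z" "int (B.d k l) dvd z * int q"
    by (rule B.dihedral_odd_order[OF kl(1-3) yW y(5,4)])
  \<comment> \<open>As \<open>q\<close> is odd, the power of 2 in the label already divides
    \<open>z\<close>, which makes \<open>y\<close> a power of \<open>B.cel\<close>.\<close>
  have "(2 ^ t :: int) dvd int (B.d k l)" unfolding kl(5) by simp
  then have "(2 ^ t :: int) dvd z * int q" using z(2) dvd_trans by blast
  moreover have "coprime (2 ^ t :: int) (int q)" using y(4) by simp
  ultimately have "(2 ^ t :: int) dvd z" using coprime_dvd_mult_left_iff by blast
  then obtain z' where z': "z = 2 ^ t * z'" by (rule dvdE)
  have yz: "y = B.cel ?e [^]\<^bsub>G'\<^esub> z'" unfolding z(1) z' kl(8) using kl by (simp add: B.int_pow_pow)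
  obtain v where v0: "v \<in> carrier G" "\<And>g. g \<in> A.W K \<Longrightarrow> h (f g) = v \<otimes>\<^bsub>G\<^esub> g \<otimes>\<^bsub>G\<^esub> inv\<^bsub>G\<^esub> v"
    using hf_conj[OF Kd(1,2)] by auto
  have v: "v \<in> carrier G" "h (f (A.cel e)) = v \<otimes>\<^bsub>G\<^esub> A.cel e \<otimes>\<^bsub>G\<^esub> inv\<^bsub>G\<^esub> v"
    using v0 c(1) A.W_mono[OF K(2)] by blast+
  have c1: "A.cel e \<noteq> \<one>\<^bsub>G\<^esub>"
  proof
    assume c1: "A.cel e = \<one>\<^bsub>G\<^esub>"
    then have "f (A.cel e) = \<one>\<^bsub>G'\<^esub>" by simp
    then show False using h by (simp add: hits_def)
  qed
  have conj1: "a \<otimes>\<^bsub>G\<^esub> g \<otimes>\<^bsub>G\<^esub> inv\<^bsub>G\<^esub> a = \<one>\<^bsub>G\<^esub> \<longleftrightarrow> g = \<one>\<^bsub>G\<^esub>" if "a \<in> carrier G" "g \<in> carrier G" for a g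
  proof
    assume "a \<otimes>\<^bsub>G\<^esub> g \<otimes>\<^bsub>G\<^esub> inv\<^bsub>G\<^esub> a = \<one>\<^bsub>G\<^esub>"
    then have "a \<otimes>\<^bsub>G\<^esub> g = a" using that by (simp add: A.inv_solve_right')
    then show "g = \<one>\<^bsub>G\<^esub>" using that by simp
  qed (use that in simp)
  show "A.ret e (h (B.cel ?e)) \<noteq> \<one>\<^bsub>G\<^esub>"
  proof
    assume r: "A.ret e (h (B.cel ?e)) = \<one>\<^bsub>G\<^esub>"
    have "h y = h (B.cel ?e) [^]\<^bsub>G\<^esub> z'" unfolding yz using group_hom.hom_int_pow[OF S.f_hom c'(2)] .
    moreover have "A.ret e (h (B.cel ?e) [^]\<^bsub>G\<^esub> z') = A.ret e (h (B.cel ?e)) [^]\<^bsub>G\<^esub> z'"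
      by (rule group_hom.hom_int_pow[of G G]) (use c' A.ret_hom in \<open>auto simp: group_hom_def group_hom_axioms_def A.is_group\<close>)
    ultimately have "A.ret e (h y) = \<one>\<^bsub>G\<^esub>" using r by simp
    then have "A.ret e (h (f (A.cel e))) = \<one>\<^bsub>G\<^esub>" unfolding y(3) using y(1) yc by simp
    then have "A.ret e v \<otimes>\<^bsub>G\<^esub> A.ret e (A.cel e) \<otimes>\<^bsub>G\<^esub> inv\<^bsub>G\<^esub> (A.ret e v) = \<one>\<^bsub>G\<^esub>" unfolding v(2) using v(1) c by simp
    then have "A.ret e (A.cel e) = \<one>\<^bsub>G\<^esub>" using conj1 v(1) c by simp
    moreover have "A.ret e (A.cel e) = A.cel e" by (rule A.ret_id[OF c(1)]) (use K Kd in blast)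
    ultimately show False using c1 by simp
  qed
  assume u': "B.cel ?e [^]\<^bsub>G'\<^esub> u' = \<one>\<^bsub>G'\<^esub>"
  have "y [^]\<^bsub>G'\<^esub> u' = \<one>\<^bsub>G'\<^esub>"
  proof -
    have "y [^]\<^bsub>G'\<^esub> int u' = (B.cel ?e [^]\<^bsub>G'\<^esub> int u') [^]\<^bsub>G'\<^esub> z'"
      unfolding yz using c'(2) by (simp add: B.int_pow_pow mult.commute)
    then show ?thesis using u' by (simp add: int_pow_int)
  qed
  moreover have hp: "h y = inv\<^bsub>G\<^esub> (h w) \<otimes>\<^bsub>G\<^esub> h (f (A.cel e)) \<otimes>\<^bsub>G\<^esub> h w"
    unfolding y(3) using y(1) yc by (simp add: A.m_assoc[symmetric]) (simp add: A.m_assoc)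
  have "h y = (inv\<^bsub>G\<^esub> (h w) \<otimes>\<^bsub>G\<^esub> v) \<otimes>\<^bsub>G\<^esub> A.cel e \<otimes>\<^bsub>G\<^esub> inv\<^bsub>G\<^esub> (inv\<^bsub>G\<^esub> (h w) \<otimes>\<^bsub>G\<^esub> v)" (is "_ = ?a \<otimes>\<^bsub>G\<^esub> _ \<otimes>\<^bsub>G\<^esub> _")
    unfolding hp v(2) using v(1) y(1) c by (simp add: A.m_assoc A.inv_mult_group)
  moreover have cp: "(a \<otimes>\<^bsub>G\<^esub> g \<otimes>\<^bsub>G\<^esub> inv\<^bsub>G\<^esub> a) [^]\<^bsub>G\<^esub> (k::nat) = a \<otimes>\<^bsub>G\<^esub> g [^]\<^bsub>G\<^esub> k \<otimes>\<^bsub>G\<^esub> inv\<^bsub>G\<^esub> a"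
    if "a \<in> carrier G" "g \<in> carrier G" for a g k
    by (induction k) (use that in \<open>simp_all add: A.m_assoc A.inv_solve_left'\<close>)
  moreover have "h (y [^]\<^bsub>G'\<^esub> u') = h y [^]\<^bsub>G\<^esub> u'" by (rule S.f_pow[OF yc])
  ultimately have "?a \<otimes>\<^bsub>G\<^esub> A.cel e [^]\<^bsub>G\<^esub> u' \<otimes>\<^bsub>G\<^esub> inv\<^bsub>G\<^esub> ?a = \<one>\<^bsub>G\<^esub>" using v(1) y(1) c by simp
  then show "A.cel e [^]\<^bsub>G\<^esub> u' = \<one>\<^bsub>G\<^esub>" using conj1[of ?a "A.cel e [^]\<^bsub>G\<^esub> u'"] v(1) y(1) c by simp
qed

lemma half:
  assumes eta': "\<And>e. e \<in> oddE n A.d \<Longrightarrow> eta' (eta e) = e"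
    and sub': "\<And>e K. e \<in> oddE n A.d \<Longrightarrow> K \<in> A.maxsph \<Longrightarrow> eta e \<subseteq> K \<Longrightarrow> e \<subseteq> K"
  shows "half_matching n A.d B.d A.maxsph (\<lambda>k i. L k i) (\<lambda>i k. L' i k) eta eta'"
proof
  fix i j t assume "i < n" "j < n" "i \<noteq> j"
  then show "2 ^ t dvd A.d i j \<longleftrightarrow> 2 ^ t dvd B.d i j" using two_eq by simp
next
  fix i j assume "i < n" "j < n" "i \<noteq> j" "A.d i j \<noteq> 0"
  then have "{i, j} \<subseteq> {..<n}" "finite (A.W {i, j})" using A.finite_W_pair[of i j] by auto
  then obtain K where "K \<in> A.maxsph" "{i, j} \<subseteq> K" by (rule A.maxsph_ex)
  then show "\<exists>K\<in>A.maxsph. i \<in> K \<and> j \<in> K" by blast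
next
  fix K i j assume "K \<in> A.maxsph" "i \<in> K" "j \<in> K"
  then show "A.d i j \<noteq> 0" using A.finite_W_d A.maxsphD by blast
next
  fix K i j k assume "K \<in> A.maxsph" "i \<in> K" "j \<in> K" "k \<in> K" "i \<noteq> j" "j \<noteq> k" "i \<noteq> k"
  then show "\<not> (2 < A.d i j \<and> 2 < A.d j k)" using A.finite_W_matching A.maxsphD(1,2) by blast
next
  fix i j assume "i < n" "j < n" then show "(\<Sum>k<n. L i k * L' k j) = of_bool (i = j)" by (rule LL')
next
  fix e assume e: "e \<in> oddE n A.d"
  show "eta e \<in> oddE n B.d" by (rule hits_E[OF eta_hits[OF e]])
  show "eta' (eta e) = e" by (rule eta'[OF e])
  fix K assume K: "K \<in> A.maxsph"
  show "eta e \<subseteq> K \<longleftrightarrow> e \<subseteq> K" using hits_sub[OF eta_hits[OF e] K] sub'[OF e K] by blast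
  fix x assume "e \<subseteq> K" "x \<in> K"
  then show "(\<Sum>k\<in>eta e. L k x) = of_bool (x \<in> e)" using hits_lam[OF eta_hits[OF e] K] by blast
next
  fix i j assume e: "{i, j} \<in> oddE n A.d" and ij: "i \<noteq> j" "4 dvd A.d i j"
  obtain K where K: "K \<in> A.maxsph" "{i, j} \<subseteq> K" by (rule oddE_maxsph[OF e])
  show "eta {i, j} = {i, j}"
  proof (rule lam_unique[OF K(1) hits_sub[OF eta_hits[OF e] K] K(2)])
    fix x assume x: "x \<in> K"
    have "(\<Sum>k\<in>{i, j}. L k x) = of_bool (x \<in> {i, j})" using four[OF K(1) _ _ ij x] K(2) ij(1) by simp
    then show "(\<Sum>k\<in>eta {i, j}. L k x) = (\<Sum>k\<in>{i, j}. L k x)" using hits_lam[OF eta_hits[OF e] K x] by simp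
  qed
next
  fix i j k l q assume e: "{i, j} \<in> oddE n A.d" and ij: "i \<noteq> j" and eq: "eta {i, j} = {k, l}" and q: "odd q" "q dvd A.d i j"
  obtain a b t u where ab: "a < n" "b < n" "a \<noteq> b" "{i, j} = {a, b}" "A.d a b = 2 ^ t * u" "odd u" "1 < u"
    "A.cel {i, j} = A.rot a b [^]\<^bsub>G\<^esub> (2 ^ t :: int)" by (rule A.oddE_cel[OF e])
  obtain a' b' t' u' where ab': "a' < n" "b' < n" "a' \<noteq> b'" "eta {i, j} = {a', b'}" "B.d a' b' = 2 ^ t' * u'" "odd u'" "1 < u'"
    "B.cel (eta {i, j}) = B.rot a' b' [^]\<^bsub>G'\<^esub> (2 ^ t' :: int)" by (rule B.oddE_cel[OF hits_E[OF eta_hits[OF e]]])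
  have "A.cel {i, j} [^]\<^bsub>G\<^esub> u' = \<one>\<^bsub>G\<^esub>" by (rule eta_back(2)[OF e]) (use B.cel_order[OF ab'(1,2,5,8), of u'] in simp)
  then have uu: "u dvd u'" using A.cel_order[OF ab(1,2,5,8)] by simp
  have "A.d i j = 2 ^ t * u" using ab A.d_sym[of a b] by (auto simp: doubleton_eq_iff)
  then have "q dvd 2 ^ t * u" using q by simp
  moreover have "coprime q (2 ^ t)" using q(1) by simp
  ultimately have "q dvd u" using coprime_dvd_mult_right_iff by blast
  moreover have "B.d k l = 2 ^ t' * u'" using ab' eq B.d_sym[of a' b'] by (auto simp: doubleton_eq_iff)
  ultimately show "q dvd B.d k l" using uu by (simp add: dvd_mult dvd_trans)
next
  fix i assume "i < n" then show "A.d i i = 1" by (rule A.d_self)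
next
  fix i j assume "i < n" "j < n" then show "A.d i j = A.d j i" by (rule A.d_sym)
next
  fix i j assume "i < n" "j < n" "i \<noteq> j" then show "even (A.d i j)" by (rule A.d_even)
next
  fix K i k assume a: "K \<in> A.maxsph" "i \<in> K" "k < n" "L k i \<noteq> 0"
  show "k \<in> K" by (rule L_MK[OF a(1,2,4)])
next
  fix i k assume "i < n" "k < n" "L k i \<noteq> 0" then show "dom2 n A.d i k" by (rule dom)
qed

text \<open>By \<open>eta_back\<close> the rotation of \<open>eta e\<close> is detected on
  \<open>e\<close>, so the edge correspondences of the two directions are mutually inverse and both
  halves of the matching situation are available.\<close>

theorem aligned_labels:
  "\<exists>p. bij_betw p {..<n} {..<n} \<and> (\<forall>i<n. \<forall>j<n. B.d (p i) (p j) = A.d i j)"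
proof -
  interpret S: aligned G' n s' m' G s m h f N by (rule aligned_swap)
  have b1: "S.eta (eta e) = e" if e: "e \<in> oddE n A.d" for e
  proof (rule S.eta_eqI)
    have "\<exists>k l. e = {k, l} \<and> k < n \<and> l < n \<and> k \<noteq> l" using e by (auto simp: oddE_def)
    then show "S.hits (eta e) e" unfolding S.hits_def using hits_E[OF eta_hits[OF e]] eta_back(1)[OF e] by blast
  qed
  have b2: "eta (S.eta e) = e" if e: "e \<in> oddE n B.d" for e
  proof (rule eta_eqI)
    have "\<exists>k l. e = {k, l} \<and> k < n \<and> l < n \<and> k \<noteq> l" using e by (auto simp: oddE_def)
    then show "hits (S.eta e) e" unfolding hits_def using S.hits_E[OF S.eta_hits[OF e]] S.eta_back(1)[OF e] by blast
  qed
  have h1: "half_matching n A.d B.d A.maxsph (\<lambda>k i. L k i) (\<lambda>i k. L' i k) eta S.eta"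
  proof (rule half[OF b1])
    fix e K assume "e \<in> oddE n A.d" "K \<in> A.maxsph" "eta e \<subseteq> K"
    then show "e \<subseteq> K" using S.hits_sub[OF S.eta_hits[OF hits_E[OF eta_hits]], of e K] b1 maxsph_eq by simp
  qed
  have h2: "half_matching n B.d A.d A.maxsph (\<lambda>i k. L' i k) (\<lambda>k i. L k i) S.eta eta"
  proof (rule S.half[OF b2, unfolded maxsph_eq])
    fix e K assume "e \<in> oddE n B.d" "K \<in> A.maxsph" "S.eta e \<subseteq> K"
    then show "e \<subseteq> K" using hits_sub[OF eta_hits[OF S.hits_E[OF S.eta_hits]], of e K] b2 by simp
  qed
  have odd: "odd_matching n A.d B.d A.maxsph (\<lambda>k i. L k i) (\<lambda>i k. L' i k) eta S.eta"
    by (rule odd_matching.intro[OF h1 h2])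
  show ?thesis by (rule odd_matching.matching[OF odd]) blast
qed

end

section \<open>The isomorphism\<close>

text \<open>The ones on the diagonal let every generator stand for its own image under
  \<open>f\<close>. The statements about \<open>h\<close> come from inverting \<open>L\<close>,
  since \<open>L'\<close> is not known to have such a diagonal.\<close>

lemma alignedI:
  assumes pair: "coxeter_pair G n s m G' n s' m' f h N"
    and diag: "\<And>i. i < n \<Longrightarrow> even_coxeter.par G' n s' i (f (s i)) = 1"
    and two: "\<And>i j t. i < n \<Longrightarrow> j < n \<Longrightarrow> i \<noteq> j \<Longrightarrow> 2 ^ t dvd even_coxeter.d m' i j \<longleftrightarrow> 2 ^ t dvd even_coxeter.d m i j"
    and sph: "\<And>K. K \<subseteq> {..<n} \<Longrightarrow> finite (even_coxeter.W G' s' K) \<longleftrightarrow> finite (even_coxeter.W G s K)"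
  shows "aligned G n s m G' s' m' f h N"
proof -
  interpret coxeter_pair G n s m G' n s' m' f h N by (rule pair)
  interpret S: coxeter_pair G' n s' m' G n s m h f N by (rule swap)
  have dom: "dom2 n A.d i k" if ik: "i < n" "k < n" "L k i \<noteq> 0" for i k
    unfolding dom2_def
  proof (intro allI impI)
    fix y t assume y: "y < n" "y \<noteq> i" "y \<noteq> k" "2 ^ t dvd A.d k y"
    then have "2 ^ t dvd B.d k y" using two ik by simp
    then show "2 ^ t dvd A.d i y" using two_part[of i y k y t] ik y diag by simp
  qed
  have fK: "\<exists>w\<in>carrier G'. \<forall>g\<in>A.W K. inv\<^bsub>G'\<^esub> w \<otimes>\<^bsub>G'\<^esub> f g \<otimes>\<^bsub>G'\<^esub> w \<in> B.W K"
    and LK: "i \<in> K \<Longrightarrow> L k i \<noteq> 0 \<Longrightarrow> k \<in> K" if K: "K \<in> A.maxsph" for K i k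
  proof -
    note Kd = A.maxsphD[OF K]
    obtain w K' where w: "w \<in> carrier G'" "K' \<subseteq> {..<n}" "finite (B.W K')"
      "\<And>g. g \<in> A.W K \<Longrightarrow> inv\<^bsub>G'\<^esub> w \<otimes>\<^bsub>G'\<^esub> f g \<otimes>\<^bsub>G'\<^esub> w \<in> B.W K'"
      "\<And>i k. i \<in> K \<Longrightarrow> L k i \<noteq> 0 \<Longrightarrow> k \<in> K'" using spherical_image[OF Kd(1,2)] by auto
    \<comment> \<open>The diagonal puts \<open>K\<close> inside \<open>K'\<close>, and maximality of
      \<open>K\<close> gives equality.\<close>
    have "i \<in> K'" if "i \<in> K" for i using w(5)[OF that, of i] diag[of i] that Kd(1) by auto
    then have "K' = K" using Kd(3)[of K'] w sph by auto
    then show "\<exists>w\<in>carrier G'. \<forall>g\<in>A.W K. inv\<^bsub>G'\<^esub> w \<otimes>\<^bsub>G'\<^esub> f g \<otimes>\<^bsub>G'\<^esub> w \<in> B.W K"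
      "i \<in> K \<Longrightarrow> L k i \<noteq> 0 \<Longrightarrow> k \<in> K" using w by auto
  qed
  have hK: "\<exists>w\<in>carrier G. \<forall>g\<in>B.W K. inv\<^bsub>G\<^esub> w \<otimes>\<^bsub>G\<^esub> h g \<otimes>\<^bsub>G\<^esub> w \<in> A.W K"
    and L'K: "k \<in> K \<Longrightarrow> L' i k \<noteq> 0 \<Longrightarrow> i \<in> K" if K: "K \<in> A.maxsph" for K i k
  proof -
    note Kd = A.maxsphD[OF K]
    have fin: "finite (B.W K)" using sph Kd by simp
    obtain w K' where w: "w \<in> carrier G" "K' \<subseteq> {..<n}" "finite (A.W K')"
      "\<And>g. g \<in> B.W K \<Longrightarrow> inv\<^bsub>G\<^esub> w \<otimes>\<^bsub>G\<^esub> h g \<otimes>\<^bsub>G\<^esub> w \<in> A.W K'"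
      "\<And>k i. k \<in> K \<Longrightarrow> L' i k \<noteq> 0 \<Longrightarrow> i \<in> K'" using S.spherical_image[OF Kd(1) fin] by auto
    have "i \<in> K'" if i: "i \<in> K" for i
    proof (rule ccontr)
      assume "i \<notin> K'"
      \<comment> \<open>Column \<open>i\<close> of \<open>L\<close> is supported in
        \<open>K\<close>, where row \<open>i\<close> of \<open>L'\<close> would vanish; this
        contradicts that their product is 1.\<close>
      have "L' i k * L k i = 0" for k
      proof (cases "k \<in> K")
        case True
        then have "L' i k = 0" using w(5) \<open>i \<notin> K'\<close> by blast
        then show ?thesis by simp
      next
        case False
        then have "L k i = 0" using LK[OF K i] by blast
        then show ?thesis by simp
      qed
      then have "(\<Sum>k<n. L' i k * L k i) = 0" by (intro sum.neutral) simp
      then show False using L'L[of i i] i Kd(1) by auto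
    qed
    then have "K' = K" using Kd(3)[of K'] w by auto
    then show "\<exists>w\<in>carrier G. \<forall>g\<in>B.W K. inv\<^bsub>G\<^esub> w \<otimes>\<^bsub>G\<^esub> h g \<otimes>\<^bsub>G\<^esub> w \<in> A.W K"
      "k \<in> K \<Longrightarrow> L' i k \<noteq> 0 \<Longrightarrow> i \<in> K" using w by auto
  qed
  have dom': "dom2 n A.d k i" if ik: "i < n" "k < n" "L' i k \<noteq> 0" for i k
  proof (rule ccontr)
    assume ni: "\<not> dom2 n A.d k i"
    \<comment> \<open>By transitivity of dominance \<open>L\<close> maps vectors supported on
      \<open>D\<close> to such vectors. It does so injectively on a finite set, hence bijectively,
      so the inverse \<open>L'\<close> preserves them as well. The basis vector at \<open>k\<close>
      then bounds the support of column \<open>k\<close> of \<open>L'\<close>.\<close>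
    define D where "D = {x. x < n \<and> dom2 n A.d k x}"
    define V where "V = {v :: nat \<Rightarrow> bit. \<forall>x. (x \<in> D \<longrightarrow> v x \<in> UNIV) \<and> (x \<notin> D \<longrightarrow> v x = 0)}"
    define F where "F v = (\<lambda>a. if a < n then \<Sum>b<n. L a b * v b else 0)" for v
    have "finite D" unfolding D_def by simp
    then have finV: "finite V" unfolding V_def by (rule finite_set_of_finite_funs) (simp add: UNIV_bit_eq)
    have FV: "F ` V \<subseteq> V"
    proof safe
      fix v assume v: "v \<in> V"
      have "F v a = 0" if a: "a \<notin> D" for a
      proof (cases "a < n")
        case True
        have "L a b * v b = 0" if b: "b < n" for b
        proof (rule ccontr)
          assume nz: "L a b * v b \<noteq> 0"
          then have "b \<in> D" "L a b \<noteq> 0" using v unfolding V_def by auto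
          then have "dom2 n A.d k b" "dom2 n A.d b a" using dom[OF b True] by (auto simp: D_def)
          then have "dom2 n A.d k a" using dom2_transitive[of n A.d k b a] A.d_sym ik b True by blast
          then show False using a True by (simp add: D_def)
        qed
        then show ?thesis by (auto simp: F_def intro!: sum.neutral)
      qed (simp add: F_def)
      then show "F v \<in> V" by (simp add: V_def)
    qed
    have bk: "(\<Sum>a<n. L' j a * F v a) = v j" if "j < n" for v j
      using left_inverse_apply[where n = n and n' = n and M = "\<lambda>k i. L k i" and M' = "\<lambda>i k. L' i k" and v = v, OF L'L that] by (simp add: F_def)
    have "inj_on F V"
    proof (rule inj_onI, rule ext)
      fix v w j assume vw: "v \<in> V" "w \<in> V" "F v = F w"
      show "v j = w j"
      proof (cases "j < n")
        case True then show ?thesis using bk[OF True, of v] bk[OF True, of w] vw(3) by simp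
      next
        case False then show ?thesis using vw by (simp add: V_def D_def)
      qed
    qed
    then have FVV: "F ` V = V" by (rule endo_inj_surj[OF finV FV])
    define ek where "ek x = (of_bool (x = k) :: bit)" for x
    have "k \<in> D" using ik by (simp add: D_def dom2_def)
    then have "ek \<in> V" by (auto simp: V_def ek_def)
    then have "ek \<in> F ` V" using FVV by simp
    then obtain v where v: "v \<in> V" "F v = ek" by auto
    have "v i = (\<Sum>a<n. L' i a * of_bool (a = k))" using bk[OF ik(1), of v] v(2) by (simp add: ek_def)
    also have "\<dots> = (\<Sum>a<n. if a = k then L' i a else 0)" by (intro sum.cong) auto
    also have "\<dots> = L' i k" using ik by simp
    finally have "v i \<noteq> 0" using ik by simp
    moreover have "v i = 0" using v(1) ni ik by (simp add: V_def D_def)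
    ultimately show False by simp
  qed
  have four: "L i x + L j x = of_bool (x \<in> {i, j})"
    if K: "K \<in> A.maxsph" "i \<in> K" "j \<in> K" "i \<noteq> j" "4 dvd A.d i j" "x \<in> K" for K i j x
  proof -
    note Kd = A.maxsphD[OF K(1)]
    have n: "i < n" "j < n" "x < n" using K Kd by auto
    have d4: "4 dvd B.d i j" using two[OF n(1,2) K(4), of 2] K(5) by simp
    have inv: "B.ret {i, j} (f (s x)) \<otimes>\<^bsub>G'\<^esub> B.ret {i, j} (f (s x)) = \<one>\<^bsub>G'\<^esub>" if "x < n" for x
      using that A.s_sq[of x] by (metis A.s_closed B.ret_mult B.ret_one f_closed f_mult f_one)
    have RW: "B.ret {i, j} (f (s x)) \<in> B.W {i, j}" if "x < n" for x
      using B.ret_in_W[of "f (s x)" "{i, j}"] that n by (simp add: Int_absorb2)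
    have rp: "B.par i (B.ret {i, j} (f (s x))) = L i x" "B.par j (B.ret {i, j} (f (s x))) = L j x" if "x < n" for x
      using B.ret_par[of "f (s x)"] that by auto
    \<comment> \<open>Since 4 divides the label, the retraction of \<open>f (s i)\<close> is a
      reflection; its parity at \<open>i\<close> is 1, so its parity at \<open>j\<close> is
      0.\<close>
    have ex: "L j i = 0" using B.dihedral_involution[OF n(1,2) K(4) d4 RW inv] rp n diag by simp
    have eji: "{j, i} = {i, j}" by auto
    have ey: "L i j = 0"
      using B.dihedral_involution[OF n(2,1) K(4)[symmetric], of "B.ret {i, j} (f (s j))"] RW inv rp n diag d4 B.d_sym[OF n(1,2)] eji by simp
    \<comment> \<open>An entry 1 would make 4 divide the label between \<open>x\<close> and one of
      \<open>i\<close>, \<open>j\<close>, while the matching condition bounds that label by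
      2.\<close>
    have other: "L i x = 0 \<and> L j x = 0" if xe: "x \<noteq> i" "x \<noteq> j"
    proof -
      have "4 \<le> A.d i j" using K(5) A.finite_W_d[OF Kd(2,1) K(2,3)] dvd_imp_le by simp
      then have g: "2 < A.d i j" "2 < A.d j i" using A.d_sym[OF n(1,2)] by simp_all
      have m: "\<not> 2 < A.d i x" "\<not> 2 < A.d j x"
        using A.finite_W_matching[OF Kd(2,1) K(3,2,6)] A.finite_W_matching[OF Kd(2,1) K(2,3,6)] g xe K(4) by auto
      have nz: "A.d i x \<noteq> 0" "A.d j x \<noteq> 0" using A.finite_W_d[OF Kd(2,1)] K by auto
      have n4: "\<not> 4 dvd A.d x i" "\<not> 4 dvd A.d x j"
        using m nz dvd_imp_le[of 4 "A.d x i"] dvd_imp_le[of 4 "A.d x j"] A.d_sym n by auto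
      have "L i x = 0"
      proof (rule ccontr)
        assume "L i x \<noteq> 0"
        then have "L i x = 1" by simp
        from two_part[OF n(3,2) xe(2) n(1,2) K(4) this diag[OF n(2)], of 2] show False using d4 n4 by simp
      qed
      moreover have "L j x = 0"
      proof (rule ccontr)
        assume "L j x \<noteq> 0"
        then have "L j x = 1" by simp
        from two_part[OF n(3,1) xe(1) n(2,1) K(4)[symmetric] this diag[OF n(1)], of 2]
        show False using d4 n4 B.d_sym[OF n(1,2)] by simp
      qed
      ultimately show ?thesis by simp
    qed
    show ?thesis using ex ey other diag[OF n(1)] diag[OF n(2)] K(4) by (cases "x = i"; cases "x = j") auto
  qed
  have four': "L' i x + L' j x = of_bool (x \<in> {i, j})"
    if K: "K \<in> A.maxsph" "i \<in> K" "j \<in> K" "i \<noteq> j" "4 dvd A.d i j" "x \<in> K" for K i j x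
  proof -
    have n: "i < n" "j < n" "x < n" using K A.maxsphD(1)[OF K(1)] by auto
    \<comment> \<open>Column \<open>x\<close> of \<open>L'\<close> is supported in \<open>K\<close>,
      where the sum of the rows \<open>i\<close> and \<open>j\<close> of \<open>L\<close> is the
      indicator of the pair; multiplying the two gives the claim.\<close>
    have "of_bool (x \<in> {i, j}) = (\<Sum>y<n. L i y * L' y x) + (\<Sum>y<n. L j y * L' y x)"
      using S.L'L n K(4) by auto
    also have "\<dots> = (\<Sum>y<n. (L i y + L j y) * L' y x)" by (simp add: sum.distrib algebra_simps)
    also have "\<dots> = (\<Sum>y<n. of_bool (y \<in> {i, j}) * L' y x)"
    proof (rule sum.cong[OF HOL.refl])
      fix y assume "y \<in> {..<n}"
      show "(L i y + L j y) * L' y x = of_bool (y \<in> {i, j}) * L' y x"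
        using four[OF K(1-5), of y] L'K[OF K(1,6), of y] by (cases "L' y x = 0") auto
    qed
    also have "\<dots> = (\<Sum>y<n. (if y = i then L' y x else 0) + (if y = j then L' y x else 0))"
      using K(4) by (intro sum.cong) auto
    also have "\<dots> = L' i x + L' j x" using n by (simp add: sum.distrib)
    finally show ?thesis by simp
  qed
  show ?thesis
  proof (intro aligned.intro aligned_axioms.intro pair)
    show "2 ^ t dvd B.d i j \<longleftrightarrow> 2 ^ t dvd A.d i j" if "i < n" "j < n" "i \<noteq> j" for i j t by (rule two[OF that])
    show "finite (B.W K) \<longleftrightarrow> finite (A.W K)" if "K \<subseteq> {..<n}" for K by (rule sph[OF that])
  qed (rule dom dom' fK hK four four'; assumption)+
qed

lemma coxeter_iso:
  assumes G: "even_coxeter G n s m" and G': "even_coxeter G' n s' m'" and p: "bij_betw p {..<n} {..<n}"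
    and eq: "\<And>i j. i < n \<Longrightarrow> j < n \<Longrightarrow> even_coxeter.d m' (p i) (p j) = even_coxeter.d m i j"
  shows "G \<cong> G'"
proof -
  interpret A: even_coxeter G n s m by (rule G)
  interpret B: even_coxeter G' n s' m' by (rule G')
  define q where "q = inv_into {..<n} p"
  have q: "q i < n" "p (q i) = i" if "i < n" for i
    using that p bij_betw_inv_into_right[OF p, of i] bij_betwE[OF bij_betw_inv_into[OF p]] by (auto simp: q_def)
  have pn: "p i < n" "q (p i) = i" if "i < n" for i
    using that bij_betwE[OF p] bij_betw_inv_into_left[OF p] by (auto simp: q_def)
  let ?f = "A.lift G' (\<lambda>i. s' (p i))" and ?h = "B.lift G (\<lambda>i. s (q i))"
  have relsf: "(s' (p i) \<otimes>\<^bsub>G'\<^esub> s' (p j)) [^]\<^bsub>G'\<^esub> A.d i j = \<one>\<^bsub>G'\<^esub>" if "i < n" "j < n" for i j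
    using B.s_pow[of "p i" "p j"] eq[OF that] pn that by simp
  have relsh: "(s (q i) \<otimes>\<^bsub>G\<^esub> s (q j)) [^]\<^bsub>G\<^esub> B.d i j = \<one>\<^bsub>G\<^esub>" if "i < n" "j < n" for i j
    using A.s_pow[of "q i" "q j"] eq[of "q i" "q j"] q that by simp
  have f: "?f \<in> hom G G'" by (rule A.lift_hom[OF B.monoid_axioms]) (use relsf pn in auto)
  have h: "?h \<in> hom G' G" by (rule B.lift_hom[OF A.monoid_axioms]) (use relsh q in auto)
  have fs: "?f (s i) = s' (p i)" if "i < n" for i by (rule A.lift_s[OF B.monoid_axioms _ _ that]) (use relsf pn in auto)
  have hs: "?h (s' i) = s (q i)" if "i < n" for i by (rule B.lift_s[OF A.monoid_axioms _ _ that]) (use relsh q in auto)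
  have hf: "?h (?f g) = g" if "g \<in> carrier G" for g
    using A.hom_eqI[OF hom_comp[OF f h] hom_id A.is_group _ that] fs hs pn by simp
  have fh: "?f (?h g) = g" if "g \<in> carrier G'" for g
    using B.hom_eqI[OF hom_comp[OF h f] hom_id B.is_group _ that] fs hs q by simp
  have "bij_betw ?f (carrier G) (carrier G')"
    by (rule bij_betw_byWitness[of _ ?h]) (use hf fh f h in \<open>auto simp: hom_def\<close>)
  then show ?thesis using f by (auto simp: is_iso_def iso_def)
qed

lemma coxeter_pair_iso:
  assumes pair: "coxeter_pair W n s m W' n s' m' f h N"
  shows "W \<cong> W'"
proof -
  interpret P: coxeter_pair W n s m W' n s' m' f h N by (rule pair)
  note W = P.A.even_coxeter_axioms
  obtain p where p: "p permutes {..<n}" "\<And>i. i < n \<Longrightarrow> P.L (p i) i = 1"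
    "\<And>i j t. i < n \<Longrightarrow> j < n \<Longrightarrow> i \<noteq> j \<Longrightarrow> 2 ^ t dvd P.B.d (p i) (p j) \<longleftrightarrow> 2 ^ t dvd P.A.d i j"
    "\<And>K. K \<subseteq> {..<n} \<Longrightarrow> finite (P.B.W (p ` K)) \<longleftrightarrow> finite (P.A.W K)"
    using P.align by metis
  let ?s = "\<lambda>i. s' (p i)" and ?m = "\<lambda>i j. m' (p i) (p j)"
  have C: "even_coxeter W' n ?s ?m" using P.B.relabel[OF p(1)] by (simp add: comp_def)
  interpret C: even_coxeter W' n ?s ?m by (rule C)
  have pn: "p i < n \<longleftrightarrow> i < n" for i using permutes_in_image[OF p(1)] by simp
  have d: "C.d i j = P.B.d (p i) (p j)" for i j by (simp add: C.d_def P.B.d_def)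
  have ev: "C.ev w = P.B.ev (map p w)" for w by (induction w) auto
  have Wp: "C.W K = P.B.W (p ` K)" for K unfolding C.W_def P.B.W_def lists_image by (simp add: ev image_image)
  have par: "C.par i g = P.B.par (p i) g" if "g \<in> carrier W'" "i < n" for g i
    using that(1)
  proof (induction rule: C.word_induct)
    case (mult j g)
    then show ?case using that(2) pn inj_eq[OF permutes_inj[OF p(1)], of j i] by (simp add: C.par_s P.B.par_s)
  qed simp
  have "coxeter_pair W n s m W' n ?s ?m f h N"
    by unfold_locales (use P.f P.h P.N P.hf P.fh in auto)
  then have "aligned W n s m W' ?s ?m f h N"
  proof (rule alignedI)
    show "C.par i (f (s i)) = 1" if "i < n" for i using par[of "f (s i)" i] p(2) that by simp
    show "2 ^ t dvd C.d i j \<longleftrightarrow> 2 ^ t dvd P.A.d i j" if "i < n" "j < n" "i \<noteq> j" for i j t using p(3) that d by simp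
    show "finite (C.W K) \<longleftrightarrow> finite (P.A.W K)" if "K \<subseteq> {..<n}" for K using p(4) that Wp by simp
  qed
  then obtain q where q: "bij_betw q {..<n} {..<n}" "\<forall>i<n. \<forall>j<n. C.d (q i) (q j) = P.A.d i j"
    using aligned.aligned_labels by blast
  show ?thesis by (rule coxeter_iso[OF W C q(1)]) (use q(2) in simp)
qed

theorem elementarily_equivalent_iso:
  fixes W :: "'a monoid" and W' :: "'b monoid"
  assumes W: "even_coxeter W n s m" and W': "even_coxeter W' n' s' m'"
    and eq: "elem_equiv (group_struct W) (group_struct W')"
  shows "W \<cong> W'"
proof -
  interpret A: even_coxeter W n s m by (rule W)
  interpret B: even_coxeter W' n' s' m' by (rule W')
  have eq': "elem_equiv (group_struct W') (group_struct W)" using eq by (simp add: elem_equiv_def)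
  \<comment> \<open>Tuples need room for the generators of either group.\<close>
  let ?N = "max n n'"
  obtain f where f: "f \<in> hom W W'" "class_inj ?N W W' f" by (rule chi_sentence_transfer[OF W B.is_group eq])
  obtain g where g: "g \<in> hom W' W" "class_inj ?N W' W g" by (rule chi_sentence_transfer[OF W' A.is_group eq'])
  obtain R where R: "finite R" "R \<subseteq> fin_tuples W ?N" "\<And>t. t \<in> fin_tuples W ?N \<Longrightarrow> \<exists>r\<in>R. tconj W ?N r t"
    using A.finite_tuple_classes by blast
  obtain h where h: "h \<in> hom W' W" "\<And>t. t \<in> fin_tuples W ?N \<Longrightarrow> tconj W ?N (h \<circ> f \<circ> t) t"
    "\<And>t. t \<in> fin_tuples W' ?N \<Longrightarrow> tconj W' ?N (f \<circ> h \<circ> t) t"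
    using class_inj_mutual[OF A.is_group B.is_group f g R] by blast
  interpret P: coxeter_pair W n s m W' n' s' m' f h ?N
    by unfold_locales (use f h in auto)
  have "coxeter_pair W n s m W' n s' m' f h ?N" using P.coxeter_pair_axioms P.rank_eq by simp
  then show ?thesis by (rule coxeter_pair_iso)
qed

theorem theorem1p11:
  fixes W :: "'a monoid" and W' :: "'b monoid"
  assumes "even_coxeter_group W" and "even_coxeter_group W'"
  shows "(elem_equiv (group_struct W) (group_struct W') \<longrightarrow> W \<cong> W') \<and>
         (\<forall>M :: 'c gstruct. model_of_theory M (group_struct W) \<longrightarrow>
            (\<exists>h. gembedding h (group_struct W) M))"
proof -
  have ec: "\<exists>n s m. even_coxeter H n s m" if "even_coxeter_group H" for H :: "'x monoid"
    using that unfolding even_coxeter_group_def even_coxeter_def even_coxeter_axioms_def coxeter_system_def by blast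
  obtain n s m where W: "even_coxeter W n s m" using ec[OF assms(1)] by blast
  obtain n' s' m' where W': "even_coxeter W' n' s' m'" using assms(2)
    unfolding even_coxeter_group_def even_coxeter_def even_coxeter_axioms_def coxeter_system_def by blast
  show ?thesis using elementarily_equivalent_iso[OF W W'] embeds_in_models[OF W] by blast
qed

end
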